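(* Every $5$-dimensional real unimodular Lie algebra $\mathfrak g$ possesses an inner product with a geodesic basis. Moreover, $\mathfrak g$ has an inner product with an orthonormal geodesic basis if and only if at least one of the following holds: (a) $\mathfrak g$ has an abelian ideal of codimension one; (b) $\mathfrak g$ has nontrivial centre; (c) $\mathfrak g$ has a three-dimensional abelian nilradical $\mathfrak n$, and a basis $\{X_1,\dots,X_5\}$ with $\mathfrak n=\operatorname{Span}(X_3,X_4,X_5)$ such that, relative to the basis $\{X_3,X_4,X_5\}$ of $\mathfrak n$, $$\operatorname{ad}(X_1)|_{\mathfrak n}=\begin{pmatrix}-2&0&0\\0&1&0\\0&0&1\end{pmatrix},\qquad \operatorname{ad}(X_2)|_{\mathfrak n}=\begin{pmatrix}0&0&0\\0&0&1\\0&-1&0\end{pmatrix},$$ i.e. $[X_1,X_3]=-2X_3$, $[X_1,X_4]=X_4$, $[X_1,X_5]=X_5$, $[X_2,X_3]=0$, $[X_2,X_4]=-X_5$, $[X_2,X_5]=X_4$.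
   Context: For an inner product $\langle\cdot,\cdot\rangle$ on a real Lie algebra $\mathfrak g$, a nonzero $X\in\mathfrak g$ is a geodesic element if $\langle X,[X,Y]\rangle=0$ for all $Y\in\mathfrak g$; a geodesic basis is a basis consisting of geodesic elements, and an orthonormal geodesic basis is one that is also orthonormal. A Lie algebra is unimodular if $\operatorname{Tr}(\operatorname{ad}(X))=0$ for all $X$. The nilradical is the maximal nilpotent ideal. Matrices of linear maps are written with the images of basis vectors as columns. *)

theory Defs
  imports "HOL-Analysis.Analysis"
begin

text \<open>A finite-dimensional real Lie algebra is modelled as a Euclidean space (used only as
an abstract finite-dimensional real vector space) carrying a bracket br.
(The Euclidean inner product of the type plays no role; inner products on the Lie algebra
are arbitrary functions satisfying the axioms below.)\<close>

definition lie_algebra :: "('a::real_vector \<Rightarrow> 'a \<Rightarrow> 'a) \<Rightarrow> bool" where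
  "lie_algebra br \<longleftrightarrow> bilinear br \<and> (\<forall>x. br x x = 0) \<and>
     (\<forall>x y z. br x (br y z) + br y (br z x) + br z (br x y) = 0)"

text \<open>Trace of a linear endomorphism, computed in an orthonormal basis of the
Euclidean type (this is basis independent).\<close>
definition lin_trace :: "('a::euclidean_space \<Rightarrow> 'a) \<Rightarrow> real" where
  "lin_trace f = (\<Sum>b\<in>Basis. inner (f b) b)"

definition unimodular :: "('a::euclidean_space \<Rightarrow> 'a \<Rightarrow> 'a) \<Rightarrow> bool" where
  "unimodular br \<longleftrightarrow> (\<forall>X. lin_trace (br X) = 0)"

definition is_inner_product :: "('a::real_vector \<Rightarrow> 'a \<Rightarrow> real) \<Rightarrow> bool" where
  "is_inner_product ip \<longleftrightarrow> bilinear ip \<and> (\<forall>x y. ip x y = ip y x) \<and>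
     (\<forall>x. x \<noteq> 0 \<longrightarrow> ip x x > 0)"

definition geodesic_element ::
  "('a::real_vector \<Rightarrow> 'a \<Rightarrow> 'a) \<Rightarrow> ('a \<Rightarrow> 'a \<Rightarrow> real) \<Rightarrow> 'a \<Rightarrow> bool" where
  "geodesic_element br ip X \<longleftrightarrow> X \<noteq> 0 \<and> (\<forall>Y. ip X (br X Y) = 0)"

definition is_basis :: "'a::real_vector set \<Rightarrow> bool" where
  "is_basis B \<longleftrightarrow> independent B \<and> span B = UNIV"

definition geodesic_basis ::
  "('a::real_vector \<Rightarrow> 'a \<Rightarrow> 'a) \<Rightarrow> ('a \<Rightarrow> 'a \<Rightarrow> real) \<Rightarrow> 'a set \<Rightarrow> bool" where
  "geodesic_basis br ip B \<longleftrightarrow> is_basis B \<and> (\<forall>X\<in>B. geodesic_element br ip X)"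

definition orthonormal_geodesic_basis ::
  "('a::real_vector \<Rightarrow> 'a \<Rightarrow> 'a) \<Rightarrow> ('a \<Rightarrow> 'a \<Rightarrow> real) \<Rightarrow> 'a set \<Rightarrow> bool" where
  "orthonormal_geodesic_basis br ip B \<longleftrightarrow> geodesic_basis br ip B \<and>
     (\<forall>X\<in>B. ip X X = 1) \<and> (\<forall>X\<in>B. \<forall>Y\<in>B. X \<noteq> Y \<longrightarrow> ip X Y = 0)"

definition lie_ideal :: "('a::real_vector \<Rightarrow> 'a \<Rightarrow> 'a) \<Rightarrow> 'a set \<Rightarrow> bool" where
  "lie_ideal br I \<longleftrightarrow> subspace I \<and> (\<forall>X Y. Y \<in> I \<longrightarrow> br X Y \<in> I)"

definition abelian_set :: "('a::real_vector \<Rightarrow> 'a \<Rightarrow> 'a) \<Rightarrow> 'a set \<Rightarrow> bool" where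
  "abelian_set br I \<longleftrightarrow> (\<forall>X\<in>I. \<forall>Y\<in>I. br X Y = 0)"

fun lower_central :: "('a::real_vector \<Rightarrow> 'a \<Rightarrow> 'a) \<Rightarrow> 'a set \<Rightarrow> nat \<Rightarrow> 'a set" where
  "lower_central br I 0 = I"
| "lower_central br I (Suc k) = span {br x y | x y. x \<in> I \<and> y \<in> lower_central br I k}"

definition nilpotent_ideal :: "('a::real_vector \<Rightarrow> 'a \<Rightarrow> 'a) \<Rightarrow> 'a set \<Rightarrow> bool" where
  "nilpotent_ideal br I \<longleftrightarrow> lie_ideal br I \<and> (\<exists>k. lower_central br I k = {0})"

definition is_nilradical :: "('a::real_vector \<Rightarrow> 'a \<Rightarrow> 'a) \<Rightarrow> 'a set \<Rightarrow> bool" where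
  "is_nilradical br N \<longleftrightarrow> nilpotent_ideal br N \<and>
     (\<forall>J. nilpotent_ideal br J \<and> N \<subseteq> J \<longrightarrow> J = N)"

end

theory Submission
  imports Defs
begin

text \<open>A basis is an orthonormal geodesic basis of some inner product iff no bracket \<open>[b, y]\<close> with a
  basis vector \<open>b\<close> has a \<open>b\<close>-component. Writing \<open>\<phi>\<^sub>b\<close> for the dual basis and expanding a frame
  \<open>z\<^sub>1, \<dots>, z\<^sub>5\<close> adapted to \<open>br\<close>, with coordinate forms \<open>c\<^sub>i\<close>, the equations \<open>\<phi>\<^sub>b([b, y]) = 0\<close>
  become polynomial relations between the products \<open>\<phi>\<^sub>b(z\<^sub>i) c\<^sub>j(b)\<close>. These contradict
  \<open>\<Sum>\<^sub>b \<phi>\<^sub>b(z\<^sub>i) c\<^sub>j(b) = \<delta>\<^sub>i\<^sub>j\<close> in four explicit families of algebras, for which a skew geodesic basis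
  is written down instead.

  That nothing else is left is a structure theorem. If \<open>br\<close> is not perfect, there is a unimodular
  ideal of codimension one, whose four-dimensional structure is known explicitly, and the
  derivation by which a complementary vector acts is put into normal form. If \<open>br\<close> is perfect, the
  Fitting decomposition of an \<open>ad X\<close> that is not nilpotent has a one-dimensional null component, and
  the Jacobi identity forces resonant eigenvalues, which yields the semidirect product of
  \<open>sl\<^sub>2\<close> with the plane.\<close>

section \<open>Traces and dual frames\<close>

text \<open>The contradictions are arithmetic. In each family the geodesic equations pin the share
  of a basis vector in a suitable trace, a sum of products \<open>\<phi> b z * c b\<close>, to zero
  or to one fixed rational number, while the whole trace is known. Either the number of contributing
  basis vectors then fails to be an integer, or it is three, and those three vectors cannot exist
  over the reals. For the split torus they would have to involve ratios that are cube roots of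
  unity; replacing the eigenvalues 1, -1 of the second torus generator by i, -i supplies exactly
  these, which is why the rotation torus has an orthonormal geodesic basis and its split twin has
  none.

  The obstacle in the structure theory is that eigenvalues of \<open>br X\<close> may be complex.
  Eigenvectors are therefore avoided: a traceless operator on a plane is described by a cyclic
  vector \<open>u\<close>, its image and the scalar by which its square acts, and in the perfect
  case the resonance argument is carried out for the square of \<open>br X\<close>, with the
  coefficients of its quadratic equation in place of its eigenvalues.\<close>

lemma lin_trace_eq_of_rank_one:
  fixes v :: "'a::euclidean_space"
  assumes "linear \<phi>"
  shows "lin_trace (\<lambda>x. \<phi> x *\<^sub>R v) = \<phi> v"
proof -
  have "\<phi> v = \<phi> (\<Sum>b\<in>Basis. inner v b *\<^sub>R b)"
    by (simp add: euclidean_representation)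
  also have "\<dots> = (\<Sum>b\<in>Basis. inner v b * \<phi> b)"
    using assms by (simp add: linear_sum linear_scale)
  finally show ?thesis
    by (simp add: lin_trace_def mult.commute)
qed

lemma lin_trace_add: "lin_trace (\<lambda>x. f x + g x) = lin_trace f + lin_trace g"
  by (simp add: lin_trace_def inner_add_left sum.distrib)

lemma lin_trace_diff: "lin_trace (\<lambda>x. f x - g x) = lin_trace f - lin_trace g"
  by (simp add: lin_trace_def inner_diff_left sum_subtractf)

lemma lin_trace_scaleR: "lin_trace (\<lambda>x. r *\<^sub>R f x) = r * lin_trace f"
  by (simp add: lin_trace_def sum_distrib_left)

lemma lin_trace_zero: "lin_trace (\<lambda>x. 0) = 0"
  by (simp add: lin_trace_def)

lemma lin_trace_id: "lin_trace (\<lambda>x::'a::euclidean_space. x) = DIM('a)"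
  by (simp add: lin_trace_def inner_Basis)

lemma lin_trace_sum: "finite I \<Longrightarrow> lin_trace (\<lambda>x. \<Sum>i\<in>I. f i x) = (\<Sum>i\<in>I. lin_trace (f i))"
  by (induction I rule: finite_induct) (simp_all add: lin_trace_add lin_trace_zero)

text \<open>Domain and codomain may differ: this is how traces pass to ideals, central quotients and
  Fitting components, with an embedding or a projection among the two factors.\<close>

lemma lin_trace_comm:
  fixes f :: "'a::euclidean_space \<Rightarrow> 'b::euclidean_space" and g :: "'b \<Rightarrow> 'a"
  assumes "linear f" "linear g"
  shows "lin_trace (\<lambda>x. g (f x)) = lin_trace (\<lambda>y. f (g y))"
proof -
  have "lin_trace (\<lambda>x. g (f x)) = (\<Sum>b\<in>Basis. \<Sum>c\<in>Basis. inner (f b) c * inner (g c) b)"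
    unfolding lin_trace_def
  proof (rule sum.cong)
    fix b :: 'a
    have "g (f b) = g (\<Sum>c\<in>Basis. inner (f b) c *\<^sub>R c)"
      by (simp add: euclidean_representation)
    also have "\<dots> = (\<Sum>c\<in>Basis. inner (f b) c *\<^sub>R g c)"
      using assms by (simp add: linear_sum linear_scale)
    finally show "inner (g (f b)) b = (\<Sum>c\<in>Basis. inner (f b) c * inner (g c) b)"
      by (simp add: inner_sum_left)
  qed simp
  also have "\<dots> = (\<Sum>c\<in>Basis. \<Sum>b\<in>Basis. inner (f b) c * inner (g c) b)"
    by (rule sum.swap)
  also have "\<dots> = lin_trace (\<lambda>y. f (g y))"
    unfolding lin_trace_def
  proof (rule sum.cong)
    fix c :: 'b
    have "f (g c) = f (\<Sum>b\<in>Basis. inner (g c) b *\<^sub>R b)"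
      by (simp add: euclidean_representation)
    also have "\<dots> = (\<Sum>b\<in>Basis. inner (g c) b *\<^sub>R f b)"
      using assms by (simp add: linear_sum linear_scale)
    finally show "(\<Sum>b\<in>Basis. inner (f b) c * inner (g c) b) = inner (f (g c)) c"
      by (simp add: inner_sum_left mult.commute)
  qed simp
  finally show ?thesis .
qed

definition frame :: "nat \<Rightarrow> (nat \<Rightarrow> 'a::euclidean_space) \<Rightarrow> (nat \<Rightarrow> 'a \<Rightarrow> real) \<Rightarrow> bool" where
  "frame n e c \<longleftrightarrow> (\<forall>i<n. linear (c i)) \<and> (\<forall>i<n. \<forall>j<n. c i (e j) = (if i = j then 1 else 0))
     \<and> (\<forall>x. x = (\<Sum>i<n. c i x *\<^sub>R e i))"

lemma frame_exists:
  fixes e :: "nat \<Rightarrow> 'a::euclidean_space"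
  assumes "DIM('a) = n" "span (e ` {..<n}) = UNIV"
  shows "\<exists>c. frame n e c"
proof -
  let ?B = "e ` {..<n}"
  have c1: "card ?B \<le> n"
    by (metis card_image_le card_lessThan finite_lessThan)
  have d: "dim ?B = n"
    using assms by (metis dim_UNIV dim_span)
  have c2: "card ?B = n"
    using c1 d dim_le_card'[of ?B] by simp
  have inj: "inj_on e {..<n}"
    by (rule eq_card_imp_inj_on) (simp_all add: c2)
  have ind: "independent ?B"
    by (rule card_le_dim_spanning[of _ UNIV]) (use assms c2 in auto)
  define c where "c i x = representation ?B x (e i)" for i x
  have "frame n e c"
    unfolding frame_def
  proof (intro conjI allI impI)
    fix i
    show "linear (c i)"
      unfolding c_def using ind assms
      by (intro linearI) (simp_all add: representation_add representation_scale)
    fix j assume "i < n" "j < n"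
    then show "c i (e j) = (if i = j then 1 else 0)"
      unfolding c_def using ind inj
      by (auto simp: representation_basis inj_on_def)
  next
    fix x
    have "(\<Sum>b\<in>?B. representation ?B x b *\<^sub>R b) = x"
      by (rule sum_representation_eq) (use ind assms in auto)
    then show "x = (\<Sum>i<n. c i x *\<^sub>R e i)"
      by (simp add: c_def sum.reindex[OF inj])
  qed
  then show ?thesis by blast
qed

lemma lin_trace_frame:
  assumes "frame n e c" "linear f"
  shows "lin_trace f = (\<Sum>i<n. c i (f (e i)))"
proof -
  have l: "linear (c i)" if "i < n" for i
    using assms(1) that by (auto simp: frame_def)
  have x: "x = (\<Sum>i<n. c i x *\<^sub>R e i)" for x
    using assms(1) unfolding frame_def by blast
  have "f x = (\<Sum>i<n. c i x *\<^sub>R f (e i))" for x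
    using arg_cong[OF x[of x], of f] assms(2) by (simp add: linear_sum linear_scale)
  then have "f = (\<lambda>x. \<Sum>i<n. c i x *\<^sub>R f (e i))"
    by (rule ext)
  then have "lin_trace f = lin_trace (\<lambda>x. \<Sum>i<n. c i x *\<^sub>R f (e i))"
    by (rule arg_cong)
  also have "\<dots> = (\<Sum>i<n. lin_trace (\<lambda>x. c i x *\<^sub>R f (e i)))"
    by (rule lin_trace_sum) simp
  finally have "lin_trace f = (\<Sum>i<n. lin_trace (\<lambda>x. c i x *\<^sub>R f (e i)))" .
  then show ?thesis
    using l by (simp add: lin_trace_eq_of_rank_one)
qed

text \<open>Names the coordinate forms one by one, so that applying them to brackets evaluates by
  rewriting; the trace clause turns unimodularity into an equation between structure
  constants.\<close>

lemma frame3E: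
  fixes e1 e2 e3 :: "'a::euclidean_space"
  assumes "DIM('a) = 3" "span {e1,e2,e3} = UNIV"
  obtains c1 c2 c3 :: "'a \<Rightarrow> real" where
    "linear c1" "linear c2" "linear c3"
    "c1 e1 = 1" "c1 e2 = 0" "c1 e3 = 0"
    "c2 e1 = 0" "c2 e2 = 1" "c2 e3 = 0"
    "c3 e1 = 0" "c3 e2 = 0" "c3 e3 = 1"
    "\<And>x. x = c1 x *\<^sub>R e1 + c2 x *\<^sub>R e2 + c3 x *\<^sub>R e3"
    "\<And>f. linear f \<Longrightarrow> lin_trace f = c1 (f e1) + c2 (f e2) + c3 (f e3)"
proof -
  let ?e = "\<lambda>i. [e1,e2,e3] ! i"
  have "?e ` {..<3} = {e1,e2,e3}"
    by (simp add: lessThan_nat_numeral lessThan_Suc numeral_3_eq_3 insert_commute)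
  then obtain c where c: "frame 3 ?e c"
    using frame_exists[of 3 ?e] assms by auto
  have l: "\<And>i. i < 3 \<Longrightarrow> linear (c i)"
    and d: "\<And>i j. i < 3 \<Longrightarrow> j < 3 \<Longrightarrow> c i (?e j) = (if i = j then 1 else 0)"
    and x: "\<And>x. x = (\<Sum>i<3. c i x *\<^sub>R ?e i)"
    using c unfolding frame_def by blast+
  show thesis
  proof (rule that[of "c 0" "c 1" "c 2"])
    show "x = c 0 x *\<^sub>R e1 + c 1 x *\<^sub>R e2 + c 2 x *\<^sub>R e3" for x
      using x[of x] by (simp add: eval_nat_numeral)
    show "lin_trace f = c 0 (f e1) + c 1 (f e2) + c 2 (f e3)" if "linear f" for f
      using lin_trace_frame[OF c that] by (simp add: eval_nat_numeral)
  qed (use l[of 0] l[of 1] l[of 2]  d[of 0 0] d[of 0 1] d[of 0 2] d[of 1 0] d[of 1 1] d[of 1 2] d[of 2 0] d[of 2 1] d[of 2 2] in \<open>simp_all add: eval_nat_numeral\<close>)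
qed

lemma frame4E:
  fixes e1 e2 e3 e4 :: "'a::euclidean_space"
  assumes "DIM('a) = 4" "span {e1,e2,e3,e4} = UNIV"
  obtains c1 c2 c3 c4 :: "'a \<Rightarrow> real" where
    "linear c1" "linear c2" "linear c3" "linear c4"
    "c1 e1 = 1" "c1 e2 = 0" "c1 e3 = 0" "c1 e4 = 0"
    "c2 e1 = 0" "c2 e2 = 1" "c2 e3 = 0" "c2 e4 = 0"
    "c3 e1 = 0" "c3 e2 = 0" "c3 e3 = 1" "c3 e4 = 0"
    "c4 e1 = 0" "c4 e2 = 0" "c4 e3 = 0" "c4 e4 = 1"
    "\<And>x. x = c1 x *\<^sub>R e1 + c2 x *\<^sub>R e2 + c3 x *\<^sub>R e3 + c4 x *\<^sub>R e4"
    "\<And>f. linear f \<Longrightarrow> lin_trace f = c1 (f e1) + c2 (f e2) + c3 (f e3) + c4 (f e4)"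
proof -
  let ?e = "\<lambda>i. [e1,e2,e3,e4] ! i"
  have "?e ` {..<4} = {e1,e2,e3,e4}"
    by (simp add: lessThan_Suc eval_nat_numeral insert_commute)
  then obtain c where c: "frame 4 ?e c"
    using frame_exists[of 4 ?e] assms by auto
  have l: "\<And>i. i < 4 \<Longrightarrow> linear (c i)"
    and d: "\<And>i j. i < 4 \<Longrightarrow> j < 4 \<Longrightarrow> c i (?e j) = (if i = j then 1 else 0)"
    and x: "\<And>x. x = (\<Sum>i<4. c i x *\<^sub>R ?e i)"
    using c unfolding frame_def by blast+
  show thesis
  proof (rule that[of "c 0" "c 1" "c 2" "c 3"])
    show "x = c 0 x *\<^sub>R e1 + c 1 x *\<^sub>R e2 + c 2 x *\<^sub>R e3 + c 3 x *\<^sub>R e4" for x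
      using x[of x] by (simp add: eval_nat_numeral)
    show "lin_trace f = c 0 (f e1) + c 1 (f e2) + c 2 (f e3) + c 3 (f e4)" if "linear f" for f
      using lin_trace_frame[OF c that] by (simp add: eval_nat_numeral)
  qed (use l[of 0] l[of 1] l[of 2] l[of 3]  d[of 0 0] d[of 0 1] d[of 0 2] d[of 0 3] d[of 1 0] d[of 1 1] d[of 1 2] d[of 1 3] d[of 2 0] d[of 2 1] d[of 2 2] d[of 2 3] d[of 3 0] d[of 3 1] d[of 3 2] d[of 3 3] in \<open>simp_all add: eval_nat_numeral\<close>)
qed

lemma frame5E:
  fixes e1 e2 e3 e4 e5 :: "'a::euclidean_space"
  assumes "DIM('a) = 5" "span {e1,e2,e3,e4,e5} = UNIV"
  obtains c1 c2 c3 c4 c5 :: "'a \<Rightarrow> real" where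
    "linear c1" "linear c2" "linear c3" "linear c4" "linear c5"
    "c1 e1 = 1" "c1 e2 = 0" "c1 e3 = 0" "c1 e4 = 0" "c1 e5 = 0"
    "c2 e1 = 0" "c2 e2 = 1" "c2 e3 = 0" "c2 e4 = 0" "c2 e5 = 0"
    "c3 e1 = 0" "c3 e2 = 0" "c3 e3 = 1" "c3 e4 = 0" "c3 e5 = 0"
    "c4 e1 = 0" "c4 e2 = 0" "c4 e3 = 0" "c4 e4 = 1" "c4 e5 = 0"
    "c5 e1 = 0" "c5 e2 = 0" "c5 e3 = 0" "c5 e4 = 0" "c5 e5 = 1"
    "\<And>x. x = c1 x *\<^sub>R e1 + c2 x *\<^sub>R e2 + c3 x *\<^sub>R e3 + c4 x *\<^sub>R e4 + c5 x *\<^sub>R e5"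
    "\<And>f. linear f \<Longrightarrow>
      lin_trace f = c1 (f e1) + c2 (f e2) + c3 (f e3) + c4 (f e4) + c5 (f e5)"
proof -
  let ?e = "\<lambda>i. [e1,e2,e3,e4,e5] ! i"
  have "?e ` {..<5} = {e1,e2,e3,e4,e5}"
    by (simp add: lessThan_Suc eval_nat_numeral insert_commute)
  then obtain c where c: "frame 5 ?e c"
    using frame_exists[of 5 ?e] assms by auto
  have l: "\<And>i. i < 5 \<Longrightarrow> linear (c i)"
    and d: "\<And>i j. i < 5 \<Longrightarrow> j < 5 \<Longrightarrow> c i (?e j) = (if i = j then 1 else 0)"
    and x: "\<And>x. x = (\<Sum>i<5. c i x *\<^sub>R ?e i)"
    using c unfolding frame_def by blast+
  show thesis
  proof (rule that[of "c 0" "c 1" "c 2" "c 3" "c 4"])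
    show "x = c 0 x *\<^sub>R e1 + c 1 x *\<^sub>R e2 + c 2 x *\<^sub>R e3 + c 3 x *\<^sub>R e4 + c 4 x *\<^sub>R e5" for x
      using x[of x] by (simp add: eval_nat_numeral)
    show "lin_trace f = c 0 (f e1) + c 1 (f e2) + c 2 (f e3) + c 3 (f e4) + c 4 (f e5)"
      if "linear f" for f
      using lin_trace_frame[OF c that] by (simp add: eval_nat_numeral)
  qed (use l[of 0] l[of 1] l[of 2] l[of 3] l[of 4] d[of 0 0] d[of 0 1] d[of 0 2] d[of 0 3] d[of 0 4] d[of 1 0] d[of 1 1] d[of 1 2] d[of 1 3] d[of 1 4] d[of 2 0] d[of 2 1] d[of 2 2] d[of 2 3] d[of 2 4] d[of 3 0] d[of 3 1] d[of 3 2] d[of 3 3] d[of 3 4] d[of 4 0] d[of 4 1] d[of 4 2] d[of 4 3] d[of 4 4] in \<open>simp_all add: eval_nat_numeral\<close>)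
qed

section \<open>Lie algebras and orthonormal geodesic bases\<close>

locale lie =
  fixes br :: "'a::euclidean_space \<Rightarrow> 'a \<Rightarrow> 'a"
  assumes lie_algebra: "lie_algebra br"
begin

lemma br_bilinear: "bilinear br"
  using lie_algebra by (simp add: lie_algebra_def)

lemmas br_add [simp] = bilinear_ladd[OF br_bilinear] bilinear_radd[OF br_bilinear]
lemmas br_scaleR [simp] = bilinear_lmul[OF br_bilinear] bilinear_rmul[OF br_bilinear]
lemmas br_zero [simp] = bilinear_lzero[OF br_bilinear] bilinear_rzero[OF br_bilinear]
lemmas br_minus [simp] = bilinear_lneg[OF br_bilinear] bilinear_rneg[OF br_bilinear]
lemmas br_diff [simp] = bilinear_lsub[OF br_bilinear] bilinear_rsub[OF br_bilinear]

lemma br_same [simp]: "br x x = 0"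
  using lie_algebra by (simp add: lie_algebra_def)

lemma br_skew: "br x y = - br y x"
proof -
  have "br (x + y) (x + y) = 0" by (rule br_same)
  then have "br x y + br y x = 0" by (simp del: br_same) (simp add: add.commute)
  then show ?thesis by (simp add: add_eq_0_iff)
qed

lemma jacobi: "br x (br y z) = br (br x y) z + br y (br x z)"
proof -
  have "br x (br y z) + br y (br z x) + br z (br x y) = 0"
    using lie_algebra by (auto simp: lie_algebra_def)
  then show ?thesis
    using br_skew[of z x] br_skew[of z "br x y"]
    by (simp add: algebra_simps)
qed

lemma linear_br [simp]: "linear (br x)" "linear (\<lambda>y. br y x)"
  using br_bilinear by (auto simp: bilinear_def)

end

locale unimodular_lie = lie +
  assumes unimodular: "unimodular br"
begin

lemma trace_br: "lin_trace (br x) = 0"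
  using unimodular by (auto simp: unimodular_def)

end

locale inner_prod =
  fixes ip :: "'a::real_vector \<Rightarrow> 'a \<Rightarrow> real"
  assumes is_inner_product: "is_inner_product ip"
begin

lemma ip_bilinear: "bilinear ip"
  using is_inner_product by (simp add: is_inner_product_def)

lemmas ip_simps [simp] =
  bilinear_ladd[OF ip_bilinear] bilinear_radd[OF ip_bilinear]
  bilinear_lmul[OF ip_bilinear] bilinear_rmul[OF ip_bilinear]
  bilinear_lzero[OF ip_bilinear] bilinear_rzero[OF ip_bilinear]
  bilinear_lneg[OF ip_bilinear] bilinear_rneg[OF ip_bilinear]
  bilinear_lsub[OF ip_bilinear] bilinear_rsub[OF ip_bilinear]

lemma ip_sym: "ip x y = ip y x"
  using is_inner_product by (simp add: is_inner_product_def)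

lemma linear_ip: "linear (ip x)" "linear (\<lambda>y. ip y x)"
  using ip_bilinear by (auto simp: bilinear_def)

lemma orthonormal_independent:
  assumes "\<And>x. x \<in> B \<Longrightarrow> ip x x = 1" "\<And>x y. x \<in> B \<Longrightarrow> y \<in> B \<Longrightarrow> x \<noteq> y \<Longrightarrow> ip x y = 0"
  shows "independent B"
  unfolding independent_explicit_finite_subsets
proof safe
  fix A u v
  assume A: "A \<subseteq> B" "finite A" "(\<Sum>v\<in>A. u v *\<^sub>R v) = 0" "v \<in> A"
  have "0 = ip v (\<Sum>v\<in>A. u v *\<^sub>R v)"
    using A by simp
  also have "\<dots> = (\<Sum>w\<in>A. u w * ip v w)"
    by (simp add: linear_sum[OF linear_ip(1)])
  also have "\<dots> = (\<Sum>w\<in>A. if w = v then u v else 0)"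
  proof (rule sum.cong)
    fix w assume "w \<in> A"
    then show "u w * ip v w = (if w = v then u v else 0)"
      using A assms(1)[of v] assms(2)[of v w] by auto
  qed simp
  also have "\<dots> = u v"
    using A by simp
  finally show "u v = 0" by simp
qed

end

definition has_ongb :: "('a::real_vector \<Rightarrow> 'a \<Rightarrow> 'a) \<Rightarrow> bool" where
  "has_ongb br \<longleftrightarrow> (\<exists>ip. is_inner_product ip \<and> (\<exists>B. orthonormal_geodesic_basis br ip B))"

definition has_gb :: "('a::real_vector \<Rightarrow> 'a \<Rightarrow> 'a) \<Rightarrow> bool" where
  "has_gb br \<longleftrightarrow> (\<exists>ip. is_inner_product ip \<and> (\<exists>B. geodesic_basis br ip B))"

lemma has_ongb_imp_has_gb:
  assumes "has_ongb br"
  shows "has_gb br"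
proof -
  obtain ip B where "is_inner_product ip" "orthonormal_geodesic_basis br ip B"
    using assms unfolding has_ongb_def by (elim exE conjE)
  then have "is_inner_product ip" "geodesic_basis br ip B"
    by (simp_all only: orthonormal_geodesic_basis_def)
  then show ?thesis
    unfolding has_gb_def by (intro exI conjI)
qed

lemma has_ongbI:
  assumes "is_inner_product ip" "span B = UNIV"
    and "\<And>x. x \<in> B \<Longrightarrow> ip x x = 1" "\<And>x y. x \<in> B \<Longrightarrow> y \<in> B \<Longrightarrow> x \<noteq> y \<Longrightarrow> ip x y = 0"
    and "\<And>x y. x \<in> B \<Longrightarrow> ip x (br x y) = 0"
  shows "has_ongb br"
proof -
  interpret inner_prod ip by unfold_locales fact
  have "independent B"
    by (rule orthonormal_independent) (use assms in auto)
  moreover have "x \<noteq> 0" if "x \<in> B" for x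
    using assms(3)[OF that] by auto
  ultimately have "orthonormal_geodesic_basis br ip B"
    unfolding orthonormal_geodesic_basis_def geodesic_basis_def is_basis_def
      geodesic_element_def using assms(2-5) by blast
  then show ?thesis
    using assms(1) unfolding has_ongb_def by blast
qed

lemma orthonormal_geodesic_basis_expansion:
  fixes br :: "'a::euclidean_space \<Rightarrow> 'a \<Rightarrow> 'a"
  assumes "is_inner_product ip" "orthonormal_geodesic_basis br ip B"
  shows "finite B" "\<And>x. x = (\<Sum>b\<in>B. ip b x *\<^sub>R b)"
proof -
  interpret inner_prod ip by unfold_locales fact
  note B = assms(2)[unfolded orthonormal_geodesic_basis_def geodesic_basis_def is_basis_def]
  show fin: "finite B"
    using B independent_imp_finite by blast
  fix x
  have "x \<in> span B" using B by simp
  then obtain u where u: "x = (\<Sum>b\<in>B. u b *\<^sub>R b)"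
    unfolding span_finite[OF fin] by auto
  have "ip b x = u b" if b: "b \<in> B" for b
  proof -
    have "ip b x = (\<Sum>w\<in>B. u w * ip b w)"
      unfolding u by (simp add: linear_sum[OF linear_ip(1)])
    also have "\<dots> = (\<Sum>w\<in>B. if w = b then u b else 0)"
    proof (rule sum.cong)
      fix w assume "w \<in> B"
      then show "u w * ip b w = (if w = b then u b else 0)"
        using b B by auto
    qed simp
    finally show ?thesis using fin b by simp
  qed
  then show "x = (\<Sum>b\<in>B. ip b x *\<^sub>R b)"
    using u by simp
qed

lemma inner_product_of_frame:
  assumes "frame n e c" "\<And>i. i < n \<Longrightarrow> 0 < w i"
  shows "is_inner_product (\<lambda>x y. \<Sum>i<n. w i * c i x * c i y)"
  unfolding is_inner_product_def bilinear_def
proof (intro conjI allI impI)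
  have l: "linear (c i)" if "i < n" for i
    using assms(1) that by (auto simp: frame_def)
  show "linear (\<lambda>y. \<Sum>i<n. w i * c i x * c i y)" for x
    by (rule linearI) (simp_all add: l linear_add linear_scale algebra_simps sum.distrib sum_distrib_left)
  show "linear (\<lambda>x. \<Sum>i<n. w i * c i x * c i y)" for y
    by (rule linearI) (simp_all add: l linear_add linear_scale algebra_simps sum.distrib sum_distrib_left)
  show "(\<Sum>i<n. w i * c i x * c i y) = (\<Sum>i<n. w i * c i y * c i x)" for x y
    by (simp add: mult_ac)
  fix x :: 'a assume "x \<noteq> 0"
  have "x = (\<Sum>i<n. c i x *\<^sub>R e i)"
    using assms(1) unfolding frame_def by blast
  then have "\<exists>i<n. c i x \<noteq> 0"
    using \<open>x \<noteq> 0\<close> by (metis (no_types, lifting) lessThan_iff scale_zero_left sum.neutral)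
  then obtain i where i: "i < n" "c i x \<noteq> 0" by blast
  show "(\<Sum>i<n. w i * c i x * c i x) > 0"
  proof (rule sum_pos2[of _ i])
    show "0 < w i * c i x * c i x"
      using mult_pos_pos[OF assms(2)[OF i(1)], of "c i x * c i x"] i(2)
      by (simp add: mult.assoc zero_less_mult_iff linorder_neq_iff disj_commute)
    show "0 \<le> w j * c j x * c j x" if "j \<in> {..<n}" for j
      using assms(2)[of j] that by (simp add: mult.assoc)
  qed (use i in auto)
qed

text \<open>Once the frame is declared orthonormal, pairing with \<open>e i\<close> is the form
  \<open>c i\<close>, and the geodesic condition becomes the vanishing of the structure constants
  whose upper index repeats a lower one.\<close>

lemma (in lie) has_ongb_of_frame:
  assumes fr: "frame n e c"
    and hollow: "\<And>i j. i < n \<Longrightarrow> j < n \<Longrightarrow> c i (br (e i) (e j)) = 0"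
  shows "has_ongb br"
proof -
  let ?ip = "\<lambda>x y. \<Sum>i<n. c i x * c i y"
  have l: "linear (c i)" if "i < n" for i
    using fr that by (auto simp: frame_def)
  have d: "c i (e j) = (if i = j then 1 else 0)" if "i < n" "j < n" for i j
    using fr that by (auto simp: frame_def)
  have x: "x = (\<Sum>i<n. c i x *\<^sub>R e i)" for x
    using fr unfolding frame_def by blast
  have ip: "?ip (e j) y = c j y" if "j < n" for j y
  proof -
    have "?ip (e j) y = (\<Sum>i<n. if i = j then c j y else 0)"
      by (rule sum.cong) (use d that in auto)
    then show ?thesis using that by simp
  qed
  show ?thesis
  proof (rule has_ongbI[of ?ip "e ` {..<n}"])
    show "is_inner_product ?ip"
      using inner_product_of_frame[OF fr, of "\<lambda>_. 1"] by simp
    show "span (e ` {..<n}) = UNIV"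
    proof -
      have "(\<Sum>i<n. c i x *\<^sub>R e i) \<in> span (e ` {..<n})" for x
        by (intro span_sum span_scale span_base) auto
      then show ?thesis using x by (metis UNIV_eq_I)
    qed
    show "?ip x x = 1" if x: "x \<in> e ` {..<n}" for x
    proof -
      obtain i where "i < n" "x = e i" using x by auto
      then show ?thesis using ip[of i "e i"] d[of i i] by simp
    qed
    show "?ip x y = 0" if xy: "x \<in> e ` {..<n}" "y \<in> e ` {..<n}" "x \<noteq> y" for x y
    proof -
      obtain i j where "i < n" "x = e i" "j < n" "y = e j" using xy by auto
      then show ?thesis using ip[of i "e j"] d[of i j] xy(3) by auto
    qed
    show "?ip x (br x y) = 0" if b: "x \<in> e ` {..<n}" for x y
    proof -
      obtain i where i: "i < n" "x = e i" using b by auto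
      have "br (e i) y = (\<Sum>j<n. c j y *\<^sub>R br (e i) (e j))"
        using arg_cong[OF x[of y], of "br (e i)"] by (simp add: linear_sum[OF linear_br(1)])
      then have "c i (br (e i) y) = (\<Sum>j<n. c j y *\<^sub>R c i (br (e i) (e j)))"
        using l[OF i(1)] by (simp add: linear_sum linear_scale)
      also have "\<dots> = 0" using hollow i by simp
      finally show ?thesis using ip i by simp
    qed
  qed
qed

text \<open>Each bracket of two frame vectors may have any component except those along these two
  vectors, which is the pattern asked for by \<open>has_ongb_of_frame\<close>.\<close>

lemma (in lie) has_ongb4:
  fixes e1 e2 e3 e4 :: 'a
  assumes dim: "DIM('a) = 4" and sp: "span {e1,e2,e3,e4} = UNIV"
    and b: "br e1 e2 = a *\<^sub>R e3 + a' *\<^sub>R e4" "br e1 e3 = b *\<^sub>R e2 + b' *\<^sub>R e4"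
    "br e1 e4 = c *\<^sub>R e2 + c' *\<^sub>R e3" "br e2 e3 = d *\<^sub>R e1 + d' *\<^sub>R e4"
    "br e2 e4 = p *\<^sub>R e1 + p' *\<^sub>R e3" "br e3 e4 = q *\<^sub>R e1 + q' *\<^sub>R e2"
  shows "has_ongb br"
proof -
  let ?e = "\<lambda>i. [e1,e2,e3,e4] ! i"
  have "?e ` {..<4} = {e1,e2,e3,e4}"
    by (simp add: lessThan_Suc eval_nat_numeral insert_commute)
  then obtain f where f: "frame 4 ?e f"
    using frame_exists[of 4 ?e] assms by auto
  have l: "linear (f i)" if "i < 4" for i
    using f that by (auto simp: frame_def)
  have ad: "f i (x + y) = f i x + f i y" and sc: "f i (r *\<^sub>R x) = r * f i x"
    and mi: "f i (- x) = - f i x" and ze: "f i 0 = 0" if "i < 4" for i x y r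
    using l[OF that] by (simp_all add: linear_add linear_scale linear_neg linear_0)
  have d: "f i (?e j) = (if i = j then 1 else 0)" if "i < 4" "j < 4" for i j
    using f that by (auto simp: frame_def)
  have di: "f i (x - y) = f i x - f i y" if "i < 4" for i x y
    using l[OF that] by (simp add: linear_diff)
  note dd = d[of 0 0] d[of 0 1] d[of 0 2] d[of 0 3] d[of 1 0] d[of 1 1] d[of 1 2] d[of 1 3]
    d[of 2 0] d[of 2 1] d[of 2 2] d[of 2 3] d[of 3 0] d[of 3 1] d[of 3 2] d[of 3 3]
  note bs = b br_skew[of e2 e1] br_skew[of e3 e1] br_skew[of e4 e1] br_skew[of e3 e2]
    br_skew[of e4 e2] br_skew[of e4 e3]
  have h: "\<forall>i\<in>{0,1,2,3}. \<forall>j\<in>{0,1,2,3}. f i (br (?e i) (?e j)) = 0"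
    using dd by (simp add: bs ad sc mi ze di eval_nat_numeral)
  show ?thesis
  proof (rule has_ongb_of_frame[OF f])
    fix i j :: nat assume "i < 4" "j < 4"
    then have "i \<in> {0,1,2,3}" "j \<in> {0,1,2,3}" by auto
    then show "f i (br (?e i) (?e j)) = 0" using h by blast
  qed
qed

lemma (in lie) has_ongb5:
  fixes e1 e2 e3 e4 e5 :: 'a
  assumes dim: "DIM('a) = 5" and sp: "span {e1,e2,e3,e4,e5} = UNIV"
    and b: "br e1 e2 = a *\<^sub>R e3 + a' *\<^sub>R e4 + a'' *\<^sub>R e5"
    "br e1 e3 = b *\<^sub>R e4 + b' *\<^sub>R e5" "br e1 e4 = c *\<^sub>R e3 + c' *\<^sub>R e5"
    "br e1 e5 = d *\<^sub>R e3 + d' *\<^sub>R e4"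
    "br e2 e3 = p *\<^sub>R e4 + p' *\<^sub>R e5" "br e2 e4 = q *\<^sub>R e3 + q' *\<^sub>R e5"
    "br e2 e5 = r *\<^sub>R e3 + r' *\<^sub>R e4"
    "br e3 e4 = 0" "br e3 e5 = 0" "br e4 e5 = 0"
  shows "has_ongb br"
proof -
  let ?e = "\<lambda>i. [e1,e2,e3,e4,e5] ! i"
  have "?e ` {..<5} = {e1,e2,e3,e4,e5}"
    by (simp add: lessThan_Suc eval_nat_numeral insert_commute)
  then obtain f where f: "frame 5 ?e f"
    using frame_exists[of 5 ?e] assms by auto
  have l: "linear (f i)" if "i < 5" for i
    using f that by (auto simp: frame_def)
  have ad: "f i (x + y) = f i x + f i y" and sc: "f i (r *\<^sub>R x) = r * f i x"
    and mi: "f i (- x) = - f i x" and ze: "f i 0 = 0" if "i < 5" for i x y r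
    using l[OF that] by (simp_all add: linear_add linear_scale linear_neg linear_0)
  have d: "f i (?e j) = (if i = j then 1 else 0)" if "i < 5" "j < 5" for i j
    using f that by (auto simp: frame_def)
  have di: "f i (x - y) = f i x - f i y" if "i < 5" for i x y
    using l[OF that] by (simp add: linear_diff)
  note dd = d[of 0 0] d[of 0 1] d[of 0 2] d[of 0 3] d[of 0 4]
    d[of 1 0] d[of 1 1] d[of 1 2] d[of 1 3] d[of 1 4]
    d[of 2 0] d[of 2 1] d[of 2 2] d[of 2 3] d[of 2 4]
    d[of 3 0] d[of 3 1] d[of 3 2] d[of 3 3] d[of 3 4]
    d[of 4 0] d[of 4 1] d[of 4 2] d[of 4 3] d[of 4 4]
  note bs = b br_skew[of e2 e1] br_skew[of e3 e1] br_skew[of e4 e1] br_skew[of e5 e1]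
    br_skew[of e3 e2] br_skew[of e4 e2] br_skew[of e5 e2]
    br_skew[of e4 e3] br_skew[of e5 e3] br_skew[of e5 e4]
  have h: "\<forall>i\<in>{0,1,2,3,4}. \<forall>j\<in>{0,1,2,3,4}. f i (br (?e i) (?e j)) = 0"
    using dd by (simp add: bs ad sc mi ze di eval_nat_numeral)
  show ?thesis
  proof (rule has_ongb_of_frame[OF f])
    fix i j :: nat assume "i < 5" "j < 5"
    then have "i \<in> {0,1,2,3,4}" "j \<in> {0,1,2,3,4}" by auto
    then show "f i (br (?e i) (?e j)) = 0" using h by blast
  qed
qed

text \<open>Both sums are the trace of \<open>f\<close> composed with the orthogonal projection onto
  the common span, and that projection does not depend on the orthonormal basis.\<close>

lemma sum_inner_orthonormal_eq:
  fixes f :: "'a::euclidean_space \<Rightarrow> 'a"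
  assumes "linear f" "span B = span C"
    and B: "pairwise orthogonal B" "\<And>x. x \<in> B \<Longrightarrow> norm x = 1"
    and C: "pairwise orthogonal C" "\<And>x. x \<in> C \<Longrightarrow> norm x = 1"
  shows "(\<Sum>b\<in>B. inner (f b) b) = (\<Sum>b\<in>C. inner (f b) b)"
proof -
  have fin: "finite B" "finite C"
    using pairwise_orthogonal_imp_finite B C by blast+
  define P where "P S x = (\<Sum>b\<in>S. inner x b *\<^sub>R b)" for S and x :: 'a
  have orth: "inner (x - P S x) y = 0"
    if "finite S" "pairwise orthogonal S" "\<And>x. x \<in> S \<Longrightarrow> norm x = 1" "y \<in> span S" for S x y
    using that(4)
  proof (induction rule: span_induct_alt)
    case (step r b y)
    have "inner (P S x) b = (\<Sum>a\<in>S. inner x a * inner a b)"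
      by (simp add: P_def inner_sum_left)
    also have "\<dots> = (\<Sum>a\<in>S. if a = b then inner x b else 0)"
      using that(2,3) step(1)
      by (intro sum.cong) (auto simp: pairwise_def orthogonal_def dot_square_norm)
    also have "\<dots> = inner x b" using that(1) step(1) by simp
    finally show ?case using step
      by (simp add: inner_add_right inner_diff_left)
  qed simp
  have mem: "P S x \<in> span S" for S x
    unfolding P_def by (intro span_sum span_scale span_base)
  have "P B x = P C x" for x
  proof -
    let ?d = "P B x - P C x"
    have d: "?d \<in> span B"
      using mem[of B x] mem[of C x] assms(2) span_diff by blast
    have "inner (x - P C x) ?d - inner (x - P B x) ?d = 0"
      using orth[OF fin(1) B d] orth[OF fin(2) C, of ?d] d assms(2) by simp
    then have "inner ?d ?d = 0"
      by (simp add: inner_diff_left)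
    then show ?thesis by simp
  qed
  then have "P B = P C" by (rule ext)
  moreover have "lin_trace (\<lambda>x. f (P S x)) = (\<Sum>b\<in>S. inner (f b) b)" if "finite S" for S
  proof -
    have "(\<lambda>x. f (P S x)) = (\<lambda>x. \<Sum>b\<in>S. inner x b *\<^sub>R f b)"
      using assms(1) by (simp add: P_def linear_sum linear_scale)
    moreover have "linear (\<lambda>x. inner x b)" for b :: 'a
      by (simp add: bounded_linear.linear bounded_linear_inner_left)
    ultimately show ?thesis
      using that by (simp add: lin_trace_sum lin_trace_eq_of_rank_one)
  qed
  note this[OF fin(1)] this[OF fin(2)]
  ultimately show ?thesis by simp
qed

text \<open>A nonzero diagonal with sum zero has a positive entry at some \<open>p\<close> and a
  negative one at some \<open>q\<close>. Rotating \<open>p\<close> into \<open>q\<close>, the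
  quadratic form of \<open>f\<close> vanishes at an intermediate unit vector \<open>v t\<close>. On
  the orthogonal complement of \<open>v t\<close> the diagonal sum is again zero by
  \<open>sum_inner_orthonormal_eq\<close>, so induction on the dimension applies.\<close>

lemma hollow_orthonormal_basis:
  fixes f :: "'a::euclidean_space \<Rightarrow> 'a"
  assumes "linear f" "pairwise orthogonal B" "\<And>x. x \<in> B \<Longrightarrow> norm x = 1"
    and "(\<Sum>b\<in>B. inner (f b) b) = 0"
  shows "\<exists>C. span C = span B \<and> pairwise orthogonal C \<and> (\<forall>x\<in>C. norm x = 1 \<and> inner (f x) x = 0)"
  using assms(2-)
proof (induction "dim (span B)" arbitrary: B rule: less_induct)
  case (less B)
  note fin = pairwise_orthogonal_imp_finite[OF less(2)]
  show ?case
  proof (cases "\<forall>b\<in>B. inner (f b) b = 0")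
    case True
    then show ?thesis using less by blast
  next
    case False
    have "\<exists>b\<in>B. inner (f b) b > 0"
    proof (rule ccontr)
      assume "\<not> ?thesis"
      then have "\<forall>b\<in>B. 0 \<le> - inner (f b) b" by force
      moreover have "(\<Sum>b\<in>B. - inner (f b) b) = 0" using less(4) by (simp add: sum_negf)
      ultimately show False
        using False fin by (simp add: sum_nonneg_eq_0_iff)
    qed
    moreover have "\<exists>b\<in>B. inner (f b) b < 0"
    proof (rule ccontr)
      assume "\<not> ?thesis"
      then have "\<forall>b\<in>B. 0 \<le> inner (f b) b" by force
      then show False
        using False fin less(4) by (simp add: sum_nonneg_eq_0_iff)
    qed
    ultimately obtain p q where pq: "p \<in> B" "q \<in> B" "inner (f p) p > 0" "inner (f q) q < 0"
      by blast
    then have "p \<noteq> q" by auto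
    with pq less(2) have o: "inner p q = 0" by (auto simp: pairwise_def orthogonal_def)
    define v where "v t = cos t *\<^sub>R p + sin t *\<^sub>R q" for t
    have "\<exists>t\<ge>0. t \<le> pi/2 \<and> inner (f (v t)) (v t) = 0"
    proof (rule IVT2')
      show "continuous_on {0..pi/2} (\<lambda>t. inner (f (v t)) (v t))"
        unfolding v_def using assms(1)
        by (simp add: linear_add linear_scale) (intro continuous_intros)
    qed (use pq in \<open>auto simp: v_def\<close>)
    then obtain t where t: "inner (f (v t)) (v t) = 0" by blast
    have "inner (v t) (v t) = 1"
      using o less(3)[OF pq(1)] less(3)[OF pq(2)] sin_cos_squared_add[of t]
      by (simp add: v_def inner_add_left inner_add_right inner_commute[of q p]
          power2_eq_square norm_eq_1)
    then have nv: "norm (v t) = 1" by (simp add: norm_eq_1)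
    have vB: "v t \<in> span B"
      unfolding v_def using pq by (intro span_add span_scale span_base)
    define W where "W = {x \<in> span B. inner (v t) x = 0}"
    have W: "subspace W"
      unfolding W_def subspace_def by (auto simp: span_zero span_add span_scale inner_add_right)
    obtain D where D: "D \<subseteq> W" "pairwise orthogonal D" "\<And>x. x \<in> D \<Longrightarrow> norm x = 1" "span D = W"
      using orthonormal_basis_subspace[OF W] by metis
    have o': "inner (v t) x = 0" if "x \<in> D" for x using that D(1) by (auto simp: W_def)
    have vD: "v t \<notin> D" using o' nv by force
    have po: "pairwise orthogonal (insert (v t) D)"
      using D(2) o' by (auto simp: pairwise_insert orthogonal_def inner_commute)
    have sp: "span (insert (v t) D) = span B"
    proof
      show "span (insert (v t) D) \<subseteq> span B"
        by (rule span_minimal) (use vB D(1) in \<open>auto simp: W_def\<close>)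
      show "span B \<subseteq> span (insert (v t) D)"
      proof
        fix x assume x: "x \<in> span B"
        let ?y = "x - inner (v t) x *\<^sub>R v t"
        have "?y \<in> W"
          using x vB nv by (auto simp: W_def span_diff span_scale inner_diff_right norm_eq_1)
        moreover have "W \<subseteq> span (insert (v t) D)"
          using D(4) span_mono[of D "insert (v t) D"] by blast
        ultimately have "?y \<in> span (insert (v t) D)" by blast
        then have "?y + inner (v t) x *\<^sub>R v t \<in> span (insert (v t) D)"
          by (rule span_add) (intro span_scale span_base insertI1)
        then show "x \<in> span (insert (v t) D)" by simp
      qed
    qed
    have finD: "finite D" using pairwise_orthogonal_imp_finite[OF D(2)] .
    have "(\<Sum>b\<in>insert (v t) D. inner (f b) b) = 0"
      using sum_inner_orthonormal_eq[OF assms(1) sp po _ less(2,3)] less(4) nv D(3) by auto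
    then have s0: "(\<Sum>b\<in>D. inner (f b) b) = 0"
      using finD vD t by simp
    have "v t \<notin> span D" using D(4) nv by (auto simp: W_def)
    then have "span D \<subset> span B"
      using sp span_mono[of D "insert (v t) D"] vB by blast
    then have "dim (span D) < dim (span B)"
      by (metis dim_psubset span_span)
    from less(1)[OF this D(2,3) s0] obtain C where
      C: "span C = span D" "pairwise orthogonal C" "\<forall>x\<in>C. norm x = 1 \<and> inner (f x) x = 0"
      by blast
    have "C \<subseteq> W" using C(1) D(4) span_superset by blast
    then have oC: "inner (v t) x = 0" if "x \<in> C" for x using that by (auto simp: W_def)
    show ?thesis
    proof (intro exI[of _ "insert (v t) C"] conjI)
      show "span (insert (v t) C) = span B"
        using sp C(1) unfolding span_insert by simp
      show "pairwise orthogonal (insert (v t) C)"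
        using C(2) oC by (auto simp: pairwise_insert orthogonal_def inner_commute)
    qed (use C nv t in auto)
  qed
qed

lemma is_inner_product_inner: "is_inner_product inner"
  unfolding is_inner_product_def bilinear_def
  by (auto simp: inner_commute inner_add_left inner_add_right intro!: linearI)

text \<open>The unit normal \<open>x\<close> of \<open>I\<close> acts on \<open>I\<close> with trace
  zero, hence with zero diagonal in some orthonormal basis \<open>C\<close> of \<open>I\<close>. As
  \<open>I\<close> is abelian, the bracket of \<open>b \<in> C\<close> with \<open>y\<close> sees
  only the \<open>x\<close>-component of \<open>y\<close>; and \<open>x\<close> is geodesic because
  its brackets lie in \<open>I\<close>.\<close>

lemma (in unimodular_lie) has_ongb_of_abelian_ideal:
  assumes "lie_ideal br I" "abelian_set br I" "dim I = DIM('a) - 1"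
  shows "has_ongb br"
proof -
  have I: "subspace I" "\<And>x y. y \<in> I \<Longrightarrow> br x y \<in> I"
    using assms(1) by (auto simp: lie_ideal_def)
  have sI: "span I = I" using I(1) by (simp add: span_eq_iff)
  have "dim I < DIM('a)" using assms(3) DIM_positive[where 'a='a] by linarith
  then obtain x0 where x0: "x0 \<noteq> 0" "\<And>y. y \<in> span I \<Longrightarrow> orthogonal x0 y"
    using orthogonal_to_subspace_exists by blast
  define x where "x = x0 /\<^sub>R norm x0"
  have nx: "norm x = 1" using x0 by (simp add: x_def)
  have ox: "inner x y = 0" if "y \<in> I" for y
    using x0(2) that sI by (auto simp: x_def orthogonal_def)
  obtain B where B: "B \<subseteq> I" "pairwise orthogonal B" "\<And>x. x \<in> B \<Longrightarrow> norm x = 1"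
    "independent B" "card B = dim I" "span B = I"
    using orthonormal_basis_subspace[OF I(1)] by metis
  have xI: "x \<notin> I" using ox nx by force
  have full: "span (insert x I) = UNIV"
  proof -
    have "dim (insert x I) = DIM('a)"
      using assms(3) xI DIM_positive[where 'a='a] dim_insert[of x I] unfolding sI by simp
    then show ?thesis by (simp add: dim_eq_full)
  qed
  have po: "pairwise orthogonal (insert x C)" if "C \<subseteq> I" "pairwise orthogonal C" for C
    using that ox by (auto simp: pairwise_insert orthogonal_def inner_commute)
  have finB: "finite B" using pairwise_orthogonal_imp_finite[OF B(2)] .
  have xB: "x \<notin> B" using xI B(1) by blast
  have spB: "span (insert x B) = UNIV"
    using full B(6) sI unfolding span_insert by simp
  have "(\<Sum>b\<in>insert x B. inner (br x b) b) = (\<Sum>b\<in>Basis. inner (br x b) b)"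
    by (rule sum_inner_orthonormal_eq)
      (use spB B(3) po[OF B(1,2)] nx in \<open>auto simp: orthogonal_Basis\<close>)
  then have "(\<Sum>b\<in>B. inner (br x b) b) = 0"
    using finB xB trace_br[of x] by (simp add: lin_trace_def)
  from hollow_orthonormal_basis[OF linear_br(1) B(2,3) this] obtain C where
    C: "span C = I" "pairwise orthogonal C" "\<And>b. b \<in> C \<Longrightarrow> norm b = 1"
      "\<And>b. b \<in> C \<Longrightarrow> inner (br x b) b = 0"
    using B(6) by blast
  have CI: "C \<subseteq> I" using C(1) span_superset by blast
  show ?thesis
  proof (rule has_ongbI[of inner "insert x C"])
    show "is_inner_product (inner :: 'a \<Rightarrow> 'a \<Rightarrow> real)" by (rule is_inner_product_inner)
    show sp: "span (insert x C) = UNIV"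
      using full C(1) sI unfolding span_insert by simp
    show "inner y y = 1" if "y \<in> insert x C" for y
      using that C nx by (auto simp: norm_eq_1)
    show "inner y z = 0" if "y \<in> insert x C" "z \<in> insert x C" "y \<noteq> z" for y z
      using po[OF CI C(2)] that by (auto simp: pairwise_def orthogonal_def)
    show "inner b (br b y) = 0" if b: "b \<in> insert x C" for b y
    proof -
      have "y \<in> span (insert x I)" using full by simp
      then obtain k where k: "y - k *\<^sub>R x \<in> I"
        unfolding span_insert sI by auto
      define z where "z = y - k *\<^sub>R x"
      have y: "y = k *\<^sub>R x + z" by (simp add: z_def)
      have z: "z \<in> I" using k z_def by simp
      show ?thesis
      proof (cases "b = x")
        case True
        then show ?thesis unfolding y using ox[OF I(2)[OF z]] by (simp add: inner_add_right)
      next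
        case False
        then have "b \<in> C" using b by blast
        moreover have "br b z = 0"
          using assms(2) z CI \<open>b \<in> C\<close> by (auto simp: abelian_set_def)
        ultimately show ?thesis
          unfolding y using br_skew[of b x] C(4)[of b]
          by (simp add: inner_add_right inner_commute)
      qed
    qed
  qed
qed

section \<open>Algebras without orthonormal geodesic bases\<close>

text \<open>What remains of an orthonormal geodesic basis when the inner product is forgotten:
  \<open>\<phi> b\<close> is pairing with \<open>b\<close>. The last conjunct, applied to frame
  vectors and their coordinate forms, expresses the identity matrix as a sum over
  \<open>B\<close>.\<close>

definition dual_family ::
  "('a::real_vector \<Rightarrow> 'a \<Rightarrow> 'a) \<Rightarrow> 'a set \<Rightarrow> ('a \<Rightarrow> 'a \<Rightarrow> real) \<Rightarrow> bool" where
  "dual_family br B \<phi> \<longleftrightarrow> finite B \<and>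
     (\<forall>b\<in>B. linear (\<phi> b) \<and> \<phi> b b = 1 \<and> (\<forall>x. \<phi> b (br x b) = 0)) \<and>
     (\<forall>b\<in>B. \<forall>b'\<in>B. b \<noteq> b' \<longrightarrow> \<phi> b b' = 0) \<and>
     (\<forall>l x. linear l \<longrightarrow> (\<Sum>b\<in>B. \<phi> b x * l b) = l x)"

lemma dual_familyD:
  assumes "dual_family br B \<phi>"
  shows "finite B" "b \<in> B \<Longrightarrow> linear (\<phi> b)" "b \<in> B \<Longrightarrow> \<phi> b b = 1"
    "b \<in> B \<Longrightarrow> \<phi> b (br x b) = 0" "b \<in> B \<Longrightarrow> b' \<in> B \<Longrightarrow> b \<noteq> b' \<Longrightarrow> \<phi> b b' = 0"
    "linear l \<Longrightarrow> (\<Sum>b\<in>B. \<phi> b x * l b) = l x"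
  using assms unfolding dual_family_def by blast+

lemma (in lie) has_ongb_dual_family:
  assumes "has_ongb br"
  obtains B \<phi> where "dual_family br B \<phi>"
proof -
  from assms obtain ip B where ip: "is_inner_product ip" and B: "orthonormal_geodesic_basis br ip B"
    unfolding has_ongb_def by (elim exE conjE)
  interpret inner_prod ip by unfold_locales fact
  note B' = B[unfolded orthonormal_geodesic_basis_def geodesic_basis_def geodesic_element_def]
  have geo: "ip b (br x b) = 0" if "b \<in> B" for b x
  proof -
    have "ip b (br b x) = 0" using B' that by blast
    then show ?thesis using br_skew[of x b] by simp
  qed
  have "(\<Sum>b\<in>B. ip b x * l b) = l x" if "linear l" for l x
    using arg_cong[OF orthonormal_geodesic_basis_expansion(2)[OF ip B, of x], of l] that
    by (simp add: linear_sum linear_scale)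
  then have "dual_family br B ip"
    using B' geo orthonormal_geodesic_basis_expansion(1)[OF ip B] linear_ip(1)
    unfolding dual_family_def by simp
  then show thesis by (rule that)
qed

definition sl2_semidirect :: "('a::real_vector \<Rightarrow> 'a \<Rightarrow> 'a) \<Rightarrow> bool" where
  "sl2_semidirect br \<longleftrightarrow> (\<exists>h e f v w. span {h,e,f,v,w} = UNIV \<and>
     br h e = 2 *\<^sub>R e \<and> br h f = - 2 *\<^sub>R f \<and> br e f = h \<and>
     br h v = v \<and> br h w = - w \<and> br e v = 0 \<and> br e w = v \<and> br f v = w \<and> br f w = 0 \<and>
     br v w = 0)"

text \<open>The nilradical is the Heisenberg algebra of \<open>x, y, z\<close> plus the line of
  \<open>w\<close>. The scaling of \<open>t\<close> gives it trace 2 on the plane of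
  \<open>x, y\<close>, hence 2 on \<open>z\<close> and -4 on \<open>w\<close>; \<open>x\<close> and
  \<open>y\<close> are chosen with equal diagonal entries, so the product \<open>p * q\<close>
  decides whether this plane carries real or complex eigenvalues.\<close>

definition heisenberg_extension :: "('a::real_vector \<Rightarrow> 'a \<Rightarrow> 'a) \<Rightarrow> bool" where
  "heisenberg_extension br \<longleftrightarrow> (\<exists>t x y z w p q a b c d. span {t,x,y,z,w} = UNIV \<and>
     br x y = z \<and> br x z = 0 \<and> br x w = 0 \<and> br y z = 0 \<and> br y w = 0 \<and> br z w = 0 \<and>
     br t x = x + p *\<^sub>R y + a *\<^sub>R z + b *\<^sub>R w \<and> br t y = q *\<^sub>R x + y + c *\<^sub>R z + d *\<^sub>R w \<and>
     br t z = 2 *\<^sub>R z \<and> br t w = - 4 *\<^sub>R w)"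

text \<open>The weights are forced up to scale: weights \<alpha>, \<beta> on \<open>x, y\<close>
  give \<alpha> + \<beta> on \<open>z\<close> and 2\<alpha> + \<beta> on \<open>w\<close>, and trace
  zero means 4\<alpha> + 3\<beta> = 0.\<close>

definition filiform_extension :: "('a::real_vector \<Rightarrow> 'a \<Rightarrow> 'a) \<Rightarrow> bool" where
  "filiform_extension br \<longleftrightarrow> (\<exists>t x y z w. span {t,x,y,z,w} = UNIV \<and>
     br x y = z \<and> br x z = w \<and> br x w = 0 \<and> br y z = 0 \<and> br y w = 0 \<and> br z w = 0 \<and>
     br t x = 3 *\<^sub>R x \<and> br t y = - 4 *\<^sub>R y \<and> br t z = - z \<and> br t w = 2 *\<^sub>R w)"

definition split_torus_extension :: "('a::real_vector \<Rightarrow> 'a \<Rightarrow> 'a) \<Rightarrow> bool" where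
  "split_torus_extension br \<longleftrightarrow> (\<exists>a b x y z. span {a,b,x,y,z} = UNIV \<and>
     br a b = 0 \<and> br x y = 0 \<and> br x z = 0 \<and> br y z = 0 \<and>
     br a x = - 2 *\<^sub>R x \<and> br a y = y \<and> br a z = z \<and>
     br b x = 0 \<and> br b y = y \<and> br b z = - z)"

definition rotation_torus_extension :: "('a::euclidean_space \<Rightarrow> 'a \<Rightarrow> 'a) \<Rightarrow> bool" where
  "rotation_torus_extension br \<longleftrightarrow> (\<exists>N X1 X2 X3 X4 X5.
     is_nilradical br N \<and> abelian_set br N \<and> dim N = 3 \<and>
     is_basis {X1, X2, X3, X4, X5} \<and> card {X1, X2, X3, X4, X5} = 5 \<and>
     N = span {X3, X4, X5} \<and>
     br X1 X3 = -2 *\<^sub>R X3 \<and> br X1 X4 = X4 \<and> br X1 X5 = X5 \<and>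
     br X2 X3 = 0 \<and> br X2 X4 = - X5 \<and> br X2 X5 = X4)"

text \<open>Every basis vector whose dual form is nonzero on the plane of \<open>v, w\<close> has
  the share 2/3 in the trace 2 of that plane, so there are three of them. Their components in
  \<open>sl2\<close> are quadratic in the pairs (\<open>\<phi> b v\<close>,
  \<open>\<phi> b w\<close>), which makes cubic sums over the three pairs vanish. Cubes of three
  pairwise independent vectors of the plane being linearly independent, the pairs are parallel and
  cannot span the plane.\<close>

lemma (in lie) sl2_semidirect_no_ongb:
  assumes dim: "DIM('a) = 5" and "sl2_semidirect br"
  shows "\<not> has_ongb br"
proof
  assume "has_ongb br"
  then obtain B \<phi> where "dual_family br B \<phi>" by (rule has_ongb_dual_family)
  note fin = dual_familyD(1)[OF this] and lin = dual_familyD(2)[OF this]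
    and one = dual_familyD(3)[OF this] and geo = dual_familyD(4)[OF this]
    and tr = dual_familyD(6)[OF this]
  from assms(2) obtain h e f v w where sp: "span {h,e,f,v,w} = UNIV"
    and br: "br h e = 2 *\<^sub>R e" "br h f = - 2 *\<^sub>R f" "br e f = h" "br h v = v" "br h w = - w"
      "br e v = 0" "br e w = v" "br f v = w" "br f w = 0" "br v w = 0"
    unfolding sl2_semidirect_def by blast
  obtain c1 c2 c3 c4 c5 where c: "linear c1" "linear c2" "linear c3" "linear c4" "linear c5"
    and c45: "c4 v = 1" "c4 w = 0" "c5 v = 0" "c5 w = 1" "c1 v = 0" "c2 v = 0" "c3 v = 0"
      "c1 w = 0" "c2 w = 0" "c3 w = 0"
    and x: "\<And>x. x = c1 x *\<^sub>R h + c2 x *\<^sub>R e + c3 x *\<^sub>R f + c4 x *\<^sub>R v + c5 x *\<^sub>R w"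
    by (rule frame5E[OF dim sp]) metis
  note skew = br_skew[of e h] br_skew[of f h] br_skew[of f e] br_skew[of v h] br_skew[of w h]
    br_skew[of v e] br_skew[of w e] br_skew[of v f] br_skew[of w f] br_skew[of w v]
  define S where "S = {b \<in> B. \<phi> b v \<noteq> 0 \<or> \<phi> b w \<noteq> 0}"
  define \<tau> where "\<tau> b = \<phi> b v * c4 b + \<phi> b w * c5 b" for b
  have \<tau>0: "\<tau> b = 0" if "b \<in> B - S" for b
    using that by (auto simp: S_def \<tau>_def)
  have ex: "\<exists>\<kappa>. \<kappa> \<noteq> 0 \<and> c1 b = \<kappa> * \<phi> b v * \<phi> b w \<and> c2 b = \<kappa> * (\<phi> b w)\<^sup>2 \<and>
      c3 b = - \<kappa> * (\<phi> b v)\<^sup>2 \<and> \<tau> b = 2/3" if b: "b \<in> S" for b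
  proof -
    have bB: "b \<in> B" and nz: "\<phi> b v \<noteq> 0 \<or> \<phi> b w \<noteq> 0" using b by (auto simp: S_def)
    define H E F V W where "H = \<phi> b h" and "E = \<phi> b e" and "F = \<phi> b f"
      and "V = \<phi> b v" and "W = \<phi> b w"
    define p q r s t where "p = c1 b" and "q = c2 b" and "r = c3 b" and "s = c4 b" and "t = c5 b"
    have b': "b = p *\<^sub>R h + q *\<^sub>R e + r *\<^sub>R f + s *\<^sub>R v + t *\<^sub>R w"
      unfolding p_def q_def r_def s_def t_def by (rule x)
    have L: "\<phi> b (br u b) = \<phi> b (br u (p *\<^sub>R h + q *\<^sub>R e + r *\<^sub>R f + s *\<^sub>R v + t *\<^sub>R w))" for u
      using b' by simp
    note ls = lin[OF bB, THEN linear_add] lin[OF bB, THEN linear_scale] lin[OF bB, THEN linear_neg]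
      lin[OF bB, THEN linear_diff]
    note defs = H_def[symmetric] E_def[symmetric] F_def[symmetric] V_def[symmetric] W_def[symmetric]
    have "\<phi> b (br v b) = 0" "\<phi> b (br w b) = 0" "\<phi> b (br h b) = 0" "\<phi> b (br e b) = 0"
      "\<phi> b (br f b) = 0"
      using geo[OF bB] by auto
    then have eqs: "p * V + r * W = 0" "p * W = q * V" "2 * q * E - 2 * r * F + s * V - t * W = 0"
      "- 2 * p * E + r * H + t * V = 0" "2 * p * F - q * H + s * W = 0"
      unfolding L by (simp_all add: br skew ls defs)
    have "\<phi> b (p *\<^sub>R h + q *\<^sub>R e + r *\<^sub>R f + s *\<^sub>R v + t *\<^sub>R w) = 1"
      using one[OF bB] b' by simp
    then have n: "p * H + q * E + r * F + s * V + t * W = 1"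
      by (simp add: ls defs)
    \<comment> \<open>The first two equations say that the covector (\<open>V\<close>,
      \<open>W\<close>) annihilates the image of the matrix with entries \<open>p, q, r, -p\<close>.
      A traceless matrix of this kind is a multiple of one fixed nilpotent matrix.\<close>
    obtain \<kappa> where k: "p = \<kappa> * V * W" "q = \<kappa> * W\<^sup>2" "r = - \<kappa> * V\<^sup>2"
    proof (cases "V = 0")
      case True
      then have "W \<noteq> 0" using nz by (simp add: V_def W_def)
      then show thesis using True eqs that[of "q / W\<^sup>2"] by auto
    next
      case False
      have "p = - (r / V\<^sup>2) * V * W"
        using False eqs(1) by (simp add: field_simps power2_eq_square)
      moreover have "q = - (r / V\<^sup>2) * W\<^sup>2"
        using False eqs(1,2) by (simp add: field_simps power2_eq_square) algebra
      ultimately show thesis using False that[of "- (r / V\<^sup>2)"] by simp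
    qed
    have st: "s * V + t * W = 2 * \<kappa> * (W\<^sup>2 * E - V\<^sup>2 * F + V * W * H)"
    proof (cases "V = 0")
      case True
      then show ?thesis using eqs(3,5) k nz by (simp add: V_def W_def)
    next
      case V: False
      have "V * (t - \<kappa> * (2 * W * E + V * H)) = 0"
        using eqs(4) k by algebra
      then have "t = \<kappa> * (2 * W * E + V * H)"
        using V by simp
      then show ?thesis using eqs(3) k by algebra
    qed
    have tau: "s * V + t * W = 2/3"
      using st n k by algebra
    have "\<kappa> \<noteq> 0" using st tau by auto
    then show ?thesis
      using k tau by (intro exI[of _ \<kappa>])
        (simp add: \<tau>_def p_def q_def r_def s_def t_def V_def W_def mult.commute)
  qed
  \<comment> \<open>The sum of the \<tau> is the trace of the projection onto the plane of
    \<open>v, w\<close>; portions of 2/3 add up to 2 exactly three times.\<close>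
  have "(\<Sum>b\<in>B. \<tau> b) = 2"
    using tr[OF c(4), of v] tr[OF c(5), of w] c45 by (simp add: \<tau>_def sum.distrib)
  then have "(\<Sum>b\<in>S. \<tau> b) = 2"
    using sum.mono_neutral_right[of B S \<tau>] fin \<tau>0 by (auto simp: S_def)
  moreover have "(\<Sum>b\<in>S. \<tau> b) = (\<Sum>b\<in>S. 2/3)"
    by (rule sum.cong[OF refl]) (use ex in blast)
  ultimately have "real (card S) * (2/3) = 2"
    by simp
  then have "card S = 3" by simp
  then obtain b1 b2 b3 where S: "S = {b1,b2,b3}" "b1 \<noteq> b2" "b1 \<noteq> b3" "b2 \<noteq> b3"
    by (auto simp: card_3_iff)
  obtain k where k: "\<And>b. b \<in> S \<Longrightarrow> k b \<noteq> 0 \<and> c1 b = k b * \<phi> b v * \<phi> b w \<and>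
      c2 b = k b * (\<phi> b w)\<^sup>2 \<and> c3 b = - k b * (\<phi> b v)\<^sup>2"
    using ex by metis
  have sumS: "(\<Sum>b\<in>B. \<phi> b u * l b) = (\<Sum>b\<in>S. \<phi> b u * l b)" if "u = v \<or> u = w" for u and l :: "'a \<Rightarrow> real"
    by (rule sum.mono_neutral_right) (use fin that in \<open>auto simp: S_def\<close>)
  have E3: "\<phi> b1 u * l b1 + \<phi> b2 u * l b2 + \<phi> b3 u * l b3 = l u"
    if "u = v \<or> u = w" "linear l" for u l
    using tr[OF that(2), of u] sumS[OF that(1), of l] S by simp
  note E3v = E3[of v, simplified] and E3w = E3[of w, simplified]
  define x1 y1 x2 y2 x3 y3 where d: "x1 = \<phi> b1 v" "y1 = \<phi> b1 w" "x2 = \<phi> b2 v" "y2 = \<phi> b2 w"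
    "x3 = \<phi> b3 v" "y3 = \<phi> b3 w"
  define k1 k2 k3 where kd: "k1 = k b1" "k2 = k b2" "k3 = k b3"
  have kk: "k1 \<noteq> 0" "k2 \<noteq> 0" "k3 \<noteq> 0" using k S by (auto simp: kd)
  have nz3: "x3 \<noteq> 0 \<or> y3 \<noteq> 0" "x2 \<noteq> 0 \<or> y2 \<noteq> 0" "x1 \<noteq> 0 \<or> y1 \<noteq> 0"
  proof -
    have "b1 \<in> S" "b2 \<in> S" "b3 \<in> S" using S(1) by auto
    then show "x3 \<noteq> 0 \<or> y3 \<noteq> 0" "x2 \<noteq> 0 \<or> y2 \<noteq> 0" "x1 \<noteq> 0 \<or> y1 \<noteq> 0"
      unfolding d by (simp_all add: S_def)
  qed
  have cs: "c1 b1 = k1 * x1 * y1" "c2 b1 = k1 * y1\<^sup>2" "c3 b1 = - k1 * x1\<^sup>2"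
    "c1 b2 = k2 * x2 * y2" "c2 b2 = k2 * y2\<^sup>2" "c3 b2 = - k2 * x2\<^sup>2"
    "c1 b3 = k3 * x3 * y3" "c2 b3 = k3 * y3\<^sup>2" "c3 b3 = - k3 * x3\<^sup>2"
    using k S by (auto simp: d kd)
  \<comment> \<open>These are the vanishing of \<open>c3\<close> and \<open>c1\<close> at
    \<open>v\<close> and of \<open>c1\<close> and \<open>c2\<close> at \<open>w\<close>, expanded
    over the three basis vectors.\<close>
  have cub: "k1 * x1^3 + k2 * x2^3 + k3 * x3^3 = 0"
    "k1 * x1\<^sup>2 * y1 + k2 * x2\<^sup>2 * y2 + k3 * x3\<^sup>2 * y3 = 0"
    "k1 * x1 * y1\<^sup>2 + k2 * x2 * y2\<^sup>2 + k3 * x3 * y3\<^sup>2 = 0"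
    "k1 * y1^3 + k2 * y2^3 + k3 * y3^3 = 0"
    using E3v[OF c(3)] E3v[OF c(1)] E3w[OF c(1)] E3w[OF c(2)]
    unfolding cs c45 d[symmetric] by algebra+
  \<comment> \<open>The \<open>k\<close>-weighted sum of the cubes of the three vectors \<open>(x\<^sub>i, y\<^sub>i)\<close> vanishes, so evaluating
    it on \<open>det(\<cdot>, j) det(\<cdot>, j) det(\<cdot>, l)\<close> forces two of them to be parallel.\<close>
  have par: "(x1 * y2 - x2 * y1)\<^sup>2 * (x1 * y3 - x3 * y1) * k1 = 0"
    "(x2 * y1 - x1 * y2)\<^sup>2 * (x2 * y3 - x3 * y2) * k2 = 0"
    "(x1 * y3 - x3 * y1)\<^sup>2 * (x1 * y2 - x2 * y1) * k1 = 0"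
    "(x3 * y1 - x1 * y3)\<^sup>2 * (x3 * y2 - x2 * y3) * k3 = 0"
    "(x2 * y3 - x3 * y2)\<^sup>2 * (x2 * y1 - x1 * y2) * k2 = 0"
    using cub by algebra+
  obtain s1 s2 s3 t1 t2 t3 where st: "s1 = c4 b1" "s2 = c4 b2" "s3 = c4 b3"
    "t1 = c5 b1" "t2 = c5 b2" "t3 = c5 b3" by blast
  have id: "x1 * s1 + x2 * s2 + x3 * s3 = 1" "x1 * t1 + x2 * t2 + x3 * t3 = 0"
    "y1 * s1 + y2 * s2 + y3 * s3 = 0" "y1 * t1 + y2 * t2 + y3 * t3 = 1"
    using E3v[OF c(4)] E3v[OF c(5)] E3w[OF c(4)] E3w[OF c(5)] by (simp_all add: d c45 st)
  have "x1 * y2 - x2 * y1 = 0"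
  proof (rule ccontr)
    assume n: "x1 * y2 - x2 * y1 \<noteq> 0"
    then have "x1 * y3 - x3 * y1 = 0" "x2 * y3 - x3 * y2 = 0"
      using par(1,2) kk by auto
    then have "x3 * (x1 * y2 - x2 * y1) = 0" "y3 * (x1 * y2 - x2 * y1) = 0"
      by algebra+
    then show False using n nz3 by auto
  qed
  moreover have "x1 * y3 - x3 * y1 = 0"
  proof (rule ccontr)
    assume n: "x1 * y3 - x3 * y1 \<noteq> 0"
    then have "x3 * y2 - x2 * y3 = 0"
      using par(4) kk by auto
    with \<open>x1 * y2 - x2 * y1 = 0\<close> have "x2 * (x1 * y3 - x3 * y1) = 0" "y2 * (x1 * y3 - x3 * y1) = 0"
      by algebra+
    then show False using n nz3 by auto
  qed
  ultimately have "x1 = 0 \<and> y1 = 0"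
    using id by algebra
  then show False using nz3 by blast
qed

text \<open>If \<open>\<phi> b z\<close> is nonzero, the brackets of \<open>b\<close> with
  \<open>z\<close>, \<open>x\<close> and \<open>y\<close> remove the \<open>t\<close>,
  \<open>y\<close> and \<open>x\<close> components of \<open>b\<close>. What is left has shares of
  \<open>z\<close> and \<open>w\<close> with sum 1 and, by the bracket with \<open>t\<close>, ratio
  2 to 1. So the trace 1 on the line of \<open>z\<close> would be a sum of portions 2/3.\<close>

lemma (in lie) heisenberg_extension_no_ongb:
  assumes dim: "DIM('a) = 5" and "heisenberg_extension br"
  shows "\<not> has_ongb br"
proof
  assume "has_ongb br"
  then obtain B \<phi> where "dual_family br B \<phi>" by (rule has_ongb_dual_family)
  note fin = dual_familyD(1)[OF this] and lin = dual_familyD(2)[OF this]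
    and one = dual_familyD(3)[OF this] and geo = dual_familyD(4)[OF this]
    and tr = dual_familyD(6)[OF this]
  from assms(2) obtain t x y z w p' q' a' b' c' d' where sp: "span {t,x,y,z,w} = UNIV"
    and br: "br x y = z" "br x z = 0" "br x w = 0" "br y z = 0" "br y w = 0" "br z w = 0"
      "br t x = x + p' *\<^sub>R y + a' *\<^sub>R z + b' *\<^sub>R w" "br t y = q' *\<^sub>R x + y + c' *\<^sub>R z + d' *\<^sub>R w"
      "br t z = 2 *\<^sub>R z" "br t w = - 4 *\<^sub>R w"
    unfolding heisenberg_extension_def by blast
  obtain c1 c2 c3 c4 c5 where c: "linear c4" "c4 z = 1"
    and ex: "\<And>x'. x' = c1 x' *\<^sub>R t + c2 x' *\<^sub>R x + c3 x' *\<^sub>R y + c4 x' *\<^sub>R z + c5 x' *\<^sub>R w"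
    by (rule frame5E[OF dim sp]) metis
  note skew = br_skew[of x t] br_skew[of y t] br_skew[of z t] br_skew[of w t]
    br_skew[of y x] br_skew[of z x] br_skew[of w x] br_skew[of z y] br_skew[of w y] br_skew[of w z]
  have val: "\<phi> b z * c4 b = (if \<phi> b z \<noteq> 0 then 2/3 else 0)" if bB: "b \<in> B" for b
  proof (cases "\<phi> b z = 0")
    case False
    define T X Y Z W where "T = \<phi> b t" and "X = \<phi> b x" and "Y = \<phi> b y"
      and "Z = \<phi> b z" and "W = \<phi> b w"
    define m n r s u where "m = c1 b" and "n = c2 b" and "r = c3 b" and "s = c4 b" and "u = c5 b"
    have b'': "b = m *\<^sub>R t + n *\<^sub>R x + r *\<^sub>R y + s *\<^sub>R z + u *\<^sub>R w"
      unfolding m_def n_def r_def s_def u_def by (rule ex)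
    have L: "\<phi> b (br o' b) = \<phi> b (br o' (m *\<^sub>R t + n *\<^sub>R x + r *\<^sub>R y + s *\<^sub>R z + u *\<^sub>R w))" for o'
      using b'' by simp
    note ls = lin[OF bB, THEN linear_add] lin[OF bB, THEN linear_scale] lin[OF bB, THEN linear_neg]
      lin[OF bB, THEN linear_diff]
    note defs = T_def[symmetric] X_def[symmetric] Y_def[symmetric] Z_def[symmetric] W_def[symmetric]
    have Z: "Z \<noteq> 0" using False by (simp add: Z_def)
    have g: "\<phi> b (br z b) = 0" "\<phi> b (br x b) = 0" "\<phi> b (br y b) = 0" "\<phi> b (br t b) = 0"
      using geo[OF bB] by auto
    have m0: "m = 0"
      using g(1) Z unfolding L by (simp add: br skew ls defs)
    have nr: "r = 0" "n = 0"
      using g(2,3) Z m0 unfolding L by (simp_all add: br skew ls defs)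
    have "2 * s * Z - 4 * u * W = 0"
      using g(4) m0 nr unfolding L by (simp add: br skew ls defs)
    moreover have "\<phi> b (m *\<^sub>R t + n *\<^sub>R x + r *\<^sub>R y + s *\<^sub>R z + u *\<^sub>R w) = 1"
      using one[OF bB] b'' by simp
    then have "s * Z + u * W = 1" using m0 nr by (simp add: ls defs)
    ultimately have "Z * s = 2/3" by algebra
    then show ?thesis using False by (simp add: Z_def s_def)
  qed simp
  have "1 = (\<Sum>b\<in>B. \<phi> b z * c4 b)"
    using tr[OF c(1), of z] c(2) by simp
  also have "\<dots> = (\<Sum>b\<in>B. if \<phi> b z \<noteq> 0 then 2/3 else 0)"
    using val by simp
  also have "\<dots> = real (card {b \<in> B. \<phi> b z \<noteq> 0}) * (2/3)"
    using fin by (simp flip: sum.inter_filter)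
  finally have "real (2 * card {b \<in> B. \<phi> b z \<noteq> 0}) = real 3" by simp
  then have "2 * card {b \<in> B. \<phi> b z \<noteq> 0} = 3" by (simp only: of_nat_eq_iff)
  then show False by presburger
qed

text \<open>Adding four times the normalisation of \<open>b\<close> to the equation from
  \<open>t\<close> eliminates the share of \<open>y\<close> and leaves
  \<open>3 * (share of z) + 6 * (share of w) = 4\<close> whenever \<open>\<phi> b w\<close> is
  nonzero; otherwise both shares vanish. The total of the left side is 3 + 6 = 9, not a multiple of
  4.\<close>

lemma (in lie) filiform_extension_no_ongb:
  assumes dim: "DIM('a) = 5" and "filiform_extension br"
  shows "\<not> has_ongb br"
proof
  assume "has_ongb br"
  then obtain B \<phi> where "dual_family br B \<phi>" by (rule has_ongb_dual_family)
  note fin = dual_familyD(1)[OF this] and lin = dual_familyD(2)[OF this]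
    and one = dual_familyD(3)[OF this] and geo = dual_familyD(4)[OF this]
    and tr = dual_familyD(6)[OF this]
  from assms(2) obtain t x y z w where sp: "span {t,x,y,z,w} = UNIV"
    and br: "br x y = z" "br x z = w" "br x w = 0" "br y z = 0" "br y w = 0" "br z w = 0"
      "br t x = 3 *\<^sub>R x" "br t y = - 4 *\<^sub>R y" "br t z = - z" "br t w = 2 *\<^sub>R w"
    unfolding filiform_extension_def by blast
  obtain c1 c2 c3 c4 c5 where c: "linear c4" "c4 z = 1" "linear c5" "c5 w = 1"
    and ex: "\<And>x'. x' = c1 x' *\<^sub>R t + c2 x' *\<^sub>R x + c3 x' *\<^sub>R y + c4 x' *\<^sub>R z + c5 x' *\<^sub>R w"
    by (rule frame5E[OF dim sp]) metis
  note skew = br_skew[of x t] br_skew[of y t] br_skew[of z t] br_skew[of w t]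
    br_skew[of y x] br_skew[of z x] br_skew[of w x] br_skew[of z y] br_skew[of w y] br_skew[of w z]
  have val: "3 * (\<phi> b z * c4 b) + 6 * (\<phi> b w * c5 b) = (if \<phi> b w \<noteq> 0 then 4 else 0)"
    if bB: "b \<in> B" for b
  proof -
    define T X Y Z W where "T = \<phi> b t" and "X = \<phi> b x" and "Y = \<phi> b y"
      and "Z = \<phi> b z" and "W = \<phi> b w"
    define m n r s u where "m = c1 b" and "n = c2 b" and "r = c3 b" and "s = c4 b" and "u = c5 b"
    have b'': "b = m *\<^sub>R t + n *\<^sub>R x + r *\<^sub>R y + s *\<^sub>R z + u *\<^sub>R w"
      unfolding m_def n_def r_def s_def u_def by (rule ex)
    have L: "\<phi> b (br o' b) = \<phi> b (br o' (m *\<^sub>R t + n *\<^sub>R x + r *\<^sub>R y + s *\<^sub>R z + u *\<^sub>R w))" for o'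
      using b'' by simp
    note ls = lin[OF bB, THEN linear_add] lin[OF bB, THEN linear_scale] lin[OF bB, THEN linear_neg]
      lin[OF bB, THEN linear_diff]
    note defs = T_def[symmetric] X_def[symmetric] Y_def[symmetric] Z_def[symmetric] W_def[symmetric]
    have "\<phi> b (br w b) = 0" "\<phi> b (br z b) = 0" "\<phi> b (br y b) = 0" "\<phi> b (br x b) = 0"
      "\<phi> b (br t b) = 0"
      using geo[OF bB] by auto
    then have eqs: "m * W = 0" "m * Z = n * W" "4 * m * Y = n * Z"
      "r * Z + s * W = 3 * m * X"
      "3 * n * X - 4 * r * Y - s * Z + 2 * u * W = 0"
      unfolding L by (simp_all add: br skew ls defs)
    have "\<phi> b (m *\<^sub>R t + n *\<^sub>R x + r *\<^sub>R y + s *\<^sub>R z + u *\<^sub>R w) = 1"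
      using one[OF bB] b'' by simp
    then have n: "m * T + n * X + r * Y + s * Z + u * W = 1" by (simp add: ls defs)
    have "3 * (Z * s) + 6 * (W * u) = (if W \<noteq> 0 then 4 else 0)"
    proof (cases "W = 0")
      case False
      then have "m = 0" "n = 0" using eqs by auto
      then have "3 * (Z * s) + 6 * (W * u) = 4" using eqs(5) n by simp algebra
      then show ?thesis using False by simp
    next
      case W: True
      have "Z = 0"
      proof (rule ccontr)
        assume "Z \<noteq> 0"
        then have "m = 0" "n = 0" using eqs W by auto
        moreover have "r = 0" using eqs W \<open>Z \<noteq> 0\<close> \<open>m = 0\<close> by auto
        ultimately show False using eqs(5) n W by auto
      qed
      then show ?thesis using W by simp
    qed
    then show ?thesis by (simp add: Z_def s_def W_def u_def)
  qed
  have "9 = (\<Sum>b\<in>B. 3 * (\<phi> b z * c4 b) + 6 * (\<phi> b w * c5 b))"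
    using tr[OF c(1), of z] c(2) tr[OF c(3), of w] c(4)
    by (simp add: sum.distrib flip: sum_distrib_left)
  also have "\<dots> = (\<Sum>b\<in>B. if \<phi> b w \<noteq> 0 then 4 else 0)"
    by (rule sum.cong) (use val in auto)
  also have "\<dots> = real (card {b \<in> B. \<phi> b w \<noteq> 0}) * 4"
    using fin by (simp flip: sum.inter_filter)
  finally have "real (4 * card {b \<in> B. \<phi> b w \<noteq> 0}) = real 9" by simp
  then have "4 * card {b \<in> B. \<phi> b w \<noteq> 0} = 9" by (simp only: of_nat_eq_iff)
  then show False by presburger
qed

text \<open>The equations from \<open>t\<close> and \<open>t'\<close> equalise the shares of
  \<open>x\<close>, \<open>y\<close> and \<open>z\<close> in a basis vector. Whenever this share is
  nonzero it is 1/3, and the vector lies in the span of \<open>x, y, z\<close>. Hence there are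
  three such vectors, and the orthogonality of two of them is what fails.\<close>

lemma (in lie) split_torus_extension_no_ongb:
  assumes dim: "DIM('a) = 5" and "split_torus_extension br"
  shows "\<not> has_ongb br"
proof
  assume "has_ongb br"
  then obtain B \<phi> where "dual_family br B \<phi>" by (rule has_ongb_dual_family)
  note fin = dual_familyD(1)[OF this] and lin = dual_familyD(2)[OF this]
    and one = dual_familyD(3)[OF this] and geo = dual_familyD(4)[OF this]
    and orth = dual_familyD(5)[OF this] and tr = dual_familyD(6)[OF this]
  from assms(2) obtain t t' x y z where sp: "span {t,t',x,y,z} = UNIV"
    and br: "br t t' = 0" "br x y = 0" "br x z = 0" "br y z = 0"
      "br t x = - 2 *\<^sub>R x" "br t y = y" "br t z = z" "br t' x = 0" "br t' y = y" "br t' z = - z"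
    unfolding split_torus_extension_def by blast
  obtain c1 c2 c3 c4 c5 where c: "linear c3" "c3 x = 1"
    and ex: "\<And>x'. x' = c1 x' *\<^sub>R t + c2 x' *\<^sub>R t' + c3 x' *\<^sub>R x + c4 x' *\<^sub>R y + c5 x' *\<^sub>R z"
    by (rule frame5E[OF dim sp]) metis
  note skew = br_skew[of t' t] br_skew[of x t] br_skew[of y t] br_skew[of z t] br_skew[of x t']
    br_skew[of y t'] br_skew[of z t'] br_skew[of y x] br_skew[of z x] br_skew[of z y]
  define S where "S = {b \<in> B. \<phi> b x * c3 b \<noteq> 0}"
  have val: "\<phi> b x * c3 b = 1/3 \<and> \<phi> b y * c4 b = 1/3 \<and> \<phi> b z * c5 b = 1/3 \<and> c1 b = 0 \<and> c2 b = 0"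
    if "b \<in> S" for b
  proof -
    have bB: "b \<in> B" and nz: "\<phi> b x * c3 b \<noteq> 0" using that by (auto simp: S_def)
    define T T' X Y Z where "T = \<phi> b t" and "T' = \<phi> b t'" and "X = \<phi> b x"
      and "Y = \<phi> b y" and "Z = \<phi> b z"
    define m n r s u where "m = c1 b" and "n = c2 b" and "r = c3 b" and "s = c4 b" and "u = c5 b"
    have b'': "b = m *\<^sub>R t + n *\<^sub>R t' + r *\<^sub>R x + s *\<^sub>R y + u *\<^sub>R z"
      unfolding m_def n_def r_def s_def u_def by (rule ex)
    have L: "\<phi> b (br o' b) = \<phi> b (br o' (m *\<^sub>R t + n *\<^sub>R t' + r *\<^sub>R x + s *\<^sub>R y + u *\<^sub>R z))" for o'
      using b'' by simp
    note ls = lin[OF bB, THEN linear_add] lin[OF bB, THEN linear_scale] lin[OF bB, THEN linear_neg]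
      lin[OF bB, THEN linear_diff]
    note defs = T_def[symmetric] T'_def[symmetric] X_def[symmetric] Y_def[symmetric] Z_def[symmetric]
    have "\<phi> b (br x b) = 0" "\<phi> b (br y b) = 0" "\<phi> b (br z b) = 0" "\<phi> b (br t b) = 0"
      "\<phi> b (br t' b) = 0"
      using geo[OF bB] by auto
    then have eqs: "m * X = 0" "m * Y + n * Y = 0" "m * Z = n * Z"
      "- 2 * r * X + s * Y + u * Z = 0" "s * Y - u * Z = 0"
      unfolding L by (auto simp add: br skew ls defs)
    have "\<phi> b (m *\<^sub>R t + n *\<^sub>R t' + r *\<^sub>R x + s *\<^sub>R y + u *\<^sub>R z) = 1"
      using one[OF bB] b'' by simp
    then have n: "m * T + n * T' + r * X + s * Y + u * Z = 1" by (simp add: ls defs)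
    have X: "X \<noteq> 0" "r \<noteq> 0" using nz by (auto simp: X_def r_def)
    have Y: "s * Y = r * X" "u * Z = r * X" using eqs(4,5) by (simp_all add: mult.commute)
    then have "Y \<noteq> 0" "Z \<noteq> 0" using X by auto
    then have "m = 0" "n = 0" using eqs(1-3) X by auto
    then show ?thesis using n Y
      by (simp add: X_def r_def Y_def s_def Z_def u_def m_def n_def mult.commute)
  qed
  have "1 = (\<Sum>b\<in>B. \<phi> b x * c3 b)"
    using tr[OF c(1), of x] c(2) by simp
  also have "\<dots> = (\<Sum>b\<in>S. \<phi> b x * c3 b)"
    by (rule sum.mono_neutral_right) (use fin in \<open>auto simp: S_def\<close>)
  also have "\<dots> = (\<Sum>b\<in>S. 1/3)"
    by (rule sum.cong[OF refl]) (use val in blast)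
  finally have "card S = 3" by simp
  then obtain b b' where b: "b \<in> S" "b' \<in> S" "b \<noteq> b'"
    by (auto simp: card_3_iff)
  then have bB: "b \<in> B" "b' \<in> B" by (auto simp: S_def)
  have z: "\<phi> d x * c3 e + \<phi> d y * c4 e + \<phi> d z * c5 e = 0" if "d \<in> S" "e \<in> S" "d \<noteq> e" for d e
  proof -
    have dB: "d \<in> B" "e \<in> B" using that by (auto simp: S_def)
    have "e = c3 e *\<^sub>R x + c4 e *\<^sub>R y + c5 e *\<^sub>R z"
      using ex[of e] val[OF that(2)] by simp
    then have "\<phi> d (c3 e *\<^sub>R x + c4 e *\<^sub>R y + c5 e *\<^sub>R z) = 0"
      using orth[OF dB that(3)] by simp
    then show ?thesis
      using lin[OF dB(1)] by (simp add: linear_add linear_scale mult.commute)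
  qed
  define p1 p2 p3 q1 q2 q3 where p: "p1 = \<phi> b x * c3 b'" "p2 = \<phi> b y * c4 b'" "p3 = \<phi> b z * c5 b'"
    "q1 = \<phi> b' x * c3 b" "q2 = \<phi> b' y * c4 b" "q3 = \<phi> b' z * c5 b"
  \<comment> \<open>Three reals with zero sum whose inverses also have zero sum do not exist.\<close>
  have "p1 + p2 + p3 = 0" "q1 + q2 + q3 = 0"
    using z b by (simp_all add: p)
  moreover have "p1 * q1 = 1/9" "p2 * q2 = 1/9" "p3 * q3 = 1/9"
    using val[OF b(1)] val[OF b(2)] unfolding p by algebra+
  ultimately have "p1\<^sup>2 + p2\<^sup>2 + p3\<^sup>2 = 0" by algebra
  then have "p1 = 0" by (simp add: add_nonneg_eq_0_iff)
  with \<open>p1 * q1 = 1/9\<close> show False by simp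
qed

section \<open>Explicit geodesic bases\<close>

lemma span_eq_UNIV_mono: "span E = UNIV \<Longrightarrow> E \<subseteq> span B \<Longrightarrow> span B = UNIV"
  using span_minimal[of E "span B"] by auto

lemma in_span_insert_combination:
  fixes x :: "'a::real_vector"
  assumes "x = r *\<^sub>R a + s *\<^sub>R b + t *\<^sub>R c" "{a,b,c} \<subseteq> S"
  shows "x \<in> span S"
  unfolding assms(1) using assms(2) by (intro span_add span_scale span_base) auto

text \<open>Brackets are tested against the spanning set \<open>E\<close>, the frame in which
  \<open>br\<close> is known, instead of against the skew basis itself.\<close>

lemma (in lie) has_gbI:
  fixes b1 b2 b3 b4 b5 :: 'a
  assumes "DIM('a) = 5" "is_inner_product ip" "span {b1,b2,b3,b4,b5} = UNIV" "span E = UNIV"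
    and geo: "\<And>b e. b \<in> {b1,b2,b3,b4,b5} \<Longrightarrow> e \<in> E \<Longrightarrow> ip b (br b e) = 0"
  shows "has_gb br"
proof -
  interpret inner_prod ip by unfold_locales fact
  let ?B = "{b1,b2,b3,b4,b5}"
  have ind: "independent ?B"
    by (rule card_le_dim_spanning[of _ UNIV]) (use assms(1,3) in \<open>auto simp: card_insert_if\<close>)
  have "ip b (br b y) = 0" if b: "b \<in> ?B" for b y
  proof -
    have "y \<in> span E" using assms(4) by simp
    then show ?thesis
      by (induction rule: span_induct_alt) (use geo[OF b] in auto)
  qed
  moreover have "b \<noteq> 0" if "b \<in> ?B" for b
    using ind dependent_zero[of ?B] that by blast
  ultimately have "geodesic_basis br ip ?B"
    unfolding geodesic_basis_def geodesic_element_def is_basis_def using ind assms(3) by blast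
  then show ?thesis unfolding has_gb_def using assms(2) by blast
qed

lemma inner_product_of_coordinates:
  assumes "linear c1" "linear c2" "linear c3" "linear c4" "linear c5"
    and x: "\<And>x. x = c1 x *\<^sub>R e1 + c2 x *\<^sub>R e2 + c3 x *\<^sub>R e3 + c4 x *\<^sub>R e4 + c5 x *\<^sub>R e5"
    and w: "w1 > 0" "w2 > 0" "w3 > 0" "w4 > 0" "(w5::real) > 0"
  shows "is_inner_product (\<lambda>x y. w1 * (c1 x * c1 y) + w2 * (c2 x * c2 y) + w3 * (c3 x * c3 y)
    + w4 * (c4 x * c4 y) + w5 * (c5 x * c5 y))" (is "is_inner_product ?ip")
  unfolding is_inner_product_def bilinear_def
proof (intro conjI allI impI)
  show "linear (?ip x)" for x
    by (rule linearI) (simp_all add: assms linear_add linear_scale algebra_simps)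
  show "linear (\<lambda>x. ?ip x y)" for y
    by (rule linearI) (simp_all add: assms linear_add linear_scale algebra_simps)
  show "?ip x y = ?ip y x" for x y by (simp add: mult.commute)
  fix x :: 'a assume "x \<noteq> 0"
  have "\<not> (c1 x = 0 \<and> c2 x = 0 \<and> c3 x = 0 \<and> c4 x = 0 \<and> c5 x = 0)"
  proof
    assume "c1 x = 0 \<and> c2 x = 0 \<and> c3 x = 0 \<and> c4 x = 0 \<and> c5 x = 0"
    then have "x = 0" by (subst x[of x]) simp
    with \<open>x \<noteq> 0\<close> show False ..
  qed
  moreover have sq: "0 \<le> w * (r * r)" "r \<noteq> 0 \<Longrightarrow> 0 < w * (r * r)" if "w > 0" for w r :: real
    using that by (simp_all add: zero_less_mult_iff linorder_neq_iff disj_commute)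
  ultimately show "?ip x x > 0"
    using sq[OF w(1), of "c1 x"] sq[OF w(2), of "c2 x"] sq[OF w(3), of "c3 x"]
      sq[OF w(4), of "c4 x"] sq[OF w(5), of "c5 x"] by linarith
qed

lemma (in lie) sl2_semidirect_has_gb:
  assumes dim: "DIM('a) = 5" and "sl2_semidirect br"
  shows "has_gb br"
proof -
  from assms(2) obtain h e f v w where sp: "span {h,e,f,v,w} = UNIV"
    and br: "br h e = 2 *\<^sub>R e" "br h f = - 2 *\<^sub>R f" "br e f = h" "br h v = v" "br h w = - w"
      "br e v = 0" "br e w = v" "br f v = w" "br f w = 0" "br v w = 0"
    unfolding sl2_semidirect_def by blast
  note skew = br_skew[of e h] br_skew[of f h] br_skew[of f e] br_skew[of v h] br_skew[of w h]
    br_skew[of v e] br_skew[of w e] br_skew[of v f] br_skew[of w f] br_skew[of w v]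
  show ?thesis
  proof (rule frame5E[OF dim sp])
    fix c1 c2 c3 c4 c5 :: "'a \<Rightarrow> real"
    assume l: "linear c1" "linear c2" "linear c3" "linear c4" "linear c5"
    assume d: "c1 h = 1" "c1 e = 0" "c1 f = 0" "c1 v = 0" "c1 w = 0"
      "c2 h = 0" "c2 e = 1" "c2 f = 0" "c2 v = 0" "c2 w = 0"
      "c3 h = 0" "c3 e = 0" "c3 f = 1" "c3 v = 0" "c3 w = 0"
      "c4 h = 0" "c4 e = 0" "c4 f = 0" "c4 v = 1" "c4 w = 0"
      "c5 h = 0" "c5 e = 0" "c5 f = 0" "c5 v = 0" "c5 w = 1"
    assume x: "\<And>x. x = c1 x *\<^sub>R h + c2 x *\<^sub>R e + c3 x *\<^sub>R f + c4 x *\<^sub>R v + c5 x *\<^sub>R w"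
    note ls = l[THEN linear_add] l[THEN linear_scale] l[THEN linear_neg] l[THEN linear_diff]
      l[THEN linear_0]
    let ?B = "{h, e + w, e - w, f + v, f - v}"
    have "e \<in> span ?B" "w \<in> span ?B" "f \<in> span ?B" "v \<in> span ?B"
      by (rule in_span_insert_combination[of _ "1/2" "e + w" "1/2" "e - w" 0 h], simp add: algebra_simps flip: scaleR_add_left, simp)
        (rule in_span_insert_combination[of _ "1/2" "e + w" "-1/2" "e - w" 0 h], simp add: algebra_simps flip: scaleR_add_left, simp,
         rule in_span_insert_combination[of _ "1/2" "f + v" "1/2" "f - v" 0 h], simp add: algebra_simps flip: scaleR_add_left, simp,
         rule in_span_insert_combination[of _ "1/2" "f + v" "-1/2" "f - v" 0 h], simp add: algebra_simps flip: scaleR_add_left, simp)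
    then have spB: "span ?B = UNIV"
      by (intro span_eq_UNIV_mono[OF sp]) (auto intro: span_base)
    \<comment> \<open>The weights balance the eigenvalues of \<open>h\<close>: the bracket of
      \<open>e + w\<close> with \<open>h\<close> is \<open>- 2 e + w\<close>, and weight 1/2 on
      \<open>e\<close> cancels weight 1 on \<open>w\<close>. The same holds for \<open>f\<close> and
      \<open>v\<close>, and for either sign.\<close>
    show ?thesis
      by (rule has_gbI[OF dim inner_product_of_coordinates[OF l x, of 1 "1/2" "1/2" 1 1] spB sp])
        (auto simp: br skew ls d)
  qed
qed

lemma (in lie) heisenberg_extension_has_gb:
  assumes dim: "DIM('a) = 5" and "heisenberg_extension br"
  shows "has_gb br"
proof -
  from assms(2) obtain t x y z w p q a b c d where sp: "span {t,x,y,z,w} = UNIV"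
    and br: "br x y = z" "br x z = 0" "br x w = 0" "br y z = 0" "br y w = 0" "br z w = 0"
      "br t x = x + p *\<^sub>R y + a *\<^sub>R z + b *\<^sub>R w" "br t y = q *\<^sub>R x + y + c *\<^sub>R z + d *\<^sub>R w"
      "br t z = 2 *\<^sub>R z" "br t w = - 4 *\<^sub>R w"
    unfolding heisenberg_extension_def by blast
  note skew = br_skew[of x t] br_skew[of y t] br_skew[of z t] br_skew[of w t]
    br_skew[of y x] br_skew[of z x] br_skew[of w x] br_skew[of z y] br_skew[of w y] br_skew[of w z]
  \<comment> \<open>With \<open>k = b\<close> this expression is the pairing of
    \<open>x + r w\<close> with its bracket from \<open>t\<close>, and likewise for \<open>y\<close>
    with \<open>k = d\<close>. The discriminant \<open>k^2 + 16\<close> is positive, so a real root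
    exists.\<close>
  have root: "\<exists>r. 1 + r * (k - 4 * r) = 0" for k :: real
  proof -
    define S where "S = sqrt (k\<^sup>2 + 16)"
    have "S * S = k * k + 16" by (simp add: S_def power2_eq_square)
    then have "1 + ((k + S) / 8) * (k - 4 * ((k + S) / 8)) = 0"
      by (simp add: field_simps)
    then show ?thesis ..
  qed
  from root obtain r s where rs: "1 + r * (b - 4 * r) = 0" "1 + s * (d - 4 * s) = 0" by metis
  show ?thesis
  proof (rule frame5E[OF dim sp])
    fix c1 c2 c3 c4 c5 :: "'a \<Rightarrow> real"
    assume l: "linear c1" "linear c2" "linear c3" "linear c4" "linear c5"
    assume dd: "c1 t = 1" "c1 x = 0" "c1 y = 0" "c1 z = 0" "c1 w = 0"
      "c2 t = 0" "c2 x = 1" "c2 y = 0" "c2 z = 0" "c2 w = 0"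
      "c3 t = 0" "c3 x = 0" "c3 y = 1" "c3 z = 0" "c3 w = 0"
      "c4 t = 0" "c4 x = 0" "c4 y = 0" "c4 z = 1" "c4 w = 0"
      "c5 t = 0" "c5 x = 0" "c5 y = 0" "c5 z = 0" "c5 w = 1"
    assume ex: "\<And>u. u = c1 u *\<^sub>R t + c2 u *\<^sub>R x + c3 u *\<^sub>R y + c4 u *\<^sub>R z + c5 u *\<^sub>R w"
    note ls = l[THEN linear_add] l[THEN linear_scale] l[THEN linear_neg] l[THEN linear_diff]
      l[THEN linear_0]
    let ?B = "{t, x + r *\<^sub>R w, y + s *\<^sub>R w, z + w, z - w}"
    have "z \<in> span ?B"
      by (rule in_span_insert_combination[of _ "1/2" "z + w" "1/2" "z - w" 0 t])
        (simp_all add: algebra_simps flip: scaleR_add_left)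
    moreover have "w \<in> span ?B"
      by (rule in_span_insert_combination[of _ "1/2" "z + w" "-1/2" "z - w" 0 t])
        (simp_all add: algebra_simps flip: scaleR_add_left)
    moreover have "x \<in> span ?B"
      by (rule in_span_insert_combination[of _ 1 "x + r *\<^sub>R w" "-r/2" "z + w" "r/2" "z - w"])
        (simp_all add: algebra_simps flip: scaleR_add_left)
    moreover have "y \<in> span ?B"
      by (rule in_span_insert_combination[of _ 1 "y + s *\<^sub>R w" "-s/2" "z + w" "s/2" "z - w"])
        (simp_all add: algebra_simps flip: scaleR_add_left)
    ultimately have spB: "span ?B = UNIV"
      by (intro span_eq_UNIV_mono[OF sp]) (auto intro: span_base)
    \<comment> \<open>Weight 2 on \<open>z\<close> and 1 on \<open>w\<close> cancel the eigenvalues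
      2 and -4 in the pairing of \<open>z + w\<close> or \<open>z - w\<close> with its bracket from
      \<open>t\<close>.\<close>
    show ?thesis
      by (rule has_gbI[OF dim inner_product_of_coordinates[OF l ex, of 1 1 1 2 1] spB sp],
          auto simp: br skew ls dd)
        (use rs in \<open>simp_all add: algebra_simps\<close>)
  qed
qed

lemma (in lie) filiform_extension_has_gb:
  assumes dim: "DIM('a) = 5" and "filiform_extension br"
  shows "has_gb br"
proof -
  from assms(2) obtain t x y z w where sp: "span {t,x,y,z,w} = UNIV"
    and br: "br x y = z" "br x z = w" "br x w = 0" "br y z = 0" "br y w = 0" "br z w = 0"
      "br t x = 3 *\<^sub>R x" "br t y = - 4 *\<^sub>R y" "br t z = - z" "br t w = 2 *\<^sub>R w"
    unfolding filiform_extension_def by blast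
  note skew = br_skew[of x t] br_skew[of y t] br_skew[of z t] br_skew[of w t]
    br_skew[of y x] br_skew[of z x] br_skew[of w x] br_skew[of z y] br_skew[of w y] br_skew[of w z]
  show ?thesis
  proof (rule frame5E[OF dim sp])
    fix c1 c2 c3 c4 c5 :: "'a \<Rightarrow> real"
    assume l: "linear c1" "linear c2" "linear c3" "linear c4" "linear c5"
    assume dd: "c1 t = 1" "c1 x = 0" "c1 y = 0" "c1 z = 0" "c1 w = 0"
      "c2 t = 0" "c2 x = 1" "c2 y = 0" "c2 z = 0" "c2 w = 0"
      "c3 t = 0" "c3 x = 0" "c3 y = 1" "c3 z = 0" "c3 w = 0"
      "c4 t = 0" "c4 x = 0" "c4 y = 0" "c4 z = 1" "c4 w = 0"
      "c5 t = 0" "c5 x = 0" "c5 y = 0" "c5 z = 0" "c5 w = 1"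
    assume ex: "\<And>u. u = c1 u *\<^sub>R t + c2 u *\<^sub>R x + c3 u *\<^sub>R y + c4 u *\<^sub>R z + c5 u *\<^sub>R w"
    note ls = l[THEN linear_add] l[THEN linear_scale] l[THEN linear_neg] l[THEN linear_diff]
      l[THEN linear_0]
    let ?u = "y + (5/2) *\<^sub>R w" and ?v = "y - (5/2) *\<^sub>R w"
    \<comment> \<open>Only this vector has a \<open>z\<close>-component, so besides the condition
      from \<open>t\<close> it meets one from \<open>x\<close>. With weights 3, 3, 24/25 on
      \<open>y, z, w\<close> they read -12 - 27/4 + 75/4 = 0 and 9/2 - 9/2 = 0. For
      \<open>?u\<close> and \<open>?v\<close> the condition from \<open>t\<close> is -12 + 12 = 0,
      and for \<open>x + y / 2\<close>, with weight 1 on \<open>x\<close>, it is 3 - 3 = 0.\<close>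
    let ?n = "y + (3/2) *\<^sub>R z - (25/8) *\<^sub>R w"
    let ?B = "{t, x + (1/2) *\<^sub>R y, ?u, ?v, ?n}"
    have "y \<in> span ?B"
      by (rule in_span_insert_combination[of _ "1/2" ?u "1/2" ?v 0 t])
        (simp_all add: algebra_simps flip: scaleR_add_left)
    moreover have "w \<in> span ?B"
      by (rule in_span_insert_combination[of _ "1/5" ?u "-1/5" ?v 0 t])
        (simp_all add: algebra_simps flip: scaleR_add_left)
    moreover have "x \<in> span ?B"
      by (rule in_span_insert_combination[of _ 1 "x + (1/2) *\<^sub>R y" "-1/4" ?u "-1/4" ?v])
        (simp_all add: algebra_simps flip: scaleR_add_left scaleR_diff_left)
    moreover have "z \<in> span ?B"
      by (rule in_span_insert_combination[of _ "2/3" ?n "1/12" ?u "-3/4" ?v])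
        (simp_all add: algebra_simps flip: scaleR_add_left scaleR_diff_left)
    ultimately have spB: "span ?B = UNIV"
      by (intro span_eq_UNIV_mono[OF sp]) (auto intro: span_base)
    show ?thesis
      by (rule has_gbI[OF dim inner_product_of_coordinates[OF l ex, of 1 1 3 3 "24/25"] spB sp])
        (auto simp: br skew ls dd)
  qed
qed

text \<open>The pairing of a combination of \<open>x, y, z\<close> with its brackets involves only
  squares of the coefficients, and the weights -2, 1, 1 and 0, 1, -1 sum to zero. So every choice of
  signs gives a geodesic vector, and three sign patterns are independent.\<close>

lemma (in lie) split_torus_extension_has_gb:
  assumes dim: "DIM('a) = 5" and "split_torus_extension br"
  shows "has_gb br"
proof -
  from assms(2) obtain a b x y z where sp: "span {a,b,x,y,z} = UNIV"
    and br: "br a b = 0" "br x y = 0" "br x z = 0" "br y z = 0"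
      "br a x = - 2 *\<^sub>R x" "br a y = y" "br a z = z" "br b x = 0" "br b y = y" "br b z = - z"
    unfolding split_torus_extension_def by blast
  note skew = br_skew[of b a] br_skew[of x a] br_skew[of y a] br_skew[of z a] br_skew[of x b]
    br_skew[of y b] br_skew[of z b] br_skew[of y x] br_skew[of z x] br_skew[of z y]
  show ?thesis
  proof (rule frame5E[OF dim sp])
    fix c1 c2 c3 c4 c5 :: "'a \<Rightarrow> real"
    assume l: "linear c1" "linear c2" "linear c3" "linear c4" "linear c5"
    assume dd: "c1 a = 1" "c1 b = 0" "c1 x = 0" "c1 y = 0" "c1 z = 0"
      "c2 a = 0" "c2 b = 1" "c2 x = 0" "c2 y = 0" "c2 z = 0"
      "c3 a = 0" "c3 b = 0" "c3 x = 1" "c3 y = 0" "c3 z = 0"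
      "c4 a = 0" "c4 b = 0" "c4 x = 0" "c4 y = 1" "c4 z = 0"
      "c5 a = 0" "c5 b = 0" "c5 x = 0" "c5 y = 0" "c5 z = 1"
    assume ex: "\<And>u. u = c1 u *\<^sub>R a + c2 u *\<^sub>R b + c3 u *\<^sub>R x + c4 u *\<^sub>R y + c5 u *\<^sub>R z"
    note ls = l[THEN linear_add] l[THEN linear_scale] l[THEN linear_neg] l[THEN linear_diff]
      l[THEN linear_0]
    let ?B = "{a, b, x + y + z, x - y + z, x + y - z}"
    have "y \<in> span ?B"
      by (rule in_span_insert_combination[of _ "1/2" "x + y + z" "-1/2" "x - y + z" 0 a])
        (simp_all add: algebra_simps flip: scaleR_add_left)
    moreover have "z \<in> span ?B"
      by (rule in_span_insert_combination[of _ "1/2" "x + y + z" "-1/2" "x + y - z" 0 a])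
        (simp_all add: algebra_simps flip: scaleR_add_left)
    moreover have "x \<in> span ?B"
      by (rule in_span_insert_combination[of _ "1/2" "x - y + z" "1/2" "x + y - z" 0 a])
        (simp_all add: algebra_simps flip: scaleR_add_left scaleR_diff_left)
    ultimately have spB: "span ?B = UNIV"
      by (intro span_eq_UNIV_mono[OF sp]) (auto intro: span_base)
    show ?thesis
      by (rule has_gbI[OF dim inner_product_of_coordinates[OF l ex, of 1 1 1 1 1] spB sp])
        (auto simp: br skew ls dd)
  qed
qed

text \<open>\<open>[X1, X2]\<close> acts trivially on \<open>N\<close>, hence lies in
  \<open>N\<close>. The rotation by a third of a turn about \<open>X3\<close> commutes with both
  torus generators and permutes \<open>f1, f2, f3\<close> cyclically, so the generators are
  circulant matrices in this basis, and a circulant matrix of trace zero has zero diagonal.\<close>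

lemma (in lie) rotation_torus_extension_has_ongb:
  assumes dim: "DIM('a) = 5" and "rotation_torus_extension br"
  shows "has_ongb br"
proof -
  from assms(2) obtain N X1 X2 X3 X4 X5 where ab: "abelian_set br N" and N: "N = span {X3,X4,X5}"
    and "is_basis {X1,X2,X3,X4,X5}"
    and b: "br X1 X3 = -2 *\<^sub>R X3" "br X1 X4 = X4" "br X1 X5 = X5"
      "br X2 X3 = 0" "br X2 X4 = - X5" "br X2 X5 = X4"
    unfolding rotation_torus_extension_def by blast
  then have sp: "span {X1,X2,X3,X4,X5} = UNIV" by (auto simp: is_basis_def)
  have "X3 \<in> N" "X4 \<in> N" "X5 \<in> N" unfolding N by (auto intro: span_base)
  then have ab': "br X3 X4 = 0" "br X3 X5 = 0" "br X4 X5 = 0"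
    using ab by (auto simp: abelian_set_def)
  show ?thesis
  proof (rule frame5E[OF dim sp])
    fix c1 c2 c3 c4 c5 :: "'a \<Rightarrow> real"
    assume l: "linear c1" "linear c2" "linear c3" "linear c4" "linear c5"
    assume dd: "c1 X4 = 0" "c1 X5 = 0" "c4 X4 = 1" "c4 X5 = 0" "c5 X4 = 0" "c5 X5 = 1"
    assume ex: "\<And>u. u = c1 u *\<^sub>R X1 + c2 u *\<^sub>R X2 + c3 u *\<^sub>R X3 + c4 u *\<^sub>R X4 + c5 u *\<^sub>R X5"
    define p q r s t where d: "p = c1 (br X1 X2)" "q = c2 (br X1 X2)" "r = c3 (br X1 X2)"
      "s = c4 (br X1 X2)" "t = c5 (br X1 X2)"
    have b12: "br X1 X2 = p *\<^sub>R X1 + q *\<^sub>R X2 + r *\<^sub>R X3 + s *\<^sub>R X4 + t *\<^sub>R X5"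
      unfolding d by (rule ex)
    have "br (br X1 X2) X4 = 0"
      using jacobi[of X1 X2 X4] by (simp add: b)
    then have "p *\<^sub>R X4 - q *\<^sub>R X5 = 0"
      unfolding b12 by (simp add: b ab' br_skew[of X5 X4])
    then have "c4 (p *\<^sub>R X4 - q *\<^sub>R X5) = 0" "c5 (p *\<^sub>R X4 - q *\<^sub>R X5) = 0"
      using l(4,5) by (simp_all add: linear_0)
    then have pq: "p = 0" "q = 0"
      by (simp_all add: linear_diff[OF l(4)] linear_diff[OF l(5)]
          linear_scale[OF l(4)] linear_scale[OF l(5)] linear_neg[OF l(5)] dd)
    \<comment> \<open>A regular triangle in the rotation plane, tilted towards the axis \<open>X3\<close>.\<close>
    define k :: real where "k = sqrt 3"
    have k: "k * k = 3" "k > 0" by (simp_all add: k_def)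
    define f1 f2 f3 where f: "f1 = X3 + X4" "f2 = X3 - (1/2) *\<^sub>R X4 + (k/2) *\<^sub>R X5"
      "f3 = X3 - (1/2) *\<^sub>R X4 - (k/2) *\<^sub>R X5"
    have X: "X3 = (1/3) *\<^sub>R f1 + (1/3) *\<^sub>R f2 + (1/3) *\<^sub>R f3"
      "X4 = (2/3) *\<^sub>R f1 + (-1/3) *\<^sub>R f2 + (-1/3) *\<^sub>R f3"
      "X5 = (1/k) *\<^sub>R f2 + (-1/k) *\<^sub>R f3 + 0 *\<^sub>R f1"
      using k by (simp_all add: f algebra_simps flip: scaleR_add_left scaleR_diff_left)
    have "span {X1,X2,f1,f2,f3} = UNIV"
    proof (rule span_eq_UNIV_mono[OF sp])
      have "X3 \<in> span {X1,X2,f1,f2,f3}" "X4 \<in> span {X1,X2,f1,f2,f3}" "X5 \<in> span {X1,X2,f1,f2,f3}"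
        by (rule in_span_insert_combination[OF X(1)] in_span_insert_combination[OF X(2)]
            in_span_insert_combination[OF X(3)]; simp)+
      then show "{X1,X2,X3,X4,X5} \<subseteq> span {X1,X2,f1,f2,f3}"
        by (auto intro: span_base)
    qed
    moreover have "br X1 X2 = (r/3 + 2 * s / 3) *\<^sub>R f1 + (r/3 - s/3 + t/k) *\<^sub>R f2 + (r/3 - s/3 - t/k) *\<^sub>R f3"
      unfolding b12 pq X using k by (simp add: algebra_simps)
    moreover have "br X1 f1 = (-1) *\<^sub>R f2 + (-1) *\<^sub>R f3" "br X1 f2 = (-1) *\<^sub>R f1 + (-1) *\<^sub>R f3"
      "br X1 f3 = (-1) *\<^sub>R f1 + (-1) *\<^sub>R f2"
      by (simp_all add: f b algebra_simps flip: scaleR_2)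
    moreover have "br X2 f1 = (-1/k) *\<^sub>R f2 + (1/k) *\<^sub>R f3" "br X2 f2 = (1/k) *\<^sub>R f1 + (-1/k) *\<^sub>R f3"
      "br X2 f3 = (-1/k) *\<^sub>R f1 + (1/k) *\<^sub>R f2"
      using k by (simp_all add: f b algebra_simps field_simps flip: scaleR_add_left scaleR_diff_left)
    moreover have "br f1 f2 = 0" "br f1 f3 = 0" "br f2 f3 = 0"
      by (simp_all add: f ab' br_skew[of X5 X4] br_skew[of X5 X3] br_skew[of X4 X3])
    ultimately show ?thesis
      by (rule has_ongb5[OF dim])
  qed
qed

text \<open>The point is maximality. An element of a larger nilpotent ideal \<open>J\<close> with a
  nonzero \<open>X1\<close>-coefficient acts invertibly on the line of \<open>X3\<close>; with
  coefficient zero there but a nonzero \<open>X2\<close>-coefficient it acts invertibly on the plane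
  of \<open>X4, X5\<close>. Either way a nonzero subspace persists in the whole lower central series
  of \<open>J\<close>.\<close>

lemma (in lie) rotation_torus_extensionI:
  fixes X1 :: 'a
  assumes dim: "DIM('a) = 5" and sp: "span {X1,X2,X3,X4,X5} = UNIV"
    and b12: "br X1 X2 \<in> span {X3,X4,X5}"
    and ab: "br X3 X4 = 0" "br X3 X5 = 0" "br X4 X5 = 0"
    and b: "br X1 X3 = -2 *\<^sub>R X3" "br X1 X4 = X4" "br X1 X5 = X5"
      "br X2 X3 = 0" "br X2 X4 = - X5" "br X2 X5 = X4"
  shows "rotation_torus_extension br"
proof -
  let ?B = "{X1,X2,X3,X4,X5}" and ?N = "span {X3,X4,X5}"
  have le5: "card ?B \<le> 5" by (simp add: card_insert_if)
  have ind: "independent ?B"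
    by (rule card_le_dim_spanning[of _ UNIV]) (use sp dim le5 in auto)
  have c5: "card ?B = 5"
    using le5 dim sp dim_le_card'[of ?B] dim_span[of ?B] by simp
  then have d: "X1 \<noteq> X2" "X1 \<noteq> X3" "X1 \<noteq> X4" "X1 \<noteq> X5" "X2 \<noteq> X3" "X2 \<noteq> X4" "X2 \<noteq> X5"
    "X3 \<noteq> X4" "X3 \<noteq> X5" "X4 \<noteq> X5"
    by (auto simp: card_insert_if split: if_splits)
  have "independent {X3,X4,X5}" by (rule independent_mono[OF ind]) auto
  then have dimN: "dim ?N = 3" using d by (simp add: dim_eq_card_independent)
  have nz: "X3 \<noteq> 0" "X4 \<noteq> 0" using ind dependent_zero[of ?B] by auto
  have memN: "X3 \<in> ?N" "X4 \<in> ?N" "X5 \<in> ?N" by (auto intro: span_base)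
  note skew = br_skew[of X4 X3] br_skew[of X5 X3] br_skew[of X5 X4]
  have abel: "br x y = 0" if "x \<in> ?N" "y \<in> ?N" for x y
  proof -
    have 1: "br u y = 0" if "u \<in> {X3,X4,X5}" for u
      using \<open>y \<in> ?N\<close> by (induction rule: span_induct_alt) (use that in \<open>auto simp: ab skew\<close>)
    show ?thesis using \<open>x \<in> ?N\<close> by (induction rule: span_induct_alt) (use 1 in auto)
  qed
  have ideal: "br x y \<in> ?N" if y: "y \<in> ?N" for x y
  proof -
    have 1: "br u y \<in> ?N" if "u \<in> ?B" for u
      using y by (induction rule: span_induct_alt)
        (use that memN in \<open>auto simp: b ab skew span_zero intro!: span_add span_scale span_neg\<close>)
    have "x \<in> span ?B" using sp by simp
    then show ?thesis by (induction rule: span_induct_alt)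
      (use 1 in \<open>auto simp: span_zero intro!: span_add span_scale\<close>)
  qed
  have "lower_central br ?N (Suc 0) = {0}"
  proof -
    have "{br x y |x y. x \<in> ?N \<and> y \<in> ?N} = {0}"
    proof (intro equalityI subsetI)
      fix u :: 'a assume "u \<in> {0}"
      then have "u = br X3 X3" by simp
      then show "u \<in> {br x y |x y. x \<in> ?N \<and> y \<in> ?N}" using memN(1) by blast
    qed (use abel in auto)
    then show ?thesis by simp
  qed
  then have nil: "nilpotent_ideal br ?N"
    unfolding nilpotent_ideal_def lie_ideal_def using ideal by blast
  have "is_nilradical br ?N"
    unfolding is_nilradical_def
  proof (intro conjI allI impI nil)
    fix J assume J: "nilpotent_ideal br J \<and> ?N \<subseteq> J"
    then obtain k where k: "lower_central br J k = {0}" by (auto simp: nilpotent_ideal_def)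
    have sJ: "subspace J" using J by (auto simp: nilpotent_ideal_def lie_ideal_def)
    have step: "br x y \<in> lower_central br J (Suc m)" if "x \<in> J" "y \<in> lower_central br J m" for x y m
      using that by (auto intro: span_base)
    have sub: "subspace (lower_central br J m)" for m
      by (cases m) (auto simp: sJ)
    have "x \<in> ?N" if x: "x \<in> J" for x
    proof -
      have "x \<in> span (insert X1 (insert X2 {X3,X4,X5}))" using sp by simp
      then obtain p where "x - p *\<^sub>R X1 \<in> span (insert X2 {X3,X4,X5})"
        by (subst (asm) span_insert) blast
      then obtain q where n: "x - p *\<^sub>R X1 - q *\<^sub>R X2 \<in> ?N"
        by (subst (asm) span_insert) blast
      define n where "n = x - p *\<^sub>R X1 - q *\<^sub>R X2"
      have x': "x = p *\<^sub>R X1 + q *\<^sub>R X2 + n" and nN: "n \<in> ?N" using n by (auto simp: n_def)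
      have "br x X3 = (- 2 * p) *\<^sub>R X3" "br x X4 = p *\<^sub>R X4 - q *\<^sub>R X5" "br x X5 = p *\<^sub>R X5 + q *\<^sub>R X4"
        using abel[OF nN memN(1)] abel[OF nN memN(2)] abel[OF nN memN(3)] unfolding x' by (simp_all add: b)
      note brx = this
      have p0: "p = 0"
      proof (rule ccontr)
        assume p: "p \<noteq> 0"
        have "X3 \<in> lower_central br J m" for m
        proof (induction m)
          case 0 show ?case using J memN by auto
        next
          case (Suc m)
          from subspace_scale[OF sub step[OF x Suc], of "1 / (- 2 * p)"] show ?case
            unfolding brx using p by simp
        qed
        then show False using k nz by blast
      qed
      have q0: "q = 0"
      proof (rule ccontr)
        assume q: "q \<noteq> 0"
        have "X4 \<in> lower_central br J m \<and> X5 \<in> lower_central br J m" for m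
        proof (induction m)
          case 0 show ?case using J memN by auto
        next
          case (Suc m)
          from subspace_scale[OF sub step[OF x], of X5 m "1/q"] subspace_scale[OF sub step[OF x], of X4 m "-1/q"]
          show ?case using Suc q unfolding brx p0 by simp
        qed
        then show False using k nz by blast
      qed
      show ?thesis using x' p0 q0 nN by simp
    qed
    then show "J = ?N" using J by blast
  qed
  then show ?thesis
    unfolding rotation_torus_extension_def abelian_set_def is_basis_def
    using abel dimN ind sp c5 b by blast
qed

section \<open>Ideals of codimension one and central quotients\<close>

definition perfect :: "('a::real_vector \<Rightarrow> 'a \<Rightarrow> 'a) \<Rightarrow> bool" where
  "perfect br \<longleftrightarrow> span {br x y | x y. True} = UNIV"

text \<open>Any hyperplane containing all brackets is an ideal; its normal vector serves as
  complement.\<close>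

lemma (in lie) not_perfect_ideal:
  assumes "\<not> perfect br"
  obtains h t where "lie_ideal br h" "dim h = DIM('a) - 1" "t \<notin> h"
    "\<And>x y. br x y \<in> h" "\<And>x. \<exists>r. x - r *\<^sub>R t \<in> h"
proof -
  let ?D = "{br x y | x y. True}"
  have "dim ?D < DIM('a)"
    using assms dim_eq_full[of ?D] dim_subset_UNIV[of ?D] by (simp add: perfect_def)
  then obtain a where a: "a \<noteq> 0" "span ?D \<subseteq> {x. a \<bullet> x = 0}"
    using lowdim_subset_hyperplane by blast
  let ?h = "{x. a \<bullet> x = 0}"
  have D: "br x y \<in> ?h" for x y
    using a(2) span_base[of "br x y" ?D] by blast
  show thesis
  proof (rule that[of ?h a])
    show "lie_ideal br ?h"
      using D by (auto simp: lie_ideal_def subspace_hyperplane)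
    show "dim ?h = DIM('a) - 1" using a(1) by (rule dim_hyperplane)
    show "a \<notin> ?h" using a(1) by simp
    show "\<exists>r. x - r *\<^sub>R a \<in> ?h" for x
      using a(1) by (intro exI[of _ "(a \<bullet> x) / (a \<bullet> a)"]) (simp add: inner_diff_right)
  qed (rule D)
qed

lemma linear_comp_frame: "linear f \<Longrightarrow> linear g \<Longrightarrow> linear (\<lambda>x. f (g x))"
  using linear_compose[of g f] by (simp add: o_def)

text \<open>Moves the ideal to a type of its own dimension, where the results on lower-dimensional
  algebras apply. Unimodularity is inherited because an element of \<open>h\<close> brackets
  everything into \<open>h\<close>, so restricting its adjoint action does not change the
  trace.\<close>

lemma (in unimodular_lie) ideal_embedding:
  assumes "lie_ideal br h" "dim h = DIM('b::euclidean_space)"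
  obtains \<iota> :: "'b::euclidean_space \<Rightarrow> 'a" and br' where
    "linear \<iota>" "inj \<iota>" "range \<iota> = h" "unimodular_lie br'" "\<And>x y. \<iota> (br' x y) = br (\<iota> x) (\<iota> y)"
proof -
  have h: "subspace h" "\<And>x y. y \<in> h \<Longrightarrow> br x y \<in> h"
    using assms(1) by (auto simp: lie_ideal_def)
  obtain \<iota> :: "'b \<Rightarrow> 'a" and r where ir: "linear \<iota>" "linear r" "\<iota> ` UNIV = h"
    "\<And>x. r (\<iota> x) = x" "\<And>x. x \<in> h \<Longrightarrow> \<iota> (r x) = x"
    by (rule isometries_subspaces[of "UNIV :: 'b set" h]) (use assms(2) h(1) in auto)
  define br' where "br' x y = r (br (\<iota> x) (\<iota> y))" for x y
  have hom: "\<iota> (br' x y) = br (\<iota> x) (\<iota> y)" for x y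
    unfolding br'_def using h(2)[of "\<iota> y" "\<iota> x"] ir(3,5) by auto
  have inj: "inj \<iota>" using ir(4) by (metis injI)
  have bil: "bilinear br'"
    unfolding bilinear_def br'_def
    using ir(1,2) by (auto simp: linear_add linear_scale intro!: linearI)
  have "lie_algebra br'"
    unfolding lie_algebra_def
  proof (intro conjI allI bil)
    show "br' x x = 0" for x by (simp add: br'_def linear_0[OF ir(2)])
    show "br' x (br' y z) + br' y (br' z x) + br' z (br' x y) = 0" for x y z
    proof -
      have "\<iota> (br' x (br' y z) + br' y (br' z x) + br' z (br' x y)) = 0"
        using lie_algebra by (simp add: linear_add[OF ir(1)] hom lie_algebra_def)
      then have "r (\<iota> (br' x (br' y z) + br' y (br' z x) + br' z (br' x y))) = r 0" by simp
      then show ?thesis by (simp add: ir(4) linear_0[OF ir(2)])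
    qed
  qed
  moreover have "unimodular br'"
    unfolding unimodular_def
  proof
    fix x
    have "lin_trace (br' x) = lin_trace (\<lambda>y. r (br (\<iota> x) (\<iota> y)))"
      by (simp add: br'_def[abs_def])
    also have "\<dots> = lin_trace (\<lambda>y. \<iota> (r (br (\<iota> x) y)))"
      by (rule lin_trace_comm[of \<iota> "\<lambda>y. r (br (\<iota> x) y)"]) (simp_all add: ir(1,2) linear_comp_frame)
    also have "(\<lambda>y. \<iota> (r (br (\<iota> x) y))) = br (\<iota> x)"
    proof
      fix y
      have "br y (\<iota> x) \<in> h" using h(2) ir(3) by auto
      then have "br (\<iota> x) y \<in> h" using br_skew[of "\<iota> x" y] subspace_neg[OF h(1)] by simp
      then show "\<iota> (r (br (\<iota> x) y)) = br (\<iota> x) y" by (rule ir(5))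
    qed
    finally show "lin_trace (br' x) = 0" by (simp add: trace_br)
  qed
  ultimately have "unimodular_lie br'" by unfold_locales
  then show thesis using that[of \<iota> br'] ir(1,3) inj hom by auto
qed

text \<open>The quotient by the central line lives on the orthogonal complement of \<open>z\<close>,
  with projection \<pi>. An orthonormal geodesic basis of the quotient lifts, and adding
  \<open>z\<close> as a further unit vector orthogonal to the lifts keeps all conditions, since
  \<open>z\<close> brackets to zero. The quotient is unimodular because brackets ignore
  \<open>z\<close>-components.\<close>

lemma (in unimodular_lie) has_ongb_of_centre:
  assumes z: "z \<noteq> 0" "\<And>x. br z x = 0" and dim: "DIM('a) = DIM('b::euclidean_space) + 1"
    and quot: "\<And>br' :: 'b::euclidean_space \<Rightarrow> 'b \<Rightarrow> 'b. unimodular_lie br' \<Longrightarrow> has_ongb br'"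
  shows "has_ongb br"
proof -
  let ?W = "{x. z \<bullet> x = 0}"
  have W: "subspace ?W" "dim ?W = DIM('a) - 1"
    using z(1) by (simp_all add: subspace_hyperplane dim_hyperplane)
  obtain \<sigma> :: "'b \<Rightarrow> 'a" and g where sg: "linear \<sigma>" "linear g" "\<sigma> ` UNIV = ?W"
    "\<And>x. g (\<sigma> x) = x" "\<And>x. x \<in> ?W \<Longrightarrow> \<sigma> (g x) = x"
    by (rule isometries_subspaces[of "UNIV :: 'b set" ?W]) (use W dim in auto)
  define \<zeta> where "\<zeta> x = (z \<bullet> x) / (z \<bullet> z)" for x
  define \<pi> where "\<pi> x = g (x - \<zeta> x *\<^sub>R z)" for x
  have lz: "linear \<zeta>" unfolding \<zeta>_def
    by (rule linearI) (simp_all add: inner_add_right add_divide_distrib)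
  have lp: "linear \<pi>" unfolding \<pi>_def
    by (rule linearI)
      (simp_all add: linear_add[OF lz] linear_scale[OF lz] linear_add[OF sg(2)] linear_diff[OF sg(2)]
        linear_scale[OF sg(2)] algebra_simps)
  have zz: "\<zeta> z = 1" "\<zeta> (\<sigma> x) = 0" for x using z(1) sg(3) by (auto simp: \<zeta>_def)
  have ps: "\<pi> (\<sigma> x) = x" "\<pi> z = 0" for x
    by (simp_all add: \<pi>_def zz sg(4) linear_0[OF sg(2)])
  have dec: "x = \<sigma> (\<pi> x) + \<zeta> x *\<^sub>R z" for x
  proof -
    have "x - \<zeta> x *\<^sub>R z \<in> ?W" using z(1) by (simp add: \<zeta>_def inner_diff_right)
    then show ?thesis by (simp add: \<pi>_def sg(5))
  qed
  have z': "br x z = 0" for x using z(2) br_skew[of x z] by simp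
  define br' where "br' x y = \<pi> (br (\<sigma> x) (\<sigma> y))" for x y
  have hom: "\<pi> (br x y) = br' (\<pi> x) (\<pi> y)" for x y
    by (subst dec[of x], subst dec[of y]) (simp add: z(2) z' br'_def)
  have bil: "bilinear br'"
    unfolding bilinear_def br'_def
    using sg(1) lp by (auto simp: linear_add linear_scale intro!: linearI)
  have "lie_algebra br'"
    unfolding lie_algebra_def
  proof (intro conjI allI bil)
    show "br' x x = 0" for x by (simp add: br'_def linear_0[OF lp])
    show "br' x (br' y w) + br' y (br' w x) + br' w (br' x y) = 0" for x y w
    proof -
      have "br' x (br' y w) + br' y (br' w x) + br' w (br' x y)
        = \<pi> (br (\<sigma> x) (br (\<sigma> y) (\<sigma> w)) + br (\<sigma> y) (br (\<sigma> w) (\<sigma> x)) + br (\<sigma> w) (br (\<sigma> x) (\<sigma> y)))"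
        by (simp add: linear_add[OF lp] hom ps)
      also have "\<dots> = 0" using lie_algebra by (simp add: lie_algebra_def linear_0[OF lp])
      finally show ?thesis .
    qed
  qed
  moreover have "unimodular br'"
    unfolding unimodular_def
  proof
    fix x
    have "lin_trace (br' x) = lin_trace (\<lambda>y. \<pi> (br (\<sigma> x) (\<sigma> y)))"
      by (simp add: br'_def[abs_def])
    also have "\<dots> = lin_trace (\<lambda>y. br (\<sigma> x) (\<sigma> (\<pi> y)))"
      by (rule lin_trace_comm[of "\<lambda>y. br (\<sigma> x) (\<sigma> y)" \<pi>]) (simp_all add: sg(1) lp linear_comp_frame)
    also have "(\<lambda>y. br (\<sigma> x) (\<sigma> (\<pi> y))) = br (\<sigma> x)"
    proof
      fix y show "br (\<sigma> x) (\<sigma> (\<pi> y)) = br (\<sigma> x) y"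
        using arg_cong[OF dec[of y], of "br (\<sigma> x)"] by (simp add: z')
    qed
    finally show "lin_trace (br' x) = 0" by (simp add: trace_br)
  qed
  ultimately have "unimodular_lie br'" by unfold_locales
  then obtain ip' B where ip': "is_inner_product ip'" and B: "orthonormal_geodesic_basis br' ip' B"
    using quot unfolding has_ongb_def by (metis (no_types))
  interpret q: inner_prod ip' by unfold_locales fact
  note B' = B[unfolded orthonormal_geodesic_basis_def geodesic_basis_def geodesic_element_def
      is_basis_def]
  define ip where "ip x y = ip' (\<pi> x) (\<pi> y) + \<zeta> x * \<zeta> y" for x y
  show ?thesis
  proof (rule has_ongbI[of ip "insert z (\<sigma> ` B)"])
    show "is_inner_product ip"
      unfolding is_inner_product_def bilinear_def
    proof (intro conjI allI impI)
      show "linear (ip x)" "linear (\<lambda>x. ip x y)" for x y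
        unfolding ip_def
        by (auto intro!: linearI simp: linear_add[OF lp] linear_scale[OF lp] linear_add[OF lz]
            linear_scale[OF lz] algebra_simps)
      show "ip x y = ip y x" for x y by (simp add: ip_def q.ip_sym[of "\<pi> x"] mult.commute)
      fix x :: 'a assume "x \<noteq> 0"
      show "ip x x > 0"
      proof (cases "\<pi> x = 0")
        case True
        then have "\<zeta> x \<noteq> 0" using dec[of x] \<open>x \<noteq> 0\<close> by (auto simp: linear_0[OF sg(1)])
        then show ?thesis using True by (simp add: ip_def zero_less_mult_iff linorder_neq_iff disj_commute)
      next
        case False
        then have "ip' (\<pi> x) (\<pi> x) > 0" using ip' by (simp add: is_inner_product_def)
        then show ?thesis by (simp add: ip_def add_pos_nonneg)
      qed
    qed
    show "span (insert z (\<sigma> ` B)) = UNIV"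
    proof -
      have "x \<in> span (insert z (\<sigma> ` B))" for x
      proof -
        have "\<pi> x \<in> span B" using B' by simp
        then have "\<sigma> (\<pi> x) \<in> span (\<sigma> ` B)"
          by (simp add: linear_span_image[OF sg(1)])
        then have "\<sigma> (\<pi> x) \<in> span (insert z (\<sigma> ` B))"
          using span_mono[of "\<sigma> ` B" "insert z (\<sigma> ` B)"] by blast
        then have "\<sigma> (\<pi> x) + \<zeta> x *\<^sub>R z \<in> span (insert z (\<sigma> ` B))"
          by (rule span_add) (intro span_scale span_base insertI1)
        then show ?thesis using dec[of x] by simp
      qed
      then show ?thesis by blast
    qed
    show "ip x x = 1" if "x \<in> insert z (\<sigma> ` B)" for x
      using that B' by (auto simp: ip_def zz ps)
    show "ip x y = 0" if "x \<in> insert z (\<sigma> ` B)" "y \<in> insert z (\<sigma> ` B)" "x \<noteq> y" for x y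
    proof -
      have "ip' a b = 0" if "a \<in> B" "b \<in> B" "\<sigma> a \<noteq> \<sigma> b" for a b
        using B' that by metis
      then show ?thesis using that by (auto simp: ip_def zz ps)
    qed
    show "ip x (br x y) = 0" if "x \<in> insert z (\<sigma> ` B)" for x y
      using that B' by (auto simp: ip_def zz ps z(2) hom linear_0[OF lz])
  qed
qed

section \<open>Linear algebra: cyclic vectors, traces of projections, Cayley-Hamilton for traceless
  operators\<close>

lemma traceless_plane_cyclic:
  fixes f :: "'a::real_vector \<Rightarrow> 'a"
  assumes f: "linear f" "f p = a *\<^sub>R p + b *\<^sub>R q" "f q = c *\<^sub>R p - a *\<^sub>R q"
    and nz: "a \<noteq> 0 \<or> b \<noteq> 0 \<or> c \<noteq> 0"
  obtains u where "f (f u) = (a * a + b * c) *\<^sub>R u" "span {u, f u} = span {p, q}"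
proof -
  have ff: "f (f p) = (a * a + b * c) *\<^sub>R p" "f (f q) = (a * a + b * c) *\<^sub>R q"
    by (simp_all add: f linear_add[OF f(1)] linear_diff[OF f(1)] linear_scale[OF f(1)] algebra_simps)
  have sp: "span {u, f u} = span {p, q}"
    if "u = r *\<^sub>R p + s *\<^sub>R q" "p = r1 *\<^sub>R u + s1 *\<^sub>R f u" "q = r2 *\<^sub>R u + s2 *\<^sub>R f u" for u r s r1 s1 r2 s2
  proof (rule span_eq[THEN iffD2], rule conjI[rotated])
    have "p \<in> span {u, f u}" "q \<in> span {u, f u}"
      by (subst that(2), intro span_add span_scale span_base; simp)
        (subst that(3), intro span_add span_scale span_base; simp)
    then show "{p, q} \<subseteq> span {u, f u}" by simp
    have u: "u \<in> span {p, q}"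
      unfolding that(1) by (intro span_add span_scale span_base) auto
    have "f u = (r * a + s * c) *\<^sub>R p + (r * b - s * a) *\<^sub>R q"
      unfolding that(1) by (simp add: f linear_add[OF f(1)] linear_scale[OF f(1)] algebra_simps)
    then have "f u \<in> span {p, q}"
      by (simp only:) (intro span_add span_scale span_base; simp)
    with u show "{u, f u} \<subseteq> span {p, q}" by simp
  qed
  \<comment> \<open>A nonzero traceless operator on the plane is not scalar, so some vector is not
    an eigenvector: \<open>p\<close> if \<open>b \<noteq> 0\<close>, \<open>q\<close> if
    \<open>c \<noteq> 0\<close>, and \<open>p + q\<close> in the diagonal case, where it mixes the
    eigenvalues \<open>a\<close> and \<open>- a\<close>.\<close>
  consider "b \<noteq> 0" | "c \<noteq> 0" | "b = 0" "c = 0" "a \<noteq> 0" using nz by blast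
  then show thesis
  proof cases
    case 1
    show thesis
      by (rule that[of p, OF ff(1)], rule sp[of p 1 0 1 0 "- a / b" "1 / b"])
        (use 1 in \<open>simp_all add: f algebra_simps\<close>)
  next
    case 2
    show thesis
      by (rule that[of q, OF ff(2)], rule sp[of q 0 1 "a / c" "1 / c" 1 0])
        (use 2 in \<open>simp_all add: f algebra_simps\<close>)
  next
    case 3
    have "f (p + q) = a *\<^sub>R p - a *\<^sub>R q" using 3 by (simp add: f linear_add[OF f(1)])
    show thesis
      by (rule that[of "p + q"], simp add: linear_add[OF f(1)] ff algebra_simps,
          rule sp[of "p + q" 1 1 "1/2" "1 / (2 * a)" "1/2" "- 1 / (2 * a)"])
        (use 3 in \<open>simp_all add: f linear_add[OF f(1)] algebra_simps flip: scaleR_add_left\<close>)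
  qed
qed

lemma linear_funpow_self:
  fixes f :: "'a::real_vector \<Rightarrow> 'a"
  assumes "linear f"
  shows "linear (f ^^ n)"
proof (induction n)
  case 0
  show ?case by (simp add: linear_id[unfolded id_def] id_def)
next
  case (Suc n)
  then show ?case using linear_compose[OF Suc assms] by (simp add: o_def)
qed

text \<open>The commutator of \<open>D\<close> with the \<open>n\<close>-th power of
  \<open>A\<close> is \<open>n * a\<close> times that power. Comparing operator norms,
  \<open>n * \<bar>a\<bar>\<close> stays below twice the norm of \<open>D\<close> as long as the
  power is nonzero.\<close>

lemma eigenvector_of_ad_nilpotent:
  fixes A D :: "'a::euclidean_space \<Rightarrow> 'a"
  assumes lin: "linear A" "linear D" and comm: "\<And>x. D (A x) - A (D x) = a *\<^sub>R A x" and a: "a \<noteq> 0"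
  shows "\<exists>n. \<forall>x. (A ^^ n) x = 0"
proof (rule ccontr)
  assume "\<not> ?thesis"
  then have nn: "\<exists>x. (A ^^ n) x \<noteq> 0" for n by blast
  have lA: "linear (A ^^ n)" for n using linear_funpow_self[OF lin(1)] by simp
  have c: "D ((A ^^ n) x) - (A ^^ n) (D x) = (n * a) *\<^sub>R (A ^^ n) x" for n x
  proof (induction n arbitrary: x)
    case (Suc n)
    have "D (A ((A ^^ n) x)) = A (D ((A ^^ n) x)) + a *\<^sub>R A ((A ^^ n) x)"
      using comm[of "(A ^^ n) x"] by (simp add: algebra_simps)
    also have "D ((A ^^ n) x) = (A ^^ n) (D x) + (n * a) *\<^sub>R (A ^^ n) x"
      using Suc[of x] by (simp add: algebra_simps)
    finally show ?case
      by (simp add: linear_add[OF lin(1)] linear_scale[OF lin(1)] algebra_simps)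
  qed simp
  have bl: "bounded_linear (A ^^ n)" "bounded_linear D" for n
    using lA lin(2) by (simp_all add: linear_conv_bounded_linear)
  have le: "n * \<bar>a\<bar> \<le> 2 * onorm D" for n :: nat
  proof -
    let ?F = "A ^^ n"
    have pos: "onorm ?F > 0"
      using nn[of n] onorm_pos_lt[OF bl(1)] by blast
    have "\<bar>n * a\<bar> * onorm ?F = onorm (\<lambda>x. (n * a) *\<^sub>R ?F x)"
      by (rule onorm_scaleR[symmetric]) (rule bl(1))
    also have "(\<lambda>x. (n * a) *\<^sub>R ?F x) = (\<lambda>x. D (?F x) + - ?F (D x))"
      using c[of n] by (auto simp: fun_eq_iff)
    also have "onorm (\<lambda>x. D (?F x) + - ?F (D x)) \<le> onorm (\<lambda>x. D (?F x)) + onorm (\<lambda>x. - ?F (D x))"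
      by (rule onorm_triangle)
        (intro bounded_linear_compose[OF bl(2) bl(1)] bounded_linear_minus
          bounded_linear_compose[OF bl(1) bl(2)])+
    also have "onorm (\<lambda>x. - ?F (D x)) = onorm (\<lambda>x. ?F (D x))" by (rule onorm_neg)
    also have "onorm (\<lambda>x. D (?F x)) + onorm (\<lambda>x. ?F (D x)) \<le> onorm D * onorm ?F + onorm ?F * onorm D"
      using onorm_compose[OF bl(2) bl(1)[of n]] onorm_compose[OF bl(1)[of n] bl(2)]
      by (simp add: o_def mult.commute)
    finally have "(n * \<bar>a\<bar>) * onorm ?F \<le> (2 * onorm D) * onorm ?F"
      by (simp add: abs_mult algebra_simps)
    then show ?thesis using pos by simp
  qed
  obtain n :: nat where "2 * onorm D / \<bar>a\<bar> < n" using reals_Archimedean2 by blast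
  then have "2 * onorm D < n * \<bar>a\<bar>" using a by (simp add: field_simps)
  with le[of n] show False by simp
qed

lemma subspace_projection:
  fixes S :: "'a::euclidean_space set"
  assumes "subspace S"
  shows "\<exists>P. linear P \<and> (\<forall>x. P x \<in> S) \<and> (\<forall>x\<in>S. P x = x)"
proof -
  obtain B where B: "B \<subseteq> S" "independent B" "span B = S"
    using basis_exists[of S] assms by (metis span_subspace)
  obtain P where P: "linear P" "\<And>x. x \<in> B \<Longrightarrow> P x = id x" "range P = span (id ` B)"
    using linear_independent_extend_subspace[OF B(2), of id] by blast
  have "P x = x" if "x \<in> S" for x
  proof -
    have "x \<in> span B" using that B(3) by simp
    then show ?thesis
      by (induction rule: span_induct_alt)
        (simp_all add: linear_0[OF P(1)] linear_add[OF P(1)] linear_scale[OF P(1)] P(2))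
  qed
  moreover have "P x \<in> S" for x using P(3) B(3) by auto
  ultimately show ?thesis using P(1) by blast
qed

text \<open>Since \<open>f\<close> maps the range of its \<open>k\<close>-th power into the next
  range, cyclicity allows shrinking the range by one power at a time. Hence the Fitting null
  component contributes nothing to the trace.\<close>

lemma lin_trace_projection_range:
  fixes f :: "'a::euclidean_space \<Rightarrow> 'a"
  assumes "linear f" "linear P" "\<And>x. P x \<in> range (f ^^ k)" "\<And>x. x \<in> range (f ^^ k) \<Longrightarrow> P x = x"
  shows "lin_trace (\<lambda>x. f (P x)) = lin_trace f"
  using assms(2-)
proof (induction k arbitrary: P)
  case 0
  then show ?case by simp
next
  case (Suc k)
  have lk: "linear (f ^^ k)" using linear_funpow_self[OF assms(1)] by simp
  have "subspace (range (f ^^ k))" by (rule linear_subspace_image[OF lk subspace_UNIV])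
  then obtain Q where Q: "linear Q" "\<And>x. Q x \<in> range (f ^^ k)" "\<And>x. x \<in> range (f ^^ k) \<Longrightarrow> Q x = x"
    using subspace_projection by blast
  have r: "range (f ^^ Suc k) \<subseteq> range (f ^^ k)"
    by (auto simp: funpow_swap1)
  have "f (Q x) \<in> range (f ^^ Suc k)" for x using Q(2)[of x] by auto
  then have "f (Q x) = P (f (Q x))" for x using Suc.prems(3)[of "f (Q x)"] by simp
  then have "(\<lambda>x. f (Q x)) = (\<lambda>x. P (f (Q x)))" by (rule ext)
  then have "lin_trace (\<lambda>x. f (Q x)) = lin_trace (\<lambda>x. P (f (Q x)))" by (rule arg_cong)
  also have "\<dots> = lin_trace (\<lambda>x. f (Q (P x)))"
    by (rule lin_trace_comm[of "\<lambda>x. f (Q x)" P]) (simp_all add: assms(1) Q(1) Suc.prems linear_comp_frame)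
  also have "(\<lambda>x. f (Q (P x))) = (\<lambda>x. f (P x))"
  proof
    fix x
    have "P x \<in> range (f ^^ k)" using Suc.prems(2) r by blast
    then show "f (Q (P x)) = f (P x)" using Q(3) by simp
  qed
  finally show ?case using Suc.IH[of Q] Q by simp
qed

lemma lin_trace_projection:
  fixes P :: "'a::euclidean_space \<Rightarrow> 'a"
  assumes "linear P" "\<And>x. P (P x) = P x"
  shows "lin_trace P = dim (range P)"
proof -
  obtain B where B: "B \<subseteq> range P" "independent B" "range P \<subseteq> span B" "card B = dim (range P)"
    using basis_exists by metis
  have fin: "finite B" using B(2) independent_imp_finite by blast
  have sp: "P x \<in> span B" for x using B(3) by blast
  define c where "c b x = representation B (P x) b" for b x
  have lc: "linear (c b)" for b
    unfolding c_def
    by (rule linearI) (simp_all add: linear_add[OF assms(1)] linear_scale[OF assms(1)] sp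
        representation_add[OF B(2)] representation_scale[OF B(2)])
  have "P = (\<lambda>x. \<Sum>b\<in>B. c b x *\<^sub>R b)"
    unfolding c_def using sum_representation_eq[OF B(2) sp fin order_refl] by (auto simp: fun_eq_iff)
  then have "lin_trace P = lin_trace (\<lambda>x. \<Sum>b\<in>B. c b x *\<^sub>R b)" by (rule arg_cong)
  also have "\<dots> = (\<Sum>b\<in>B. c b b)"
    using fin lc by (simp add: lin_trace_sum lin_trace_eq_of_rank_one)
  also have "\<dots> = (\<Sum>b\<in>B. 1)"
  proof (rule sum.cong)
    fix b assume b: "b \<in> B"
    then have "P b = b" using B(1) assms(2) by auto
    then show "c b b = 1" using b by (simp add: c_def representation_basis[OF B(2)])
  qed simp
  finally show ?thesis using B(4) by simp
qed

lemma dim3_frame_exists: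
  assumes "DIM('a::euclidean_space) = 3"
  shows "\<exists>e1 e2 e3 :: 'a. span {e1,e2,e3} = UNIV"
proof -
  obtain e1 e2 e3 :: 'a where "Basis = {e1,e2,e3}"
    using assms by (auto simp: card_3_iff)
  then have "span {e1,e2,e3} = UNIV" by (metis span_Basis)
  then show ?thesis by blast
qed

lemma dim4_frame_exists:
  assumes "DIM('a::euclidean_space) = 4"
  shows "\<exists>e1 e2 e3 e4 :: 'a. span {e1,e2,e3,e4} = UNIV"
proof -
  have "card (Basis :: 'a set) = Suc 3" using assms by simp
  then obtain e1 and B :: "'a set" where "Basis = insert e1 B" "card B = 3"
    unfolding card_Suc_eq by blast
  then obtain e2 e3 e4 where "(Basis :: 'a set) = {e1,e2,e3,e4}"
    by (auto simp: card_3_iff)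
  then have "span {e1,e2,e3,e4} = UNIV" by (metis span_Basis)
  then show ?thesis by blast
qed

text \<open>The coefficients of the characteristic polynomial appear as power traces (Newton's
  identities); trace zero removes the quadratic term.\<close>

lemma cayley_hamilton3:
  fixes A :: "'a::euclidean_space \<Rightarrow> 'a"
  assumes dim: "DIM('a) = 3" and A: "linear A" and tr: "lin_trace A = 0"
  shows "A (A (A x)) = (lin_trace (\<lambda>x. A (A x)) / 2) *\<^sub>R A x
    + (lin_trace (\<lambda>x. A (A (A x))) / 3) *\<^sub>R x"
proof -
  obtain e1 e2 e3 :: 'a where sp: "span {e1,e2,e3} = UNIV"
    using dim3_frame_exists[OF dim] by blast
  show ?thesis
  proof (rule frame3E[OF dim sp])
    fix c1 c2 c3 :: "'a \<Rightarrow> real"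
    assume l: "linear c1" "linear c2" "linear c3"
    assume d: "c1 e1 = 1" "c1 e2 = 0" "c1 e3 = 0" "c2 e1 = 0" "c2 e2 = 1" "c2 e3 = 0"
      "c3 e1 = 0" "c3 e2 = 0" "c3 e3 = 1"
    assume ex: "\<And>x. x = c1 x *\<^sub>R e1 + c2 x *\<^sub>R e2 + c3 x *\<^sub>R e3"
    assume trf: "\<And>f. linear f \<Longrightarrow> lin_trace f = c1 (f e1) + c2 (f e2) + c3 (f e3)"
    define a11 a12 a13 a21 a22 a23 a31 a32 a33 where
      a: "a11 = c1 (A e1)" "a12 = c1 (A e2)" "a13 = c1 (A e3)" "a21 = c2 (A e1)" "a22 = c2 (A e2)"
        "a23 = c2 (A e3)" "a31 = c3 (A e1)" "a32 = c3 (A e2)" "a33 = c3 (A e3)"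
    have Ax: "A y = c1 y *\<^sub>R A e1 + c2 y *\<^sub>R A e2 + c3 y *\<^sub>R A e3" for y
      using arg_cong[OF ex[of y], of A] by (simp add: linear_add[OF A] linear_scale[OF A])
    have cA: "c1 (A y) = a11 * c1 y + a12 * c2 y + a13 * c3 y"
      "c2 (A y) = a21 * c1 y + a22 * c2 y + a23 * c3 y"
      "c3 (A y) = a31 * c1 y + a32 * c2 y + a33 * c3 y" for y
      by (subst Ax[of y], simp add: l[THEN linear_add] l[THEN linear_scale] a mult.commute)+
    have tr0: "a33 = - a11 - a22"
      using tr unfolding trf[OF A] by (simp add: a)
    have lA: "linear (\<lambda>x. A (A x))" "linear (\<lambda>x. A (A (A x)))"
      by (rule linear_comp_frame[OF A A], rule linear_comp_frame[OF A linear_comp_frame[OF A A]])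
    define T2 T3 where T: "T2 = lin_trace (\<lambda>x. A (A x))" "T3 = lin_trace (\<lambda>x. A (A (A x)))"
    note T' = T(1)[unfolded trf[OF lA(1)]] T(2)[unfolded trf[OF lA(2)]]
    \<comment> \<open>Six times the difference of the two sides, so that the coordinates are
      polynomials with integer coefficients.\<close>
    define y where "y = 6 *\<^sub>R A (A (A x)) - (3 * T2) *\<^sub>R A x - (2 * T3) *\<^sub>R x"
    have "c1 y = 0" "c2 y = 0" "c3 y = 0"
      unfolding y_def T'
      by (simp_all only: l[THEN linear_diff] l[THEN linear_scale] cA d tr0 real_scaleR_def)
        (algebra+)
    then have "y = 0" using ex[of y] by simp
    then have "(1/6) *\<^sub>R y = 0" by simp
    then show ?thesis unfolding T[symmetric] by (simp add: y_def algebra_simps)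
  qed
qed

text \<open>\<open>q\<close> is minus the determinant and stays implicit; the two power traces are
  explicit because the spectral argument evaluates them.\<close>

lemma cayley_hamilton4:
  fixes A :: "'a::euclidean_space \<Rightarrow> 'a"
  assumes dim: "DIM('a) = 4" and A: "linear A" and tr: "lin_trace A = 0"
  obtains q where "\<And>x. A (A (A (A x))) = (lin_trace (\<lambda>x. A (A x)) / 2) *\<^sub>R A (A x)
    + (lin_trace (\<lambda>x. A (A (A x))) / 3) *\<^sub>R A x + q *\<^sub>R x"
proof -
  obtain e1 e2 e3 e4 :: 'a where sp: "span {e1,e2,e3,e4} = UNIV"
    using dim4_frame_exists[OF dim] by blast
  show ?thesis
  proof (rule frame4E[OF dim sp])
    fix c1 c2 c3 c4 :: "'a \<Rightarrow> real"
    assume l: "linear c1" "linear c2" "linear c3" "linear c4"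
    assume d: "c1 e1 = 1" "c1 e2 = 0" "c1 e3 = 0" "c1 e4 = 0" "c2 e1 = 0" "c2 e2 = 1" "c2 e3 = 0"
      "c2 e4 = 0" "c3 e1 = 0" "c3 e2 = 0" "c3 e3 = 1" "c3 e4 = 0"
      "c4 e1 = 0" "c4 e2 = 0" "c4 e3 = 0" "c4 e4 = 1"
    assume ex: "\<And>x. x = c1 x *\<^sub>R e1 + c2 x *\<^sub>R e2 + c3 x *\<^sub>R e3 + c4 x *\<^sub>R e4"
    assume trf: "\<And>f. linear f \<Longrightarrow> lin_trace f = c1 (f e1) + c2 (f e2) + c3 (f e3) + c4 (f e4)"
    define a11 a12 a13 a14 a21 a22 a23 a24 a31 a32 a33 a34 a41 a42 a43 a44 where
      a: "a11 = c1 (A e1)" "a12 = c1 (A e2)" "a13 = c1 (A e3)" "a14 = c1 (A e4)"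
        "a21 = c2 (A e1)" "a22 = c2 (A e2)" "a23 = c2 (A e3)" "a24 = c2 (A e4)"
        "a31 = c3 (A e1)" "a32 = c3 (A e2)" "a33 = c3 (A e3)" "a34 = c3 (A e4)"
        "a41 = c4 (A e1)" "a42 = c4 (A e2)" "a43 = c4 (A e3)" "a44 = c4 (A e4)"
    have Ax: "A y = c1 y *\<^sub>R A e1 + c2 y *\<^sub>R A e2 + c3 y *\<^sub>R A e3 + c4 y *\<^sub>R A e4" for y
      using arg_cong[OF ex[of y], of A] by (simp add: linear_add[OF A] linear_scale[OF A])
    have cA: "c1 (A y) = a11 * c1 y + a12 * c2 y + a13 * c3 y + a14 * c4 y"
      "c2 (A y) = a21 * c1 y + a22 * c2 y + a23 * c3 y + a24 * c4 y"
      "c3 (A y) = a31 * c1 y + a32 * c2 y + a33 * c3 y + a34 * c4 y"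
      "c4 (A y) = a41 * c1 y + a42 * c2 y + a43 * c3 y + a44 * c4 y" for y
      by (subst Ax[of y], simp add: l[THEN linear_add] l[THEN linear_scale] a mult.commute)+
    have tr0: "a44 = - a11 - a22 - a33"
      using tr unfolding trf[OF A] by (simp add: a)
    have lA: "linear (\<lambda>x. A (A x))" "linear (\<lambda>x. A (A (A x)))" "linear (\<lambda>x. A (A (A (A x))))"
      by (rule linear_comp_frame[OF A A], rule linear_comp_frame[OF A linear_comp_frame[OF A A]],
          rule linear_comp_frame[OF A linear_comp_frame[OF A linear_comp_frame[OF A A]]])
    define T2 T3 T4 where T: "T2 = lin_trace (\<lambda>x. A (A x))" "T3 = lin_trace (\<lambda>x. A (A (A x)))"
      "T4 = lin_trace (\<lambda>x. A (A (A (A x))))"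
    note T' = T(1)[unfolded trf[OF lA(1)]] T(2)[unfolded trf[OF lA(2)]] T(3)[unfolded trf[OF lA(3)]]
    define q where "q = T4 / 4 - T2 * T2 / 8"
    show thesis
    proof (rule that[of q])
      fix x
      define y where "y = 24 *\<^sub>R A (A (A (A x))) - (12 * T2) *\<^sub>R A (A x) - (8 * T3) *\<^sub>R A x
        - (6 * T4 - 3 * T2 * T2) *\<^sub>R x"
      have "c1 y = 0" "c2 y = 0" "c3 y = 0" "c4 y = 0"
        unfolding y_def T'
        by (simp_all only: l[THEN linear_diff] l[THEN linear_scale] cA d tr0 real_scaleR_def)
          (algebra+)
      then have "y = 0" using ex[of y] by simp
      then have "(1/24) *\<^sub>R y = 0" by simp
      then show "A (A (A (A x))) = (lin_trace (\<lambda>x. A (A x)) / 2) *\<^sub>R A (A x)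
          + (lin_trace (\<lambda>x. A (A (A x))) / 3) *\<^sub>R A x + q *\<^sub>R x"
        unfolding T[symmetric] by (simp add: y_def q_def algebra_simps)
    qed
  qed
qed

section \<open>Fitting decompositions\<close>

lemma subspace_dim_psubset:
  fixes S T :: "'a::euclidean_space set"
  assumes "subspace S" "subspace T" "S \<subset> T"
  shows "dim S < dim T"
proof (rule dim_psubset)
  show "span S \<subset> span T"
    unfolding span_eq_iff[THEN iffD2, OF assms(1)] span_eq_iff[THEN iffD2, OF assms(2)]
    by (rule assms(3))
qed

lemma mem_span_insert_subspace:
  assumes "subspace K" "m \<in> span (insert y K)"
  shows "\<exists>k\<in>K. \<exists>r. m = k + r *\<^sub>R y"
proof -
  obtain r where "m - r *\<^sub>R y \<in> K"
    using assms(2) unfolding span_insert span_eq_iff[THEN iffD2, OF assms(1)] by blast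
  then show ?thesis by (intro bexI[of _ "m - r *\<^sub>R y"] exI[of _ r]) auto
qed

section \<open>Engel's theorem\<close>

context lie
begin

definition ad_nilpotent :: "'a \<Rightarrow> bool" where
  "ad_nilpotent x \<longleftrightarrow> (\<forall>y. \<exists>k. (br x ^^ k) y = 0)"

text \<open>Engel's theorem for the action of a subalgebra \<open>M\<close> on the quotient of
  \<open>U\<close> by \<open>W\<close>, stated with a pair of subspaces instead of a quotient. This
  form lets the induction hypothesis also be applied to the action of a smaller subalgebra
  \<open>K\<close> on \<open>M\<close> modulo \<open>K\<close>.\<close>

lemma engel_relative:
  assumes nil: "\<And>x. ad_nilpotent x"
    and "subspace M" "\<And>x y. x \<in> M \<Longrightarrow> y \<in> M \<Longrightarrow> br x y \<in> M"
    and "subspace W" "subspace U" "W \<subset> U"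
    and "\<And>m w. m \<in> M \<Longrightarrow> w \<in> W \<Longrightarrow> br m w \<in> W" "\<And>m u. m \<in> M \<Longrightarrow> u \<in> U \<Longrightarrow> br m u \<in> U"
  shows "\<exists>x\<in>U. x \<notin> W \<and> (\<forall>m\<in>M. br m x \<in> W)"
  using assms(2-)
proof (induction "dim M" arbitrary: M W U rule: less_induct)
  case (less M W U)
  note M = less.prems(1,2) and W = less.prems(3) and U = less.prems(4) and WU = less.prems(5)
    and MW = less.prems(6) and MU = less.prems(7)
  show ?case
  proof (cases "M = {0}")
    case True
    then show ?thesis using WU subspace_0[OF W] by auto
  next
    case False
    define sub where "sub K \<longleftrightarrow> subspace K \<and> K \<subset> M \<and> (\<forall>x\<in>K. \<forall>y\<in>K. br x y \<in> K)" for K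
    have "sub {0}" using False subspace_0[OF M(1)] by (auto simp: sub_def)
    moreover have "\<forall>K. sub K \<longrightarrow> dim K < DIM('a) + 1"
      by (simp add: dim_subset_UNIV less_Suc_eq_le)
    ultimately have "\<exists>K. sub K \<and> (\<forall>K'. sub K' \<longrightarrow> dim K' \<le> dim K)"
      by (rule Lattices_Big.ex_has_greatest_nat)
    then obtain K where K: "sub K" "\<And>K'. sub K' \<Longrightarrow> dim K' \<le> dim K" by auto
    have Ks: "subspace K" "K \<subset> M" "\<And>x y. x \<in> K \<Longrightarrow> y \<in> K \<Longrightarrow> br x y \<in> K"
      using K(1) by (auto simp: sub_def)
    have dK: "dim K < dim M"
      by (rule subspace_dim_psubset[OF Ks(1) M(1) Ks(2)])
    \<comment> \<open>The induction hypothesis for \<open>K\<close> acting on \<open>M\<close>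
      modulo \<open>K\<close> gives a vector normalising \<open>K\<close>; by maximality of
      \<open>K\<close> it generates \<open>M\<close> together with \<open>K\<close>.\<close>
    from less.hyps[OF dK Ks(1,3,1) M(1) Ks(2,3)] obtain y where
      y: "y \<in> M" "y \<notin> K" "\<And>k. k \<in> K \<Longrightarrow> br k y \<in> K"
      using Ks(2) M(2) by blast
    have mem: "\<exists>k\<in>K. \<exists>r. m = k + r *\<^sub>R y" if "m \<in> span (insert y K)" for m
      by (rule mem_span_insert_subspace[OF Ks(1) that])
    have "span (insert y K) = M"
    proof (rule ccontr)
      assume ne: "span (insert y K) \<noteq> M"
      have le: "span (insert y K) \<subseteq> M"
        by (rule span_minimal) (use y Ks M in auto)
      have "br a b \<in> span (insert y K)" if ab: "a \<in> span (insert y K)" "b \<in> span (insert y K)" for a b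
      proof -
        obtain k r where a: "k \<in> K" "a = k + r *\<^sub>R y" using mem[OF ab(1)] by blast
        obtain l s where b: "l \<in> K" "b = l + s *\<^sub>R y" using mem[OF ab(2)] by blast
        have "br a b = br k l + s *\<^sub>R br k y - r *\<^sub>R br l y"
          by (simp add: a b br_skew[of y l])
        also have "\<dots> \<in> K"
          by (intro subspace_add subspace_diff subspace_scale Ks y(3) a b)
        finally show ?thesis using span_superset[of "insert y K"] by blast
      qed
      then have "sub (span (insert y K))" using le ne by (auto simp: sub_def)
      then have "dim (span (insert y K)) \<le> dim K" by (rule K(2))
      moreover have "K \<subset> span (insert y K)"
        using y(2) span_superset[of "insert y K"] by blast
      then have "dim K < dim (span (insert y K))"
        by (rule subspace_dim_psubset[OF Ks(1) subspace_span])
      ultimately show False by simp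
    qed
    then have memM: "\<exists>k\<in>K. \<exists>r. m = k + r *\<^sub>R y" if "m \<in> M" for m using mem that by simp
    have "\<exists>x\<in>U. x \<notin> W \<and> (\<forall>m\<in>K. br m x \<in> W)"
      by (rule less.hyps[OF dK Ks(1,3) W U WU]) (use Ks(2) MW MU in auto)
    then obtain x where x: "x \<in> U" "x \<notin> W" "\<And>k. k \<in> K \<Longrightarrow> br k x \<in> W" by blast
    \<comment> \<open>The vectors sent into \<open>W\<close> by \<open>K\<close> are stable under
      \<open>y\<close> because \<open>y\<close> normalises \<open>K\<close>. The last iterate
      outside \<open>W\<close> is then sent into \<open>W\<close> by \<open>y\<close> as
      well.\<close>
    have iter: "(br y ^^ n) x \<in> U \<and> (\<forall>k\<in>K. br k ((br y ^^ n) x) \<in> W)" for n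
    proof (induction n)
      case 0
      show ?case using x by simp
    next
      case (Suc n)
      let ?z = "(br y ^^ n) x"
      have "br k (br y ?z) \<in> W" if k: "k \<in> K" for k
        unfolding jacobi[of k y ?z]
        by (intro subspace_add[OF W]) (use Suc y k MW in auto)
      then show ?case using Suc MU y(1) by auto
    qed
    obtain k where "(br y ^^ k) x = 0" using nil[of y] by (auto simp: ad_nilpotent_def)
    then have ex: "\<exists>n. (br y ^^ n) x \<in> W" using subspace_0[OF W] by metis
    define n where "n = (LEAST n. (br y ^^ n) x \<in> W)"
    have n: "(br y ^^ n) x \<in> W" unfolding n_def by (rule LeastI_ex[OF ex])
    have "n \<noteq> 0" using n x(2) by (cases n) auto
    then obtain p where p: "n = Suc p" by (cases n) auto
    have np: "(br y ^^ p) x \<notin> W"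
      using not_less_Least[of p "\<lambda>n. (br y ^^ n) x \<in> W"] p by (simp add: n_def)
    show ?thesis
    proof (intro bexI conjI ballI)
      show "(br y ^^ p) x \<in> U" "(br y ^^ p) x \<notin> W" using iter np by auto
      fix m assume "m \<in> M"
      then obtain k r where k: "k \<in> K" "m = k + r *\<^sub>R y" using memM by blast
      show "br m ((br y ^^ p) x) \<in> W"
        unfolding k(2) using n iter k(1)
        by (auto simp: p intro!: subspace_add[OF W] subspace_scale[OF W])
    qed
  qed
qed

text \<open>Modulo a maximal proper ideal \<open>K\<close>, Engel's theorem gives \<open>x\<close>
  outside \<open>K\<close> whose brackets all lie in \<open>K\<close>. Then \<open>K\<close> and
  \<open>x\<close> span an ideal, hence the whole algebra, and every bracket lies in
  \<open>K\<close>.\<close>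

lemma perfect_not_ad_nilpotent:
  assumes "perfect br"
  shows "\<exists>x. \<not> ad_nilpotent x"
proof (rule ccontr)
  assume "\<not> ?thesis"
  then have nil: "ad_nilpotent x" for x by blast
  define I where "I K \<longleftrightarrow> subspace K \<and> K \<noteq> UNIV \<and> (\<forall>x. \<forall>y\<in>K. br x y \<in> K)" for K
  have "dim ({0} :: 'a set) \<noteq> dim (UNIV :: 'a set)" using DIM_positive[where 'a='a] by simp
  then have "I {0}" by (auto simp: I_def)
  moreover have "\<forall>K. I K \<longrightarrow> dim K < DIM('a) + 1"
    by (simp add: dim_subset_UNIV less_Suc_eq_le)
  ultimately have "\<exists>K. I K \<and> (\<forall>K'. I K' \<longrightarrow> dim K' \<le> dim K)"
    by (rule Lattices_Big.ex_has_greatest_nat)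
  then obtain K where K: "I K" "\<And>K'. I K' \<Longrightarrow> dim K' \<le> dim K" by auto
  have Ks: "subspace K" "K \<subset> UNIV" "\<And>x y. y \<in> K \<Longrightarrow> br x y \<in> K" using K(1) by (auto simp: I_def)
  obtain x where x: "x \<notin> K" "\<And>m. br m x \<in> K"
    using engel_relative[OF nil subspace_UNIV _ Ks(1) subspace_UNIV Ks(2)] Ks(3) by auto
  have mem: "\<exists>k\<in>K. \<exists>r. m = k + r *\<^sub>R x" if "m \<in> span (insert x K)" for m
    by (rule mem_span_insert_subspace[OF Ks(1) that])
  have inK: "br a b \<in> K" if b: "b \<in> span (insert x K)" for a b
  proof -
    obtain k r where "k \<in> K" "b = k + r *\<^sub>R x" using mem[OF b] by blast
    then show ?thesis using Ks x by (auto intro!: subspace_add subspace_scale)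
  qed
  have "span (insert x K) = UNIV"
  proof (rule ccontr)
    assume ne: "span (insert x K) \<noteq> UNIV"
    have sup: "K \<subset> span (insert x K)" using x(1) span_superset[of "insert x K"] by blast
    have "I (span (insert x K))" unfolding I_def using ne inK sup by auto
    then have "dim (span (insert x K)) \<le> dim K" by (rule K(2))
    moreover have "dim K < dim (span (insert x K))"
      by (rule subspace_dim_psubset[OF Ks(1) subspace_span sup])
    ultimately show False by simp
  qed
  then have "{br x y | x y. True} \<subseteq> K" using inK by auto
  then have "span {br x y | x y. True} \<subseteq> K" using Ks(1) by (rule span_minimal)
  then show False using assms Ks(2) by (simp add: perfect_def)
qed

end

section \<open>Fitting decomposition of an endomorphism and of an adjoint action\<close>

lemma linear_fitting:
  fixes f :: "'a::euclidean_space \<Rightarrow> 'a"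
  assumes "linear f"
  shows "\<exists>P n. linear P \<and> (\<forall>x. P (P x) = P x) \<and> (\<forall>x. P (f x) = f (P x)) \<and>
    (\<forall>x. P x = 0 \<longrightarrow> (f ^^ n) x = 0) \<and> (\<forall>x. P x = x \<longrightarrow> f x = 0 \<longrightarrow> x = 0) \<and>
    (\<forall>x. P x = x \<longrightarrow> (\<exists>y. P y = y \<and> f y = x)) \<and> range P = range (f ^^ n)"
proof -
  have lk: "linear (f ^^ k)" for k by (rule linear_funpow_self[OF assms])
  \<comment> \<open>At the minimal dimension the images of powers have stabilised, so
    \<open>f\<close> maps \<open>?N\<close> onto itself.\<close>
  obtain n where n: "\<And>k. dim (range (f ^^ n)) \<le> dim (range (f ^^ k))"
    using ex_has_least_nat[of "\<lambda>_. True" 0 "\<lambda>k. dim (range (f ^^ k))"] by auto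
  let ?N = "range (f ^^ n)"
  have sub: "subspace (range (f ^^ k))" for k
    by (rule linear_subspace_image[OF lk subspace_UNIV])
  have fN: "f ` ?N = ?N"
  proof -
    have e: "f ` ?N = range (f ^^ Suc n)" by (auto simp: image_image)
    have "f ` ?N \<subseteq> ?N" unfolding e by (auto simp: funpow_swap1)
    moreover have "dim ?N \<le> dim (f ` ?N)" unfolding e by (rule n)
    ultimately show ?thesis
      using subspace_dim_equal[of "f ` ?N" ?N] sub e by metis
  qed
  obtain Q where Q: "linear Q" "\<And>x. Q x \<in> ?N" "\<And>x. x \<in> ?N \<Longrightarrow> Q x = x"
    using subspace_projection[OF sub] by blast
  \<comment> \<open>Equal to \<open>f\<close> on \<open>?N\<close> and to the identity on a
    complement, so \<open>g\<close> is an endomorphism of the whole space: surjectivity there yields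
    injectivity, hence injectivity of \<open>f\<close> on \<open>?N\<close>.\<close>
  define g where "g x = f (Q x) + (x - Q x)" for x
  have lg: "linear g" unfolding g_def
    by (rule linearI) (simp_all add: linear_add[OF assms] linear_add[OF Q(1)] linear_scale[OF assms]
        linear_scale[OF Q(1)] algebra_simps)
  have "surj g"
  proof -
    have "\<exists>x. z = g x" for z
    proof -
      obtain p where p: "p \<in> ?N" "f p = Q z" using fN Q(2)[of z] by (metis imageE)
      have "Q (p + (z - Q z)) = p"
        using Q(3)[OF p(1)] Q(3)[OF Q(2), of z] by (simp add: linear_add[OF Q(1)] linear_diff[OF Q(1)])
      then show ?thesis by (intro exI[of _ "p + (z - Q z)"]) (simp add: g_def p(2))
    qed
    then show ?thesis by blast
  qed
  then have ig: "inj g" using linear_surjective_imp_injective[OF lg] by blast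
  have inj: "x = 0" if "x \<in> ?N" "f x = 0" for x
  proof -
    have "g x = 0" using that by (simp add: g_def Q(3))
    then have "g x = g 0" by (simp add: linear_0[OF lg])
    then show ?thesis using ig by (simp add: inj_eq)
  qed
  have fkN: "(f ^^ k) ` ?N = ?N" for k
  proof (induction k)
    case (Suc k)
    have "(f ^^ Suc k) ` ?N = f ` ((f ^^ k) ` ?N)" by (simp add: image_comp)
    then show ?case using Suc fN by simp
  qed simp
  have injk: "x = 0" if "x \<in> ?N" "(f ^^ k) x = 0" for x k
    using that
  proof (induction k arbitrary: x)
    case (Suc k)
    have "(f ^^ k) x \<in> ?N" using fkN[of k] Suc.prems(1) by blast
    moreover have "f ((f ^^ k) x) = 0" using Suc.prems(2) by simp
    ultimately have "(f ^^ k) x = 0" by (rule inj)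
    then show ?case using Suc by blast
  qed simp
  \<comment> \<open>The witness \<open>y\<close> is the projection of \<open>x\<close> onto the
    stable image along the kernel of the \<open>n\<close>-th power.\<close>
  have "\<exists>y. y \<in> ?N \<and> (f ^^ n) (x - y) = 0" for x
  proof -
    have "(f ^^ n) x \<in> (f ^^ n) ` ?N" unfolding fkN by blast
    then obtain y where "y \<in> ?N" "(f ^^ n) x = (f ^^ n) y" by blast
    then show ?thesis by (intro exI[of _ y]) (simp add: linear_diff[OF lk])
  qed
  then obtain P where P: "\<And>x. P x \<in> ?N" "\<And>x. (f ^^ n) (x - P x) = 0" by metis
  have uniq: "P x = y" if "y \<in> ?N" "(f ^^ n) (x - y) = 0" for x y
  proof -
    have "(f ^^ n) (P x - y) = 0"
      using that(2) P(2)[of x] by (simp add: linear_diff[OF lk])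
    moreover have "P x - y \<in> ?N" using P(1) that(1) by (intro subspace_diff[OF sub])
    ultimately show ?thesis using injk by fastforce
  qed
  have lP: "linear P"
  proof (rule linearI)
    show "P (x + y) = P x + P y" for x y
      by (rule uniq) (use P in \<open>auto intro!: subspace_add[OF sub] simp: linear_add[OF lk] linear_diff[OF lk] algebra_simps\<close>)
    show "P (r *\<^sub>R x) = r *\<^sub>R P x" for r x
    proof (rule uniq)
      show "r *\<^sub>R P x \<in> ?N" by (intro subspace_scale[OF sub] P(1))
      have "(f ^^ n) (r *\<^sub>R (x - P x)) = 0" using P(2)[of x] by (simp add: linear_scale[OF lk])
      then show "(f ^^ n) (r *\<^sub>R x - r *\<^sub>R P x) = 0" by (simp add: scaleR_diff_right)
    qed
  qed
  have PN: "P x = x" if "x \<in> ?N" for x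
    by (rule uniq) (use that in \<open>simp_all add: linear_0[OF lk]\<close>)
  have comm: "P (f x) = f (P x)" for x
  proof (rule uniq)
    show "f (P x) \<in> ?N" using fN P(1)[of x] by blast
    have "(f ^^ n) (f x - f (P x)) = f ((f ^^ n) (x - P x))"
      by (simp add: funpow_swap1 flip: linear_diff[OF assms])
    then show "(f ^^ n) (f x - f (P x)) = 0" using P(2) by (simp add: linear_0[OF assms])
  qed
  show ?thesis
  proof (rule exI[of _ P], rule exI[of _ n], intro conjI allI impI)
    show "P (P x) = P x" for x using PN P(1) by blast
    show "(f ^^ n) x = 0" if "P x = 0" for x using P(2)[of x] that by simp
    show "x = 0" if "P x = x" "f x = 0" for x using inj P(1)[of x] that by simp
    show "\<exists>y. P y = y \<and> f y = x" if "P x = x" for x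
    proof -
      have "x \<in> f ` ?N" using fN P(1)[of x] that by simp
      then show ?thesis using PN by blast
    qed
    show "range P = ?N" using P(1) PN by (auto intro: rev_image_eqI) (metis PN rangeI)
  qed (use lP comm in auto)
qed

text \<open>The decomposition is carried by the projection \<open>P\<close>: its kernel is the null
  component, on which \<open>br X\<close> is nilpotent, and its fixed vectors form the component on
  which \<open>br X\<close> is invertible. All of the trace of \<open>br X\<close> sits on the
  latter, so \<open>trace_P\<close> is what unimodularity becomes.\<close>

locale fitting = unimodular_lie +
  fixes X :: 'a and P :: "'a \<Rightarrow> 'a"
  assumes linear_P: "linear P" and P_idem: "P (P x) = P x" and P_comm: "P (br X x) = br X (P x)"
    and null_nil: "P x = 0 \<Longrightarrow> \<exists>k. (br X ^^ k) x = 0"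
    and inj: "P x = x \<Longrightarrow> br X x = 0 \<Longrightarrow> x = 0"
    and surj: "P x = x \<Longrightarrow> \<exists>y. P y = y \<and> br X y = x"
    and trace_P: "lin_trace (\<lambda>x. br X (P x)) = 0"
    and not_nil: "\<not> ad_nilpotent X"
begin

lemmas P_simps [simp] = linear_add[OF linear_P] linear_scale[OF linear_P] linear_neg[OF linear_P]
  linear_diff[OF linear_P] linear_0[OF linear_P] P_idem

lemma null_iff: "P x = 0 \<longleftrightarrow> (\<exists>k. (br X ^^ k) x = 0)"
proof
  assume "\<exists>k. (br X ^^ k) x = 0"
  then obtain k where "(br X ^^ k) x = 0" by blast
  then show "P x = 0"
  proof (induction k arbitrary: x)
    case (Suc k)
    then have "(br X ^^ k) (br X x) = 0" by (simp add: funpow_swap1)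
    then have "P (br X x) = 0" by (rule Suc.IH)
    then show ?case using inj[of "P x"] by (simp add: P_comm)
  qed simp
qed (rule null_nil)

lemma P_X [simp]: "P X = 0"
  unfolding null_iff by (rule exI[of _ 1]) simp

lemma X_nonzero: "X \<noteq> 0"
proof
  assume "X = 0"
  then have "(br X ^^ 1) y = 0" for y by simp
  then show False using not_nil unfolding ad_nilpotent_def by blast
qed

lemma P_of_zero: "br X x = 0 \<Longrightarrow> P x = 0"
  unfolding null_iff by (rule exI[of _ 1]) simp

text \<open>By the Leibniz rule the exponents \<open>p\<close> and \<open>q\<close> that annihilate
  the two arguments add up.\<close>

lemma P_br_null:
  assumes "P x = 0" "P y = 0"
  shows "P (br x y) = 0"
proof -
  obtain p q where "(br X ^^ p) x = 0" "(br X ^^ q) y = 0" using assms null_iff by blast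
  then have "(br X ^^ (p + q)) (br x y) = 0"
  proof (induction "p + q" arbitrary: p q x y)
    case 0
    then show ?case by simp
  next
    case (Suc m)
    show ?case
    proof (cases "p = 0 \<or> q = 0")
      case True
      then have "br x y = 0" using Suc.prems by auto
      then show ?thesis using linear_0[OF linear_funpow_self[OF linear_br(1)]] by simp
    next
      case False
      then obtain p' q' where pq: "p = Suc p'" "q = Suc q'" by (auto simp: gr0_conv_Suc)
      have "(br X ^^ (p' + q)) (br (br X x) y) = 0" "(br X ^^ (p + q')) (br x (br X y)) = 0"
        using Suc.hyps(1)[of p' q "br X x" y] Suc.hyps(1)[of p q' x "br X y"] Suc.prems Suc.hyps(2)
        by (simp_all add: pq funpow_swap1)
      then have "(br X ^^ m) (br X (br x y)) = 0"
        using Suc.hyps(2) unfolding jacobi[of X x y]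
        by (simp add: pq linear_add[OF linear_funpow_self[OF linear_br(1)]])
      then show ?thesis unfolding Suc.hyps(2)[symmetric] by (simp add: funpow_swap1)
    qed
  qed
  then show ?thesis using null_iff by blast
qed

lemma surj_iter: "P x = x \<Longrightarrow> \<exists>y. P y = y \<and> (br X ^^ k) y = x"
proof (induction k arbitrary: x)
  case (Suc k)
  obtain y where y: "P y = y" "br X y = x" using surj[OF Suc.prems] by blast
  obtain z where "P z = z" "(br X ^^ k) z = y" using Suc.IH[OF y(1)] by blast
  then show ?case using y(2) by auto
qed simp

text \<open>Induction on the exponent annihilating \<open>x\<close>. By the hypothesis for
  \<open>br X x\<close>, the null part \<open>Q\<close> of the bracket with \<open>x\<close>
  commutes with \<open>br X\<close> on fixed vectors of \<open>P\<close>. Writing \<open>y\<close>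
  as a high iterate of some \<open>z\<close> makes \<open>Q (br x y)\<close> a high iterate of a
  null vector, hence zero.\<close>

lemma P_br_mixed:
  assumes "P x = 0" "P y = y"
  shows "P (br x y) = br x y"
proof -
  obtain k where "(br X ^^ k) x = 0" using null_nil[OF assms(1)] by blast
  then show ?thesis using assms(2)
  proof (induction k arbitrary: x y)
    case (Suc k)
    have IH: "P (br (br X x) y) = br (br X x) y" if "P y = y" for y
      by (rule Suc.IH) (use Suc.prems that in \<open>simp_all add: funpow_swap1\<close>)
    define Q where "Q z = z - P z" for z
    have lQ: "linear Q" unfolding Q_def by (rule linearI) (simp_all add: algebra_simps)
    have cQ: "Q (br X z) = br X (Q z)" for z by (simp add: Q_def P_comm)
    have step: "Q (br x ((br X ^^ j) z)) = (br X ^^ j) (Q (br x z))" if z: "P z = z" for j z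
    proof (induction j)
      case (Suc j)
      have Pj: "P ((br X ^^ j) z) = (br X ^^ j) z"
        by (induction j) (simp_all add: z P_comm)
      have "Q (br x (br X ((br X ^^ j) z))) = Q (br X (br x ((br X ^^ j) z))) - Q (br (br X x) ((br X ^^ j) z))"
        using jacobi[of X x "(br X ^^ j) z"] by (simp add: linear_add[OF lQ])
      also have "Q (br (br X x) ((br X ^^ j) z)) = 0"
        using IH[OF Pj] by (simp add: Q_def)
      finally show ?case using Suc by (simp add: cQ)
    qed simp
    have "Q (br x y) = 0"
    proof -
      \<comment> \<open>One exponent for the whole null component: the sum of the exponents of its
        basis vectors.\<close>
      obtain n where n: "\<And>z. P z = 0 \<Longrightarrow> (br X ^^ n) z = 0"
      proof -
        have "\<exists>n. \<forall>z. P z = 0 \<longrightarrow> (br X ^^ n) z = 0"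
        proof -
          obtain B where B: "B \<subseteq> {z. P z = 0}" "independent B" "{z. P z = 0} \<subseteq> span B"
            using basis_exists by metis
          have fin: "finite B" using B(2) independent_imp_finite by blast
          have "\<forall>b\<in>B. \<exists>k. (br X ^^ k) b = 0" using B(1) null_nil by blast
          then obtain k where k: "\<And>b. b \<in> B \<Longrightarrow> (br X ^^ k b) b = 0" by metis
          define n where "n = (\<Sum>b\<in>B. k b)"
          have lp: "linear (br X ^^ n)" by (rule linear_funpow_self[OF linear_br(1)])
          have "(br X ^^ n) b = 0" if b: "b \<in> B" for b
          proof -
            have "k b \<le> n" unfolding n_def using fin b by (simp add: member_le_sum)
            then have "(br X ^^ n) b = (br X ^^ (n - k b)) ((br X ^^ k b) b)"
              by (simp flip: funpow_add comp_apply[of "br X ^^ (n - k b)"])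
            then show ?thesis
              using k[OF b] linear_0[OF linear_funpow_self[OF linear_br(1)]] by simp
          qed
          note zB = this
          have "(br X ^^ n) z = 0" if "z \<in> span B" for z
            using \<open>z \<in> span B\<close> by (induction rule: span_induct_alt)
              (simp_all add: zB linear_0[OF lp] linear_add[OF lp] linear_scale[OF lp])
          then show ?thesis using B(3) by blast
        qed
        then show thesis using that by blast
      qed
      obtain z where z: "P z = z" "(br X ^^ n) z = y" using surj_iter[OF Suc.prems(2)] by blast
      have "Q (br x y) = (br X ^^ n) (Q (br x z))" using step[OF z(1), of n] z(2) by simp
      also have "\<dots> = 0" by (rule n) (simp add: Q_def)
      finally show ?thesis .
    qed
    then show ?case by (simp add: Q_def)
  qed simp
qed

lemma decompose:
  obtains a b where "x = a + b" "P a = 0" "P b = b"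
  using that[of "x - P x" "P x"] by simp

lemma subspace_null: "subspace {x. P x = 0}" and subspace_range: "subspace (range P)"
  using linear_subspace_image[OF linear_P subspace_UNIV] by (auto simp: subspace_def)

lemma range_P_iff: "x \<in> range P \<longleftrightarrow> P x = x"
  by (metis P_idem rangeE rangeI)

lemma dim_null_range: "dim {x. P x = 0} + dim (range P) = DIM('a)"
proof -
  have "{x + y | x y. x \<in> {x. P x = 0} \<and> y \<in> range P} = UNIV"
  proof -
    have "\<exists>a b. x = a + b \<and> P a = 0 \<and> b \<in> range P" for x
      by (intro exI[of _ "x - P x"] exI[of _ "P x"]) simp
    then show ?thesis by blast
  qed
  moreover have "{x. P x = 0} \<inter> range P = {0}"
    using P_simps(5) range_P_iff by auto
  ultimately show ?thesis using dim_sums_Int[OF subspace_null subspace_range] by simp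
qed

lemma dim_range_neq_0: "dim (range P) \<noteq> 0"
proof
  assume "dim (range P) = 0"
  then have "range P \<subseteq> {0}" by simp
  then have "ad_nilpotent X" unfolding ad_nilpotent_def using null_nil by blast
  then show False using not_nil by blast
qed

text \<open>On a line, trace zero would make \<open>br X\<close> vanish, against
  injectivity.\<close>

lemma dim_range_neq_1: "dim (range P) \<noteq> 1"
proof
  assume d: "dim (range P) = 1"
  obtain B where B: "B \<subseteq> range P" "independent B" "range P \<subseteq> span B" "card B = dim (range P)"
    using basis_exists by metis
  then obtain u where "B = {u}" using d by (auto simp: card_1_singleton_iff)
  then have u: "u \<in> range P" "u \<noteq> 0" "range P \<subseteq> span {u}" using B dependent_zero[of B] by auto
  have "br X u \<in> range P" using u(1) by (metis P_comm range_P_iff)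
  then obtain k where k: "br X u = k *\<^sub>R u" using u(3) by (auto simp: span_singleton)
  have "br X (P x) = k *\<^sub>R P x" for x
  proof -
    obtain r where "P x = r *\<^sub>R u" using u(3) by (auto simp: span_singleton)
    then show ?thesis by (simp add: k)
  qed
  then have "lin_trace (\<lambda>x. k *\<^sub>R P x) = 0" using trace_P by simp
  then have "k * lin_trace P = 0" by (simp add: lin_trace_scaleR)
  then have "k = 0" using lin_trace_projection[OF linear_P P_idem] d by simp
  then show False using inj[of u] u k range_P_iff by simp
qed

end

lemma (in unimodular_lie) fitting_exists:
  assumes "\<not> ad_nilpotent x"
  shows "\<exists>P. fitting br x P"
proof -
  from linear_fitting[OF linear_br(1)[of x]] obtain P n where
    P: "linear P" "\<forall>y. P (P y) = P y" "\<forall>y. P (br x y) = br x (P y)"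
      "\<forall>y. P y = 0 \<longrightarrow> (br x ^^ n) y = 0" "\<forall>y. P y = y \<longrightarrow> br x y = 0 \<longrightarrow> y = 0"
      "\<forall>y. P y = y \<longrightarrow> (\<exists>z. P z = z \<and> br x z = y)" "range P = range (br x ^^ n)"
    by blast
  have "lin_trace (\<lambda>y. br x (P y)) = lin_trace (br x)"
  proof (rule lin_trace_projection_range[OF linear_br(1) P(1), of n])
    show "P y \<in> range (br x ^^ n)" for y using P(7) by blast
    show "P y = y" if "y \<in> range (br x ^^ n)" for y
      using that P(2) unfolding P(7)[symmetric] by auto
  qed
  then have tr: "lin_trace (\<lambda>y. br x (P y)) = 0" by (simp add: trace_br)
  have "fitting br x P"
  proof (intro fitting.intro fitting_axioms.intro)
    show "unimodular_lie br" by unfold_locales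
    show "\<exists>k. (br x ^^ k) y = 0" if "P y = 0" for y using P(4) that by blast
    show "y = 0" if "P y = y" "br x y = 0" for y using P(5) that by blast
    show "\<exists>z. P z = z \<and> br x z = y" if "P y = y" for y using P(6) that by blast
  qed (use P(1-3) assms tr in simp_all)
  then show ?thesis by blast
qed

section \<open>Perfect algebras in low dimensions\<close>

lemma subspace_dim1:
  fixes S :: "'a::euclidean_space set"
  assumes "subspace S" "dim S = 1" "v \<in> S" "v \<noteq> 0" "x \<in> S"
  shows "\<exists>r. x = r *\<^sub>R v"
proof -
  have "independent {v}" using assms(4) by simp
  then have "S \<subseteq> span {v}"
    by (intro card_ge_dim_independent) (use assms in auto)
  then show ?thesis using assms(5) by (auto simp: span_singleton)
qed

lemma subspace_dim2:
  fixes S :: "'a::euclidean_space set"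
  assumes "subspace S" "dim S = 2"
  obtains p q where "span {p, q} = S" "p \<noteq> q" "independent {p, q}"
proof -
  obtain B where B: "B \<subseteq> S" "independent B" "S \<subseteq> span B" "card B = dim S"
    using basis_exists by metis
  then obtain p q where "B = {p, q}" "p \<noteq> q" using assms(2) by (auto simp: card_2_iff)
  moreover have "span B = S" using span_minimal[OF B(1) assms(1)] B(3) by blast
  ultimately show thesis using that B(2) by blast
qed

lemma subspace_dim3:
  fixes S :: "'a::euclidean_space set"
  assumes "subspace S" "dim S = 3"
  obtains p q r where "span {p, q, r} = S" "p \<noteq> q" "p \<noteq> r" "q \<noteq> r" "independent {p, q, r}"
proof -
  obtain B where B: "B \<subseteq> S" "independent B" "S \<subseteq> span B" "card B = dim S"
    using basis_exists by metis
  then obtain p q r where "B = {p, q, r}" "p \<noteq> q" "p \<noteq> r" "q \<noteq> r"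
    using assms(2) by (auto simp: card_3_iff)
  moreover have "span B = S" using span_minimal[OF B(1) assms(1)] B(3) by blast
  ultimately show thesis using that B(2) by blast
qed

lemma in_span2: "x \<in> span {p, q} \<longleftrightarrow> (\<exists>a b. x = a *\<^sub>R p + b *\<^sub>R q)"
  by (simp add: span_insert algebra_simps eq_diff_eq)

lemma in_span3: "x \<in> span {p, q, r} \<longleftrightarrow> (\<exists>a b c. x = a *\<^sub>R p + b *\<^sub>R q + c *\<^sub>R r)"
  unfolding span_insert[of p] in_span2 mem_Collect_eq
  by (metis add.assoc diff_add_cancel add.commute add_diff_cancel_left')

lemma lin_trace_span:
  fixes f P :: "'a::euclidean_space \<Rightarrow> 'a"
  assumes "linear f" "linear P" "\<And>x. P (P x) = P x" "range P = span B" "independent B" "finite B"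
    and f: "\<And>b. b \<in> B \<Longrightarrow> f b \<in> span B"
  shows "lin_trace (\<lambda>x. f (P x)) = (\<Sum>b\<in>B. representation B (f b) b)"
proof -
  have P: "P x \<in> span B" for x using assms(4) by blast
  have PB: "P x = x" if "x \<in> span B" for x using that assms(3,4) by (metis rangeE)
  define c where "c b x = representation B (P x) b" for b x
  have lc: "linear (c b)" for b
    unfolding c_def
    by (rule linearI) (simp_all add: linear_add[OF assms(2)] linear_scale[OF assms(2)] P
        representation_add[OF assms(5)] representation_scale[OF assms(5)])
  have "f (P x) = (\<Sum>b\<in>B. c b x *\<^sub>R f b)" for x
  proof -
    have "P x = (\<Sum>b\<in>B. c b x *\<^sub>R b)"
      unfolding c_def by (rule sum_representation_eq[OF assms(5) P assms(6) order_refl, symmetric])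
    then show ?thesis by (simp add: linear_sum[OF assms(1)] linear_scale[OF assms(1)])
  qed
  then have "lin_trace (\<lambda>x. f (P x)) = (\<Sum>b\<in>B. c b (f b))"
    using assms(6) lc by (simp add: lin_trace_sum lin_trace_eq_of_rank_one)
  then show ?thesis using f PB by (simp add: c_def)
qed

lemma lin_trace_span2:
  fixes f P :: "'a::euclidean_space \<Rightarrow> 'a"
  assumes "linear f" "linear P" "\<And>x. P (P x) = P x" "range P = span {p, q}"
    and i: "independent {p, q}" "p \<noteq> q"
    and f: "f p = a *\<^sub>R p + b *\<^sub>R q" "f q = c *\<^sub>R p + d *\<^sub>R q"
  shows "lin_trace (\<lambda>x. f (P x)) = a + d"
proof -
  have "f p \<in> span {p, q}" "f q \<in> span {p, q}" unfolding in_span2 f by blast+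
  then have "lin_trace (\<lambda>x. f (P x)) = (\<Sum>b\<in>{p, q}. representation {p, q} (f b) b)"
    by (intro lin_trace_span) (use assms(1-4) i in auto)
  then show ?thesis using i(2)
    by (simp add: f representation_add[OF i(1)] representation_scale[OF i(1)] span_base span_add
        span_scale representation_basis[OF i(1)])
qed

lemma lin_trace_span3:
  fixes f P :: "'a::euclidean_space \<Rightarrow> 'a"
  assumes "linear f" "linear P" "\<And>x. P (P x) = P x" "range P = span {p, q, r}"
    and i: "independent {p, q, r}" "p \<noteq> q" "p \<noteq> r" "q \<noteq> r"
    and f: "f p = a11 *\<^sub>R p + a21 *\<^sub>R q + a31 *\<^sub>R r" "f q = a12 *\<^sub>R p + a22 *\<^sub>R q + a32 *\<^sub>R r"
      "f r = a13 *\<^sub>R p + a23 *\<^sub>R q + a33 *\<^sub>R r"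
  shows "lin_trace (\<lambda>x. f (P x)) = a11 + a22 + a33"
proof -
  have "f p \<in> span {p, q, r}" "f q \<in> span {p, q, r}" "f r \<in> span {p, q, r}"
    unfolding in_span3 f by blast+
  then have "lin_trace (\<lambda>x. f (P x)) = (\<Sum>b\<in>{p, q, r}. representation {p, q, r} (f b) b)"
    by (intro lin_trace_span) (use assms(1-4) i in auto)
  then show ?thesis using i(2-4)
    by (simp add: f representation_add[OF i(1)] representation_scale[OF i(1)] span_base span_add
        span_scale representation_basis[OF i(1)])
qed

lemma plane_cyclic_vector:
  fixes f P :: "'a::euclidean_space \<Rightarrow> 'a"
  assumes f: "linear f" and P: "linear P" "\<And>x. P (P x) = P x" "\<And>x. P (f x) = f (P x)"
    and dim: "dim (range P) = 2" and tr: "lin_trace (\<lambda>x. f (P x)) = 0"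
    and inj: "\<And>x. P x = x \<Longrightarrow> f x = 0 \<Longrightarrow> x = 0"
  shows "\<exists>u y. y \<noteq> 0 \<and> P u = u \<and> f (f u) = y *\<^sub>R u \<and> range P = span {u, f u}"
proof -
  have iff: "x \<in> range P \<longleftrightarrow> P x = x" for x by (metis P(2) rangeE rangeI)
  obtain p q where pq: "span {p, q} = range P" "p \<noteq> q" "independent {p, q}"
    by (rule subspace_dim2[OF linear_subspace_image[OF P(1) subspace_UNIV] dim])
  have "p \<in> range P" "q \<in> range P" unfolding pq(1)[symmetric] by (auto intro: span_base)
  then have Ppq: "P p = p" "P q = q" by (simp_all add: iff)
  have "f p \<in> span {p, q}" "f q \<in> span {p, q}"
    unfolding pq(1) iff by (simp_all add: P(3) Ppq)
  then obtain a b c d where fpq: "f p = a *\<^sub>R p + b *\<^sub>R q" "f q = c *\<^sub>R p + d *\<^sub>R q"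
    unfolding in_span2 by blast
  have "a + d = 0"
    using lin_trace_span2[OF f P(1,2) pq(1)[symmetric] pq(3,2) fpq] tr by simp
  then have f': "f q = c *\<^sub>R p - a *\<^sub>R q" using fpq(2) by (simp add: add_eq_0_iff)
  have "a \<noteq> 0 \<or> b \<noteq> 0 \<or> c \<noteq> 0"
  proof (rule ccontr)
    assume "\<not> ?thesis"
    then have "p = 0" using fpq(1) inj[OF Ppq(1)] by simp
    then show False using pq(3) dependent_zero by blast
  qed
  then obtain u where u: "f (f u) = (a * a + b * c) *\<^sub>R u" "span {u, f u} = span {p, q}"
    by (rule traceless_plane_cyclic[OF f fpq(1) f'])
  have Pu: "P u = u" unfolding iff[symmetric] pq(1)[symmetric] u(2)[symmetric]
    by (simp add: span_base)
  have "a * a + b * c \<noteq> 0"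
  proof
    assume "a * a + b * c = 0"
    then have "f u = 0" using u(1) inj[of "f u"] by (simp add: P(3) Pu)
    then have "u = 0" using inj[OF Pu] by simp
    then have "range P = {0}" using u(2) pq(1) \<open>f u = 0\<close> by simp
    then show False using dim by simp
  qed
  then show ?thesis using u Pu pq(1) by metis
qed

context fitting
begin

lemma range_dim2:
  assumes "dim (range P) = 2"
  shows "\<exists>u y. y \<noteq> 0 \<and> P u = u \<and> br X (br X u) = y *\<^sub>R u \<and> range P = span {u, br X u}"
  by (rule plane_cyclic_vector[OF linear_br(1) linear_P P_idem P_comm assms trace_P inj])

lemma null_dim1: "dim {x. P x = 0} = 1 \<Longrightarrow> P x = 0 \<Longrightarrow> \<exists>r. x = r *\<^sub>R X"
  using subspace_dim1[OF subspace_null _ _ X_nonzero, of x] by simp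

text \<open>Write \<open>br X Y\<close> as \<open>a X + b Y\<close>. A nonzero \<open>b\<close>
  contradicts nilpotency of \<open>br X\<close> on \<open>Y\<close>; a nonzero \<open>a\<close>
  makes \<open>X\<close> an eigenvector of \<open>br Y\<close> and hence \<open>br X\<close>
  nilpotent by \<open>eigenvector_of_ad_nilpotent\<close>.\<close>

lemma null_dim2:
  assumes "dim {x. P x = 0} = 2"
  shows "\<exists>Y. br X Y = 0 \<and> (\<forall>x. P x = 0 \<longrightarrow> (\<exists>a b. x = a *\<^sub>R X + b *\<^sub>R Y))"
proof -
  have "\<not> {x. P x = 0} \<subseteq> span {X}"
  proof
    assume "{x. P x = 0} \<subseteq> span {X}"
    then have "dim {x. P x = 0} \<le> card {X}" by (rule dim_le_card) simp
    then show False using assms by simp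
  qed
  then obtain Y where Y: "P Y = 0" "Y \<notin> span {X}" by blast
  have "independent {Y, X}" using Y(2) X_nonzero by (simp add: independent_insert)
  moreover have "Y \<noteq> X" using Y(2) span_base[of X "{X}"] by auto
  ultimately have "{x. P x = 0} \<subseteq> span {Y, X}"
    by (intro card_ge_dim_independent) (use Y assms in auto)
  then have sp: "\<exists>a b. x = a *\<^sub>R X + b *\<^sub>R Y" if "P x = 0" for x
  proof -
    have "x \<in> span {Y, X}" using \<open>{x. P x = 0} \<subseteq> span {Y, X}\<close> that by blast
    then show ?thesis unfolding in_span2 by (metis add.commute)
  qed
  have "P (br X Y) = 0" using P_br_null Y by simp
  then obtain a b where ab: "br X Y = a *\<^sub>R X + b *\<^sub>R Y" using sp by blast
  have b: "b = 0"
  proof (rule ccontr)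
    assume b: "b \<noteq> 0"
    have it: "(br X ^^ Suc k) Y = b ^ k *\<^sub>R (a *\<^sub>R X + b *\<^sub>R Y)" for k
      by (induction k) (simp_all add: ab)
    obtain k where k: "(br X ^^ k) Y = 0" using null_nil[OF Y(1)] by blast
    have "(br X ^^ Suc k) Y = 0" using k by simp
    then have "a *\<^sub>R X + b *\<^sub>R Y = 0" unfolding it using b by simp
    then have "b *\<^sub>R Y = (- a) *\<^sub>R X" by (simp add: add_eq_0_iff)
    then have "(1 / b) *\<^sub>R (b *\<^sub>R Y) = (1 / b) *\<^sub>R ((- a) *\<^sub>R X)" by simp
    then have "Y = (- a / b) *\<^sub>R X" using b by simp
    then show False using Y(2) span_scale[OF span_base[of X "{X}"], of "- a / b"] by simp
  qed
  have "a = 0"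
  proof (rule ccontr)
    assume a: "a \<noteq> 0"
    have "br Y (br X x) - br X (br Y x) = (- a) *\<^sub>R br X x" for x
      using jacobi[of Y X x] br_skew[of Y X] by (simp add: ab b)
    then have "\<exists>n. \<forall>x. (br X ^^ n) x = 0"
      using eigenvector_of_ad_nilpotent[OF linear_br(1) linear_br(1), of Y X "- a"] a by simp
    then show False using not_nil unfolding ad_nilpotent_def by blast
  qed
  then show ?thesis using sp ab b by (intro exI[of _ Y]) simp
qed

text \<open>The null part of the bracket, followed by a linear functional, is an alternating form on
  a 3-space that is invariant under the traceless operator \<open>br X\<close>. A volume form turns
  it into a vector annihilated by \<open>br X\<close>, which is zero by injectivity.\<close>

lemma bracket_in_range:
  assumes d: "dim (range P) = 3" and null: "\<And>x. P x = 0 \<Longrightarrow> br X x = 0"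
    and xy: "P x = x" "P y = y"
  shows "P (br x y) = br x y"
proof -
  obtain p q r where pqr: "span {p, q, r} = range P" "p \<noteq> q" "p \<noteq> r" "q \<noteq> r" "independent {p, q, r}"
    by (rule subspace_dim3[OF subspace_range d])
  have "p \<in> range P" "q \<in> range P" "r \<in> range P"
    unfolding pqr(1)[symmetric] by (auto intro: span_base)
  then have Pp: "P p = p" "P q = q" "P r = r" by (simp_all add: range_P_iff)
  have "br X p \<in> span {p, q, r}" "br X q \<in> span {p, q, r}" "br X r \<in> span {p, q, r}"
    unfolding pqr(1) range_P_iff by (simp_all add: P_comm Pp)
  then obtain a11 a21 a31 a12 a22 a32 a13 a23 a33 where
    f: "br X p = a11 *\<^sub>R p + a21 *\<^sub>R q + a31 *\<^sub>R r" "br X q = a12 *\<^sub>R p + a22 *\<^sub>R q + a32 *\<^sub>R r"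
      "br X r = a13 *\<^sub>R p + a23 *\<^sub>R q + a33 *\<^sub>R r"
    unfolding in_span3 by blast
  have tr: "a11 + a22 + a33 = 0"
    using lin_trace_span3[OF linear_br(1) linear_P P_idem pqr(1)[symmetric] pqr(5,2-4) f] trace_P by simp
  define Q where "Q z = z - P z" for z
  have lQ: "linear Q" unfolding Q_def by (rule linearI) (simp_all add: algebra_simps)
  have QX: "Q (br X z) = 0" for z
  proof -
    have "Q (br X z) = br X (z - P z)" by (simp add: Q_def P_comm)
    then show ?thesis using null[of "z - P z"] by simp
  qed
  have eq: "Q (br (br X u) v) + Q (br u (br X v)) = 0" for u v
    using QX[of "br u v"] unfolding jacobi[of X u v] by (simp add: linear_add[OF lQ])
  have "Q (br p q) = 0 \<and> Q (br p r) = 0 \<and> Q (br q r) = 0"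
  proof -
    have "inner (Q (br p q)) b = 0 \<and> inner (Q (br p r)) b = 0 \<and> inner (Q (br q r)) b = 0" for b
    proof -
      \<comment> \<open>The coordinates in \<open>p, q, r\<close> of the vector dual to the
        alternating form.\<close>
      define l1 l2 l3 where l: "l1 = inner (Q (br q r)) b" "l2 = - inner (Q (br p r)) b"
        "l3 = inner (Q (br p q)) b"
      note Qs = linear_add[OF lQ] linear_diff[OF lQ] linear_scale[OF lQ] linear_neg[OF lQ] linear_0[OF lQ]
      have "inner (Q (br (br X p) q) + Q (br p (br X q))) b = 0"
        "inner (Q (br (br X p) r) + Q (br p (br X r))) b = 0"
        "inner (Q (br (br X q) r) + Q (br q (br X r))) b = 0"
        by (simp_all only: eq inner_zero_left)
      then have "(a11 + a22) * l3 - a31 * l1 - a32 * l2 = 0"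
        "- (a11 + a33) * l2 + a21 * l1 + a23 * l3 = 0" "(a22 + a33) * l1 - a12 * l2 - a13 * l3 = 0"
        unfolding f by (simp_all add: Qs inner_add_left l br_skew[of q p] br_skew[of r p] br_skew[of r q]
          algebra_simps)
      then have z: "a31 * l1 + a32 * l2 + a33 * l3 = 0" "a21 * l1 + a22 * l2 + a23 * l3 = 0"
        "a11 * l1 + a12 * l2 + a13 * l3 = 0"
        using tr by algebra+
      have "br X (l1 *\<^sub>R p + l2 *\<^sub>R q + l3 *\<^sub>R r)
        = (a11 * l1 + a12 * l2 + a13 * l3) *\<^sub>R p + (a21 * l1 + a22 * l2 + a23 * l3) *\<^sub>R q
          + (a31 * l1 + a32 * l2 + a33 * l3) *\<^sub>R r"
        by (simp add: f algebra_simps)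
      then have "br X (l1 *\<^sub>R p + l2 *\<^sub>R q + l3 *\<^sub>R r) = 0" by (simp add: z)
      then have "l1 *\<^sub>R p + l2 *\<^sub>R q + l3 *\<^sub>R r = 0"
        using inj[of "l1 *\<^sub>R p + l2 *\<^sub>R q + l3 *\<^sub>R r"] by (simp add: Pp)
      then have "(\<Sum>v\<in>{p,q,r}. (if v = p then l1 else if v = q then l2 else l3) *\<^sub>R v) = 0"
        using pqr(2-4) by (simp add: add.assoc)
      then have "\<forall>v\<in>{p,q,r}. (if v = p then l1 else if v = q then l2 else l3) = 0"
        by (rule independent_explicit[THEN iffD1, OF pqr(5), THEN conjunct2, THEN spec, THEN mp])
      then have "l1 = 0" "l2 = 0" "l3 = 0" using pqr(2-4) by auto
      then show ?thesis by (simp add: l)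
    qed
    then show ?thesis by (metis inner_eq_zero_iff)
  qed
  note Q0 = this
  obtain a b c where x: "x = a *\<^sub>R p + b *\<^sub>R q + c *\<^sub>R r"
    using xy(1) in_span3[of x p q r] unfolding pqr(1) range_P_iff by blast
  obtain a' b' c' where y: "y = a' *\<^sub>R p + b' *\<^sub>R q + c' *\<^sub>R r"
    using xy(2) in_span3[of y p q r] unfolding pqr(1) range_P_iff by blast
  have "Q (br x y) = 0"
    unfolding x y using Q0
    by (simp add: linear_add[OF lQ] linear_diff[OF lQ] linear_scale[OF lQ] linear_neg[OF lQ] linear_0[OF lQ]
        br_skew[of q p] br_skew[of r p] br_skew[of r q])
  then show ?thesis by (simp add: Q_def)
qed

lemma dim_range_le: "dim (range P) < DIM('a)"
proof -
  have "X \<in> {x. P x = 0}" by simp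
  then have "dim {x. P x = 0} \<noteq> 0" using X_nonzero by (metis dim_eq_0 singletonD subsetD)
  then show ?thesis using dim_null_range by linarith
qed

lemma perfect_span:
  assumes "perfect br" "\<And>x y. br x y \<in> S" "subspace S"
  shows "S = UNIV"
proof -
  have "span {br x y | x y. True} \<subseteq> S" by (rule span_minimal) (use assms in auto)
  then show ?thesis using assms(1) by (auto simp: perfect_def)
qed

lemma bracket_abelian_null:
  assumes "\<And>x y. P x = 0 \<Longrightarrow> P y = 0 \<Longrightarrow> br x y = 0" "subspace S" "range P \<subseteq> S"
    and "\<And>x y. P x = x \<Longrightarrow> P y = y \<Longrightarrow> br x y \<in> S"
  shows "br x y \<in> S"
proof -
  obtain a b where x: "x = a + b" "P a = 0" "P b = b" by (rule decompose)
  obtain c d where y: "y = c + d" "P c = 0" "P d = d" by (rule decompose)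
  have "br a d \<in> range P" "br c b \<in> range P"
    unfolding range_P_iff using P_br_mixed x y by blast+
  then have "br a d \<in> S" "- br c b \<in> S" "br b d \<in> S"
    using assms x y subspace_neg by blast+
  then have "br a d + - br c b + br b d \<in> S" using assms(2) by (intro subspace_add)
  moreover have "br x y = br a d + - br c b + br b d"
    unfolding x(1) y(1) using assms(1)[OF x(2) y(2)] br_skew[of b c] by simp
  ultimately show ?thesis by simp
qed

text \<open>The null component is abelian in both dimensions and brackets within the range stay
  there, so all brackets would lie in the proper subspace \<open>range P\<close>.\<close>

lemma dim_range_neq_3:
  assumes "perfect br" "DIM('a) = 4 \<or> DIM('a) = 5"
  shows "dim (range P) \<noteq> 3"
proof
  assume d: "dim (range P) = 3"
  have ab: "br x y = 0" if xy: "P x = 0" "P y = 0" for x y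
  proof (cases "DIM('a) = 4")
    case True
    then have "dim {x. P x = 0} = 1" using dim_null_range d by simp
    then obtain r s where "x = r *\<^sub>R X" "y = s *\<^sub>R X" using null_dim1 xy by metis
    then show ?thesis by simp
  next
    case False
    then have "dim {x. P x = 0} = 2" using dim_null_range d assms(2) by simp
    then obtain Y where Y: "br X Y = 0" "\<forall>x. P x = 0 \<longrightarrow> (\<exists>a b. x = a *\<^sub>R X + b *\<^sub>R Y)"
      using null_dim2 by blast
    obtain a b where "x = a *\<^sub>R X + b *\<^sub>R Y" using Y(2) xy(1) by blast
    moreover obtain c d where "y = c *\<^sub>R X + d *\<^sub>R Y" using Y(2) xy(2) by blast
    ultimately show ?thesis using Y(1) br_skew[of Y X] by simp
  qed
  have "range P = UNIV"
  proof (rule perfect_span[OF assms(1) bracket_abelian_null[OF ab subspace_range order_refl] subspace_range])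
    show "br x y \<in> range P" if "P x = x" "P y = y" for x y
      unfolding range_P_iff by (rule bracket_in_range[OF d _ that]) (use ab[OF P_X] in auto)
  qed
  then show False using dim_range_le by (simp add: dim_UNIV)
qed

text \<open>The null component being abelian, all brackets lie in the span of the range and of the
  single bracket \<open>br u (br X u)\<close>, of dimension at most 3.\<close>

lemma dim_range_neq_2_dim4:
  assumes "perfect br" "DIM('a) = 4"
  shows "dim (range P) \<noteq> 2"
proof
  assume d: "dim (range P) = 2"
  obtain u y where u: "P u = u" "range P = span {u, br X u}" using range_dim2[OF d] by blast
  define S where "S = span {u, br X u, br u (br X u)}"
  have S: "subspace S" "u \<in> S" "br X u \<in> S" "br u (br X u) \<in> S"
    unfolding S_def by (auto intro: span_base)
  have "dim {x. P x = 0} = 2" using dim_null_range d assms(2) by simp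
  then obtain Y where Y: "br X Y = 0" "\<forall>x. P x = 0 \<longrightarrow> (\<exists>a b. x = a *\<^sub>R X + b *\<^sub>R Y)"
    using null_dim2 by blast
  have ab: "br x y = 0" if xy: "P x = 0" "P y = 0" for x y
  proof -
    obtain a b where "x = a *\<^sub>R X + b *\<^sub>R Y" using Y(2) xy(1) by blast
    moreover obtain c d where "y = c *\<^sub>R X + d *\<^sub>R Y" using Y(2) xy(2) by blast
    ultimately show ?thesis using Y(1) br_skew[of Y X] by simp
  qed
  have "S = UNIV"
  proof (rule perfect_span[OF assms(1) bracket_abelian_null[OF ab S(1)] S(1)])
    show "range P \<subseteq> S" unfolding u(2) by (rule span_minimal) (use S in auto)
    show "br x y \<in> S" if "P x = x" "P y = y" for x y
    proof -
      have "x \<in> span {u, br X u}" "y \<in> span {u, br X u}"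
        unfolding u(2)[symmetric] range_P_iff using that by simp_all
      then obtain a b c d where "x = a *\<^sub>R u + b *\<^sub>R br X u" "y = c *\<^sub>R u + d *\<^sub>R br X u"
        unfolding in_span2 by blast
      then have "br x y = (a * d - b * c) *\<^sub>R br u (br X u)"
        by (simp add: br_skew[of "br X u" u] algebra_simps)
      then show ?thesis using S by (simp add: subspace_scale)
    qed
  qed
  moreover have "dim S \<le> 3"
    unfolding S_def dim_span by (rule order_trans[OF dim_le_card']) (auto simp: card_insert_if)
  ultimately show False using assms(2) by (simp add: dim_UNIV)
qed

text \<open>The null component acts on the plane by commuting operators, so its derived algebra
  \<open>M\<close> kills the plane and hence also \<open>w\<close>. Perfectness makes the null
  component the sum of \<open>M\<close> and the line of \<open>w\<close>, so \<open>M\<close> equals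
  its own derived algebra. As \<open>X\<close> is outside \<open>M\<close>, \<open>M\<close> has
  dimension at most 2, hence is zero, and a 3-dimensional space would be spanned by
  \<open>w\<close>.\<close>

lemma dim_range_neq_2_dim5:
  assumes "perfect br" "DIM('a) = 5"
  shows "dim (range P) \<noteq> 2"
proof
  assume d: "dim (range P) = 2"
  obtain u y where y: "y \<noteq> 0" and u: "P u = u" "br X (br X u) = y *\<^sub>R u" "range P = span {u, br X u}"
    using range_dim2[OF d] by blast
  define v where "v = br X u"
  have v: "br X u = v" "br X v = y *\<^sub>R u" "P v = v"
    using u by (simp_all add: v_def P_comm)
  have Ps: "\<exists>a b. x = a *\<^sub>R u + b *\<^sub>R v" if "P x = x" for x
    using that u(3) in_span2[of x u v] by (simp add: v_def flip: range_P_iff)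
  have ind: "a = 0 \<and> b = 0" if e: "a *\<^sub>R u + b *\<^sub>R v = 0" for a b
  proof -
    have ne: "u \<noteq> v \<and> independent {u, v}"
    proof -
      have "card {u, v} \<le> dim (range P)" using d by (simp add: card_insert_if)
      then have "independent {u, v}"
        by (intro card_le_dim_spanning[of _ "range P"])
          (use u(3) in \<open>auto simp: v_def span_base\<close>)
      moreover have "u \<noteq> v"
      proof
        assume "u = v"
        then have "range P \<subseteq> span {u}" using u(3) by (simp add: v_def)
        then have "dim (range P) \<le> card {u}" by (rule dim_le_card) simp
        then show False using d by simp
      qed
      ultimately show ?thesis by simp
    qed
    have "v \<noteq> u" using ne by blast
    then have "(\<Sum>z\<in>{u, v}. (if z = u then a else b) *\<^sub>R z) = 0" using e by simp
    then have "\<forall>z\<in>{u, v}. (if z = u then a else b) = 0"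
      by (rule independent_explicit[THEN iffD1, OF conjunct2[OF ne], THEN conjunct2, THEN spec, THEN mp])
    then show ?thesis using ne by auto
  qed
  \<comment> \<open>\<open>ad X\<close> is semisimple on \<open>span {u, v}\<close>, so the null component, on which it is nilpotent, acts
    on \<open>span {u, v}\<close> by operators commuting with it, that is, by \<open>p + q (ad X)\<close>.\<close>
  have act: "\<exists>p q. br z u = p *\<^sub>R u + q *\<^sub>R v \<and> br z v = (q * y) *\<^sub>R u + p *\<^sub>R v" if z: "P z = 0" for z
  proof -
    obtain k where "(br X ^^ k) z = 0" using null_nil[OF z] by blast
    then show ?thesis using z
    proof (induction k arbitrary: z)
      case 0
      then show ?case by (intro exI[of _ 0]) simp
    next
      case (Suc k)
      obtain p q where pq: "br z u = p *\<^sub>R u + q *\<^sub>R v" using Ps P_br_mixed[OF Suc.prems(2) u(1)] by metis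
      obtain r s where rs: "br z v = r *\<^sub>R u + s *\<^sub>R v" using Ps P_br_mixed[OF Suc.prems(2) v(3)] by metis
      obtain p' q' where pq': "br (br X z) u = p' *\<^sub>R u + q' *\<^sub>R v"
        "br (br X z) v = (q' * y) *\<^sub>R u + p' *\<^sub>R v"
        using Suc.IH[of "br X z"] Suc.prems by (auto simp: funpow_swap1 P_comm)
      have "br (br X z) u = br X (br z u) - br z (br X u)"
        "br (br X z) v = br X (br z v) - br z (br X v)"
        using jacobi[of X z u] jacobi[of X z v] by (simp_all add: algebra_simps)
      then have "(p' - (q * y - r)) *\<^sub>R u + (q' - (p - s)) *\<^sub>R v = 0"
        "(q' * y - (s * y - y * p)) *\<^sub>R u + (p' - (r - y * q)) *\<^sub>R v = 0"
        unfolding pq' by (simp_all add: pq rs v algebra_simps)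
      then have "p' = q * y - r" "q' = p - s" "q' * y = s * y - y * p" "p' = r - y * q"
        using ind by fastforce+
      then have "r = q * y" "(p - s) * y = 0" by algebra+
      then have "r = q * y" "s = p" using y by simp_all
      then show ?case using pq rs by blast
    qed
  qed
  define w where "w = br u v"
  have "br X w = 0" using jacobi[of X u v] by (simp add: v w_def)
  then have Pw: "P w = 0" by (rule P_of_zero)
  define M where "M = span {br a b | a b. P a = 0 \<and> P b = 0}"
  have M_sub: "subspace M" by (simp add: M_def)
  have M_base: "br a b \<in> M" if "P a = 0" "P b = 0" for a b
    unfolding M_def by (rule span_base) (use that in blast)
  have MP: "P m = 0 \<and> br m u = 0 \<and> br m v = 0" if "m \<in> M" for m
    using that unfolding M_def
  proof (induction rule: span_induct_alt)
    case (step c x z)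
    then obtain a b where ab: "x = br a b" "P a = 0" "P b = 0" by blast
    obtain p q where 1: "br a u = p *\<^sub>R u + q *\<^sub>R v" "br a v = (q * y) *\<^sub>R u + p *\<^sub>R v" using act[OF ab(2)] by blast
    obtain r s where 2: "br b u = r *\<^sub>R u + s *\<^sub>R v" "br b v = (s * y) *\<^sub>R u + r *\<^sub>R v" using act[OF ab(3)] by blast
    have "br x u = 0" "br x v = 0"
      using jacobi[of a b u] jacobi[of a b v] unfolding ab(1) by (simp_all add: 1 2 algebra_simps)
    then show ?case using step P_br_null[OF ab(2,3)] ab(1) by simp
  qed simp
  have Mw: "br m w = 0" if "m \<in> M" for m
    using jacobi[of m u v] MP[OF that] by (simp add: w_def)
  have "{a + b | a b. a \<in> span (insert w M) \<and> b \<in> range P} = UNIV"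
  proof (rule perfect_span[OF assms(1)])
    show sub: "subspace {a + b | a b. a \<in> span (insert w M) \<and> b \<in> range P}"
      by (rule subspace_sums[OF subspace_span subspace_range])
    fix s t
    obtain a b where s: "s = a + b" "P a = 0" "P b = b" by (rule decompose)
    obtain c d where t: "t = c + d" "P c = 0" "P d = d" by (rule decompose)
    obtain b1 b2 where b: "b = b1 *\<^sub>R u + b2 *\<^sub>R v" using Ps s(3) by blast
    obtain d1 d2 where d: "d = d1 *\<^sub>R u + d2 *\<^sub>R v" using Ps t(3) by blast
    have bd: "br b d = (b1 * d2 - b2 * d1) *\<^sub>R w"
      unfolding b d by (simp add: w_def br_skew[of v u] algebra_simps)
    have "br s t = (br a c + br b d) + (br a d - br c b)"
      unfolding s(1) t(1) by (simp add: br_skew[of b c])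
    moreover have "br a d - br c b \<in> range P"
      unfolding range_P_iff using P_br_mixed s t by simp
    moreover have "br a c + br b d \<in> span (insert w M)"
      unfolding bd by (intro span_add span_scale span_base) (use M_base s t in auto)
    ultimately show "br s t \<in> {a + b | a b. a \<in> span (insert w M) \<and> b \<in> range P}" by blast
  qed
  then have N0: "\<exists>m\<in>M. \<exists>r. z = m + r *\<^sub>R w" if z: "P z = 0" for z
  proof -
    obtain a b where ab: "z = a + b" "a \<in> span (insert w M)" "b \<in> range P"
      using \<open>_ = UNIV\<close> by blast
    obtain m r where m: "m \<in> M" "a = m + r *\<^sub>R w"
      using mem_span_insert_subspace[OF M_sub ab(2)] by blast
    have "b = 0" using z ab(1,3) MP[OF m(1)] Pw by (simp add: m(2) range_P_iff)
    then show ?thesis using m ab(1) by auto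
  qed
  have MM: "M \<subseteq> span {br m n | m n. m \<in> M \<and> n \<in> M}"
    unfolding M_def
  proof (rule span_minimal, safe)
    fix a b assume "P a = 0" "P b = 0"
    then obtain m r n s where mn: "m \<in> M" "a = m + r *\<^sub>R w" "n \<in> M" "b = n + s *\<^sub>R w" using N0 by metis
    have "br a b = br m n"
      unfolding mn(2,4) using Mw[OF mn(1)] Mw[OF mn(3)] br_skew[of w n] by simp
    then show "br a b \<in> span {br m n | m n. m \<in> span {br a b | a b. P a = 0 \<and> P b = 0} \<and>
        n \<in> span {br a b | a b. P a = 0 \<and> P b = 0}}"
      using mn(1,3) unfolding M_def by (auto intro: span_base)
  qed
  have dimN: "dim {x. P x = 0} = 3" using dim_null_range d assms(2) by simp
  have XM: "X \<notin> M"
  proof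
    assume "X \<in> M"
    then have "v = 0" using MP v(1) by metis
    then show False using ind[of 0 1] by simp
  qed
  have "M \<subset> {x. P x = 0}" using MP XM by auto
  then have "dim M < 3" using subspace_dim_psubset[OF M_sub subspace_null] dimN by simp
  have "\<exists>r. M \<subseteq> span {r}"
  proof (cases "dim M = 2")
    case True
    then obtain p q where pq: "span {p, q} = M" using subspace_dim2[OF M_sub] by blast
    have "{br m n | m n. m \<in> M \<and> n \<in> M} \<subseteq> span {br p q}"
    proof safe
      fix m n assume "m \<in> M" "n \<in> M"
      then obtain a b c d where "m = a *\<^sub>R p + b *\<^sub>R q" "n = c *\<^sub>R p + d *\<^sub>R q"
        unfolding pq[symmetric] in_span2 by blast
      then have "br m n = (a * d - b * c) *\<^sub>R br p q"
        by (simp add: br_skew[of q p] algebra_simps)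
      then show "br m n \<in> span {br p q}" by (simp add: span_base span_scale)
    qed
    then show ?thesis using MM span_minimal[of _ "span {br p q}"] by (meson order_trans subspace_span)
  next
    case False
    then have le: "dim M \<le> 1" using \<open>dim M < 3\<close> by simp
    show ?thesis
    proof (cases "M = {0}")
      case False
      then obtain r where r: "r \<in> M" "r \<noteq> 0" using subspace_0[OF M_sub] by blast
      have "dim M \<noteq> 0" using r by auto
      then have "dim M = 1" using le by linarith
      then have "\<exists>s. x = s *\<^sub>R r" if "x \<in> M" for x
        using subspace_dim1[OF M_sub _ r that] by blast
      then have "M \<subseteq> span {r}" by (auto simp: span_singleton)
      then show ?thesis by blast
    qed (auto intro: span_zero)
  qed
  then obtain r where r: "M \<subseteq> span {r}" by blast
  have "{br m n | m n. m \<in> M \<and> n \<in> M} \<subseteq> {0}"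
  proof safe
    fix m n assume "m \<in> M" "n \<in> M"
    then have "m \<in> span {r}" "n \<in> span {r}" using r by blast+
    then obtain a b where "m = a *\<^sub>R r" "n = b *\<^sub>R r" unfolding span_singleton by blast
    then show "br m n = 0" by simp
  qed
  then have M0: "M \<subseteq> {0}"
    using MM span_minimal[of _ "{0::'a}"] by (meson order_trans subspace_single_0)
  have "{x. P x = 0} \<subseteq> span {w}"
  proof safe
    fix x assume "P x = 0"
    then obtain m s where "m \<in> M" "x = m + s *\<^sub>R w" using N0 by blast
    moreover have "m = 0" using \<open>m \<in> M\<close> M0 by blast
    ultimately show "x \<in> span {w}" by (simp add: span_base span_scale)
  qed
  then have "dim {x. P x = 0} \<le> card {w}" by (rule dim_le_card) simp
  then show False using dimN by simp
qed

end

lemma (in unimodular_lie) not_perfect_dim4: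
  assumes "DIM('a) = 4"
  shows "\<not> perfect br"
proof
  assume p: "perfect br"
  obtain X where "\<not> ad_nilpotent X" using perfect_not_ad_nilpotent[OF p] by blast
  then obtain P where "fitting br X P" using fitting_exists by blast
  then interpret fitting br X P .
  show False
    using dim_range_neq_0 dim_range_neq_1 dim_range_neq_2_dim4[OF p assms] dim_range_neq_3[OF p]
      dim_range_le assms by linarith
qed

lemma (in unimodular_lie) perfect_dim5:
  assumes "DIM('a) = 5" "perfect br"
  shows "\<exists>X P. fitting br X P \<and> dim (range P) = 4"
proof -
  obtain X where "\<not> ad_nilpotent X" using perfect_not_ad_nilpotent[OF assms(2)] by blast
  then obtain P where f: "fitting br X P" using fitting_exists by blast
  then interpret fitting br X P .
  have "dim (range P) = 4"
    using dim_range_neq_0 dim_range_neq_1 dim_range_neq_2_dim5[OF assms(2,1)] dim_range_neq_3[OF assms(2)]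
      dim_range_le assms by linarith
  then show ?thesis using f by blast
qed

text \<open>In the perfect case \<open>x\<close> has a Fitting range of dimension 2, and
  \<open>br u v\<close> commutes with \<open>x\<close>, hence is a multiple of it. Otherwise
  unimodularity makes a 2-dimensional ideal abelian and the complement act on it without trace;
  \<open>u\<close> is a cyclic vector of that action.\<close>

lemma (in unimodular_lie) dim3_structure:
  assumes dim: "DIM('a) = 3"
  shows "(\<forall>x y. br x y = 0) \<or> (\<exists>x u v y c. span {x,u,v} = UNIV \<and> br x u = v \<and> br x v = y *\<^sub>R u \<and>
    br u v = c *\<^sub>R x \<and> (c = 0 \<or> y \<noteq> 0))"
proof (cases "perfect br")
  case True
  obtain X where "\<not> ad_nilpotent X" using perfect_not_ad_nilpotent[OF True] by blast
  then obtain P where "fitting br X P" using fitting_exists by blast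
  then interpret fitting br X P .
  have d: "dim (range P) = 2" using dim_range_neq_0 dim_range_neq_1 dim_range_le dim by linarith
  then have d0: "dim {x. P x = 0} = 1" using dim_null_range dim by simp
  obtain u y where y: "y \<noteq> 0" and u: "P u = u" "br X (br X u) = y *\<^sub>R u" "range P = span {u, br X u}"
    using range_dim2[OF d] by blast
  have "br X (br u (br X u)) = 0" using jacobi[of X u "br X u"] u(2) by simp
  then obtain c where c: "br u (br X u) = c *\<^sub>R X" using null_dim1[OF d0 P_of_zero] by blast
  have "span {X, u, br X u} = UNIV"
  proof -
    have "x \<in> span {X, u, br X u}" for x
    proof -
      obtain a b where x: "x = a + b" "P a = 0" "P b = b" by (rule decompose)
      have "b \<in> span {u, br X u}" using u(3) x(3) range_P_iff by blast
      moreover obtain r where "a = r *\<^sub>R X" using null_dim1[OF d0 x(2)] by blast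
      ultimately show ?thesis unfolding x(1) in_span2 in_span3 by (metis add.assoc)
    qed
    then show ?thesis by blast
  qed
  then show ?thesis using y u(2) c by blast
next
  case False
  then obtain h t where h: "lie_ideal br h" "dim h = DIM('a) - 1" "t \<notin> h"
    "\<And>x y. br x y \<in> h" "\<And>x. \<exists>r. x - r *\<^sub>R t \<in> h"
    by (rule not_perfect_ideal) auto
  have "subspace h" "dim h = 2" using h(1,2) dim by (simp_all add: lie_ideal_def)
  then obtain p q where pq: "span {p, q} = h" by (rule subspace_dim2)
  have ex: "\<exists>a b. x = a *\<^sub>R p + b *\<^sub>R q" if "x \<in> h" for x using that pq in_span2 by blast
  have sp: "span {t, p, q} = UNIV"
  proof -
    have "x \<in> span {t, p, q}" for x
    proof -
      obtain r where "x - r *\<^sub>R t \<in> h" using h(5) by blast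
      then show ?thesis unfolding span_insert[of t] pq by blast
    qed
    then show ?thesis by blast
  qed
  obtain a b where pqb: "br p q = a *\<^sub>R p + b *\<^sub>R q" using ex h(4) by blast
  obtain a1 b1 where tp: "br t p = a1 *\<^sub>R p + b1 *\<^sub>R q" using ex h(4) by blast
  obtain a2 b2 where tq: "br t q = a2 *\<^sub>R p + b2 *\<^sub>R q" using ex h(4) by blast
  have ab: "a = 0 \<and> b = 0 \<and> b2 = - a1"
  proof (rule frame3E[OF dim sp])
    fix c1 c2 c3 :: "'a \<Rightarrow> real"
    assume l: "linear c1" "linear c2" "linear c3"
    assume d: "c1 p = 0" "c1 q = 0" "c2 p = 1" "c2 q = 0" "c3 p = 0" "c3 q = 1"
    assume tr: "\<And>f. linear f \<Longrightarrow> lin_trace f = c1 (f t) + c2 (f p) + c3 (f q)"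
    note ls = l[THEN linear_add] l[THEN linear_scale] l[THEN linear_neg] l[THEN linear_diff]
      l[THEN linear_0]
    show ?thesis
      using tr[OF linear_br(1), of p] tr[OF linear_br(1), of q] tr[OF linear_br(1), of t]
      by (simp add: trace_br br_skew[of p t] br_skew[of q t] br_skew[of q p] pqb tp tq ls d)
  qed
  show ?thesis
  proof (cases "a1 \<noteq> 0 \<or> b1 \<noteq> 0 \<or> a2 \<noteq> 0")
    case True
    have tq': "br t q = a2 *\<^sub>R p - a1 *\<^sub>R q" using tq ab by simp
    obtain u where u: "br t (br t u) = (a1 * a1 + b1 * a2) *\<^sub>R u" "span {u, br t u} = span {p, q}"
      by (rule traceless_plane_cyclic[OF linear_br(1) tp tq' True])
    have "u \<in> span {p, q}" "br t u \<in> span {p, q}" unfolding u(2)[symmetric] by (auto intro: span_base)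
    then obtain r s r' s' where "u = r *\<^sub>R p + s *\<^sub>R q" "br t u = r' *\<^sub>R p + s' *\<^sub>R q"
      unfolding in_span2 by blast
    moreover have "br p q = 0" using pqb ab by simp
    ultimately have "br u (br t u) = 0 *\<^sub>R t" using br_skew[of q p] by simp
    moreover have "span {t, u, br t u} = UNIV"
      using sp unfolding span_insert[of t] u(2) .
    ultimately show ?thesis using u(1) by blast
  next
    case False
    have "br x y = 0" for x y
    proof -
      have "x \<in> span {t, p, q}" "y \<in> span {t, p, q}" using sp by simp_all
      then obtain r s k r' s' k' where "x = r *\<^sub>R t + s *\<^sub>R p + k *\<^sub>R q" "y = r' *\<^sub>R t + s' *\<^sub>R p + k' *\<^sub>R q"
        unfolding in_span3 by blast
      then show ?thesis using pqb tp tq ab False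
        by (simp add: br_skew[of p t] br_skew[of q t] br_skew[of q p])
    qed
    then show ?thesis by blast
  qed
qed

section \<open>Perfect algebras of dimension five\<close>

text \<open>Transports the restriction of \<open>f\<close> to \<open>real^4\<close>; the traces of
  its powers agree with those on the range by cyclicity.\<close>

lemma cayley_hamilton_range4:
  fixes f P :: "'a::euclidean_space \<Rightarrow> 'a"
  assumes f: "linear f" and P: "linear P" "\<And>x. P (P x) = P x" "\<And>x. P (f x) = f (P x)"
    and dim: "dim (range P) = 4" and tr: "lin_trace (\<lambda>x. f (P x)) = 0"
  shows "\<exists>q. \<forall>x. P x = x \<longrightarrow> f (f (f (f x))) = (lin_trace (\<lambda>x. f (f (P x))) / 2) *\<^sub>R f (f x)
    + (lin_trace (\<lambda>x. f (f (f (P x)))) / 3) *\<^sub>R f x + q *\<^sub>R x"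
proof -
  have iff: "x \<in> range P \<longleftrightarrow> P x = x" for x by (metis P(2) rangeE rangeI)
  have sub: "subspace (range P)" by (rule linear_subspace_image[OF P(1) subspace_UNIV])
  obtain \<sigma> :: "real^4 \<Rightarrow> 'a" and g where sg: "linear \<sigma>" "linear g" "\<sigma> ` UNIV = range P"
    "\<And>x. g (\<sigma> x) = x" "\<And>x. x \<in> range P \<Longrightarrow> \<sigma> (g x) = x"
    by (rule isometries_subspaces[of "UNIV :: (real^4) set" "range P"]) (use sub dim in auto)
  have Ps: "P (\<sigma> y) = \<sigma> y" for y using sg(3) iff by blast
  have sgP: "\<sigma> (g x) = x" if "P x = x" for x using sg(5) that iff by blast
  define A where "A y = g (f (\<sigma> y))" for y
  have lA: "linear A" unfolding A_def using linear_comp_frame[OF sg(2) linear_comp_frame[OF f sg(1)]] .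
  have sA: "\<sigma> (A y) = f (\<sigma> y)" for y unfolding A_def by (rule sgP) (simp add: P(3) Ps)
  have trace: "lin_trace (\<lambda>y. g (F (\<sigma> y))) = lin_trace (\<lambda>x. F (P x))"
    if F: "linear F" "\<And>x. P (F x) = F (P x)" for F
  proof -
    have l: "linear (\<lambda>x. g (F (P x)))"
      by (rule linear_comp_frame[OF sg(2) linear_comp_frame[OF F(1) P(1)]])
    have "lin_trace (\<lambda>y. g (F (\<sigma> y))) = lin_trace (\<lambda>y. g (F (P (\<sigma> y))))" by (simp add: Ps)
    also have "\<dots> = lin_trace (\<lambda>x. \<sigma> (g (F (P x))))"
      by (rule lin_trace_comm[OF sg(1) l])
    also have "(\<lambda>x. \<sigma> (g (F (P x)))) = (\<lambda>x. F (P x))"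
      by (rule ext, rule sgP) (simp add: F(2) P(2))
    finally show ?thesis .
  qed
  have A2: "A (A y) = g (f (f (\<sigma> y)))" for y
    unfolding A_def[of "A y"] sA ..
  have A3: "A (A (A y)) = g (f (f (f (\<sigma> y))))" for y
    unfolding A_def[of "A (A y)"] sA ..
  have "lin_trace A = 0" using trace[OF f P(3)] tr by (simp add: A_def[abs_def])
  then obtain q where q: "\<And>y. A (A (A (A y))) = (lin_trace (\<lambda>y. A (A y)) / 2) *\<^sub>R A (A y)
    + (lin_trace (\<lambda>y. A (A (A y))) / 3) *\<^sub>R A y + q *\<^sub>R y"
    using cayley_hamilton4[OF _ lA] by auto
  have t2: "lin_trace (\<lambda>y. A (A y)) = lin_trace (\<lambda>x. f (f (P x)))"
    unfolding A2 by (rule trace[OF linear_comp_frame[OF f f]]) (simp add: P(3))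
  have t3: "lin_trace (\<lambda>y. A (A (A y))) = lin_trace (\<lambda>x. f (f (f (P x))))"
    unfolding A3 by (rule trace[OF linear_comp_frame[OF f linear_comp_frame[OF f f]]]) (simp add: P(3))
  show ?thesis
  proof (intro exI[of _ q] allI impI)
    fix x assume x: "P x = x"
    have "\<sigma> (A (A (A (A (g x))))) = (lin_trace (\<lambda>x. f (f (P x))) / 2) *\<^sub>R \<sigma> (A (A (g x)))
      + (lin_trace (\<lambda>x. f (f (f (P x)))) / 3) *\<^sub>R \<sigma> (A (g x)) + q *\<^sub>R \<sigma> (g x)"
      unfolding q t2 t3 by (simp add: linear_add[OF sg(1)] linear_scale[OF sg(1)])
    then show "f (f (f (f x))) = (lin_trace (\<lambda>x. f (f (P x))) / 2) *\<^sub>R f (f x)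
      + (lin_trace (\<lambda>x. f (f (f (P x)))) / 3) *\<^sub>R f x + q *\<^sub>R x"
      unfolding sA sgP[OF x] .
  qed
qed

locale fitting5 = fitting +
  assumes dim5: "DIM('a) = 5" and dim_range: "dim (range P) = 4" and perfect: "perfect br"
begin

lemma null_scaleX: "\<exists>r. x - P x = r *\<^sub>R X"
  by (rule null_dim1) (use dim_null_range dim5 dim_range in simp_all)

definition \<gamma> :: "'a \<Rightarrow> real" where
  "\<gamma> x = (SOME r. x - P x = r *\<^sub>R X)"

lemma minus_P_eq: "x - P x = \<gamma> x *\<^sub>R X"
  using someI_ex[OF null_scaleX[of x]] unfolding \<gamma>_def[symmetric] .

lemma \<gamma>_unique: "x - P x = r *\<^sub>R X \<Longrightarrow> \<gamma> x = r"
  unfolding minus_P_eq using X_nonzero by simp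

lemma linear_\<gamma>: "linear \<gamma>"
proof (rule linearI)
  show "\<gamma> (x + y) = \<gamma> x + \<gamma> y" for x y
  proof (rule \<gamma>_unique)
    have "x + y - P (x + y) = (x - P x) + (y - P y)" by simp
    then show "x + y - P (x + y) = (\<gamma> x + \<gamma> y) *\<^sub>R X" unfolding minus_P_eq by (simp add: scaleR_add_left)
  qed
  show "\<gamma> (r *\<^sub>R x) = r *\<^sub>R \<gamma> x" for r x
  proof (rule \<gamma>_unique)
    have "r *\<^sub>R x - P (r *\<^sub>R x) = r *\<^sub>R (x - P x)" by (simp add: scaleR_diff_right)
    then show "r *\<^sub>R x - P (r *\<^sub>R x) = (r *\<^sub>R \<gamma> x) *\<^sub>R X" unfolding minus_P_eq by simp
  qed
qed

lemmas \<gamma>_simps [simp] = linear_add[OF linear_\<gamma>] linear_scale[OF linear_\<gamma>] linear_neg[OF linear_\<gamma>]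
  linear_diff[OF linear_\<gamma>] linear_0[OF linear_\<gamma>]

lemma \<gamma>_ad [simp]: "\<gamma> (br X x) = 0"
proof (rule \<gamma>_unique)
  have "br X x - P (br X x) = br X (x - P x)" by (simp add: P_comm)
  then show "br X x - P (br X x) = 0 *\<^sub>R X" unfolding minus_P_eq by simp
qed

lemma \<gamma>_range: "P x = x \<Longrightarrow> \<gamma> x = 0"
  by (rule \<gamma>_unique) simp

lemma \<gamma>_skew: "\<gamma> (br (br X u) v) = - \<gamma> (br u (br X v))"
  using arg_cong[OF jacobi[of X u v], of \<gamma>] by simp

text \<open>Otherwise every bracket lies in \<open>range P\<close>, against perfectness.\<close>

lemma exists_\<gamma>: "\<exists>u v. P u = u \<and> P v = v \<and> \<gamma> (br u v) \<noteq> 0"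
proof (rule ccontr)
  assume n: "\<not> ?thesis"
  have ab: "br x y = 0" if xy: "P x = 0" "P y = 0" for x y
  proof -
    obtain r s where "x = r *\<^sub>R X" "y = s *\<^sub>R X"
      using null_scaleX[of x] null_scaleX[of y] unfolding xy diff_zero by blast
    then show ?thesis by simp
  qed
  have "range P = UNIV"
  proof (rule perfect_span[OF perfect bracket_abelian_null[OF ab subspace_range order_refl] subspace_range])
    show "br x y \<in> range P" if "P x = x" "P y = y" for x y
    proof -
      have "\<gamma> (br x y) = 0" using n that by blast
      then show ?thesis unfolding range_P_iff using minus_P_eq[of "br x y"] by simp
    qed
  qed
  then show False using dim_range dim5 by (simp add: dim_UNIV)
qed

text \<open>When all brackets on \<open>N\<close> are multiples of \<open>X\<close>, the Jacobi
  identity says that \<open>br X\<close> annihilates the cyclic sum of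
  \<open>\<gamma> (br u v) w\<close>. Injectivity turns this into a linear relation, which is solved
  for \<open>w\<close>.\<close>

lemma plane_of_jacobi:
  assumes N: "\<And>u v. u \<in> N \<Longrightarrow> v \<in> N \<Longrightarrow> br u v = \<gamma> (br u v) *\<^sub>R X"
    and NP: "\<And>u. u \<in> N \<Longrightarrow> P u = u"
    and uv: "u \<in> N" "v \<in> N" "\<gamma> (br u v) \<noteq> 0" and w: "w \<in> N"
  shows "w \<in> span {u, v}"
proof -
  have b: "br a (br c d) = - \<gamma> (br c d) *\<^sub>R br X a" if "c \<in> N" "d \<in> N" for a c d
    using arg_cong[OF N[OF that], of "br a"] by (simp add: br_skew[of a X])
  have "br u (br v w) = br (br u v) w + br v (br u w)" by (rule jacobi)
  moreover have "br (br u v) w = \<gamma> (br u v) *\<^sub>R br X w"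
    using b[OF uv(1,2), of w] br_skew[of "br u v" w] by simp
  ultimately have "br X (\<gamma> (br v w) *\<^sub>R u + \<gamma> (br u v) *\<^sub>R w - \<gamma> (br u w) *\<^sub>R v) = 0"
    using b[OF uv(2) w, of u] b[OF uv(1) w, of v] by (simp add: algebra_simps)
  then have "\<gamma> (br v w) *\<^sub>R u + \<gamma> (br u v) *\<^sub>R w - \<gamma> (br u w) *\<^sub>R v = 0"
    by (rule inj[rotated]) (simp_all add: NP uv w)
  then have "\<gamma> (br u v) *\<^sub>R w = (- \<gamma> (br v w)) *\<^sub>R u + \<gamma> (br u w) *\<^sub>R v"
    by (simp add: algebra_simps add_eq_0_iff2)
  then have "(1 / \<gamma> (br u v)) *\<^sub>R (\<gamma> (br u v) *\<^sub>R w)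
      = (1 / \<gamma> (br u v)) *\<^sub>R ((- \<gamma> (br v w)) *\<^sub>R u + \<gamma> (br u w) *\<^sub>R v)" by simp
  then have "w = (- \<gamma> (br v w) / \<gamma> (br u v)) *\<^sub>R u + (\<gamma> (br u w) / \<gamma> (br u v)) *\<^sub>R v"
    using uv(3) by (simp add: scaleR_add_right scaleR_diff_right)
  then show ?thesis unfolding in_span2 by blast
qed

abbreviation S :: "'a \<Rightarrow> 'a" where "S x \<equiv> br X (br X x)"

text \<open>Let \<alpha>, \<beta> be the actions of \<open>br X\<close> on the first and second
  argument. On the bracket \<open>br X\<close> acts as \<alpha> + \<beta>, and the claim is
  \<open>((\<alpha> + \<beta>)^2 - \<alpha>^2 - \<beta>^2)^2 = 4 \<alpha>^2 \<beta>^2\<close>, which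
  involves only the square \<open>S\<close> of \<open>br X\<close>.\<close>

lemma P_br_relation:
  assumes SS: "\<And>x. P x = x \<Longrightarrow> S (S x) = a *\<^sub>R S x + q *\<^sub>R x" and uv: "P u = u" "P v = v"
  shows "S (S (P (br u v))) + P (br (S (S u)) v) + P (br u (S (S v)))
    = 2 *\<^sub>R S (P (br (S u) v)) + 2 *\<^sub>R S (P (br u (S v))) + 2 *\<^sub>R P (br (S u) (S v))"
proof -
  have D: "br X (P (br x y)) = P (br (br X x) y) + P (br x (br X y))" for x y
    by (simp add: P_comm[symmetric] jacobi[of X x y])
  show ?thesis by (simp add: D scaleR_2)
qed

text \<open>If \<open>y\<^sub>1, y\<^sub>2\<close> are the roots of \<open>y\<^sup>2 = a y + q\<close>, then the eigenvalues of \<open>ad X\<close> on its range are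
  \<open>\<plusminus>\<surd>y\<^sub>1, \<plusminus>\<surd>y\<^sub>2\<close>, and \<open>4 a\<^sup>2 + 25 q\<close> vanishes exactly when one of \<open>y\<^sub>1, y\<^sub>2\<close> is four times the other,
  i.e. when the sum of two of the four eigenvalues can be an eigenvalue again.\<close>

lemma P_br_zero:
  assumes SS: "\<And>x. P x = x \<Longrightarrow> S (S x) = a *\<^sub>R S x + q *\<^sub>R x"
    and nz: "q \<noteq> 0" "4 * a * a + 25 * q \<noteq> 0" and uv: "P u = u" "P v = v"
  shows "P (br u v) = 0"
proof -
  have E: "a *\<^sub>R S (P (br x y)) + a *\<^sub>R P (br (S x) y) + a *\<^sub>R P (br x (S y)) + (3 * q) *\<^sub>R P (br x y)
    - 2 *\<^sub>R S (P (br (S x) y)) - 2 *\<^sub>R S (P (br x (S y))) - 2 *\<^sub>R P (br (S x) (S y)) = 0"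
    if "P x = x" "P y = y" for x y
  proof -
    have "S (S (P (br x y))) = a *\<^sub>R S (P (br x y)) + q *\<^sub>R P (br x y)" by (rule SS) simp
    moreover have "(3 * q) *\<^sub>R z = q *\<^sub>R z + q *\<^sub>R z + q *\<^sub>R z" for z :: 'a
      by (simp flip: scaleR_add_left)
    ultimately show ?thesis
      using P_br_relation[OF SS that] SS[OF that(1)] SS[OF that(2)] by (simp add: algebra_simps)
  qed
  have "inner (P (br u v)) b = 0" for b
  proof -
    \<comment> \<open>The relation \<open>E\<close> for \<open>u, v\<close> and their images under
      \<open>S\<close>, together with the image of each instance under \<open>S\<close>, gives eight
      linear equations in these eight numbers. Eliminating all but \<open>t000\<close> leaves the
      resonance factor.\<close>
    define t000 t001 t010 t011 t100 t101 t110 t111 where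
      t: "t000 = inner (P (br u v)) b" "t001 = inner (S (P (br u v))) b"
      "t010 = inner (P (br u (S v))) b" "t011 = inner (S (P (br u (S v)))) b"
      "t100 = inner (P (br (S u) v)) b" "t101 = inner (S (P (br (S u) v))) b"
      "t110 = inner (P (br (S u) (S v))) b" "t111 = inner (S (P (br (S u) (S v)))) b"
    have PS: "P (S x) = S x" if "P x = x" for x using that by (simp add: P_comm)
    have SSP: "S (S (P x)) = a *\<^sub>R S (P x) + q *\<^sub>R P x" for x by (rule SS) simp
    note e = E[OF uv] E[OF PS[OF uv(1)] uv(2)] E[OF uv(1) PS[OF uv(2)]] E[OF PS[OF uv(1)] PS[OF uv(2)]]
    have i: "inner z b = 0" "inner (S z) b = 0" if "z = 0" for z using that by simp_all
    note eqs = i[OF e(1)] i[OF e(2)] i[OF e(3)] i[OF e(4)]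
    have "q * q * (4 * a * a + 25 * q) * t000 = 0"
      using eqs
      by (simp only: SS[OF uv(1)] SS[OF uv(2)] SSP br_add br_diff br_scaleR P_simps inner_add_left
          inner_diff_left inner_scaleR_left t[symmetric]) algebra
    then show ?thesis using nz by (simp add: t)
  qed
  then show ?thesis by (metis inner_eq_zero_iff)
qed

text \<open>Without resonance all brackets on the range are multiples of \<open>X\<close>, and
  \<open>plane_of_jacobi\<close> bounds the dimension of the range by 2.\<close>

lemma resonance:
  assumes SS: "\<And>x. P x = x \<Longrightarrow> S (S x) = a *\<^sub>R S x + q *\<^sub>R x" and q: "q \<noteq> 0"
  shows "4 * a * a + 25 * q = 0"
proof (rule ccontr)
  assume nz: "4 * a * a + 25 * q \<noteq> 0"
  obtain u v where uv: "P u = u" "P v = v" "\<gamma> (br u v) \<noteq> 0" using exists_\<gamma> by blast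
  have "range P \<subseteq> span {u, v}"
  proof
    fix w assume "w \<in> range P"
    show "w \<in> span {u, v}"
    proof (rule plane_of_jacobi[of "range P"])
      show "br x y = \<gamma> (br x y) *\<^sub>R X" if "x \<in> range P" "y \<in> range P" for x y
      proof -
        have "P (br x y) = 0" using P_br_zero[OF SS q nz] that unfolding range_P_iff by blast
        then show ?thesis using minus_P_eq[of "br x y"] by (simp only: diff_zero)
      qed
    qed (use uv \<open>w \<in> range P\<close> in \<open>simp_all add: range_P_iff\<close>)
  qed
  then have "dim (range P) \<le> card {u, v}" by (rule dim_le_card) simp
  also have "\<dots> \<le> 2" by (simp add: card_insert_if)
  finally show False using dim_range by simp
qed

lemma spectrum:
  "\<exists>y. y \<noteq> 0 \<and> (\<forall>x. P x = x \<longrightarrow> S (S x) = (5 * y) *\<^sub>R S x - (4 * y * y) *\<^sub>R x) \<and>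
    lin_trace (\<lambda>x. S (P x)) = 10 * y \<and> lin_trace (\<lambda>x. br X (S (P x))) = 0"
proof -
  define T2 T3 where T: "T2 = lin_trace (\<lambda>x. S (P x))" "T3 = lin_trace (\<lambda>x. br X (S (P x)))"
  obtain q where q: "\<And>x. P x = x \<Longrightarrow> S (S x) = (T2 / 2) *\<^sub>R S x + (T3 / 3) *\<^sub>R br X x + q *\<^sub>R x"
    using cayley_hamilton_range4[OF linear_br(1) linear_P P_idem P_comm dim_range trace_P]
    unfolding T by blast
  \<comment> \<open>For the form \<open>\<gamma> (br u v)\<close> the operator \<open>br X\<close>
    is skew, so its even powers are symmetric. The quartic relation would make its term in
    \<open>br X\<close> symmetric too, which forces the coefficient to vanish.\<close>
  have T3: "T3 = 0"
  proof -
    obtain u v where uv: "P u = u" "P v = v" "\<gamma> (br u v) \<noteq> 0" using exists_\<gamma> by blast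
    obtain u' where u': "P u' = u'" "br X u' = u" using surj[OF uv(1)] by blast
    have "\<gamma> (br (S (S u')) v) = \<gamma> (br u' (S (S v)))" "\<gamma> (br (S u') v) = \<gamma> (br u' (S v))"
      by (simp_all only: \<gamma>_skew minus_minus)
    moreover have "\<gamma> (br (br X u') v) = - \<gamma> (br u' (br X v))" by (rule \<gamma>_skew)
    ultimately have "T3 * \<gamma> (br (br X u') v) = 0"
      unfolding q[OF u'(1)] q[OF uv(2)] by simp
    then show ?thesis using uv(3) u'(2) by simp
  qed
  define a where "a = T2 / 2"
  have SS: "S (S x) = a *\<^sub>R S x + q *\<^sub>R x" if "P x = x" for x
    using q[OF that] by (simp add: T3 a_def)
  have q0: "q \<noteq> 0"
  proof
    assume "q = 0"
    have Sa: "S x = a *\<^sub>R x" if x: "P x = x" for x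
    proof -
      have "S (S x - a *\<^sub>R x) = 0" using SS[OF x] \<open>q = 0\<close> by simp
      then have "br X (S x - a *\<^sub>R x) = 0" by (rule inj[rotated]) (simp_all add: P_comm x)
      then have "S x - a *\<^sub>R x = 0" by (rule inj[rotated]) (simp_all add: P_comm x)
      then show ?thesis by simp
    qed
    have a: "a \<noteq> 0"
    proof
      assume "a = 0"
      obtain u where u: "P u = u" "u \<noteq> 0"
        using exists_\<gamma> by (metis P_idem br_zero(1) \<gamma>_simps(5))
      have "S u = 0" using Sa[OF u(1)] \<open>a = 0\<close> by simp
      then have "br X u = 0" by (rule inj[rotated]) (simp_all add: P_comm u)
      then show False using inj u by blast
    qed
    \<comment> \<open>With \<open>q = 0\<close> the operator \<open>S\<close> is the scalar
      \<open>a\<close>, hence also a double root of \<open>(S - a)^2 = 0\<close>. In this form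
      \<open>resonance\<close> applies and would give 16 a^2 = 25 a^2.\<close>
    have SS': "S (S x) = (2 * a) *\<^sub>R S x + (- (a * a)) *\<^sub>R x" if x: "P x = x" for x
      using Sa[OF x] by (simp flip: scaleR_add_left scaleR_diff_left)
    have "4 * (2 * a) * (2 * a) + 25 * (- (a * a)) = 0"
      by (rule resonance[OF SS']) (use a in simp_all)
    then show False using a by simp
  qed
  have res: "4 * a * a + 25 * q = 0" by (rule resonance[OF SS q0])
  \<comment> \<open>At resonance the roots are \<open>y\<close> and \<open>4 y\<close>, with sum
    \<open>a\<close>.\<close>
  define y where "y = a / 5"
  have ay: "a = 5 * y" "q = - (4 * y * y)" using res by (simp_all add: y_def)
  show ?thesis
  proof (intro exI[of _ y] conjI allI impI)
    show "y \<noteq> 0" using q0 ay by auto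
    show "S (S x) = (5 * y) *\<^sub>R S x - (4 * y * y) *\<^sub>R x" if "P x = x" for x
      using SS[OF that] by (simp add: ay)
    show "lin_trace (\<lambda>x. S (P x)) = 10 * y" using ay(1) by (simp add: T a_def)
    show "lin_trace (\<lambda>x. br X (S (P x))) = 0" using T3 by (simp add: T)
  qed
qed

text \<open>Up to scale \<open>br X\<close> has eigenvalues 1, -1 and 2, -2. The plane of the first
  pair becomes the abelian ideal; the plane of the second pair and \<open>X\<close> act on it by
  traceless matrices and become \<open>sl2\<close>. The scale may be imaginary, so the computation
  uses \<open>S\<close> and cyclic vectors.\<close>

lemma sl2_semidirect: "sl2_semidirect br"
proof -
  obtain y where y: "y \<noteq> 0" and SS: "\<And>x. P x = x \<Longrightarrow> S (S x) = (5 * y) *\<^sub>R S x - (4 * y * y) *\<^sub>R x"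
    and tr2: "lin_trace (\<lambda>x. S (P x)) = 10 * y" and tr3: "lin_trace (\<lambda>x. br X (S (P x))) = 0"
    using spectrum by blast
  have trP: "lin_trace P = 4" using lin_trace_projection[OF linear_P P_idem] dim_range by simp
  have SSP: "S (S (P x)) = (5 * y) *\<^sub>R S (P x) - (4 * y * y) *\<^sub>R P x" for x by (rule SS) simp
  \<comment> \<open>The spectral projections \<open>(4 y - S) / (3 y)\<close> and
    \<open>(S - y) / (3 y)\<close> of \<open>S\<close> on the range. The traces 4 of
    \<open>P\<close> and 10 y of \<open>S\<close> give each of them trace 2, hence rank 2.\<close>
  define E1 where "E1 x = (4/3) *\<^sub>R P x - (1 / (3 * y)) *\<^sub>R S (P x)" for x
  define E2 where "E2 x = (1 / (3 * y)) *\<^sub>R S (P x) - (1/3) *\<^sub>R P x" for x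
  have lE: "linear E1" "linear E2" unfolding E1_def E2_def
    by (auto intro!: linearI simp: algebra_simps)
  have cE: "E1 (br X x) = br X (E1 x)" "E2 (br X x) = br X (E2 x)" for x
    by (simp_all add: E1_def E2_def P_comm)
  have PE: "P (E1 x) = E1 x" "P (E2 x) = E2 x" for x by (simp_all add: E1_def E2_def P_comm)
  have SE: "S (E1 x) = y *\<^sub>R E1 x" "S (E2 x) = (4 * y) *\<^sub>R E2 x" for x
    using y by (simp_all add: E1_def E2_def SSP algebra_simps flip: scaleR_add_left scaleR_diff_left)
  have EE: "E1 (E1 x) = E1 x" "E2 (E2 x) = E2 x" for x
    unfolding E1_def[of "E1 x"] E2_def[of "E2 x"] PE SE using y
    by (simp_all flip: scaleR_diff_left)
  have sumE: "P x = E1 x + E2 x" for x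
    by (simp add: E1_def E2_def flip: scaleR_diff_left)
  have tE: "lin_trace E1 = 2" "lin_trace E2 = 2"
    unfolding E1_def[abs_def] E2_def[abs_def] lin_trace_diff lin_trace_scaleR trP tr2 using y by simp_all
  have dE: "dim (range E1) = 2" "dim (range E2) = 2"
    using lin_trace_projection[OF lE(1) EE(1)] lin_trace_projection[OF lE(2) EE(2)] tE by simp_all
  have tfE: "lin_trace (\<lambda>x. br X (E1 x)) = 0" "lin_trace (\<lambda>x. br X (E2 x)) = 0"
    unfolding E1_def E2_def br_diff br_scaleR lin_trace_diff lin_trace_scaleR trace_P tr3 by simp_all
  have injE: "E1 x = x \<Longrightarrow> br X x = 0 \<Longrightarrow> x = 0" "E2 x = x \<Longrightarrow> br X x = 0 \<Longrightarrow> x = 0" for x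
    using inj[of x] PE by metis+
  obtain u1 where u1: "E1 u1 = u1" "range E1 = span {u1, br X u1}"
    using plane_cyclic_vector[OF linear_br(1) lE(1) EE(1) cE(1) dE(1) tfE(1) injE(1)] by blast
  obtain w1 where w1: "E2 w1 = w1" "range E2 = span {w1, br X w1}"
    using plane_cyclic_vector[OF linear_br(1) lE(2) EE(2) cE(2) dE(2) tfE(2) injE(2)] by blast
  define u2 w2 where uw: "u2 = br X u1" "w2 = br X w1"
  have X1: "br X u1 = u2" "br X u2 = y *\<^sub>R u1" using SE(1)[of u1] u1(1) by (simp_all add: uw)
  have X2: "br X w1 = w2" "br X w2 = (4 * y) *\<^sub>R w1" using SE(2)[of w1] w1(1) by (simp_all add: uw)
  have E1u: "E1 u1 = u1" "E1 u2 = u2" using u1(1) by (simp_all add: uw cE)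
  have E2w: "E2 w1 = w1" "E2 w2 = w2" using w1(1) by (simp_all add: uw cE)
  have exu: "\<exists>a b. x = a *\<^sub>R u1 + b *\<^sub>R u2" if "E1 x = x" for x
    using u1(2) in_span2[of x u1 u2] that unfolding uw by (metis rangeI)
  have exw: "\<exists>a b. x = a *\<^sub>R w1 + b *\<^sub>R w2" if "E2 x = x" for x
    using w1(2) in_span2[of x w1 w2] that unfolding uw by (metis rangeI)
  have indep: "a = 0 \<and> b = 0" if "a *\<^sub>R u1 + b *\<^sub>R u2 = 0" for a b
  proof -
    have c: "card {u1, u2} \<le> dim (range E1)" using dE by (simp add: card_insert_if)
    have i: "independent {u1, u2}"
      by (rule card_le_dim_spanning[of _ "range E1"]) (use c u1(2) in \<open>auto simp: uw span_base\<close>)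
    have ne: "u2 \<noteq> u1"
    proof
      assume "u2 = u1"
      then have "range E1 \<subseteq> span {u1}" using u1(2) by (simp add: uw)
      then have "dim (range E1) \<le> card {u1}" by (rule dim_le_card) simp
      then show False using dE by simp
    qed
    then have "(\<Sum>z\<in>{u1, u2}. (if z = u1 then a else b) *\<^sub>R z) = 0" using that by simp
    then have "\<forall>z\<in>{u1, u2}. (if z = u1 then a else b) = 0"
      by (rule independent_explicit[THEN iffD1, OF i, THEN conjunct2, THEN spec, THEN mp])
    then show ?thesis using ne by auto
  qed
  have fixX: "\<exists>r. x = r *\<^sub>R X" if "br X x = 0" for x
    using null_scaleX[of x] unfolding P_of_zero[OF that] diff_zero .
  have "br X (br u1 u2) = 0" "br X (br w1 w2) = 0"
    using jacobi[of X u1 u2] jacobi[of X w1 w2] by (simp_all add: X1 X2)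
  then obtain c1 c2 where c: "br u1 u2 = c1 *\<^sub>R X" "br w1 w2 = c2 *\<^sub>R X" using fixX by metis
  \<comment> \<open>Eigenvalues with squares \<open>y\<close> and \<open>4 y\<close> add up to one
    with square \<open>y\<close> or \<open>9 y\<close>, and \<open>9 y\<close> is not in the
    spectrum. The \<open>X\<close>-component vanishes because eigenspaces of \<open>S\<close> for
    different eigenvalues are orthogonal for the form \<open>\<gamma> (br u w)\<close>.\<close>
  have mixed: "E1 (br u w) = br u w" if uw: "E1 u = u" "E2 w = w" for u w
  proof -
    have Su: "S u = y *\<^sub>R u" "S w = (4 * y) *\<^sub>R w" using SE(1)[of u] SE(2)[of w] uw by simp_all
    have Puw: "P u = u" "P w = w" using PE uw by metis+
    have "\<gamma> (br (S u) w) = \<gamma> (br u (S w))" by (simp only: \<gamma>_skew minus_minus)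
    then have "y * \<gamma> (br u w) = 4 * y * \<gamma> (br u w)" by (simp add: Su)
    then have "\<gamma> (br u w) = 0" using y by simp
    then have Pb: "P (br u w) = br u w" using minus_P_eq[of "br u w"] by simp
    have SS': "S (S x) = (5 * y) *\<^sub>R S x + (- (4 * y * y)) *\<^sub>R x" if "P x = x" for x
      using SS[OF that] by simp
    have "S (S (br u w)) = (10 * y) *\<^sub>R S (br u w) - (9 * y * y) *\<^sub>R br u w"
    proof (rule euclidean_eqI)
      fix b :: 'a
      have "S (S (br u w)) + (y * y) *\<^sub>R br u w + (16 * y * y) *\<^sub>R br u w
          = (2 * y) *\<^sub>R S (br u w) + (8 * y) *\<^sub>R S (br u w) + (8 * y * y) *\<^sub>R br u w"
        using P_br_relation[OF SS' Puw] by (simp add: Su Pb algebra_simps)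
      from arg_cong[OF this, of "\<lambda>z. inner z b"]
      show "inner (S (S (br u w))) b = inner ((10 * y) *\<^sub>R S (br u w) - (9 * y * y) *\<^sub>R br u w) b"
        by (simp only: inner_add_left inner_diff_left inner_scaleR_left)
    qed
    moreover have "S (S (br u w)) = (5 * y) *\<^sub>R S (br u w) - (4 * y * y) *\<^sub>R br u w"
      by (rule SS[OF Pb])
    ultimately have "(10 * y) *\<^sub>R S (br u w) - (5 * y) *\<^sub>R S (br u w) = (9 * y * y) *\<^sub>R br u w - (4 * y * y) *\<^sub>R br u w"
      by (simp add: algebra_simps)
    then have "(5 * y) *\<^sub>R S (br u w) = (5 * y * y) *\<^sub>R br u w"
      by (simp flip: scaleR_diff_left)
    then have "(1 / (5 * y)) *\<^sub>R ((5 * y) *\<^sub>R S (br u w)) = (1 / (5 * y)) *\<^sub>R ((5 * y * y) *\<^sub>R br u w)"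
      by simp
    then have "S (br u w) = y *\<^sub>R br u w" using y by simp
    then show ?thesis unfolding E1_def Pb using y by (simp flip: scaleR_diff_left)
  qed
  have mixed': "E1 (br w u) = br w u" if "E1 u = u" "E2 w = w" for u w
    using mixed[OF that] br_skew[of w u] by (simp add: linear_neg[OF lE(1)])
  obtain \<alpha> \<beta> where W1: "br w1 u1 = \<alpha> *\<^sub>R u1 + \<beta> *\<^sub>R u2" using exu mixed' E1u E2w by metis
  obtain \<gamma>' \<delta> where W2: "br w1 u2 = \<gamma>' *\<^sub>R u1 + \<delta> *\<^sub>R u2" using exu mixed' E1u E2w by metis
  have w2u: "br w2 u1 = (\<beta> * y - \<gamma>') *\<^sub>R u1 + (\<alpha> - \<delta>) *\<^sub>R u2"
    "br w2 u2 = (y * (\<delta> - \<alpha>)) *\<^sub>R u1 + (\<gamma>' - y * \<beta>) *\<^sub>R u2"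
    using jacobi[of X w1 u1] jacobi[of X w1 u2] by (simp_all add: X1 X2 W1 W2 algebra_simps)
  have w2X: "br X (br w2 u1) = br (br X w2) u1 + br w2 (br X u1)" by (rule jacobi)
  \<comment> \<open>Consistency of the action on \<open>u1\<close> with
    \<open>br X w2 = 4 y w1\<close>; it makes \<open>w1\<close> traceless on the plane.\<close>
  have "(y * (\<alpha> - \<delta>) - 4 * y * \<alpha> - y * (\<delta> - \<alpha>)) *\<^sub>R u1
      + ((\<beta> * y - \<gamma>') - 4 * y * \<beta> - (\<gamma>' - y * \<beta>)) *\<^sub>R u2 = 0"
  proof (rule euclidean_eqI)
    fix b :: 'a
    from arg_cong[OF w2X, of "\<lambda>z. inner z b"]
    show "inner ((y * (\<alpha> - \<delta>) - 4 * y * \<alpha> - y * (\<delta> - \<alpha>)) *\<^sub>R u1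
      + ((\<beta> * y - \<gamma>') - 4 * y * \<beta> - (\<gamma>' - y * \<beta>)) *\<^sub>R u2) b = inner 0 b"
      unfolding X1 X2 w2u br_add br_scaleR W1 inner_add_left inner_scaleR_left inner_zero_left by algebra
  qed
  from indep[OF this] have "y * (- 2 * \<alpha> - 2 * \<delta>) = 0" "\<gamma>' = - y * \<beta>"
    by (simp_all add: algebra_simps)
  then have cd: "\<delta> = - \<alpha>" "\<gamma>' = - y * \<beta>" using y by simp_all
  note W = W1 W2[unfolded cd] w2u[unfolded cd]
  \<comment> \<open>The traceless \<open>w1\<close> annihilates \<open>br u1 u2\<close>, an area
    element of the plane, whereas it does not commute with \<open>X\<close>.\<close>
  have c10: "c1 = 0"
  proof -
    have "br w1 (br u1 u2) = br (br w1 u1) u2 + br u1 (br w1 u2)" by (rule jacobi)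
    then have "br w1 (c1 *\<^sub>R X) = 0" by (simp add: c W algebra_simps)
    then have "c1 *\<^sub>R w2 = 0" by (simp add: br_skew[of w1 X] X2)
    moreover have "w2 \<noteq> 0"
    proof
      assume "w2 = 0"
      then have "range E2 \<subseteq> span {w1}" using w1(2) by (simp add: uw insert_commute)
      then have "dim (range E2) \<le> card {w1}" by (rule dim_le_card) simp
      then show False using dE by simp
    qed
    ultimately show ?thesis by simp
  qed
  have "c2 \<noteq> 0"
  proof
    assume c20: "c2 = 0"
    obtain u v where uv: "P u = u" "P v = v" "\<gamma> (br u v) \<noteq> 0" using exists_\<gamma> by blast
    obtain a b a' b' where "E1 u = a *\<^sub>R u1 + b *\<^sub>R u2" "E1 v = a' *\<^sub>R u1 + b' *\<^sub>R u2"
      using exu EE(1) by metis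
    then have 1: "br (E1 u) (E1 v) = 0" using c(1) c10 br_skew[of u2 u1] by simp
    obtain a b a' b' where "E2 u = a *\<^sub>R w1 + b *\<^sub>R w2" "E2 v = a' *\<^sub>R w1 + b' *\<^sub>R w2"
      using exw EE(2) by metis
    then have 2: "br (E2 u) (E2 v) = 0" using c(2) c20 br_skew[of w2 w1] by simp
    have 3: "\<gamma> (br (E1 u) (E2 v)) = 0" "\<gamma> (br (E2 u) (E1 v)) = 0"
      using mixed mixed' EE PE \<gamma>_range by metis+
    have "br u v = br (E1 u + E2 u) (E1 v + E2 v)" using sumE uv by metis
    then show False using uv(3) 1 2 3 by simp
  qed
  have w12: "br w1 (br w2 u1) = br (br w1 w2) u1 + br w2 (br w1 u1)" by (rule jacobi)
  have "0 *\<^sub>R u1 + (c2 + 4 * (\<alpha> * \<alpha> - y * \<beta> * \<beta>)) *\<^sub>R u2 = 0"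
  proof (rule euclidean_eqI)
    fix b :: 'a
    from arg_cong[OF w12, of "\<lambda>z. inner z b"]
    show "inner (0 *\<^sub>R u1 + (c2 + 4 * (\<alpha> * \<alpha> - y * \<beta> * \<beta>)) *\<^sub>R u2) b = inner 0 b"
      unfolding W c br_add br_scaleR W X1 inner_add_left inner_scaleR_left inner_zero_left by algebra
  qed
  from indep[OF this] have c2: "c2 = - 4 * (\<alpha> * \<alpha> - y * \<beta> * \<beta>)" by simp
  \<comment> \<open>Minus the determinant of \<open>w1\<close> on the plane. The reciprocals
    \<open>k\<close>, \<open>p\<close>, \<open>r\<close> below enter only through
    \<open>kp1\<close>, which keeps all identities polynomial.\<close>
  define D where "D = \<alpha> * \<alpha> - y * \<beta> * \<beta>"
  have D: "D \<noteq> 0" using c2 \<open>c2 \<noteq> 0\<close> by (auto simp: D_def)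
  define k p r where kp: "k = 1 / (2 * y)" "p = 1 / (4 * D)" "r = (1 / 2 :: real)"
  have kp1: "2 * k * y = 1" "4 * p * D = 1" "2 * r = 1" using y D by (simp_all add: kp)
  \<comment> \<open>The action of \<open>a X + b w1 + c w2\<close> on \<open>span {u1, u2}\<close> gives an isomorphism onto the traceless
    matrices; \<open>h, e, f\<close> below are the preimages of the standard ones.\<close>
  have act: "br (a *\<^sub>R X + b *\<^sub>R w1 + c *\<^sub>R w2) u1
      = (b * \<alpha> + 2 * c * \<beta> * y) *\<^sub>R u1 + (a + b * \<beta> + 2 * c * \<alpha>) *\<^sub>R u2"
    "br (a *\<^sub>R X + b *\<^sub>R w1 + c *\<^sub>R w2) u2
      = (y * (a - b * \<beta> - 2 * c * \<alpha>)) *\<^sub>R u1 + (- (b * \<alpha> + 2 * c * \<beta> * y)) *\<^sub>R u2" for a b c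
    by (simp_all add: X1 W algebra_simps)
  have w1w2: "br w1 w2 = (- 4 * D) *\<^sub>R X" unfolding c(2) c2 D_def ..
  have com: "br (a *\<^sub>R X + b *\<^sub>R w1 + c *\<^sub>R w2) (a' *\<^sub>R X + b' *\<^sub>R w1 + c' *\<^sub>R w2)
      = (- 4 * D * (b * c' - c * b')) *\<^sub>R X + (4 * y * (a * c' - c * a')) *\<^sub>R w1 + (a * b' - b * a') *\<^sub>R w2"
    for a b c a' b' c'
    by (simp add: X2 br_skew[of w1 X] br_skew[of w2 X] br_skew[of w2 w1] w1w2 algebra_simps)
  define h where "h = 0 *\<^sub>R X + (4 * \<alpha> * p) *\<^sub>R w1 + (- 2 * \<beta> * p) *\<^sub>R w2"
  define e where "e = k *\<^sub>R X + (2 * \<beta> * p) *\<^sub>R w1 + (- 2 * \<alpha> * p * k) *\<^sub>R w2"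
  define f where "f = r *\<^sub>R X + (- 2 * \<beta> * y * p) *\<^sub>R w1 + (\<alpha> * p) *\<^sub>R w2"
  have X': "X = y *\<^sub>R e + 1 *\<^sub>R f + 0 *\<^sub>R h"
    by (rule euclidean_eqI, unfold h_def e_def f_def com inner_add_left inner_scaleR_left)
      (use kp1 D_def in algebra)
  have w1': "w1 = \<alpha> *\<^sub>R h + (- y * \<beta>) *\<^sub>R e + \<beta> *\<^sub>R f"
    by (rule euclidean_eqI, unfold h_def e_def f_def com inner_add_left inner_scaleR_left)
      (use kp1 D_def in algebra)
  have w2': "w2 = (2 * \<beta> * y) *\<^sub>R h + (- 2 * y * \<alpha>) *\<^sub>R e + (2 * \<alpha>) *\<^sub>R f"
    by (rule euclidean_eqI, unfold h_def e_def f_def com inner_add_left inner_scaleR_left)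
      (use kp1 D_def in algebra)
  have he: "br h e = 2 *\<^sub>R e"
    by (rule euclidean_eqI, unfold h_def e_def f_def com inner_add_left inner_scaleR_left)
      (use kp1 D_def in algebra)
  have hf: "br h f = - 2 *\<^sub>R f"
    by (rule euclidean_eqI, unfold h_def e_def f_def com inner_add_left inner_scaleR_left)
      (use kp1 D_def in algebra)
  have ef: "br e f = h"
    by (rule euclidean_eqI, unfold h_def e_def f_def com inner_add_left inner_scaleR_left)
      (use kp1 D_def in algebra)
  have "span {h, e, f, u1, u2} = UNIV"
  proof -
    let ?T = "span {h, e, f, u1, u2}"
    have T: "X \<in> ?T" "w1 \<in> ?T" "w2 \<in> ?T" "u1 \<in> ?T" "u2 \<in> ?T"
      by (rule in_span_insert_combination[OF X'] in_span_insert_combination[OF w1']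
          in_span_insert_combination[OF w2'] span_base; simp)+
    have "x \<in> ?T" for x
    proof -
      obtain a b where "E1 x = a *\<^sub>R u1 + b *\<^sub>R u2" using exu EE(1) by metis
      moreover obtain c d where "E2 x = c *\<^sub>R w1 + d *\<^sub>R w2" using exw EE(2) by metis
      moreover have "x = E1 x + E2 x + \<gamma> x *\<^sub>R X"
        unfolding sumE[symmetric] minus_P_eq[symmetric] by simp
      ultimately have "x = a *\<^sub>R u1 + b *\<^sub>R u2 + (c *\<^sub>R w1 + d *\<^sub>R w2) + \<gamma> x *\<^sub>R X" by simp
      moreover have "\<dots> \<in> ?T" by (intro span_add span_scale T)
      ultimately show ?thesis by simp
    qed
    then show ?thesis by blast
  qed
  moreover have "br h u1 = u1" "br h u2 = - u2" "br e u1 = 0" "br e u2 = u1" "br f u1 = u2" "br f u2 = 0"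
    by (rule euclidean_eqI, unfold h_def e_def f_def act inner_add_left inner_scaleR_left
        inner_minus_left inner_zero_left, use kp1 D_def in algebra)+
  moreover have "br u1 u2 = 0" using c c10 by simp
  ultimately show ?thesis unfolding sl2_semidirect_def using he hf ef by blast
qed

end

section \<open>Extensions of four-dimensional algebras\<close>

lemma span_insert_add:
  assumes "w \<in> span S"
  shows "span (insert (t + w) S) = span (insert t S)"
proof -
  have w: "w \<in> span (insert t S)" "w \<in> span (insert (t + w) S)"
    using assms span_mono[of S "insert t S"] span_mono[of S "insert (t + w) S"] by auto
  have "t + w \<in> span (insert t S)"
    by (rule span_add[OF _ w(1)]) (simp add: span_base)
  moreover have "t + w - w \<in> span (insert (t + w) S)"
    by (rule span_diff[OF _ w(2)]) (simp add: span_base)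
  moreover have "t + w - w = t" by simp
  ultimately show ?thesis
    using span_superset[of "insert t S"] span_superset[of "insert (t + w) S"]
    by (intro span_eq[THEN iffD2]) auto
qed

lemma in_span4: "x \<in> span {p, q, r, s} \<longleftrightarrow> (\<exists>a b c d. x = a *\<^sub>R p + b *\<^sub>R q + c *\<^sub>R r + d *\<^sub>R s)"
  unfolding span_insert[of p] in_span3 mem_Collect_eq diff_eq_eq by (simp add: ac_simps)

lemma (in lie) abelian_ideal_span3:
  assumes "DIM('a) = 4" and sp: "span {s,x,u,v} = UNIV"
    and ab: "br x u = 0" "br x v = 0" "br u v = 0"
    and s: "br s x \<in> span {x,u,v}" "br s u \<in> span {x,u,v}" "br s v \<in> span {x,u,v}"
  shows "lie_ideal br (span {x,u,v})" "abelian_set br (span {x,u,v})" "dim (span {x,u,v}) = DIM('a) - 1"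
proof -
  have ab': "br a b = 0" if "a \<in> span {x,u,v}" "b \<in> span {x,u,v}" for a b
    using that unfolding in_span3
    by (auto simp: ab br_skew[of u x] br_skew[of v x] br_skew[of v u])
  then show "abelian_set br (span {x,u,v})" by (auto simp: abelian_set_def)
  have sI: "br s b \<in> span {x,u,v}" if "b \<in> span {x,u,v}" for b
    using that by (induction rule: span_induct_alt)
      (use s in \<open>auto simp: span_zero intro!: span_add span_scale\<close>)
  show "lie_ideal br (span {x,u,v})"
    unfolding lie_ideal_def
  proof (intro conjI allI impI subspace_span)
    fix a b assume b: "b \<in> span {x,u,v}"
    have "a \<in> span (insert s {x,u,v})" using sp by simp
    then obtain a' r where "a' \<in> span {x,u,v}" "a = a' + r *\<^sub>R s"
      using mem_span_insert_subspace[OF subspace_span, of a s "{x,u,v}"] by (auto simp: span_insert)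
        (metis diff_add_cancel)
    then show "br a b \<in> span {x,u,v}" using ab' sI b by (auto intro: span_scale)
  qed
  have "dim (span {s,x,u,v}) = 4" unfolding sp using assms(1) by simp
  then have "4 \<le> Suc (dim {x,u,v})" unfolding dim_span using dim_insert[of s "{x,u,v}"] by (simp split: if_splits)
  moreover have "dim {x,u,v} \<le> 3"
    by (rule order_trans[OF dim_le_card']) (auto simp: card_insert_if)
  ultimately show "dim (span {x,u,v}) = DIM('a) - 1" using assms(1) by simp
qed

section \<open>Unimodular algebras of dimension four\<close>

context unimodular_lie
begin

text \<open>The sum of a line and a simple algebra, which is \<open>sl2\<close> or
  \<open>so3\<close> according to the signs of \<open>y\<close> and \<open>c\<close>.\<close>

definition simple_sum_frame :: "'a \<Rightarrow> 'a \<Rightarrow> 'a \<Rightarrow> 'a \<Rightarrow> bool" where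
  "simple_sum_frame s x u v \<longleftrightarrow> (\<exists>y c. y \<noteq> 0 \<and> c \<noteq> 0 \<and> br x u = v \<and> br x v = y *\<^sub>R u \<and>
     br u v = c *\<^sub>R x \<and> br s x = 0 \<and> br s u = 0 \<and> br s v = 0)"

definition abelian_frame :: "'a \<Rightarrow> 'a \<Rightarrow> 'a \<Rightarrow> 'a \<Rightarrow> bool" where
  "abelian_frame s x u v \<longleftrightarrow> br x u = 0 \<and> br x v = 0 \<and> br u v = 0 \<and>
     br s x \<in> span {x,u,v} \<and> br s u \<in> span {x,u,v} \<and> br s v \<in> span {x,u,v}"

text \<open>The Heisenberg algebra of \<open>x, u, v\<close> extended by a rotation of the plane of
  \<open>x, u\<close> if \<open>d < 0\<close>, by a hyperbolic one if \<open>d > 0\<close>.\<close>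

definition oscillator_frame :: "'a \<Rightarrow> 'a \<Rightarrow> 'a \<Rightarrow> 'a \<Rightarrow> bool" where
  "oscillator_frame s x u v \<longleftrightarrow> (\<exists>d. d \<noteq> 0 \<and> br x u = v \<and> br x v = 0 \<and> br u v = 0 \<and>
     br s x = u \<and> br s u = d *\<^sub>R x \<and> br s v = 0)"

text \<open>\<open>t\<close> acts as a derivation of the 3-dimensional ideal. If
  \<open>y \<noteq> 0\<close>, trace zero makes it inner, and \<open>t\<close> can be corrected to a
  central \<open>s\<close>. If \<open>y = 0\<close>, the ideal is the Heisenberg algebra, and the
  traceless action on the plane modulo its centre decides: invertible gives an oscillator, nilpotent
  or zero an abelian ideal of codimension one.\<close>

lemma dim4_frame_of_ideal_frame:
  assumes dim: "DIM('a) = 4" and sp: "span {t,x,u,v} = UNIV"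
    and b: "br x u = v" "br x v = y *\<^sub>R u" "br u v = c *\<^sub>R x" "c = 0 \<or> y \<noteq> 0"
    and t: "br t x \<in> span {x,u,v}" "br t u \<in> span {x,u,v}"
  shows "\<exists>s x u v. span {s,x,u,v} = UNIV \<and>
    (simple_sum_frame s x u v \<or> abelian_frame s x u v \<or> oscillator_frame s x u v)"
proof (rule frame4E[OF dim sp])
  fix c1 c2 c3 c4 :: "'a \<Rightarrow> real"
  assume l: "linear c1" "linear c2" "linear c3" "linear c4"
  assume d: "c1 t = 1" "c1 x = 0" "c1 u = 0" "c1 v = 0" "c2 t = 0" "c2 x = 1" "c2 u = 0" "c2 v = 0"
    "c3 t = 0" "c3 x = 0" "c3 u = 1" "c3 v = 0" "c4 t = 0" "c4 x = 0" "c4 u = 0" "c4 v = 1"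
  assume ex: "\<And>z. z = c1 z *\<^sub>R t + c2 z *\<^sub>R x + c3 z *\<^sub>R u + c4 z *\<^sub>R v"
  assume tr: "\<And>f. linear f \<Longrightarrow> lin_trace f = c1 (f t) + c2 (f x) + c3 (f u) + c4 (f v)"
  note ls = l[THEN linear_add] l[THEN linear_scale] l[THEN linear_neg] l[THEN linear_diff]
    l[THEN linear_0]
  note sk = br_skew[of u x] br_skew[of v x] br_skew[of v u] br_skew[of x t] br_skew[of u t]
    br_skew[of v t]
  obtain a1 a2 a3 where tx: "br t x = a1 *\<^sub>R x + a2 *\<^sub>R u + a3 *\<^sub>R v" using t(1) unfolding in_span3 by blast
  obtain b1 b2 b3 where tu: "br t u = b1 *\<^sub>R x + b2 *\<^sub>R u + b3 *\<^sub>R v" using t(2) unfolding in_span3 by blast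
  have "br t v = br (br t x) u + br x (br t u)" using jacobi[of t x u] by (simp add: b)
  then have tv: "br t v = (- a3 * c) *\<^sub>R x + (b3 * y) *\<^sub>R u + (a1 + b2) *\<^sub>R v"
    by (simp add: tx tu b sk algebra_simps)
  have tr0: "a1 + b2 = 0"
    using tr[OF linear_br(1), of t] by (simp add: trace_br tx tu tv ls d)
  show ?thesis
  proof (cases "y = 0")
    case y: False
    have "y *\<^sub>R br t u = br (br t x) v + br x (br t v)" using jacobi[of t x v] by (simp add: b)
    then have e: "y *\<^sub>R br t u = (a2 * c) *\<^sub>R x + (a1 * y) *\<^sub>R u + ((a1 + b2) * y) *\<^sub>R u + (b3 * y) *\<^sub>R v"
      by (simp add: tx tv b sk algebra_simps)
    have e2: "y * b1 = a2 * c" "y * b2 = a1 * y"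
      using arg_cong[OF e, of c2] arg_cong[OF e, of c3] tr0 by (simp_all add: tu ls d)
    then have ab: "a1 = 0" "b2 = 0" using y tr0 by auto
    \<comment> \<open>The coefficients are read off from the inner derivations of
      \<open>x, u, v\<close> so as to cancel the action of \<open>t\<close>.\<close>
    define s where "s = t + ((- b3) *\<^sub>R x + a3 *\<^sub>R u + (a2 / y) *\<^sub>R v)"
    have c0: "br s x = 0" "br s u = 0" "br s v = 0"
      using y e2 by (simp_all add: s_def tx tu tv b sk ab algebra_simps)
        (simp add: field_simps)?
    have "span {s,x,u,v} = UNIV"
      unfolding s_def using sp span_insert_add[of "(- b3) *\<^sub>R x + a3 *\<^sub>R u + (a2 / y) *\<^sub>R v" "{x,u,v}" t]
      unfolding in_span3 by blast
    then have sps: "span {s,x,u,v} = UNIV" "span {x,s,u,v} = UNIV" by (simp_all add: insert_commute)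
    show ?thesis
    proof (cases "c = 0")
      case True
      have "abelian_frame x s u v"
        unfolding abelian_frame_def using True c0 br_skew[of x s]
        by (simp add: b span_zero span_base span_scale)
      then show ?thesis using sps(2) by blast
    next
      case False
      then have "simple_sum_frame s x u v"
        unfolding simple_sum_frame_def using y c0 b by blast
      then show ?thesis using sps(1) by blast
    qed
  next
    case y0: True
    then have c0: "c = 0" using b(4) by simp
    note bb = b[unfolded y0 c0 scale_zero_left]
    have tv0: "br t v = 0" using tv tr0 y0 c0 by simp
    have b2: "b2 = - a1" using tr0 by simp
    \<comment> \<open>The action of \<open>t\<close> modulo the central line of
      \<open>v\<close>.\<close>
    define f where "f z = br t z - c4 (br t z) *\<^sub>R v" for z
    have lf: "linear f" unfolding f_def by (rule linearI) (simp_all add: ls algebra_simps)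
    have fx: "f x = a1 *\<^sub>R x + a2 *\<^sub>R u" by (simp add: f_def tx ls d)
    have fu: "f u = b1 *\<^sub>R x - a1 *\<^sub>R u" by (simp add: f_def tu ls d b2)
    show ?thesis
    proof (cases "a1 \<noteq> 0 \<or> a2 \<noteq> 0 \<or> b1 \<noteq> 0")
      case False
      define s where "s = t + ((- b3) *\<^sub>R x + a3 *\<^sub>R u + 0 *\<^sub>R v)"
      have c0: "br s x = 0" "br s u = 0" "br s v = 0"
        using False by (simp_all add: s_def tx tu tv0 bb sk b2)
      have "span {s,x,u,v} = UNIV"
        unfolding s_def using sp span_insert_add[of "(- b3) *\<^sub>R x + a3 *\<^sub>R u + 0 *\<^sub>R v" "{x,u,v}" t]
        unfolding in_span3 by blast
      then have sps: "span {x,s,u,v} = UNIV" by (simp add: insert_commute)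
      have "abelian_frame x s u v"
        unfolding abelian_frame_def using c0 br_skew[of x s]
        by (simp add: bb span_zero span_base)
      then show ?thesis using sps by blast
    next
      case True
      obtain z where z: "f (f z) = (a1 * a1 + a2 * b1) *\<^sub>R z" "span {z, f z} = span {x, u}"
        by (rule traceless_plane_cyclic[OF lf fx fu True])
      define \<delta> where "\<delta> = a1 * a1 + a2 * b1"
      define w where "w = br t z"
      define \<epsilon> where "\<epsilon> = c4 (br t z)"
      define \<epsilon>' where "\<epsilon>' = c4 (br t (f z))"
      have w: "w = f z + \<epsilon> *\<^sub>R v" by (simp add: w_def f_def \<epsilon>_def)
      have tw: "br t w = \<delta> *\<^sub>R z + \<epsilon>' *\<^sub>R v"
        using z(1) by (simp add: w tv0 \<delta>_def \<epsilon>'_def f_def[of "f z"] algebra_simps)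
      have "z \<in> span {x, u}" "f z \<in> span {x, u}" unfolding z(2)[symmetric] by (auto intro: span_base)
      then obtain p q p' q' where zz: "z = p *\<^sub>R x + q *\<^sub>R u" "f z = p' *\<^sub>R x + q' *\<^sub>R u"
        unfolding in_span2 by blast
      define \<rho> where "\<rho> = p * q' - q * p'"
      have zfz: "br z (f z) = \<rho> *\<^sub>R v"
        by (subst zz(2), subst zz(1)) (simp add: bb sk \<rho>_def algebra_simps)
      have "x \<in> span {z, f z}" "u \<in> span {z, f z}" unfolding z(2) by (auto intro: span_base)
      then obtain p q p' q' where xu: "x = p *\<^sub>R z + q *\<^sub>R f z" "u = p' *\<^sub>R z + q' *\<^sub>R f z"
        unfolding in_span2 by blast
      have "br x u = (p * q' - q * p') *\<^sub>R br z (f z)"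
        by (subst xu(1), subst xu(2)) (simp add: br_skew[of "f z" z] algebra_simps)
      then have "v = ((p * q' - q * p') * \<rho>) *\<^sub>R v" by (simp add: bb zfz)
      then have \<rho>: "\<rho> \<noteq> 0" using d(16) ls(20) by (metis mult_zero_right scale_zero_left zero_neq_one l(4) linear_0)
      have zv: "br z v = 0" "br (f z) v = 0"
        by (subst zz(1), simp add: bb sk) (subst zz(2), simp add: bb sk)
      have wv: "br w v = 0" by (simp add: w zv)
      have zw: "br z w = \<rho> *\<^sub>R v" by (simp add: w zfz zv)
      have sp1: "span {t, z, w, v} = UNIV"
      proof (rule span_eq_UNIV_mono[OF sp])
        let ?T = "span {t, z, w, v}"
        have "w \<in> ?T" "v \<in> ?T" "z \<in> ?T" "t \<in> ?T" by (auto intro: span_base)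
        moreover have "f z = w - \<epsilon> *\<^sub>R v" by (simp add: w)
        ultimately have T: "f z \<in> ?T" "z \<in> ?T" "t \<in> ?T" "v \<in> ?T" by (auto intro: span_diff span_scale)
        have "x \<in> ?T" "u \<in> ?T"
          by (subst xu(1), intro span_add span_scale T) (subst xu(2), intro span_add span_scale T)
        then show "{t,x,u,v} \<subseteq> ?T" using T by simp
      qed
      show ?thesis
      proof (cases "\<delta> = 0")
        case False
        define x' where "x' = z + (\<epsilon>' / \<delta>) *\<^sub>R v"
        have "br t w = \<delta> *\<^sub>R x'" using False by (simp add: tw x'_def algebra_simps)
        then have "oscillator_frame t x' w (\<rho> *\<^sub>R v)"
          unfolding oscillator_frame_def using False zw zv(1) wv tv0
          by (auto simp: x'_def w_def[symmetric] br_skew[of v w])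
        moreover have "span {t, x', w, \<rho> *\<^sub>R v} = UNIV"
        proof (rule span_eq_UNIV_mono[OF sp1])
          let ?T = "span {t, x', w, \<rho> *\<^sub>R v}"
          have T: "t \<in> ?T" "x' \<in> ?T" "w \<in> ?T" "\<rho> *\<^sub>R v \<in> ?T" by (auto intro: span_base)
          have "(1 / \<rho>) *\<^sub>R (\<rho> *\<^sub>R v) \<in> ?T" by (rule span_scale[OF T(4)])
          then have v: "v \<in> ?T" using \<rho> by simp
          then have "x' - (\<epsilon>' / \<delta>) *\<^sub>R v \<in> ?T" using T by (intro span_diff span_scale)
          then show "{t, z, w, v} \<subseteq> ?T" using T v by (simp add: x'_def)
        qed
        ultimately show ?thesis by blast
      next
        case True
        \<comment> \<open>Here \<open>t\<close> and \<open>z\<close> both send \<open>w\<close> to a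
          multiple of \<open>v\<close>; the combination \<open>s\<close> commutes with
          \<open>w\<close>, so \<open>s, w, v\<close> span an abelian ideal.\<close>
        define s where "s = t - (\<epsilon>' / \<rho>) *\<^sub>R z"
        have "br s w = 0" using \<rho> True by (simp add: s_def tw zw)
        moreover have "br s v = 0" by (simp add: s_def tv0 zv)
        moreover have "br z s = - w" by (simp add: s_def br_skew[of z t] w_def)
        ultimately have "abelian_frame z s w v"
          unfolding abelian_frame_def
          by (simp add: wv zw zv span_zero span_base span_scale span_neg)
        moreover have "span {z, s, w, v} = UNIV"
        proof (rule span_eq_UNIV_mono[OF sp1])
          let ?T = "span {z, s, w, v}"
          have T: "s \<in> ?T" "z \<in> ?T" "w \<in> ?T" "v \<in> ?T" by (auto intro: span_base)
          then have "s + (\<epsilon>' / \<rho>) *\<^sub>R z \<in> ?T" by (intro span_add span_scale)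
          then show "{t, z, w, v} \<subseteq> ?T" using T by (simp add: s_def)
        qed
        ultimately show ?thesis by blast
      qed
    qed
  qed
qed

lemma dim4_structure:
  assumes dim: "DIM('a) = 4"
  shows "\<exists>s x u v. span {s,x,u,v} = UNIV \<and>
    (simple_sum_frame s x u v \<or> abelian_frame s x u v \<or> oscillator_frame s x u v)"
proof -
  obtain h t where h: "lie_ideal br h" "dim h = DIM('a) - 1" "t \<notin> h"
    "\<And>x y. br x y \<in> h" "\<And>x. \<exists>r. x - r *\<^sub>R t \<in> h"
    by (rule not_perfect_ideal[OF not_perfect_dim4[OF dim]]) auto
  have d3: "dim h = DIM(real^3)" using h(2) dim by simp
  obtain \<iota> :: "real^3 \<Rightarrow> 'a" and br' where \<iota>: "linear \<iota>" "range \<iota> = h" "unimodular_lie br'"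
    and hom: "\<And>x y. \<iota> (br' x y) = br (\<iota> x) (\<iota> y)"
    using ideal_embedding[OF h(1) d3] by (metis (no_types))
  interpret k: unimodular_lie br' by (rule \<iota>(3))
  have full: "span {t,x,u,v} = UNIV" if "span {x,u,v} = h" for x u v
  proof -
    have "z \<in> span {t,x,u,v}" for z
      using h(5)[of z] unfolding span_insert[of t] that by blast
    then show ?thesis by blast
  qed
  from k.dim3_structure consider "\<forall>x y. br' x y = 0" |
    x u v y c where "span {x,u,v} = UNIV" "br' x u = v" "br' x v = y *\<^sub>R u" "br' u v = c *\<^sub>R x" "c = 0 \<or> y \<noteq> 0"
    by fastforce
  then show ?thesis
  proof cases
    case 1
    have ab: "br a b = 0" if ab: "a \<in> h" "b \<in> h" for a b
    proof -
      obtain a' b' where "a = \<iota> a'" "b = \<iota> b'" using ab \<iota>(2) by blast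
      then show ?thesis using hom[of a' b'] 1 by (simp add: linear_0[OF \<iota>(1)])
    qed
    have "subspace h" "dim h = 3" using h(1,2) dim by (simp_all add: lie_ideal_def)
    then obtain p q r where pqr: "span {p, q, r} = h" by (rule subspace_dim3)
    have "p \<in> h" "q \<in> h" "r \<in> h" unfolding pqr[symmetric] by (auto intro: span_base)
    then have "abelian_frame t p q r" unfolding abelian_frame_def pqr using ab h(4) by blast
    then show ?thesis using full[OF pqr] by blast
  next
    case (2 x u v y c)
    have "span {\<iota> x, \<iota> u, \<iota> v} = h"
      using linear_span_image[OF \<iota>(1), of "{x,u,v}"] 2(1) \<iota>(2) by simp
    note sp = this
    show ?thesis
      by (rule dim4_frame_of_ideal_frame[OF dim full[OF sp], of y c])
        (use 2 hom[of x u] hom[of x v] hom[of u v] h(4) sp in \<open>auto simp: linear_scale[OF \<iota>(1)]\<close>)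
  qed
qed

text \<open>The simple-sum and oscillator frames already show the vanishing pattern of
  \<open>has_ongb4\<close>; the third form has an abelian hyperplane ideal. Together with
  \<open>has_ongb_of_centre\<close> this settles five-dimensional algebras with centre.\<close>

lemma dim4_has_ongb:
  assumes dim: "DIM('a) = 4"
  shows "has_ongb br"
proof -
  obtain s x u v where sp: "span {s,x,u,v} = UNIV"
    and c: "simple_sum_frame s x u v \<or> abelian_frame s x u v \<or> oscillator_frame s x u v"
    using dim4_structure[OF dim] by blast
  from c show ?thesis
  proof (elim disjE)
    assume "simple_sum_frame s x u v"
    then obtain y c where "br x u = v" "br x v = y *\<^sub>R u" "br u v = c *\<^sub>R x" "br s x = 0" "br s u = 0" "br s v = 0"
      unfolding simple_sum_frame_def by blast
    then show ?thesis
      by (intro has_ongb4[OF dim sp, of 0 0 0 0 0 0 0 1 0 y 0 c]) auto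
  next
    assume "abelian_frame s x u v"
    then have "br x u = 0" "br x v = 0" "br u v = 0"
      "br s x \<in> span {x,u,v}" "br s u \<in> span {x,u,v}" "br s v \<in> span {x,u,v}"
      unfolding abelian_frame_def by blast+
    from abelian_ideal_span3[OF dim sp this] show ?thesis by (rule has_ongb_of_abelian_ideal)
  next
    assume "oscillator_frame s x u v"
    then obtain d where "br x u = v" "br x v = 0" "br u v = 0" "br s x = u" "br s u = d *\<^sub>R x" "br s v = 0"
      unfolding oscillator_frame_def by blast
    then show ?thesis
      by (intro has_ongb4[OF dim sp, of 1 0 d 0 0 0 0 1 0 0 0 0]) auto
  qed
qed

section \<open>Extending a four-dimensional ideal by a derivation\<close>

definition has_centre :: bool where
  "has_centre \<longleftrightarrow> (\<exists>z. z \<noteq> 0 \<and> (\<forall>x. br z x = 0))"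

lemma has_centreI:
  assumes "span E = UNIV" "z \<noteq> 0" "\<And>e. e \<in> E \<Longrightarrow> br e z = 0"
  shows has_centre
proof -
  have "br x z = 0" for x
  proof -
    have "x \<in> span E" using assms(1) by simp
    then show ?thesis by (induction rule: span_induct_alt) (use assms(3) in auto)
  qed
  then have "br z x = 0" for x using br_skew[of z x] by simp
  then show ?thesis using assms(2) unfolding has_centre_def by blast
qed

text \<open>The Jacobi identity makes \<open>br t s\<close> a multiple of \<open>s\<close> and gives
  \<open>t\<close> zero diagonal on the simple part, so trace zero leaves nothing for the multiple:
  \<open>s\<close> is central.\<close>

lemma simple_sum_centre:
  assumes dim: "DIM('a) = 5" and sp: "span {t,s,x,u,v} = UNIV" and fr: "simple_sum_frame s x u v"
    and t: "br t s \<in> span {s,x,u,v}" "br t x \<in> span {s,x,u,v}" "br t u \<in> span {s,x,u,v}" "br t v \<in> span {s,x,u,v}"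
  shows has_centre
proof (rule frame5E[OF dim sp])
  fix c1 c2 c3 c4 c5 :: "'a \<Rightarrow> real"
  assume l: "linear c1" "linear c2" "linear c3" "linear c4" "linear c5"
  assume d: "c1 t = 1" "c1 s = 0" "c1 x = 0" "c1 u = 0" "c1 v = 0"
    "c2 t = 0" "c2 s = 1" "c2 x = 0" "c2 u = 0" "c2 v = 0"
    "c3 t = 0" "c3 s = 0" "c3 x = 1" "c3 u = 0" "c3 v = 0"
    "c4 t = 0" "c4 s = 0" "c4 x = 0" "c4 u = 1" "c4 v = 0"
    "c5 t = 0" "c5 s = 0" "c5 x = 0" "c5 u = 0" "c5 v = 1"
  assume tr: "\<And>f. linear f \<Longrightarrow> lin_trace f = c1 (f t) + c2 (f s) + c3 (f x) + c4 (f u) + c5 (f v)"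
  note ls = l[THEN linear_add] l[THEN linear_scale] l[THEN linear_neg] l[THEN linear_diff]
    l[THEN linear_0]
  from fr obtain y c where y: "y \<noteq> 0" "c \<noteq> 0" and b: "br x u = v" "br x v = y *\<^sub>R u" "br u v = c *\<^sub>R x"
    "br s x = 0" "br s u = 0" "br s v = 0"
    unfolding simple_sum_frame_def by blast
  note sk = br_skew[of u x] br_skew[of v x] br_skew[of v u] br_skew[of x s] br_skew[of u s] br_skew[of v s]
  obtain s0 s1 s2 s3 where ts: "br t s = s0 *\<^sub>R s + s1 *\<^sub>R x + s2 *\<^sub>R u + s3 *\<^sub>R v" using t(1) in_span4 by blast
  obtain a0 a1 a2 a3 where tx: "br t x = a0 *\<^sub>R s + a1 *\<^sub>R x + a2 *\<^sub>R u + a3 *\<^sub>R v" using t(2) in_span4 by blast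
  obtain b0 b1 b2 b3 where tu: "br t u = b0 *\<^sub>R s + b1 *\<^sub>R x + b2 *\<^sub>R u + b3 *\<^sub>R v" using t(3) in_span4 by blast
  obtain d0 d1 d2 d3 where tv: "br t v = d0 *\<^sub>R s + d1 *\<^sub>R x + d2 *\<^sub>R u + d3 *\<^sub>R v" using t(4) in_span4 by blast
  have "0 = br (br t s) x + br s (br t x)" "0 = br (br t s) u + br s (br t u)"
    using jacobi[of t s x] jacobi[of t s u] by (simp_all add: b)
  then have j0: "0 = (- s2) *\<^sub>R v + (- s3 * y) *\<^sub>R u" "0 = s1 *\<^sub>R v + (- s3 * c) *\<^sub>R x"
    by (simp_all add: ts tx tu b sk algebra_simps)
  have s0: "s1 = 0" "s2 = 0" "s3 = 0"
    using arg_cong[OF j0(1), of c4] arg_cong[OF j0(1), of c5] arg_cong[OF j0(2), of c5] y by (simp_all add: ls d)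
  have "br t v = br (br t x) u + br x (br t u)" "y *\<^sub>R br t u = br (br t x) v + br x (br t v)"
    "c *\<^sub>R br t x = br (br t u) v + br u (br t v)"
    using jacobi[of t x u] jacobi[of t x v] jacobi[of t u v] by (simp_all add: b)
  note j = this[unfolded tx tu tv]
  have "d3 = a1 + b2" using arg_cong[OF j(1), of c5] by (simp add: b sk ls d)
  moreover have "y * b2 = y * a1 + y * d3" using arg_cong[OF j(2), of c4] by (simp add: b sk ls d mult.commute)
  moreover have "c * a1 = c * b2 + c * d3" using arg_cong[OF j(3), of c3] by (simp add: b sk ls d mult.commute)
  ultimately have z: "a1 = 0" "b2 = 0" "d3 = 0" using y by algebra+
  have "s0 = 0"
    using tr[OF linear_br(1), of t] z by (simp add: trace_br ts tx tu tv ls d)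
  then have "br t s = 0" using ts s0 by simp
  moreover have "s \<noteq> 0" using d(7) ls by (metis l(2) linear_0 zero_neq_one)
  moreover have "br x s = 0" "br u s = 0" "br v s = 0" using b by (simp_all add: sk)
  ultimately show has_centre
    by (intro has_centreI[OF sp]) auto
qed

text \<open>The derivation rule scales \<open>v\<close> by the sum of the diagonal entries of
  \<open>t\<close> at \<open>x\<close> and \<open>u\<close>. Compatibility with \<open>s\<close>
  makes the diagonal entry at \<open>s\<close> zero, so the total trace is twice that sum, and
  \<open>v\<close> is central.\<close>

lemma oscillator_centre:
  assumes dim: "DIM('a) = 5" and sp: "span {t,s,x,u,v} = UNIV" and fr: "oscillator_frame s x u v"
    and t: "br t s \<in> span {s,x,u,v}" "br t x \<in> span {s,x,u,v}" "br t u \<in> span {s,x,u,v}"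
  shows has_centre
proof (rule frame5E[OF dim sp])
  fix c1 c2 c3 c4 c5 :: "'a \<Rightarrow> real"
  assume l: "linear c1" "linear c2" "linear c3" "linear c4" "linear c5"
  assume d: "c1 t = 1" "c1 s = 0" "c1 x = 0" "c1 u = 0" "c1 v = 0"
    "c2 t = 0" "c2 s = 1" "c2 x = 0" "c2 u = 0" "c2 v = 0"
    "c3 t = 0" "c3 s = 0" "c3 x = 1" "c3 u = 0" "c3 v = 0"
    "c4 t = 0" "c4 s = 0" "c4 x = 0" "c4 u = 1" "c4 v = 0"
    "c5 t = 0" "c5 s = 0" "c5 x = 0" "c5 u = 0" "c5 v = 1"
  assume tr: "\<And>f. linear f \<Longrightarrow> lin_trace f = c1 (f t) + c2 (f s) + c3 (f x) + c4 (f u) + c5 (f v)"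
  note ls = l[THEN linear_add] l[THEN linear_scale] l[THEN linear_neg] l[THEN linear_diff]
    l[THEN linear_0]
  from fr obtain e where e: "e \<noteq> 0" and b: "br x u = v" "br x v = 0" "br u v = 0"
    "br s x = u" "br s u = e *\<^sub>R x" "br s v = 0"
    unfolding oscillator_frame_def by blast
  note sk = br_skew[of u x] br_skew[of v x] br_skew[of v u] br_skew[of x s] br_skew[of u s] br_skew[of v s]
  obtain s0 s1 s2 s3 where ts: "br t s = s0 *\<^sub>R s + s1 *\<^sub>R x + s2 *\<^sub>R u + s3 *\<^sub>R v" using t(1) in_span4 by blast
  obtain a0 a1 a2 a3 where tx: "br t x = a0 *\<^sub>R s + a1 *\<^sub>R x + a2 *\<^sub>R u + a3 *\<^sub>R v" using t(2) in_span4 by blast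
  obtain b0 b1 b2 b3 where tu: "br t u = b0 *\<^sub>R s + b1 *\<^sub>R x + b2 *\<^sub>R u + b3 *\<^sub>R v" using t(3) in_span4 by blast
  have tv: "br t v = (a0 * e) *\<^sub>R x + (- b0) *\<^sub>R u + (a1 + b2) *\<^sub>R v"
    using jacobi[of t x u] by (simp add: tx tu b sk algebra_simps)
  have "0 = br (br t x) v + br x (br t v)" "0 = br (br t u) v + br u (br t v)"
    using jacobi[of t x v] jacobi[of t u v] by (simp_all add: b)
  note j0 = this[unfolded tx tu tv]
  have ab: "a0 = 0" "b0 = 0"
    using arg_cong[OF j0(1), of c5] arg_cong[OF j0(2), of c5] e by (simp_all add: b sk ls d)
  have "br t u = br (br t s) x + br s (br t x)" "e *\<^sub>R br t x = br (br t s) u + br s (br t u)"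
    using jacobi[of t s x] jacobi[of t s u] by (simp_all add: b)
  note j = this[unfolded ts tx tu]
  have "b2 = s0 + a1" using arg_cong[OF j(1), of c4] by (simp add: b sk ls d)
  moreover have "e * a1 = e * s0 + e * b2" using arg_cong[OF j(2), of c3] by (simp add: b sk ls d mult.commute)
  moreover have "s0 + a1 + b2 + (a1 + b2) = 0"
    using tr[OF linear_br(1), of t] by (simp add: trace_br ts tx tu tv ls d)
  ultimately have "a1 + b2 = 0" using e by algebra
  then have "br t v = 0" using tv ab by simp
  moreover have "v \<noteq> 0" using d(25) ls by (metis l(5) linear_0 zero_neq_one)
  ultimately show has_centre
    using b(2,3,6) by (intro has_centreI[OF sp]) auto
qed

text \<open>\<open>t\<close> scales \<open>z\<close> by its trace \<open>L\<close> on the plane of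
  \<open>x, y\<close>, so its entry at \<open>w\<close> is \<open>- 2 L\<close>. If
  \<open>L = 0\<close>, then \<open>z\<close> is central; otherwise \<open>t\<close> can be rescaled
  and the frame normalised.\<close>

lemma heisenberg_nilradical:
  assumes dim: "DIM('a) = 5" and sp: "span {t,x,y,z,w} = UNIV"
    and b: "br x y = z" "br x z = 0" "br x w = 0" "br y z = 0" "br y w = 0" "br z w = 0"
    and t: "br t x \<in> span {x,y,z,w}" "br t y \<in> span {x,y,z,w}" "br t w \<in> span {x,y,z,w}"
  shows "has_centre \<or> heisenberg_extension br"
proof (rule frame5E[OF dim sp])
  fix c1 c2 c3 c4 c5 :: "'a \<Rightarrow> real"
  assume l: "linear c1" "linear c2" "linear c3" "linear c4" "linear c5"
  assume d: "c1 t = 1" "c1 x = 0" "c1 y = 0" "c1 z = 0" "c1 w = 0"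
    "c2 t = 0" "c2 x = 1" "c2 y = 0" "c2 z = 0" "c2 w = 0"
    "c3 t = 0" "c3 x = 0" "c3 y = 1" "c3 z = 0" "c3 w = 0"
    "c4 t = 0" "c4 x = 0" "c4 y = 0" "c4 z = 1" "c4 w = 0"
    "c5 t = 0" "c5 x = 0" "c5 y = 0" "c5 z = 0" "c5 w = 1"
  assume ex: "\<And>u. u = c1 u *\<^sub>R t + c2 u *\<^sub>R x + c3 u *\<^sub>R y + c4 u *\<^sub>R z + c5 u *\<^sub>R w"
  assume tr: "\<And>f. linear f \<Longrightarrow> lin_trace f = c1 (f t) + c2 (f x) + c3 (f y) + c4 (f z) + c5 (f w)"
  note ls = l[THEN linear_add] l[THEN linear_scale] l[THEN linear_neg] l[THEN linear_diff]
    l[THEN linear_0]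
  note sk = br_skew[of y x] br_skew[of z x] br_skew[of w x] br_skew[of z y] br_skew[of w y] br_skew[of w z]
  obtain x1 x2 x3 x4 where tx: "br t x = x1 *\<^sub>R x + x2 *\<^sub>R y + x3 *\<^sub>R z + x4 *\<^sub>R w" using t(1) in_span4 by blast
  obtain y1 y2 y3 y4 where ty: "br t y = y1 *\<^sub>R x + y2 *\<^sub>R y + y3 *\<^sub>R z + y4 *\<^sub>R w" using t(2) in_span4 by blast
  obtain w1 w2 w3 w4 where tw: "br t w = w1 *\<^sub>R x + w2 *\<^sub>R y + w3 *\<^sub>R z + w4 *\<^sub>R w" using t(3) in_span4 by blast
  define L where "L = x1 + y2"
  have tz: "br t z = L *\<^sub>R z"
    using jacobi[of t x y] by (simp add: tx ty b sk L_def algebra_simps)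
  have "0 = br (br t x) w + br x (br t w)" "0 = br (br t y) w + br y (br t w)"
    using jacobi[of t x w] jacobi[of t y w] by (simp_all add: b)
  note j0 = this[unfolded tx ty tw]
  have w12: "w1 = 0" "w2 = 0"
    using arg_cong[OF j0(1), of c4] arg_cong[OF j0(2), of c4] by (simp_all add: b sk ls d)
  have w4: "w4 = - 2 * L"
    using tr[OF linear_br(1), of t] by (simp add: trace_br tx ty tw tz ls d L_def)
  have z0: "z \<noteq> 0" using d(19) by (metis l(4) linear_0 zero_neq_one)
  show ?thesis
  proof (cases "L = 0")
    case True
    have has_centre
    proof -
      have "br t z = 0" "br w z = 0" using True tz b by (simp_all add: sk)
      then show ?thesis using b(2,4) by (intro has_centreI[OF sp z0]) auto
    qed
    then show ?thesis ..
  next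
    case L: False
    define t' where "t' = (2 / L) *\<^sub>R t"
    \<comment> \<open>An eigenvector of \<open>t\<close>; the denominator is the difference of the
      eigenvalues \<open>L\<close> on \<open>z\<close> and \<open>- 2 L\<close>.\<close>
    define w' where "w' = w - (w3 / (3 * L)) *\<^sub>R z"
    have t'z: "br t' z = 2 *\<^sub>R z" using L by (simp add: t'_def tz)
    have t'w: "br t' w' = - 4 *\<^sub>R w'"
    proof -
      have "br t w' = (- 2 * L) *\<^sub>R w'"
        using L by (simp add: w'_def tw tz w12 w4 algebra_simps) (simp add: field_simps flip: scaleR_add_left)?
      then show ?thesis using L by (simp add: t'_def)
    qed
    \<comment> \<open>The action of \<open>t'\<close> minus the identity on the plane modulo
      \<open>z\<close> and \<open>w\<close>, of trace 2 - 2 = 0. A cyclic vector and its image make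
      it antidiagonal, which gives \<open>t'\<close> the diagonal entries 1, 1.\<close>
    define f where "f p = (c2 (br t' p) - c2 p) *\<^sub>R x + (c3 (br t' p) - c3 p) *\<^sub>R y" for p
    have lf: "linear f" unfolding f_def by (rule linearI) (simp_all add: ls algebra_simps)
    define a where "a = 2 * x1 / L - 1"
    have ya: "2 * y2 / L - 1 = - a" using L by (simp add: a_def L_def field_simps)
    have fx: "f x = a *\<^sub>R x + (2 * x2 / L) *\<^sub>R y" by (simp add: f_def t'_def tx ls d a_def)
    have "f y = (2 * y1 / L) *\<^sub>R x + (2 * y2 / L - 1) *\<^sub>R y" by (simp add: f_def t'_def ty ls d)
    then have fy: "f y = (2 * y1 / L) *\<^sub>R x - a *\<^sub>R y" unfolding ya by simp
    have "\<exists>x' y' p q. span {x', y'} = span {x, y} \<and> f x' = p *\<^sub>R y' \<and> f y' = q *\<^sub>R x'"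
    proof (cases "a \<noteq> 0 \<or> 2 * x2 / L \<noteq> 0 \<or> 2 * y1 / L \<noteq> 0")
      case True
      obtain u where "f (f u) = (a * a + 2 * x2 / L * (2 * y1 / L)) *\<^sub>R u" "span {u, f u} = span {x, y}"
        by (rule traceless_plane_cyclic[OF lf fx fy True])
      then have "span {u, f u} = span {x, y} \<and> f u = 1 *\<^sub>R f u \<and>
        f (f u) = (a * a + 2 * x2 / L * (2 * y1 / L)) *\<^sub>R u" by simp
      then show ?thesis by blast
    next
      case False
      then have "span {x, y} = span {x, y} \<and> f x = 0 *\<^sub>R y \<and> f y = 0 *\<^sub>R x" by (simp add: fx fy)
      then show ?thesis by blast
    qed
    then obtain x' y' p q where xy: "span {x', y'} = span {x, y}" "f x' = p *\<^sub>R y'" "f y' = q *\<^sub>R x'" by blast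
    have "x' \<in> span {x, y}" "y' \<in> span {x, y}" unfolding xy(1)[symmetric] by (auto intro: span_base)
    then obtain a1 a2 b1 b2 where xy': "x' = a1 *\<^sub>R x + a2 *\<^sub>R y" "y' = b1 *\<^sub>R x + b2 *\<^sub>R y"
      unfolding in_span2 by blast
    have "x \<in> span {x', y'}" "y \<in> span {x', y'}" unfolding xy(1) by (auto intro: span_base)
    then obtain e1 e2 g1 g2 where yx: "x = e1 *\<^sub>R x' + e2 *\<^sub>R y'" "y = g1 *\<^sub>R x' + g2 *\<^sub>R y'"
      unfolding in_span2 by blast
    define z' where "z' = br x' y'"
    have z'1: "z' = (a1 * b2 - a2 * b1) *\<^sub>R z" unfolding z'_def xy' by (simp add: b sk algebra_simps)
    have "br x y = (e1 * g2 - e2 * g1) *\<^sub>R z'"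
      by (subst yx(1), subst yx(2)) (simp add: z'_def br_skew[of y' x'] algebra_simps)
    then have z'2: "z = (e1 * g2 - e2 * g1) *\<^sub>R z'" by (simp add: b)
    have t'f: "br t' u = u + f u + c4 (br t' u) *\<^sub>R z + c5 (br t' u) *\<^sub>R w"
      if u: "u = r1 *\<^sub>R x + r2 *\<^sub>R y" for u r1 r2
    proof -
      have c1: "c1 (br t' u) = 0" unfolding u by (simp add: t'_def tx ty ls d)
      have "u = c2 u *\<^sub>R x + c3 u *\<^sub>R y" unfolding u by (simp add: ls d)
      then have "u + f u = c2 (br t' u) *\<^sub>R x + c3 (br t' u) *\<^sub>R y" by (simp add: f_def algebra_simps)
      then show ?thesis using ex[of "br t' u"] c1 by simp
    qed
    have exzw: "\<exists>r s. m *\<^sub>R z + n *\<^sub>R w = r *\<^sub>R z' + s *\<^sub>R w'" for m n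
    proof -
      have "m *\<^sub>R z + n *\<^sub>R w = (m + n * (w3 / (3 * L))) *\<^sub>R z + n *\<^sub>R w'"
        by (simp add: w'_def algebra_simps)
      also have "\<dots> = ((m + n * (w3 / (3 * L))) * (e1 * g2 - e2 * g1)) *\<^sub>R z' + n *\<^sub>R w'"
        by (subst z'2) simp
      finally show ?thesis by blast
    qed
    obtain r1 s1 where 1: "c4 (br t' x') *\<^sub>R z + c5 (br t' x') *\<^sub>R w = r1 *\<^sub>R z' + s1 *\<^sub>R w'" using exzw by blast
    obtain r2 s2 where 2: "c4 (br t' y') *\<^sub>R z + c5 (br t' y') *\<^sub>R w = r2 *\<^sub>R z' + s2 *\<^sub>R w'" using exzw by blast
    have tx': "br t' x' = x' + p *\<^sub>R y' + r1 *\<^sub>R z' + s1 *\<^sub>R w'"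
      using t'f[OF xy'(1)] 1 xy(2) by (simp add: add.assoc)
    have ty': "br t' y' = q *\<^sub>R x' + y' + r2 *\<^sub>R z' + s2 *\<^sub>R w'"
      using t'f[OF xy'(2)] 2 xy(3) by (simp add: add.assoc add.left_commute)
    have "span {t', x', y', z', w'} = UNIV"
    proof (rule span_eq_UNIV_mono[OF sp])
      let ?T = "span {t', x', y', z', w'}"
      have T: "t' \<in> ?T" "x' \<in> ?T" "y' \<in> ?T" "z' \<in> ?T" "w' \<in> ?T" by (auto intro: span_base)
      have "t = (L / 2) *\<^sub>R t'" using L by (simp add: t'_def)
      moreover have "z \<in> ?T" by (subst z'2) (intro span_scale T)
      moreover have "w = w' + (w3 / (3 * L)) *\<^sub>R z" by (simp add: w'_def)
      moreover have "x \<in> ?T" "y \<in> ?T" by (subst yx, intro span_add span_scale T)+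
      ultimately show "{t,x,y,z,w} \<subseteq> ?T" using T by (auto intro!: span_add span_scale)
    qed
    moreover have "br t' z' = 2 *\<^sub>R z'" unfolding z'1 by (simp add: t'z)
    moreover have "br x' z' = 0" "br x' w' = 0" "br y' z' = 0" "br y' w' = 0" "br z' w' = 0"
      unfolding z'1 w'_def xy' by (simp_all add: b sk)
    ultimately have "heisenberg_extension br"
      unfolding heisenberg_extension_def using tx' ty' t'w z'_def[symmetric] by blast
    then show ?thesis ..
  qed
qed

text \<open>Trace zero leaves one scale for the weights. If it is zero, \<open>w\<close> is central;
  otherwise the weights 3, -4, -1, 2 are distinct and the action can be diagonalised.\<close>

lemma filiform_nilradical:
  assumes dim: "DIM('a) = 5" and sp: "span {t,x,y,z,w} = UNIV"
    and b: "br x y = z" "br x z = w" "br x w = 0" "br y z = 0" "br y w = 0" "br z w = 0"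
    and t: "br t x \<in> span {x,y,z,w}" "br t y \<in> span {x,y,z,w}"
  shows "has_centre \<or> filiform_extension br"
proof (rule frame5E[OF dim sp])
  fix c1 c2 c3 c4 c5 :: "'a \<Rightarrow> real"
  assume l: "linear c1" "linear c2" "linear c3" "linear c4" "linear c5"
  assume d: "c1 t = 1" "c1 x = 0" "c1 y = 0" "c1 z = 0" "c1 w = 0"
    "c2 t = 0" "c2 x = 1" "c2 y = 0" "c2 z = 0" "c2 w = 0"
    "c3 t = 0" "c3 x = 0" "c3 y = 1" "c3 z = 0" "c3 w = 0"
    "c4 t = 0" "c4 x = 0" "c4 y = 0" "c4 z = 1" "c4 w = 0"
    "c5 t = 0" "c5 x = 0" "c5 y = 0" "c5 z = 0" "c5 w = 1"
  assume tr: "\<And>f. linear f \<Longrightarrow> lin_trace f = c1 (f t) + c2 (f x) + c3 (f y) + c4 (f z) + c5 (f w)"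
  note ls = l[THEN linear_add] l[THEN linear_scale] l[THEN linear_neg] l[THEN linear_diff]
    l[THEN linear_0]
  note sk = br_skew[of y x] br_skew[of z x] br_skew[of w x] br_skew[of z y] br_skew[of w y] br_skew[of w z]
  obtain x1 x2 x3 x4 where tx: "br t x = x1 *\<^sub>R x + x2 *\<^sub>R y + x3 *\<^sub>R z + x4 *\<^sub>R w" using t(1) in_span4 by blast
  obtain y1 y2 y3 y4 where ty: "br t y = y1 *\<^sub>R x + y2 *\<^sub>R y + y3 *\<^sub>R z + y4 *\<^sub>R w" using t(2) in_span4 by blast
  have tz: "br t z = (x1 + y2) *\<^sub>R z + y3 *\<^sub>R w"
    using jacobi[of t x y] by (simp add: tx ty b sk algebra_simps)
  have tw: "br t w = (x1 + (x1 + y2)) *\<^sub>R w"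
  proof -
    have "br t w = x1 *\<^sub>R w + (x1 + y2) *\<^sub>R w"
      using jacobi[of t x z] by (simp add: tx tz b sk)
    then show ?thesis by (simp only: scaleR_add_left)
  qed
  have "0 = br (br t y) z + br y (br t z)" using jacobi[of t y z] by (simp add: b)
  note j0 = this[unfolded ty tz]
  have y1: "y1 = 0" using arg_cong[OF j0, of c5] by (simp add: b sk ls d)
  have tr0: "4 * x1 + 3 * y2 = 0"
    using tr[OF linear_br(1), of t] by (simp add: trace_br tx ty tw tz ls d)
  have w0: "w \<noteq> 0" using d(25) by (metis l(5) linear_0 zero_neq_one)
  show ?thesis
  proof (cases "x1 = 0")
    case True
    have has_centre
    proof -
      have "br t w = 0" using True tr0 tw by simp
      then show ?thesis using b(3,5,6) by (intro has_centreI[OF sp w0]) auto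
    qed
    then show ?thesis ..
  next
    case False
    define k where "k = 3 / x1"
    have k: "k * x1 = 3" "k * y2 = - 4" "k \<noteq> 0" using False tr0 by (simp_all add: k_def field_simps)
    define t' where "t' = k *\<^sub>R t"
    define p2 p3 p4 q3 q4 where pq: "p2 = k * x2" "p3 = k * x3" "p4 = k * x4" "q3 = k * y3" "q4 = k * y4"
    have t': "br t' x = 3 *\<^sub>R x + p2 *\<^sub>R y + p3 *\<^sub>R z + p4 *\<^sub>R w" "br t' y = (- 4) *\<^sub>R y + q3 *\<^sub>R z + q4 *\<^sub>R w"
      "br t' z = (- 1) *\<^sub>R z + q3 *\<^sub>R w" "br t' w = 2 *\<^sub>R w"
      by (simp_all only: t'_def br_scaleR tx ty tz tw y1 scaleR_add_right scaleR_scaleR distrib_left k pq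
          scale_zero_left add_0 mult.left_commute[of k 2]) (simp_all add: k)
    \<comment> \<open>Successive corrections towards eigenvectors. The divisors 3, 6 here and 7, 4,
      1 for \<open>m\<close>, \<open>n\<close>, \<open>r\<close> are, up to sign, the differences of
      the weights.\<close>
    define h g where hg: "h = - q3 / 3" "g = - (q4 + h * q3) / 6"
    have hg': "q3 = - 3 * h" "q4 = - 6 * g - h * q3" by (simp add: hg(1)) (simp add: hg(2) field_simps)
    define m n r where mnr: "m = p2 / 7" "n = (p3 + m * q3) / 4" "r = p4 + m * q4 + n * q3"
    have mnr': "p2 = 7 * m" "p3 = 4 * n - m * q3" "p4 = r - m * q4 - n * q3"
      by (simp add: mnr(1)) (simp add: mnr(2) field_simps, simp add: mnr(3))
    define y' where "y' = y + h *\<^sub>R z + g *\<^sub>R w"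
    define x' where "x' = x + m *\<^sub>R y + n *\<^sub>R z + r *\<^sub>R w"
    have ty': "br t' y' = - 4 *\<^sub>R y'"
      by (rule euclidean_eqI, unfold y'_def br_add br_scaleR t' inner_add_left inner_scaleR_left)
        (use hg' in algebra)
    have tx': "br t' x' = 3 *\<^sub>R x'"
      by (rule euclidean_eqI, unfold x'_def br_add br_scaleR t' inner_add_left inner_scaleR_left)
        (use mnr' in algebra)
    define z' where "z' = z + h *\<^sub>R w"
    have x'y': "br x' y' = z'" by (simp add: x'_def y'_def z'_def b sk)
    have x'z': "br x' z' = w" by (simp add: x'_def z'_def b sk)
    have tz': "br t' z' = - z'"
    proof -
      have "br t' z' = 3 *\<^sub>R z' - 4 *\<^sub>R z'"
        using jacobi[of t' x' y'] by (simp add: x'y' tx' ty')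
      also have "\<dots> = (- 1) *\<^sub>R z'" by (simp flip: scaleR_diff_left)
      finally show ?thesis by simp
    qed
    have "span {t', x', y', z', w} = UNIV"
    proof (rule span_eq_UNIV_mono[OF sp])
      let ?T = "span {t', x', y', z', w}"
      have T: "t' \<in> ?T" "x' \<in> ?T" "y' \<in> ?T" "z' \<in> ?T" "w \<in> ?T" by (auto intro: span_base)
      have "t = (1 / k) *\<^sub>R t'" using k by (simp add: t'_def)
      then have tT: "t \<in> ?T" using T by (auto intro: span_scale)
      have "z = z' - h *\<^sub>R w" by (simp add: z'_def)
      then have zT: "z \<in> ?T" using T by (auto intro: span_scale span_diff)
      have "y = y' - h *\<^sub>R z - g *\<^sub>R w" by (simp add: y'_def)
      then have yT: "y \<in> ?T" using T zT by (auto intro!: span_scale span_diff)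
      have "x = x' - m *\<^sub>R y - n *\<^sub>R z - r *\<^sub>R w" by (simp add: x'_def)
      then have "x \<in> ?T" using T zT yT by (auto intro!: span_scale span_diff)
      then show "{t,x,y,z,w} \<subseteq> ?T" using tT zT yT T by simp
    qed
    moreover have "br x' w = 0" "br y' z' = 0" "br y' w = 0" "br z' w = 0"
      by (simp_all add: x'_def y'_def z'_def b sk)
    ultimately have "filiform_extension br"
      unfolding filiform_extension_def using x'y' x'z' tx' ty' tz' t'(4) by blast
    then show ?thesis ..
  qed
qed

end

section \<open>Structure in dimension five\<close>

lemma independent3_span:
  fixes p q r :: "'a::euclidean_space"
  assumes "DIM('a) = 3"
    and ind: "\<And>a b c. a *\<^sub>R p + b *\<^sub>R q + c *\<^sub>R r = 0 \<Longrightarrow> a = 0 \<and> b = 0 \<and> c = 0"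
  shows "span {p, q, r} = UNIV"
proof -
  have d: "p \<noteq> q" "p \<noteq> r" "q \<noteq> r"
    using ind[of 1 "-1" 0] ind[of 1 0 "-1"] ind[of 0 1 "-1"] by auto
  have "independent {p, q, r}"
    unfolding independent_explicit
  proof (intro conjI allI impI)
    fix f assume "(\<Sum>v\<in>{p, q, r}. f v *\<^sub>R v) = 0"
    then have "f p *\<^sub>R p + f q *\<^sub>R q + f r *\<^sub>R r = 0" using d by (simp add: add.assoc)
    from ind[OF this] show "\<forall>v\<in>{p, q, r}. f v = 0" by simp
  qed simp
  then have "UNIV \<subseteq> span {p, q, r}"
    by (intro card_ge_dim_independent) (use assms(1) d in auto)
  then show ?thesis by blast
qed

text \<open>After division by \<open>a\<close>, the cube dominates the other terms at distance
  \<open>M\<close> from 0, so the polynomial changes sign between \<open>- M\<close> and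
  \<open>M\<close>.\<close>

lemma real_cubic_root:
  fixes a b c d :: real
  assumes "a \<noteq> 0"
  shows "\<exists>x. a * x^3 + b * x\<^sup>2 + c * x + d = 0"
proof -
  define B C D where bcd: "B = b / a" "C = c / a" "D = d / a"
  define M where "M = 1 + \<bar>B\<bar> + \<bar>C\<bar> + \<bar>D\<bar>"
  have M: "M \<ge> 1" by (simp add: M_def)
  have bound: "\<bar>B * x\<^sup>2 + C * x + D\<bar> < M^3" if x: "\<bar>x\<bar> = M" for x
  proof -
    have M2: "M \<le> M\<^sup>2" "1 \<le> M\<^sup>2" "x\<^sup>2 = M\<^sup>2"
      using M self_le_power[of M 2] one_le_power[of M 2] power2_abs[of x] x by auto
    have "\<bar>B * x\<^sup>2 + C * x + D\<bar> \<le> \<bar>B\<bar> * M\<^sup>2 + \<bar>C\<bar> * M + \<bar>D\<bar>"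
      using abs_triangle_ineq[of "B * x\<^sup>2 + C * x" D] abs_triangle_ineq[of "B * x\<^sup>2" "C * x"] M2(3) x
      by (simp add: abs_mult)
    also have "\<dots> \<le> \<bar>B\<bar> * M\<^sup>2 + \<bar>C\<bar> * M\<^sup>2 + \<bar>D\<bar> * M\<^sup>2"
      using M2 mult_left_mono[of M "M\<^sup>2" "\<bar>C\<bar>"] mult_left_mono[of 1 "M\<^sup>2" "\<bar>D\<bar>"] by simp
    also have "\<dots> = M^3 - M\<^sup>2" by (simp add: M_def power2_eq_square power3_eq_cube algebra_simps)
    also have "\<dots> < M^3" using M by simp
    finally show ?thesis .
  qed
  define p where "p x = x^3 + (B * x\<^sup>2 + C * x + D)" for x
  have "\<exists>x\<ge>- M. x \<le> M \<and> p x = 0"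
  proof (rule IVT')
    show "p (- M) \<le> 0" using bound[of "- M"] M by (simp add: p_def)
    show "0 \<le> p M" using bound[of M] M by (simp add: p_def)
    show "continuous_on {- M..M} p" unfolding p_def by (intro continuous_intros)
  qed (use M in simp)
  then obtain x where "p x = 0" by blast
  then have "a * x^3 + (a * B) * x\<^sup>2 + (a * C) * x + a * D = 0"
    by (simp add: p_def mult.assoc flip: distrib_left)
  then show ?thesis using assms by (intro exI[of _ x]) (simp add: bcd)
qed

text \<open>The Jordan types 1+1+1, 2+1 and 3, with Jordan bases.\<close>

lemma cube_zero_cases:
  fixes A :: "'a::euclidean_space \<Rightarrow> 'a"
  assumes dim: "DIM('a) = 3" and A: "linear A" and cube: "\<And>x. A (A (A x)) = 0"
  shows "(\<forall>x. A x = 0) \<or> (\<exists>y w. span {y, A y, w} = UNIV \<and> A (A y) = 0 \<and> A w = 0)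
    \<or> (\<exists>y. span {y, A y, A (A y)} = UNIV)"
proof (cases "\<exists>y. A (A y) \<noteq> 0")
  case True
  then obtain y where y: "A (A y) \<noteq> 0" by blast
  have "span {y, A y, A (A y)} = UNIV"
  proof (rule independent3_span[OF dim])
    fix a b c assume e: "a *\<^sub>R y + b *\<^sub>R A y + c *\<^sub>R A (A y) = 0"
    note ls = linear_add[OF A] linear_scale[OF A] linear_0[OF A] cube
    have "A (A (a *\<^sub>R y + b *\<^sub>R A y + c *\<^sub>R A (A y))) = 0" using e by (simp add: linear_0[OF A])
    then have a: "a = 0" using y by (simp add: ls)
    have "A (a *\<^sub>R y + b *\<^sub>R A y + c *\<^sub>R A (A y)) = 0" using e by (simp add: linear_0[OF A])
    then have b: "b = 0" using y a by (simp add: ls)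
    show "a = 0 \<and> b = 0 \<and> c = 0" using a b e y by simp
  qed
  then show ?thesis by blast
next
  case False
  then have sq: "A (A x) = 0" for x by blast
  show ?thesis
  proof (cases "\<forall>x. A x = 0")
    case False
    then obtain y where y: "A y \<noteq> 0" by blast
    have "\<exists>w. A w = 0 \<and> w \<notin> span {A y}"
    proof (rule ccontr)
      assume "\<not> ?thesis"
      then have ker: "A w = 0 \<Longrightarrow> w \<in> span {A y}" for w by blast
      have "UNIV \<subseteq> span {y, A y}"
      proof
        fix x
        obtain r where r: "A x = r *\<^sub>R A y" using ker[OF sq] by (auto simp: span_singleton)
        then have "A (x - r *\<^sub>R y) = 0" by (simp add: linear_diff[OF A] linear_scale[OF A])
        then obtain s where "x - r *\<^sub>R y = s *\<^sub>R A y" using ker by (auto simp: span_singleton)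
        then have "x = r *\<^sub>R y + s *\<^sub>R A y" by (simp add: algebra_simps)
        then show "x \<in> span {y, A y}" unfolding in_span2 by blast
      qed
      then have "dim (UNIV :: 'a set) \<le> card {y, A y}" by (rule dim_le_card) simp
      also have "\<dots> \<le> 2" by (simp add: card_insert_if)
      finally show False using dim by simp
    qed
    then obtain w where w: "A w = 0" "w \<notin> span {A y}" by blast
    have "span {y, A y, w} = UNIV"
    proof (rule independent3_span[OF dim])
      fix a b c assume e: "a *\<^sub>R y + b *\<^sub>R A y + c *\<^sub>R w = 0"
      have "A (a *\<^sub>R y + b *\<^sub>R A y + c *\<^sub>R w) = 0" using e by (simp add: linear_0[OF A])
      then have a: "a = 0" using y by (simp add: linear_add[OF A] linear_scale[OF A] sq w)
      have c: "c = 0"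
      proof (rule ccontr)
        assume c: "c \<noteq> 0"
        have "c *\<^sub>R w = (- b) *\<^sub>R A y" using e a by (simp add: add_eq_0_iff)
        then have "(1 / c) *\<^sub>R (c *\<^sub>R w) = (1 / c) *\<^sub>R ((- b) *\<^sub>R A y)" by simp
        then have "w = (- b / c) *\<^sub>R A y" using c by simp
        then show False using w(2) span_scale[OF span_base[of "A y" "{A y}"], of "- b / c"] by simp
      qed
      show "a = 0 \<and> b = 0 \<and> c = 0" using a c e y by simp
    qed
    then show ?thesis using sq w by blast
  qed blast
qed

text \<open>A pencil of traceless commuting operators on a 3-space contains a singular one \<open>C\<close>; it
  satisfies \<open>C\<^sup>3 = \<epsilon> C\<close>, and \<open>\<epsilon> \<noteq> 0\<close> as \<open>C\<close> is not nilpotent. The sign of \<open>\<epsilon>\<close> decides between the split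
  torus and the one containing rotations.\<close>

lemma commuting_pair_normal_form:
  fixes A D :: "'a::euclidean_space \<Rightarrow> 'a"
  assumes dim: "DIM('a) = 3" and A: "linear A" and D: "linear D" and comm: "\<And>x. A (D x) = D (A x)"
    and tA: "lin_trace A = 0" and tD: "lin_trace D = 0"
    and nil: "\<And>\<alpha> \<beta>. \<alpha> \<noteq> 0 \<or> \<beta> \<noteq> 0 \<Longrightarrow> \<exists>C x. (\<forall>x. C x = \<alpha> *\<^sub>R A x + \<beta> *\<^sub>R D x) \<and> C (C (C x)) \<noteq> 0"
  shows "\<exists>a1 b1 a2 b2 f3 f4 f5. span {f3, f4, f5} = UNIV \<and> a1 * b2 - a2 * b1 \<noteq> 0 \<and>
    a1 *\<^sub>R A f3 + b1 *\<^sub>R D f3 = - 2 *\<^sub>R f3 \<and> a1 *\<^sub>R A f4 + b1 *\<^sub>R D f4 = f4 \<and> a1 *\<^sub>R A f5 + b1 *\<^sub>R D f5 = f5 \<and>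
    a2 *\<^sub>R A f3 + b2 *\<^sub>R D f3 = 0 \<and>
    (a2 *\<^sub>R A f4 + b2 *\<^sub>R D f4 = f4 \<and> a2 *\<^sub>R A f5 + b2 *\<^sub>R D f5 = - f5 \<or>
     a2 *\<^sub>R A f4 + b2 *\<^sub>R D f4 = - f5 \<and> a2 *\<^sub>R A f5 + b2 *\<^sub>R D f5 = f4)"
proof -
  note lA = linear_add[OF A] linear_scale[OF A] linear_diff[OF A] linear_0[OF A]
  note lD = linear_add[OF D] linear_scale[OF D] linear_diff[OF D] linear_0[OF D]
  define N where "N \<alpha> \<beta> x = \<alpha> *\<^sub>R A x + \<beta> *\<^sub>R D x" for \<alpha> \<beta> x
  have lN: "linear (N \<alpha> \<beta>)" for \<alpha> \<beta>
    unfolding N_def by (rule linearI) (simp_all add: lA lD algebra_simps)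
  have nilN: "\<exists>x. N \<alpha> \<beta> (N \<alpha> \<beta> (N \<alpha> \<beta> x)) \<noteq> 0" if "\<alpha> \<noteq> 0 \<or> \<beta> \<noteq> 0" for \<alpha> \<beta>
    using nil[OF that] by (auto simp: N_def)
  have trN: "lin_trace (N \<alpha> \<beta>) = 0" for \<alpha> \<beta>
    unfolding N_def by (simp add: lin_trace_add lin_trace_scaleR tA tD)
  \<comment> \<open>For a traceless operator on a 3-space the trace of the cube is three times the
    determinant. On the pencil it is a binary cubic form, which has a real zero.\<close>
  have "\<exists>\<alpha> \<beta>. (\<alpha> \<noteq> 0 \<or> \<beta> \<noteq> 0) \<and> lin_trace (\<lambda>x. N \<alpha> \<beta> (N \<alpha> \<beta> (N \<alpha> \<beta> x))) = 0"
  proof (cases "lin_trace (\<lambda>x. A (A (A x))) = 0")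
    case True
    then show ?thesis by (intro exI[of _ 1] exI[of _ 0]) (simp add: N_def)
  next
    case False
    have "N \<alpha> 1 (N \<alpha> 1 (N \<alpha> 1 x)) = \<alpha>^3 *\<^sub>R A (A (A x)) + \<alpha>\<^sup>2 *\<^sub>R (3 *\<^sub>R D (A (A x)))
        + \<alpha> *\<^sub>R (3 *\<^sub>R D (D (A x))) + D (D (D x))" for \<alpha> x
      by (rule euclidean_eqI)
        (simp add: N_def lA lD comm inner_add_left power2_eq_square power3_eq_cube algebra_simps)
    then have "lin_trace (\<lambda>x. N \<alpha> 1 (N \<alpha> 1 (N \<alpha> 1 x))) = lin_trace (\<lambda>x. A (A (A x))) * \<alpha>^3
        + 3 * lin_trace (\<lambda>x. D (A (A x))) * \<alpha>\<^sup>2 + 3 * lin_trace (\<lambda>x. D (D (A x))) * \<alpha>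
        + lin_trace (\<lambda>x. D (D (D x)))" for \<alpha>
      by (simp add: lin_trace_add lin_trace_scaleR algebra_simps)
    then show ?thesis using real_cubic_root[OF False] by (metis zero_neq_one)
  qed
  then obtain \<alpha> \<beta> where ab: "\<alpha> \<noteq> 0 \<or> \<beta> \<noteq> 0"
    and t3: "lin_trace (\<lambda>x. N \<alpha> \<beta> (N \<alpha> \<beta> (N \<alpha> \<beta> x))) = 0" by blast
  define C where "C = N \<alpha> \<beta>"
  have lC: "linear C" unfolding C_def by (rule lN)
  note ls = linear_add[OF lC] linear_scale[OF lC] linear_diff[OF lC] linear_0[OF lC]
  have CA: "A (C x) = C (A x)" "D (C x) = C (D x)" for x by (simp_all add: C_def N_def lA lD comm)
  define \<epsilon> where "\<epsilon> = lin_trace (\<lambda>x. C (C x)) / 2"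
  have C3: "C (C (C x)) = \<epsilon> *\<^sub>R C x" for x
    using cayley_hamilton3[OF dim lC, of x] trN t3 by (simp add: C_def \<epsilon>_def)
  have \<epsilon>: "\<epsilon> \<noteq> 0" using nilN[OF ab] C3 unfolding C_def by force
  \<comment> \<open>As \<open>C^3 = \<epsilon> C\<close>, this is the projection onto the image of
    \<open>C\<close> along its kernel, and \<open>E0\<close> is the complementary one.\<close>
  define E1 where "E1 x = (1 / \<epsilon>) *\<^sub>R C (C x)" for x
  define E0 where "E0 x = x - E1 x" for x
  have lE1: "linear E1" unfolding E1_def by (rule linearI) (simp_all add: ls algebra_simps)
  have lE0: "linear E0" unfolding E0_def
    by (rule linearI) (simp_all add: linear_add[OF lE1] linear_scale[OF lE1] algebra_simps)
  have E1E1: "E1 (E1 x) = E1 x" for x using \<epsilon> by (simp add: E1_def ls C3)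
  have E0E0: "E0 (E0 x) = E0 x" for x by (simp add: E0_def linear_diff[OF lE1] E1E1)
  have trE1: "lin_trace E1 = 2"
    unfolding E1_def[abs_def] lin_trace_scaleR using \<epsilon> by (simp add: \<epsilon>_def)
  have trE0: "lin_trace E0 = 1"
    unfolding E0_def[abs_def] lin_trace_diff lin_trace_id trE1 using dim by simp
  have d1: "dim (range E1) = 2" using lin_trace_projection[OF lE1 E1E1] trE1 by simp
  have d0: "dim (range E0) = 1" using lin_trace_projection[OF lE0 E0E0] trE0 by simp
  have "\<exists>x. E0 x \<noteq> 0"
  proof (rule ccontr)
    assume "\<not> ?thesis"
    then have "range E0 = {0}" by auto
    then show False using d0 by simp
  qed
  then obtain v where v: "E0 v = v" "v \<noteq> 0" using E0E0 by blast
  have ex0: "\<exists>r. x = r *\<^sub>R v" if "E0 x = x" for x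
    using rangeI[of E0 v] rangeI[of E0 x] v that
      subspace_dim1[OF linear_subspace_image[OF lE0 subspace_UNIV] d0, of v x] by simp
  have Cv: "C v = 0"
    using arg_cong[OF v(1), of C] \<epsilon> by (simp add: E0_def E1_def ls C3)
  have E1C: "E1 (C x) = C (E1 x)" for x by (simp add: E1_def ls)
  have tC: "lin_trace (\<lambda>x. C (E1 x)) = 0"
    using t3 unfolding C_def[symmetric] by (simp add: E1_def ls lin_trace_scaleR)
  have inj1: "x = 0" if "E1 x = x" "C x = 0" for x using that by (simp add: E1_def ls)
  obtain u where u: "E1 u = u" "range E1 = span {u, C u}"
    using plane_cyclic_vector[OF lC lE1 E1E1 E1C d1 tC inj1] by blast
  have CCu: "C (C u) = \<epsilon> *\<^sub>R u"
    using arg_cong[OF u(1), of "\<lambda>x. \<epsilon> *\<^sub>R x"] \<epsilon> by (simp add: E1_def)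
  have ex1: "\<exists>a b. x = a *\<^sub>R u + b *\<^sub>R C u" if "E1 x = x" for x
    using u(2) in_span2[of x u "C u"] that by (metis rangeI)
  have sp: "span {v, u, C u} = UNIV"
  proof -
    have "x \<in> span {v, u, C u}" for x
    proof -
      obtain r where "E0 x = r *\<^sub>R v" using ex0[OF E0E0] by blast
      moreover obtain a b where "E1 x = a *\<^sub>R u + b *\<^sub>R C u" using ex1[OF E1E1] by blast
      moreover have "x = E0 x + E1 x" by (simp add: E0_def)
      ultimately have "x = r *\<^sub>R v + a *\<^sub>R u + b *\<^sub>R C u" by (simp add: add.assoc)
      then show ?thesis unfolding in_span3 by blast
    qed
    then show ?thesis by blast
  qed
  \<comment> \<open>An operator commuting with \<open>C\<close> preserves kernel and image of
    \<open>C\<close> and acts on the image, where \<open>u\<close> is cyclic, as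
    \<open>a + b C\<close>; trace zero fixes its entry on the kernel.\<close>
  have form: "\<exists>a b. M v = (- 2 * a) *\<^sub>R v \<and> M u = a *\<^sub>R u + b *\<^sub>R C u \<and> M (C u) = a *\<^sub>R C u + (b * \<epsilon>) *\<^sub>R u"
    if M: "linear M" "\<And>x. M (C x) = C (M x)" "lin_trace M = 0" for M
  proof -
    have ME: "E1 (M x) = M (E1 x)" "E0 (M x) = M (E0 x)" for x
      by (simp_all add: E0_def E1_def M(2) linear_scale[OF M(1)] linear_diff[OF M(1)])
    obtain r where r: "M v = r *\<^sub>R v" using ex0[of "M v"] ME v(1) by auto
    obtain a b where a: "M u = a *\<^sub>R u + b *\<^sub>R C u" using ex1[of "M u"] ME u(1) by auto
    have MCu: "M (C u) = a *\<^sub>R C u + (b * \<epsilon>) *\<^sub>R u" by (simp add: M(2) a ls CCu)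
    have "r + a + a = 0"
    proof (rule frame3E[OF dim sp])
      fix c1 c2 c3 :: "'a \<Rightarrow> real"
      assume l: "linear c1" "linear c2" "linear c3"
      assume d: "c1 v = 1" "c1 u = 0" "c1 (C u) = 0" "c2 v = 0" "c2 u = 1" "c2 (C u) = 0"
        "c3 v = 0" "c3 u = 0" "c3 (C u) = 1"
      assume tr: "\<And>f. linear f \<Longrightarrow> lin_trace f = c1 (f v) + c2 (f u) + c3 (f (C u))"
      show ?thesis using tr[OF M(1)]
        by (simp add: M(3) r a MCu l[THEN linear_add] l[THEN linear_scale] d)
    qed
    then have "r = - 2 * a" by simp
    then show ?thesis using r a MCu by blast
  qed
  obtain aA bA where fA: "A v = (- 2 * aA) *\<^sub>R v" "A u = aA *\<^sub>R u + bA *\<^sub>R C u"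
    "A (C u) = aA *\<^sub>R C u + (bA * \<epsilon>) *\<^sub>R u"
    using form[OF A CA(1) tA] by blast
  obtain aD bD where fD: "D v = (- 2 * aD) *\<^sub>R v" "D u = aD *\<^sub>R u + bD *\<^sub>R C u"
    "D (C u) = aD *\<^sub>R C u + (bD * \<epsilon>) *\<^sub>R u"
    using form[OF D CA(2) tD] by blast
  have N0: "\<not> (N p q v = 0 \<and> N p q u = 0 \<and> N p q (C u) = 0)" if pq: "p \<noteq> 0 \<or> q \<noteq> 0" for p q
  proof
    assume z: "N p q v = 0 \<and> N p q u = 0 \<and> N p q (C u) = 0"
    have "N p q x = 0" for x
    proof -
      obtain r a b where "x = r *\<^sub>R v + a *\<^sub>R u + b *\<^sub>R C u" using sp in_span3[of x v u "C u"] by auto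
      then show ?thesis using z by (simp add: linear_add[OF lN] linear_scale[OF lN])
    qed
    then show False using nilN[OF pq] by simp
  qed
  \<comment> \<open>Otherwise \<open>A\<close> and \<open>D\<close> are both multiples of
    \<open>C\<close>, and some nontrivial combination of them vanishes.\<close>
  have a0: "aA \<noteq> 0 \<or> aD \<noteq> 0"
  proof (rule ccontr)
    assume n: "\<not> ?thesis"
    show False
    proof (cases "bD = 0 \<and> bA = 0")
      case True
      then show False using N0[of 1 0] n by (simp add: N_def fA)
    next
      case False
      then show False using N0[of bD "- bA"] n by (simp add: N_def fA fD mult.commute)
    qed
  qed
  obtain p q b where pq: "N p q v = - 2 *\<^sub>R v" "N p q u = u + b *\<^sub>R C u" "N p q (C u) = C u + (b * \<epsilon>) *\<^sub>R u"
  proof (cases "aA = 0")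
    case False
    show thesis by (rule that[of "1 / aA" 0 "bA / aA"]) (use False in \<open>simp_all add: N_def fA scaleR_add_right\<close>)
  next
    case True
    then have "aD \<noteq> 0" using a0 by simp
    then show thesis by (intro that[of 0 "1 / aD" "bD / aD"]) (simp_all add: N_def fD scaleR_add_right)
  qed
  \<comment> \<open>Subtracting \<open>b\<close> times \<open>C\<close> leaves the diagonal
    generator; \<open>s\<close> below scales \<open>C\<close> so that its square on the plane is 1
    or -1.\<close>
  define a1 b1 where ab1: "a1 = p - b * \<alpha>" "b1 = q - b * \<beta>"
  have N1: "a1 *\<^sub>R A x + b1 *\<^sub>R D x = N p q x - b *\<^sub>R C x" for x
    by (simp add: ab1 C_def N_def algebra_simps)
  define s where "s = 1 / sqrt \<bar>\<epsilon>\<bar>"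
  have s: "s * s * \<bar>\<epsilon>\<bar> = 1" "s \<noteq> 0" using \<epsilon> by (simp_all add: s_def)
  define a2 b2 where ab2: "a2 = s * \<alpha>" "b2 = s * \<beta>"
  have N2: "a2 *\<^sub>R A x + b2 *\<^sub>R D x = s *\<^sub>R C x" for x
    by (simp add: ab2 C_def N_def algebra_simps)
  have u1: "a1 *\<^sub>R A v + b1 *\<^sub>R D v = - 2 *\<^sub>R v" "a1 *\<^sub>R A u + b1 *\<^sub>R D u = u"
    "a1 *\<^sub>R A (C u) + b1 *\<^sub>R D (C u) = C u"
    unfolding N1 by (simp_all add: pq Cv CCu)
  have v2: "a2 *\<^sub>R A v + b2 *\<^sub>R D v = 0" unfolding N2 by (simp add: Cv)
  have det: "a1 * b2 - a2 * b1 \<noteq> 0"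
  proof
    assume z: "a1 * b2 - a2 * b1 = 0"
    have "a2 *\<^sub>R (a1 *\<^sub>R A v + b1 *\<^sub>R D v) - a1 *\<^sub>R (a2 *\<^sub>R A v + b2 *\<^sub>R D v) = (- (a1 * b2 - a2 * b1)) *\<^sub>R D v"
      "b2 *\<^sub>R (a1 *\<^sub>R A v + b1 *\<^sub>R D v) - b1 *\<^sub>R (a2 *\<^sub>R A v + b2 *\<^sub>R D v) = (a1 * b2 - a2 * b1) *\<^sub>R A v"
      by (simp_all add: algebra_simps)
    then have "a2 = 0" "b2 = 0" unfolding u1 v2 z using v(2) by simp_all
    then show False using ab s(2) by (simp add: ab2)
  qed
  have ls2: "a *\<^sub>R A (x + k *\<^sub>R y) + c *\<^sub>R D (x + k *\<^sub>R y)
      = (a *\<^sub>R A x + c *\<^sub>R D x) + k *\<^sub>R (a *\<^sub>R A y + c *\<^sub>R D y)" for a c k x y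
    by (simp add: lA lD algebra_simps)
  show ?thesis
  proof (cases "\<epsilon> > 0")
    case True
    then have ss: "s * (s * \<epsilon>) = 1" using s(1) by (simp add: mult.assoc)
    define f4 f5 where f: "f4 = u + s *\<^sub>R C u" "f5 = u + (- s) *\<^sub>R C u"
    have "span {v, f4, f5} = UNIV"
    proof (rule span_eq_UNIV_mono[OF sp])
      have "u = (1/2) *\<^sub>R f4 + (1/2) *\<^sub>R f5 + 0 *\<^sub>R v"
        by (simp add: f algebra_simps flip: scaleR_add_left)
      moreover have "C u = (1 / (2 * s)) *\<^sub>R f4 + (- 1 / (2 * s)) *\<^sub>R f5 + 0 *\<^sub>R v"
        using s(2) by (simp add: f algebra_simps flip: scaleR_add_left)
      ultimately have "u \<in> span {v, f4, f5}" "C u \<in> span {v, f4, f5}"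
        using in_span_insert_combination[of u _ f4 _ f5 _ v "{v, f4, f5}"]
          in_span_insert_combination[of "C u" _ f4 _ f5 _ v "{v, f4, f5}"] by blast+
      then show "{v, u, C u} \<subseteq> span {v, f4, f5}" by (simp add: span_base)
    qed
    moreover have "a1 *\<^sub>R A f4 + b1 *\<^sub>R D f4 = f4" "a1 *\<^sub>R A f5 + b1 *\<^sub>R D f5 = f5"
      unfolding f ls2 u1 by simp_all
    moreover have "a2 *\<^sub>R A f4 + b2 *\<^sub>R D f4 = f4" "a2 *\<^sub>R A f5 + b2 *\<^sub>R D f5 = - f5"
      unfolding f ls2 N2 CCu using ss by simp_all
    ultimately show ?thesis using det u1(1) v2 by blast
  next
    case False
    then have "\<bar>\<epsilon>\<bar> = - \<epsilon>" using \<epsilon> by simp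
    then have ss: "s * (s * \<epsilon>) = - 1" using s(1) by (simp add: mult.assoc)
    define f5 where f: "f5 = 0 + (- s) *\<^sub>R C u"
    have "span {v, u, f5} = UNIV"
    proof (rule span_eq_UNIV_mono[OF sp])
      have "C u = (- 1 / s) *\<^sub>R f5 + 0 *\<^sub>R u + 0 *\<^sub>R v" using s(2) by (simp add: f)
      then have "C u \<in> span {v, u, f5}"
        by (rule in_span_insert_combination) simp
      then show "{v, u, C u} \<subseteq> span {v, u, f5}" by (simp add: span_base)
    qed
    moreover have "a1 *\<^sub>R A f5 + b1 *\<^sub>R D f5 = f5"
      unfolding f ls2 u1 by (simp add: lA lD)
    moreover have "a2 *\<^sub>R A u + b2 *\<^sub>R D u = - f5" unfolding N2 by (simp add: f)
    moreover have "a2 *\<^sub>R A f5 + b2 *\<^sub>R D f5 = u"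
      unfolding f ls2 N2 CCu using ss by (simp add: ls)
    ultimately show ?thesis using det u1(1,2) v2 by blast
  qed
qed

section \<open>Extensions of an abelian 3-space and the final case distinction\<close>

context unimodular_lie
begin

definition has_abelian_hyperplane :: bool where
  "has_abelian_hyperplane \<longleftrightarrow> (\<exists>I. lie_ideal br I \<and> abelian_set br I \<and> dim I = DIM('a) - 1)"

text \<open>The hyperplane spanned by \<open>s\<close> and the image of \<kappa> is an ideal, and
  the Jordan type of the action of \<open>s\<close> decides its kind: abelian for 1+1+1, Heisenberg
  plus a line for 2+1, filiform for 3.\<close>

lemma nilpotent_on_abelian:
  fixes \<kappa> :: "real^3 \<Rightarrow> 'a"
  assumes dim: "DIM('a) = 5" and \<kappa>: "linear \<kappa>" and A: "linear A" "\<And>w. A (A (A w)) = 0"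
    and dec: "\<And>z. \<exists>\<tau> \<sigma> w. z = \<tau> *\<^sub>R t + \<sigma> *\<^sub>R s + \<kappa> w"
    and ab: "\<And>v w. br (\<kappa> v) (\<kappa> w) = 0" and s: "\<And>w. br s (\<kappa> w) = \<kappa> (A w)"
    and t: "\<And>w. \<exists>\<sigma> v. br t (\<kappa> w) = \<sigma> *\<^sub>R s + \<kappa> v" and ts: "\<exists>\<sigma> v. br t s = \<sigma> *\<^sub>R s + \<kappa> v"
  shows "has_abelian_hyperplane \<or> has_centre \<or> heisenberg_extension br \<or> filiform_extension br"
proof -
  note lk = linear_add[OF \<kappa>] linear_scale[OF \<kappa>] linear_0[OF \<kappa>]
  have mem: "\<sigma> *\<^sub>R s + \<kappa> w \<in> span {s, \<kappa> e1, \<kappa> e2, \<kappa> e3}" if e: "span {e1,e2,e3} = UNIV" for \<sigma> w e1 e2 e3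
  proof -
    obtain a b c where "w = a *\<^sub>R e1 + b *\<^sub>R e2 + c *\<^sub>R e3" using e in_span3[of w e1 e2 e3] by auto
    then have "\<sigma> *\<^sub>R s + \<kappa> w = \<sigma> *\<^sub>R s + a *\<^sub>R \<kappa> e1 + b *\<^sub>R \<kappa> e2 + c *\<^sub>R \<kappa> e3" by (simp add: lk add.assoc)
    then show ?thesis unfolding in_span4 by blast
  qed
  have full: "span {t, s, \<kappa> e1, \<kappa> e2, \<kappa> e3} = UNIV" if e: "span {e1,e2,e3} = UNIV" for e1 e2 e3
  proof -
    have "z \<in> span {t, s, \<kappa> e1, \<kappa> e2, \<kappa> e3}" for z
    proof -
      obtain \<tau> \<sigma> w where "z = \<tau> *\<^sub>R t + \<sigma> *\<^sub>R s + \<kappa> w" using dec by blast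
      then have "z - \<tau> *\<^sub>R t = \<sigma> *\<^sub>R s + \<kappa> w" by simp
      then show ?thesis unfolding span_insert[of t] using mem[OF e] by (metis (mono_tags, lifting) mem_Collect_eq)
    qed
    then show ?thesis by blast
  qed
  have tmem: "br t (\<kappa> w) \<in> span {s, \<kappa> e1, \<kappa> e2, \<kappa> e3}" "br t s \<in> span {s, \<kappa> e1, \<kappa> e2, \<kappa> e3}"
    if e: "span {e1,e2,e3} = UNIV" for w e1 e2 e3
    using t[of w] ts mem[OF e] by metis+
  have "DIM(real^3) = 3" by simp
  from cube_zero_cases[OF this A] consider "\<forall>x. A x = 0" |
    y w where "span {y, A y, w} = UNIV" "A (A y) = 0" "A w = 0" | y where "span {y, A y, A (A y)} = UNIV"
    by blast
  then show ?thesis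
  proof cases
    case 1
    obtain e1 e2 e3 :: "real^3" where e: "span {e1,e2,e3} = UNIV"
      using dim3_frame_exists[where 'a = "real^3"] by auto
    let ?I = "span {s, \<kappa> e1, \<kappa> e2, \<kappa> e3}"
    have I: "\<exists>\<sigma> w. i = \<sigma> *\<^sub>R s + \<kappa> w" if i: "i \<in> ?I" for i
    proof -
      obtain \<sigma> a b c where "i = \<sigma> *\<^sub>R s + a *\<^sub>R \<kappa> e1 + b *\<^sub>R \<kappa> e2 + c *\<^sub>R \<kappa> e3" using i in_span4 by blast
      then have "i = \<sigma> *\<^sub>R s + \<kappa> (a *\<^sub>R e1 + b *\<^sub>R e2 + c *\<^sub>R e3)" by (simp add: lk add.assoc)
      then show ?thesis by blast
    qed
    have sk: "br (\<kappa> w) s = 0" "br s (\<kappa> w) = 0" for w using s[of w] 1 br_skew[of "\<kappa> w" s] by (simp_all add: lk)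
    have abI: "br i j = 0" if ij: "i \<in> ?I" "j \<in> ?I" for i j
    proof -
      obtain \<sigma> w where "i = \<sigma> *\<^sub>R s + \<kappa> w" using I[OF ij(1)] by blast
      moreover obtain \<sigma>' w' where "j = \<sigma>' *\<^sub>R s + \<kappa> w'" using I[OF ij(2)] by blast
      ultimately show ?thesis using sk ab by simp
    qed
    have "lie_ideal br ?I"
      unfolding lie_ideal_def
    proof (intro conjI allI impI subspace_span)
      fix z i assume i: "i \<in> ?I"
      obtain \<sigma> w where iw: "i = \<sigma> *\<^sub>R s + \<kappa> w" using I[OF i] by blast
      obtain \<tau> \<sigma>' w' where z: "z = \<tau> *\<^sub>R t + \<sigma>' *\<^sub>R s + \<kappa> w'" using dec by blast
      have "br t i \<in> ?I" unfolding iw using tmem[OF e] by (simp add: span_add span_scale)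
      moreover have "br (\<sigma>' *\<^sub>R s + \<kappa> w') i = 0" using abI[OF mem[OF e] i] by simp
      moreover have "br z i = \<tau> *\<^sub>R br t i + br (\<sigma>' *\<^sub>R s + \<kappa> w') i" unfolding z by simp
      ultimately show "br z i \<in> ?I" by (simp add: span_scale)
    qed
    moreover have "abelian_set br ?I" using abI by (auto simp: abelian_set_def)
    moreover have "dim ?I = DIM('a) - 1"
    proof -
      have "dim (span (insert t {s, \<kappa> e1, \<kappa> e2, \<kappa> e3})) = 5" unfolding full[OF e] using dim by simp
      then have "5 \<le> Suc (dim {s, \<kappa> e1, \<kappa> e2, \<kappa> e3})"
        unfolding dim_span using dim_insert[of t "{s, \<kappa> e1, \<kappa> e2, \<kappa> e3}"] by (simp split: if_splits)
      moreover have "dim {s, \<kappa> e1, \<kappa> e2, \<kappa> e3} \<le> 4"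
        by (rule order_trans[OF dim_le_card']) (auto simp: card_insert_if)
      ultimately show ?thesis using dim by simp
    qed
    ultimately show ?thesis unfolding has_abelian_hyperplane_def by blast
  next
    case (2 y w)
    have "has_centre \<or> heisenberg_extension br"
      by (rule heisenberg_nilradical[OF dim full[OF 2(1)]]) (use 2 s ab tmem[OF 2(1)] lk(3) in simp_all)
    then show ?thesis by blast
  next
    case (3 y)
    have "has_centre \<or> filiform_extension br"
      by (rule filiform_nilradical[OF dim full[OF 3]]) (use s ab A(2) tmem[OF 3] lk(3) in simp_all)
    then show ?thesis by blast
  qed
qed

text \<open>\<open>A\<close> and \<open>D\<close> are the actions of \<open>s\<close> and
  \<open>t\<close> on the abelian 3-space. Unless \<open>A\<close> is nilpotent, \<open>t\<close>
  preserves the 3-space and commutes with \<open>s\<close> modulo it, so \<open>A\<close> and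
  \<open>D\<close> are commuting traceless operators; a nilpotent member of their pencil leads back
  to \<open>nilpotent_on_abelian\<close>, and otherwise the pencil is a torus in normal
  form.\<close>

lemma abelian_frame_structure:
  assumes dim: "DIM('a) = 5" and sp: "span {t,s,x,u,v} = UNIV" and fr: "abelian_frame s x u v"
    and t: "br t s \<in> span {s,x,u,v}" "br t x \<in> span {s,x,u,v}" "br t u \<in> span {s,x,u,v}" "br t v \<in> span {s,x,u,v}"
  shows "has_abelian_hyperplane \<or> has_centre \<or> heisenberg_extension br \<or> filiform_extension br \<or>
    split_torus_extension br \<or> rotation_torus_extension br"
proof (rule frame5E[OF dim sp])
  fix c1 c2 c3 c4 c5 :: "'a \<Rightarrow> real"
  assume l: "linear c1" "linear c2" "linear c3" "linear c4" "linear c5"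
  assume d: "c1 t = 1" "c1 s = 0" "c1 x = 0" "c1 u = 0" "c1 v = 0"
    "c2 t = 0" "c2 s = 1" "c2 x = 0" "c2 u = 0" "c2 v = 0"
    "c3 t = 0" "c3 s = 0" "c3 x = 1" "c3 u = 0" "c3 v = 0"
    "c4 t = 0" "c4 s = 0" "c4 x = 0" "c4 u = 1" "c4 v = 0"
    "c5 t = 0" "c5 s = 0" "c5 x = 0" "c5 u = 0" "c5 v = 1"
  assume ex: "\<And>z. z = c1 z *\<^sub>R t + c2 z *\<^sub>R s + c3 z *\<^sub>R x + c4 z *\<^sub>R u + c5 z *\<^sub>R v"
  assume tr: "\<And>f. linear f \<Longrightarrow> lin_trace f = c1 (f t) + c2 (f s) + c3 (f x) + c4 (f u) + c5 (f v)"
  note ls = l[THEN linear_add] l[THEN linear_scale] l[THEN linear_neg] l[THEN linear_diff]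
    l[THEN linear_0]
  have ab: "br x u = 0" "br x v = 0" "br u v = 0"
    and st: "br s x \<in> span {x,u,v}" "br s u \<in> span {x,u,v}" "br s v \<in> span {x,u,v}"
    using fr unfolding abelian_frame_def by blast+
  define \<kappa> :: "real^3 \<Rightarrow> 'a" where "\<kappa> w = (w $ 1) *\<^sub>R x + (w $ 2) *\<^sub>R u + (w $ 3) *\<^sub>R v" for w
  define \<pi> :: "'a \<Rightarrow> real^3" where "\<pi> z = vector [c3 z, c4 z, c5 z]" for z
  have lk: "linear \<kappa>" unfolding \<kappa>_def by (rule linearI) (simp_all add: algebra_simps)
  have lp: "linear \<pi>" unfolding \<pi>_def
    by (rule linearI) (simp_all add: vec_eq_iff forall_3 ls)
  have pk: "\<pi> (\<kappa> w) = w" for w by (simp add: \<pi>_def \<kappa>_def vec_eq_iff forall_3 ls d)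
  have ck: "c1 (\<kappa> w) = 0" "c2 (\<kappa> w) = 0" "c3 (\<kappa> w) = w $ 1" "c4 (\<kappa> w) = w $ 2" "c5 (\<kappa> w) = w $ 3" for w
    by (simp_all add: \<kappa>_def ls d)
  have dec': "z = c1 z *\<^sub>R t + c2 z *\<^sub>R s + \<kappa> (\<pi> z)" for z
    using ex[of z] by (simp add: \<kappa>_def \<pi>_def add.assoc)
  have dec: "\<exists>\<tau> \<sigma> w. z = \<tau> *\<^sub>R t + \<sigma> *\<^sub>R s + \<kappa> w" for z using dec' by blast
  have abk: "br (\<kappa> a) (\<kappa> b) = 0" for a b
    by (simp add: \<kappa>_def ab br_skew[of u x] br_skew[of v x] br_skew[of v u])
  have c1z: "c1 z = 0" if z: "z \<in> span {s,x,u,v}" for z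
  proof -
    obtain a b c e where "z = a *\<^sub>R s + b *\<^sub>R x + c *\<^sub>R u + e *\<^sub>R v" using z in_span4 by blast
    then show ?thesis by (simp add: ls d)
  qed
  have c12z: "c1 z = 0 \<and> c2 z = 0" if z: "z \<in> span {x,u,v}" for z
  proof -
    obtain a b c where "z = a *\<^sub>R x + b *\<^sub>R u + c *\<^sub>R v" using z in_span3 by blast
    then show ?thesis by (simp add: ls d)
  qed
  define A where "A w = \<pi> (br s (\<kappa> w))" for w
  define D where "D w = \<pi> (br t (\<kappa> w))" for w
  define \<theta> where "\<theta> w = c2 (br t (\<kappa> w))" for w
  have lA: "linear A" "linear D"
    unfolding A_def D_def using linear_comp_frame[OF lp linear_comp_frame[OF linear_br(1) lk]] by blast+
  have l\<theta>: "linear \<theta>"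
    unfolding \<theta>_def using linear_comp_frame[OF l(2) linear_comp_frame[OF linear_br(1) lk]] .
  have sA: "br s (\<kappa> w) = \<kappa> (A w)" for w
  proof -
    have "br s (\<kappa> w) \<in> span {x,u,v}" unfolding \<kappa>_def by (simp add: st span_add span_scale)
    then show ?thesis using dec'[of "br s (\<kappa> w)"] c12z by (simp add: A_def)
  qed
  have tD: "br t (\<kappa> w) = \<theta> w *\<^sub>R s + \<kappa> (D w)" for w
  proof -
    have "br t (\<kappa> w) \<in> span {s,x,u,v}" unfolding \<kappa>_def by (simp add: t span_add span_scale)
    then show ?thesis using dec'[of "br t (\<kappa> w)"] c1z by (simp add: D_def \<theta>_def)
  qed
  define a m where am: "a = c2 (br t s)" "m = \<pi> (br t s)"
  have ts: "br t s = a *\<^sub>R s + \<kappa> m" using dec'[of "br t s"] c1z[OF t(1)] by (simp add: am)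
  have trace: "lin_trace (\<lambda>w. \<pi> (F (\<kappa> w))) = c3 (F x) + c4 (F u) + c5 (F v)" if F: "linear F" for F
  proof -
    have "lin_trace (\<lambda>w. \<pi> (F (\<kappa> w))) = lin_trace (\<lambda>z. \<kappa> (\<pi> (F z)))"
      by (rule lin_trace_comm[OF lk linear_comp_frame[OF lp F]])
    also have "\<dots> = c3 (F x) + c4 (F u) + c5 (F v)"
      unfolding tr[OF linear_comp_frame[OF lk linear_comp_frame[OF lp F]]] ck by (simp add: \<pi>_def)
    finally show ?thesis .
  qed
  have trA: "lin_trace A = 0"
    using trace[OF linear_br(1), of s] tr[OF linear_br(1), of s] c1z[OF t(1)] br_skew[of s t]
    by (simp add: A_def[abs_def] trace_br ls)
  have trD: "lin_trace D = - a"
    using trace[OF linear_br(1), of t] tr[OF linear_br(1), of t]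
    by (simp add: D_def[abs_def] trace_br am ls)
  show ?thesis
  proof (cases "\<forall>w. A (A (A w)) = 0")
    case True
    then have "has_abelian_hyperplane \<or> has_centre \<or> heisenberg_extension br \<or> filiform_extension br"
      by (intro nilpotent_on_abelian[OF dim lk lA(1) _ dec abk sA]) (use tD ts in blast)+
    then show ?thesis by blast
  next
    case nonnil: False
    have \<theta>A: "\<theta> w *\<^sub>R A w' = \<theta> w' *\<^sub>R A w" for w w'
    proof -
      have "br t (br (\<kappa> w) (\<kappa> w')) = br (br t (\<kappa> w)) (\<kappa> w') + br (\<kappa> w) (br t (\<kappa> w'))" by (rule jacobi)
      then have "\<kappa> (\<theta> w *\<^sub>R A w' - \<theta> w' *\<^sub>R A w) = 0"
        by (simp add: abk tD sA br_skew[of "\<kappa> w" s] linear_diff[OF lk] linear_scale[OF lk])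
      then have "\<pi> (\<kappa> (\<theta> w *\<^sub>R A w' - \<theta> w' *\<^sub>R A w)) = 0" by (simp add: linear_0[OF lp])
      then show ?thesis by (simp add: pk)
    qed
    \<comment> \<open>If \<theta> does not vanish, \<open>\<theta>A\<close> makes \<open>A\<close>
      of rank at most one, and a traceless operator of that kind has square zero.\<close>
    have \<theta>0: "\<theta> w = 0" for w
    proof (rule ccontr)
      assume w: "\<theta> w \<noteq> 0"
      have Aw: "A w' = (\<theta> w' / \<theta> w) *\<^sub>R A w" for w'
        using arg_cong[OF \<theta>A[of w w'], of "\<lambda>z. (1 / \<theta> w) *\<^sub>R z"] w by simp
      have l': "linear (\<lambda>w'. \<theta> w' / \<theta> w)"
        by (rule linearI) (simp_all add: linear_add[OF l\<theta>] linear_scale[OF l\<theta>] add_divide_distrib)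
      have "A = (\<lambda>w'. (\<theta> w' / \<theta> w) *\<^sub>R A w)" by (rule ext) (rule Aw)
      then have "lin_trace A = \<theta> (A w) / \<theta> w" using lin_trace_eq_of_rank_one[OF l'] by metis
      then have "A (A w) = 0" using Aw[of "A w"] trA by simp
      then have "A (A w') = 0" for w' by (subst Aw[of w']) (simp add: linear_scale[OF lA(1)])
      then show False using nonnil linear_0[OF lA(1)] by simp
    qed
    have tD': "br t (\<kappa> w) = \<kappa> (D w)" for w by (simp add: tD \<theta>0)
    have commA: "D (A w) = a *\<^sub>R A w + A (D w)" for w
    proof -
      have "\<kappa> (D (A w)) = \<kappa> (a *\<^sub>R A w + A (D w))"
        using jacobi[of t s "\<kappa> w"] by (simp add: tD' sA ts abk linear_add[OF lk] linear_scale[OF lk])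
      then show ?thesis using pk by metis
    qed
    have d3: "DIM(real^3) = 3" by simp
    \<comment> \<open>If \<open>a \<noteq> 0\<close>, the commutator relation makes the traces of
      the square and the cube of \<open>A\<close> vanish, and Cayley-Hamilton makes \<open>A\<close>
      nilpotent.\<close>
    have a0: "a = 0"
    proof (rule ccontr)
      assume a: "a \<noteq> 0"
      have "a * lin_trace (\<lambda>w. A (A w)) = lin_trace (\<lambda>w. D (A (A w))) - lin_trace (\<lambda>w. A (D (A w)))"
        unfolding commA lin_trace_add lin_trace_scaleR by simp
      also have "\<dots> = 0"
        using lin_trace_comm[OF linear_comp_frame[OF lA(2,1)] lA(1)] by simp
      finally have t2: "lin_trace (\<lambda>w. A (A w)) = 0" using a by simp
      have "a * lin_trace (\<lambda>w. A (A (A w))) = lin_trace (\<lambda>w. D (A (A (A w)))) - lin_trace (\<lambda>w. A (D (A (A w))))"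
        unfolding commA lin_trace_add lin_trace_scaleR by simp
      also have "\<dots> = 0"
        using lin_trace_comm[OF linear_comp_frame[OF lA(2) linear_comp_frame[OF lA(1,1)]] lA(1)] by simp
      finally have t3: "lin_trace (\<lambda>w. A (A (A w))) = 0" using a by simp
      have "A (A (A w)) = 0" for w using cayley_hamilton3[OF d3 lA(1), of w] by (simp add: trA t2 t3)
      then show False using nonnil by blast
    qed
    have comm: "A (D w) = D (A w)" for w using commA a0 by simp
    have ts': "br t s = \<kappa> m" using ts a0 by simp
    \<comment> \<open>In a nilpotent combination the coefficient \<beta> is nonzero, as
      \<open>A\<close> itself is not nilpotent. So \<open>s' = \<alpha> s + \<beta> t\<close> can
      take over the role of \<open>s\<close>, and \<open>s\<close> that of the complement.\<close>
    show ?thesis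
    proof (cases "\<exists>\<alpha> \<beta>. (\<alpha> \<noteq> 0 \<or> \<beta> \<noteq> 0) \<and> (\<forall>C. (\<forall>w. C w = \<alpha> *\<^sub>R A w + \<beta> *\<^sub>R D w) \<longrightarrow> (\<forall>w. C (C (C w)) = 0))")
      case True
      then obtain \<alpha> \<beta> where ab0: "\<alpha> \<noteq> 0 \<or> \<beta> \<noteq> 0"
        and C: "\<And>C. (\<forall>w. C w = \<alpha> *\<^sub>R A w + \<beta> *\<^sub>R D w) \<Longrightarrow> \<forall>w. C (C (C w)) = 0" by blast
      define C where "C w = \<alpha> *\<^sub>R A w + \<beta> *\<^sub>R D w" for w
      have C3: "C (C (C w)) = 0" for w using C[of C] by (simp add: C_def)
      have lC: "linear C" unfolding C_def
        by (rule linearI) (simp_all add: linear_add[OF lA(1)] linear_add[OF lA(2)] linear_scale[OF lA(1)]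
          linear_scale[OF lA(2)] algebra_simps)
      have \<beta>: "\<beta> \<noteq> 0"
      proof
        assume \<beta>: "\<beta> = 0"
        then have "\<alpha> \<noteq> 0" using ab0 by simp
        moreover have "C (C (C w)) = (\<alpha> * \<alpha> * \<alpha>) *\<^sub>R A (A (A w))" for w
          by (simp add: C_def \<beta> linear_scale[OF lA(1)])
        ultimately show False using C3 nonnil by simp
      qed
      define s' where "s' = \<alpha> *\<^sub>R s + \<beta> *\<^sub>R t"
      have "has_abelian_hyperplane \<or> has_centre \<or> heisenberg_extension br \<or> filiform_extension br"
      proof (rule nilpotent_on_abelian[OF dim lk lC C3 _ abk, of s s'])
        show "\<exists>\<tau> \<sigma> w. z = \<tau> *\<^sub>R s + \<sigma> *\<^sub>R s' + \<kappa> w" for z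
        proof -
          obtain \<tau> \<sigma> w where z: "z = \<tau> *\<^sub>R t + \<sigma> *\<^sub>R s + \<kappa> w" using dec by blast
          have "z = (\<sigma> - \<tau> * \<alpha> / \<beta>) *\<^sub>R s + (\<tau> / \<beta>) *\<^sub>R s' + \<kappa> w"
            using \<beta> by (simp add: z s'_def algebra_simps)
          then show ?thesis by blast
        qed
        show "br s' (\<kappa> w) = \<kappa> (C w)" for w
          by (simp add: s'_def C_def sA tD' linear_add[OF lk] linear_scale[OF lk])
        have "br s (\<kappa> w) = 0 *\<^sub>R s' + \<kappa> (A w)" for w by (simp add: sA)
        then show "\<exists>\<sigma> v. br s (\<kappa> w) = \<sigma> *\<^sub>R s' + \<kappa> v" for w by blast
        have "br s s' = 0 *\<^sub>R s' + \<kappa> ((- \<beta>) *\<^sub>R m)"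
          by (simp add: s'_def br_skew[of s t] ts' linear_neg[OF lk] linear_scale[OF lk])
        then show "\<exists>\<sigma> v. br s s' = \<sigma> *\<^sub>R s' + \<kappa> v" by blast
      qed
      then show ?thesis by blast
    next
      case False
      then have nil: "\<exists>C w. (\<forall>w. C w = \<alpha> *\<^sub>R A w + \<beta> *\<^sub>R D w) \<and> C (C (C w)) \<noteq> 0" if "\<alpha> \<noteq> 0 \<or> \<beta> \<noteq> 0" for \<alpha> \<beta>
        using that by blast
      have trD0: "lin_trace D = 0" using trD a0 by simp
      obtain a1 b1 a2 b2 f3 f4 f5 where f: "span {f3, f4, f5} = UNIV" and det: "a1 * b2 - a2 * b1 \<noteq> 0"
        and C1: "a1 *\<^sub>R A f3 + b1 *\<^sub>R D f3 = - 2 *\<^sub>R f3" "a1 *\<^sub>R A f4 + b1 *\<^sub>R D f4 = f4" "a1 *\<^sub>R A f5 + b1 *\<^sub>R D f5 = f5"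
        and C2: "a2 *\<^sub>R A f3 + b2 *\<^sub>R D f3 = 0"
        and C2': "a2 *\<^sub>R A f4 + b2 *\<^sub>R D f4 = f4 \<and> a2 *\<^sub>R A f5 + b2 *\<^sub>R D f5 = - f5 \<or>
          a2 *\<^sub>R A f4 + b2 *\<^sub>R D f4 = - f5 \<and> a2 *\<^sub>R A f5 + b2 *\<^sub>R D f5 = f4"
        using commuting_pair_normal_form[OF d3 lA comm trA trD0 nil] by blast
      define X1 X2 where X: "X1 = a1 *\<^sub>R s + b1 *\<^sub>R t" "X2 = a2 *\<^sub>R s + b2 *\<^sub>R t"
      have brX: "br X1 (\<kappa> w) = \<kappa> (a1 *\<^sub>R A w + b1 *\<^sub>R D w)" "br X2 (\<kappa> w) = \<kappa> (a2 *\<^sub>R A w + b2 *\<^sub>R D w)" for w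
        by (simp_all add: X sA tD' linear_add[OF lk] linear_scale[OF lk])
      define \<delta> where "\<delta> = a1 * b2 - a2 * b1"
      have X12: "br X1 X2 = \<kappa> ((- \<delta>) *\<^sub>R m)"
        by (simp add: X br_skew[of s t] ts' \<delta>_def linear_scale[OF lk] linear_neg[OF lk] linear_diff[OF lk] algebra_simps)
      have kmem: "\<kappa> w \<in> span {\<kappa> f3, \<kappa> f4, \<kappa> f5}" for w
      proof -
        obtain a b c where "w = a *\<^sub>R f3 + b *\<^sub>R f4 + c *\<^sub>R f5" using f in_span3[of w f3 f4 f5] by auto
        then show ?thesis unfolding in_span3 by (metis linear_add[OF lk] linear_scale[OF lk])
      qed
      have spX: "span {X1, X2, \<kappa> f3, \<kappa> f4, \<kappa> f5} = UNIV"
      proof -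
        let ?T = "span {X1, X2, \<kappa> f3, \<kappa> f4, \<kappa> f5}"
        have \<delta>: "\<delta> \<noteq> 0" using det by (simp add: \<delta>_def)
        have "b2 *\<^sub>R X1 + (- b1) *\<^sub>R X2 = \<delta> *\<^sub>R s" "(- a2) *\<^sub>R X1 + a1 *\<^sub>R X2 = \<delta> *\<^sub>R t"
          by (simp_all add: X \<delta>_def algebra_simps)
        then have "(1 / \<delta>) *\<^sub>R (b2 *\<^sub>R X1 + (- b1) *\<^sub>R X2) = s" "(1 / \<delta>) *\<^sub>R ((- a2) *\<^sub>R X1 + a1 *\<^sub>R X2) = t"
          using \<delta> by simp_all
        then have "s = (b2 / \<delta>) *\<^sub>R X1 + (- b1 / \<delta>) *\<^sub>R X2 + 0 *\<^sub>R \<kappa> f3"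
          "t = (- a2 / \<delta>) *\<^sub>R X1 + (a1 / \<delta>) *\<^sub>R X2 + 0 *\<^sub>R \<kappa> f3"
          by (auto simp: scaleR_add_right scaleR_diff_right)
        then have st: "s \<in> ?T" "t \<in> ?T"
          using in_span_insert_combination[of s _ X1 _ X2 _ "\<kappa> f3" "{X1, X2, \<kappa> f3, \<kappa> f4, \<kappa> f5}"]
            in_span_insert_combination[of t _ X1 _ X2 _ "\<kappa> f3" "{X1, X2, \<kappa> f3, \<kappa> f4, \<kappa> f5}"] by blast+
        have kT: "\<kappa> w \<in> ?T" for w
          using kmem[of w] span_mono[of "{\<kappa> f3, \<kappa> f4, \<kappa> f5}" "{X1, X2, \<kappa> f3, \<kappa> f4, \<kappa> f5}"] by blast
        have "z \<in> ?T" for z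
          by (subst dec'[of z]) (intro span_add span_scale st kT)
        then show ?thesis by blast
      qed
      have k0: "br (\<kappa> f3) (\<kappa> f4) = 0" "br (\<kappa> f3) (\<kappa> f5) = 0" "br (\<kappa> f4) (\<kappa> f5) = 0" using abk by auto
      have X1f: "br X1 (\<kappa> f3) = - 2 *\<^sub>R \<kappa> f3" "br X1 (\<kappa> f4) = \<kappa> f4" "br X1 (\<kappa> f5) = \<kappa> f5"
        "br X2 (\<kappa> f3) = 0"
        unfolding brX C1 C2 by (simp_all add: linear_scale[OF lk] linear_0[OF lk] linear_neg[OF lk])
      from C2' show ?thesis
      proof
        assume r: "a2 *\<^sub>R A f4 + b2 *\<^sub>R D f4 = - f5 \<and> a2 *\<^sub>R A f5 + b2 *\<^sub>R D f5 = f4"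
        have "br X2 (\<kappa> f4) = - \<kappa> f5" "br X2 (\<kappa> f5) = \<kappa> f4"
          unfolding brX using r by (simp_all add: linear_neg[OF lk])
        moreover have "br X1 X2 \<in> span {\<kappa> f3, \<kappa> f4, \<kappa> f5}" unfolding X12 by (rule kmem)
        ultimately have "rotation_torus_extension br"
          using rotation_torus_extensionI[OF dim spX _ k0 X1f] by blast
        then show ?thesis by blast
      next
        assume r: "a2 *\<^sub>R A f4 + b2 *\<^sub>R D f4 = f4 \<and> a2 *\<^sub>R A f5 + b2 *\<^sub>R D f5 = - f5"
        obtain m3 m4 m5 where m: "m = m3 *\<^sub>R f3 + m4 *\<^sub>R f4 + m5 *\<^sub>R f5" using f in_span3[of m f3 f4 f5] by auto
        \<comment> \<open>\<open>X1\<close> is invertible on the abelian ideal, with eigenvalues -2,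
          1, 1; \<open>n\<close> is the preimage of \<open>\<delta> m\<close>, which cancels
          \<open>br X1 X2\<close>.\<close>
        define n where "n = (- (\<delta> * m3) / 2) *\<^sub>R \<kappa> f3 + (\<delta> * m4) *\<^sub>R \<kappa> f4 + (\<delta> * m5) *\<^sub>R \<kappa> f5"
        define X2' where "X2' = X2 + n"
        have "br X1 X2' = 0"
          by (simp add: X2'_def n_def X12 X1f m linear_neg[OF lk] linear_diff[OF lk] linear_add[OF lk] linear_scale[OF lk] algebra_simps)
        moreover have "br X2' (\<kappa> f3) = 0" "br X2' (\<kappa> f4) = \<kappa> f4" "br X2' (\<kappa> f5) = - \<kappa> f5"
          using brX(2) r X1f(4) by (simp_all add: X2'_def n_def abk linear_neg[OF lk])
        moreover have "span {X1, X2', \<kappa> f3, \<kappa> f4, \<kappa> f5} = UNIV"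
        proof -
          have "n \<in> span {\<kappa> f3, \<kappa> f4, \<kappa> f5}" unfolding in_span3 n_def by blast
          then have "span {X2', \<kappa> f3, \<kappa> f4, \<kappa> f5} = span {X2, \<kappa> f3, \<kappa> f4, \<kappa> f5}"
            unfolding X2'_def by (rule span_insert_add)
          then show ?thesis using spX unfolding span_insert[of X1] by simp
        qed
        ultimately have "split_torus_extension br"
          unfolding split_torus_extension_def using k0 X1f(1-3) by blast
        then show ?thesis by blast
      qed
    qed
  qed
qed

lemma dim5_structure:
  assumes dim: "DIM('a) = 5"
  shows "has_abelian_hyperplane \<or> has_centre \<or> rotation_torus_extension br \<or>
    sl2_semidirect br \<or> heisenberg_extension br \<or> filiform_extension br \<or> split_torus_extension br"
proof (cases "perfect br")
  case True
  obtain X P where f: "fitting br X P" "dim (range P) = 4" using perfect_dim5[OF dim True] by blast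
  interpret fitting br X P by (rule f(1))
  interpret fitting5 br X P by unfold_locales (use dim f(2) True in auto)
  show ?thesis using sl2_semidirect by blast
next
  case False
  obtain h t where h: "lie_ideal br h" "dim h = DIM('a) - 1" "t \<notin> h"
    "\<And>x y. br x y \<in> h" "\<And>x. \<exists>r. x - r *\<^sub>R t \<in> h"
    by (rule not_perfect_ideal[OF False]) auto
  have d4: "dim h = DIM(real^4)" using h(2) dim by simp
  obtain \<iota> :: "real^4 \<Rightarrow> 'a" and br' where \<iota>: "linear \<iota>" "range \<iota> = h" "unimodular_lie br'"
    and hom: "\<And>x y. \<iota> (br' x y) = br (\<iota> x) (\<iota> y)"
    using ideal_embedding[OF h(1) d4] by (metis (no_types))
  interpret k: unimodular_lie br' by (rule \<iota>(3))
  obtain s x u v where sp: "span {s,x,u,v} = UNIV"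
    and c: "k.simple_sum_frame s x u v \<or> k.abelian_frame s x u v \<or> k.oscillator_frame s x u v"
    using k.dim4_structure by auto
  note l\<iota> = linear_0[OF \<iota>(1)] linear_scale[OF \<iota>(1)]
  have sph: "span {\<iota> s, \<iota> x, \<iota> u, \<iota> v} = h"
    using linear_span_image[OF \<iota>(1), of "{s,x,u,v}"] sp \<iota>(2) by simp
  have full: "span {t, \<iota> s, \<iota> x, \<iota> u, \<iota> v} = UNIV"
  proof -
    have "z \<in> span {t, \<iota> s, \<iota> x, \<iota> u, \<iota> v}" for z
      using h(5)[of z] unfolding span_insert[of t] sph by blast
    then show ?thesis by blast
  qed
  have t: "br t z \<in> span {\<iota> s, \<iota> x, \<iota> u, \<iota> v}" for z unfolding sph by (rule h(4))
  from c show ?thesis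
  proof (elim disjE)
    assume "k.simple_sum_frame s x u v"
    then obtain y c where b: "y \<noteq> 0" "c \<noteq> 0" "br' x u = v" "br' x v = y *\<^sub>R u" "br' u v = c *\<^sub>R x"
      "br' s x = 0" "br' s u = 0" "br' s v = 0"
      unfolding k.simple_sum_frame_def by blast
    have "simple_sum_frame (\<iota> s) (\<iota> x) (\<iota> u) (\<iota> v)"
      unfolding simple_sum_frame_def hom[symmetric] b(3-) l\<iota> using b(1,2) by blast
    then show ?thesis using simple_sum_centre[OF dim full _ t t t t] by blast
  next
    assume "k.oscillator_frame s x u v"
    then obtain d where b: "d \<noteq> 0" "br' x u = v" "br' x v = 0" "br' u v = 0"
      "br' s x = u" "br' s u = d *\<^sub>R x" "br' s v = 0"
      unfolding k.oscillator_frame_def by blast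
    have "oscillator_frame (\<iota> s) (\<iota> x) (\<iota> u) (\<iota> v)"
      unfolding oscillator_frame_def hom[symmetric] b(2-) l\<iota> using b(1) by blast
    then show ?thesis using oscillator_centre[OF dim full _ t t t] by blast
  next
    assume "k.abelian_frame s x u v"
    then have b: "br' x u = 0" "br' x v = 0" "br' u v = 0"
      "br' s x \<in> span {x,u,v}" "br' s u \<in> span {x,u,v}" "br' s v \<in> span {x,u,v}"
      unfolding k.abelian_frame_def by blast+
    have im: "\<iota> z \<in> span {\<iota> x, \<iota> u, \<iota> v}" if "z \<in> span {x,u,v}" for z
      using linear_span_image[OF \<iota>(1), of "{x,u,v}"] that by auto
    have "abelian_frame (\<iota> s) (\<iota> x) (\<iota> u) (\<iota> v)"
      unfolding abelian_frame_def hom[symmetric] b(1-3) l\<iota> using im b(4-6) by blast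
    then show ?thesis using abelian_frame_structure[OF dim full _ t t t t] by blast
  qed
qed

end

theorem theorem1p6:
  fixes br :: "'a::euclidean_space \<Rightarrow> 'a \<Rightarrow> 'a"
  assumes "DIM('a) = 5"
    and "lie_algebra br"
    and "unimodular br"
  shows "(\<exists>ip. is_inner_product ip \<and> (\<exists>B. geodesic_basis br ip B))
    \<and> ((\<exists>ip. is_inner_product ip \<and> (\<exists>B. orthonormal_geodesic_basis br ip B)) \<longleftrightarrow>
        ((\<exists>I. lie_ideal br I \<and> abelian_set br I \<and> dim I = DIM('a) - 1)
         \<or> (\<exists>Z. Z \<noteq> 0 \<and> (\<forall>X. br Z X = 0))
         \<or> (\<exists>N X1 X2 X3 X4 X5. is_nilradical br N \<and> abelian_set br N \<and> dim N = 3 \<and>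
              is_basis {X1, X2, X3, X4, X5} \<and> card {X1, X2, X3, X4, X5} = 5 \<and>
              N = span {X3, X4, X5} \<and>
              br X1 X3 = -2 *\<^sub>R X3 \<and> br X1 X4 = X4 \<and> br X1 X5 = X5 \<and>
              br X2 X3 = 0 \<and> br X2 X4 = - X5 \<and> br X2 X5 = X4)))"
proof -
  interpret unimodular_lie br by unfold_locales fact+
  note dim = assms(1)
  have a: "has_ongb br" if has_abelian_hyperplane
    using that has_ongb_of_abelian_ideal unfolding has_abelian_hyperplane_def by blast
  have b: "has_ongb br" if c: has_centre
  proof -
    obtain z where z: "z \<noteq> 0" "\<And>x. br z x = 0" using c unfolding has_centre_def by blast
    have "DIM('a) = DIM(real^4) + 1" using dim by simp
    from has_ongb_of_centre[OF z this] show ?thesis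
      using unimodular_lie.dim4_has_ongb[where 'a = "real^4"] by simp
  qed
  note c = rotation_torus_extension_has_ongb[OF dim]
  note S = dim5_structure[OF dim]
  have "has_gb br"
    using S a b c has_ongb_imp_has_gb[of br] sl2_semidirect_has_gb[OF dim]
      heisenberg_extension_has_gb[OF dim] filiform_extension_has_gb[OF dim]
      split_torus_extension_has_gb[OF dim] by argo
  moreover have "has_ongb br \<longleftrightarrow> has_abelian_hyperplane \<or> has_centre \<or> rotation_torus_extension br"
    using S a b c sl2_semidirect_no_ongb[OF dim] heisenberg_extension_no_ongb[OF dim]
      filiform_extension_no_ongb[OF dim] split_torus_extension_no_ongb[OF dim] by argo
  ultimately show ?thesis
    unfolding has_gb_def has_ongb_def has_abelian_hyperplane_def has_centre_def
      rotation_torus_extension_def by (rule conjI)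
qed

end
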